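(* Let $N\ge 2$. (i) Let $1\le q\le 2$. For every nonempty open bounded convex set $\Omega\subset\mathbb{R}^N$ we have $$\lambda_{2,q}(\Omega)\,|\Omega|^{\frac{2-q}{q}}> \left(\frac{\pi_{2,q}}{2\,R_\Omega}\right)^2.$$ The inequality is strict, but the estimate is sharp, i.e. $$\inf\Big\{R_\Omega^2\,\lambda_{2,q}(\Omega)\,|\Omega|^{\frac{2-q}{q}}\, :\, \Omega\subset\mathbb{R}^N \text{ nonempty open bounded convex}\Big\}=\left(\frac{\pi_{2,q}}{2}\right)^2.$$ (ii) Let $2<q<2^*$. Then $$\inf\Big\{R^2_{\Omega}\,\lambda_{2,q}(\Omega)\,|\Omega|^{\frac{2-q}{q}}\, :\, \Omega\subset\mathbb{R}^N \text{ nonempty open bounded convex}\Big\}=0.$$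
   Context: $N\ge 2$ is the dimension. $2^*=\frac{2N}{N-2}$ if $N\ge 3$ and $2^*=+\infty$ if $N=2$. For $1\le q<2^*$ and an open set $\Omega\subset\mathbb{R}^N$, $$\lambda_{2,q}(\Omega)=\inf_{\varphi\in C^\infty_0(\Omega)\setminus\{0\}} \frac{\int_\Omega |\nabla \varphi|^2\,dx}{\left(\int_\Omega |\varphi|^q\,dx\right)^{2/q}},$$ where $C^\infty_0(\Omega)$ denotes smooth functions with compact support in $\Omega$. $|\Omega|$ is the $N$-dimensional Lebesgue measure of $\Omega$. $R_\Omega$ is the inradius of $\Omega$, i.e. the radius of the largest open ball contained in $\Omega$. The one-dimensional constant $\pi_{2,q}$ is $$\pi_{2,q}=\min_{\varphi\in W^{1,2}((0,1))\setminus\{0\}}\left\{\frac{\|\varphi'\|_{L^2((0,1))}}{\|\varphi\|_{L^q((0,1))}}\, :\, \varphi(0)=\varphi(1)=0\right\}.$$ *)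

theory Defs
  imports "HOL-Analysis.Analysis"
begin

text \<open>\<open>Ck k f\<close>: all iterated partial derivatives of \<open>f\<close> of order at most \<open>k\<close>
  exist and are continuous on the whole space. (In the successor step, total differentiability
  at every order is demanded; for \<open>C\<^sup>k\<close> functions it is automatic.)\<close>

primrec Ck :: "nat \<Rightarrow> ('a::euclidean_space \<Rightarrow> real) \<Rightarrow> bool" where
  "Ck 0 f \<longleftrightarrow> continuous_on UNIV f"
| "Ck (Suc k) f \<longleftrightarrow> (\<forall>x. f differentiable (at x)) \<and>
     (\<forall>b\<in>Basis. Ck k (\<lambda>x. frechet_derivative f (at x) b))"

definition smooth :: "('a::euclidean_space \<Rightarrow> real) \<Rightarrow> bool" where
  "smooth f \<longleftrightarrow> (\<forall>k. Ck k f)"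

text \<open>\<open>C\<^sub>0\<^sup>\<infinity>(\<Omega>)\<close>. A smooth function with compact support in the open set \<open>\<Omega>\<close> is
  identified with its extension by zero, which is smooth on the whole space.\<close>

definition test_functions :: "'a::euclidean_space set \<Rightarrow> ('a \<Rightarrow> real) set" where
  "test_functions \<Omega> = {\<phi>. smooth \<phi> \<and>
     compact (closure {x. \<phi> x \<noteq> 0}) \<and> closure {x. \<phi> x \<noteq> 0} \<subseteq> \<Omega>}"

definition grad :: "('a::euclidean_space \<Rightarrow> real) \<Rightarrow> 'a \<Rightarrow> 'a" where
  "grad f x = (\<Sum>b\<in>Basis. frechet_derivative f (at x) b *\<^sub>R b)"

definition lambda2 :: "real \<Rightarrow> 'a::euclidean_space set \<Rightarrow> real" where
  "lambda2 q \<Omega> = (INF \<phi>\<in>test_functions \<Omega> - {\<lambda>_. 0}.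
     (LINT x:\<Omega>|lebesgue. (norm (grad \<phi> x))\<^sup>2) /
     (LINT x:\<Omega>|lebesgue. \<bar>\<phi> x\<bar> powr q) powr (2 / q))"

definition inradius :: "'a::euclidean_space set \<Rightarrow> real" where
  "inradius \<Omega> = Sup {r. r > 0 \<and> (\<exists>x. ball x r \<subseteq> \<Omega>)}"

definition in_Lp :: "real \<Rightarrow> real set \<Rightarrow> (real \<Rightarrow> real) \<Rightarrow> bool" where
  "in_Lp p S f \<longleftrightarrow> set_borel_measurable lebesgue S f \<and>
     set_integrable lebesgue S (\<lambda>x. \<bar>f x\<bar> powr p)"

definition Lp_norm :: "real \<Rightarrow> real set \<Rightarrow> (real \<Rightarrow> real) \<Rightarrow> real" where
  "Lp_norm p S f = (LINT x:S|lebesgue. \<bar>f x\<bar> powr p) powr (1 / p)"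

text \<open>\<open>W12 f g\<close>: \<open>f\<close> belongs to \<open>W\<^sup>1\<^sup>,\<^sup>2((0,1))\<close> with weak derivative \<open>g\<close>.\<close>

definition W12 :: "(real \<Rightarrow> real) \<Rightarrow> (real \<Rightarrow> real) \<Rightarrow> bool" where
  "W12 f g \<longleftrightarrow> in_Lp 2 {0<..<1} f \<and> in_Lp 2 {0<..<1} g \<and>
     (\<forall>\<psi>\<in>test_functions {0<..<1}.
        (LINT x:{0<..<1}|lebesgue. f x * deriv \<psi> x) =
        - (LINT x:{0<..<1}|lebesgue. g x * \<psi> x))"

text \<open>\<open>\<pi>\<^sub>2\<^sub>,\<^sub>q\<close>. An element of \<open>W\<^sup>1\<^sup>,\<^sup>2((0,1))\<close> is an a.e.-class with exactly one representative
  that is continuous on \<open>[0,1]\<close>; the boundary values are those of this representative, so the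
  infimum ranges over these representatives. The weak derivative is unique up to null sets, hence
  its norm depends on \<open>\<phi>\<close> only. The minimum is written as an infimum; it is attained.\<close>

definition pi2 :: "real \<Rightarrow> real" where
  "pi2 q = Inf {Lp_norm 2 {0<..<1} \<phi>' / Lp_norm q {0<..<1} \<phi> | \<phi> \<phi>'.
     W12 \<phi> \<phi>' \<and> continuous_on {0..1} \<phi> \<and> \<phi> 0 = 0 \<and> \<phi> 1 = 0 \<and>
     (\<exists>x\<in>{0<..<1}. \<phi> x \<noteq> 0)}"

definition crit_exp :: "nat \<Rightarrow> ereal" where
  "crit_exp N = (if N = 2 then \<infinity> else ereal (2 * real N / (real N - 2)))"

end

theory Submission
  imports Defs
begin

text \<open>For a vector field \<open>W\<close>, integrating \<open>div (\<phi>\<^sup>2 W)\<close> gives \<open>\<integral>|\<nabla>\<phi>|\<^sup>2 \<ge> \<integral>(div W - |W|\<^sup>2) \<phi>\<^sup>2\<close>. Take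
  \<open>W = - (f'/f)(d) \<nabla>d\<close>, where \<open>d\<close> is the distance to the boundary and \<open>f\<close> the one-dimensional extremal, rescaled to
  length \<open>R\<^sub>\<Omega>\<close>: the weight becomes a multiple of \<open>f\<^sup>q\<^sup>-\<^sup>2(d)\<close>, Hoelder's inequality turns the right-hand side into a
  power of \<open>\<integral>|\<phi>|\<^sup>q\<close>, and the constant is right because the average of \<open>f\<^sup>q(d)\<close> over \<open>\<Omega>\<close> is at most that
  of \<open>f\<^sup>q\<close> over a segment of length \<open>R\<^sub>\<Omega>\<close>. As \<open>d\<close> is not smooth, it is replaced by a soft minimum \<open>\<delta>\<close> of the
  distances to the faces of a polytope containing \<open>\<Omega>\<close>; the identity \<open>\<Delta>\<delta> = - \<beta> (1 - |\<nabla>\<delta>|\<^sup>2)\<close> makes up for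
  \<open>|\<nabla>\<delta>| < 1\<close>.

  Strictness: for \<open>q < 2\<close> the comparison of averages is strict in dimension at least two; for \<open>q = 2\<close>, where the
  weight is constant, the field is improved by a small multiple of \<open>x - x\<^sub>0\<close> with \<open>x\<^sub>0\<close> an incentre.

  Sharpness: on long slabs of width one, products of a smoothed one-dimensional competitor and wide plateaus almost
  attain the constant. For \<open>q > 2\<close> the negative power of the volume of such slabs forces the infimum to vanish.\<close>

section \<open>Vector fields and the Dirichlet integral\<close>

text \<open>The distance to the boundary is only Lipschitz, and its Laplacian is a nonpositive
  measure: the right sign, but no pointwise divergence computation is possible. The soft minimum
  turns this measure into the function \<open>- \<beta> (1 - |\<nabla>\<delta>|\<^sup>2)\<close>,
  and the defect of the gradient is paid for as soon as \<open>\<beta>\<close> times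
  \<open>f'/f\<close> exceeds the weight. This fails at the top of the exact extremal, where
  \<open>f' = 0\<close>. Hence only nearly extremal profiles are used, cut below their maximum, and
  each strict inequality needs a margin that does not degenerate as the profile improves. The margin
  must also be uniform in the test function, since an infimum does not preserve strictness.

  The constant belongs to the slab: there the distance runs through a segment of length
  \<open>R\<^sub>\<Omega>\<close>, which is half of the interval in the one-dimensional problem;
  this is the factor 2 in the denominator.\<close>

lemma zero_derivative_off_support:
  fixes g :: "'a::euclidean_space \<Rightarrow> 'b::real_normed_vector"
  assumes "(g has_derivative D) (at x)" and "closed K" and "\<And>y. y \<notin> K \<Longrightarrow> g y = 0" and "x \<notin> K"
  shows "D = (\<lambda>_. 0)"
proof -
  have "((\<lambda>_. 0) has_derivative D) (at x)"
    by (rule has_derivative_transform_within_open[OF assms(1), of "- K"]) (use assms in auto)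
  then show ?thesis
    using has_derivative_const[of "0::'b" "at x"] has_derivative_unique by blast
qed

lemma lborel_integral_translation:
  fixes g :: "'a::euclidean_space \<Rightarrow> real"
  assumes [measurable]: "g \<in> borel_measurable borel"
  shows "(LINT x|lborel. g (c + x)) = (LINT x|lborel. g x)"
proof -
  have "(LINT x|lborel. g x) = (LINT x|distr lborel borel ((+) c). g x)"
    by (simp add: lborel_distr_plus)
  also have "\<dots> = (LINT x|lborel. g (c + x))"
    by (subst integral_distr) auto
  finally show ?thesis by simp
qed

lemma integrable_continuous_compact_support:
  fixes f :: "'a::euclidean_space \<Rightarrow> real"
  assumes "continuous_on UNIV f" and "compact K" and "\<And>x. x \<notin> K \<Longrightarrow> f x = 0"
  shows "integrable lborel f"
proof -
  have "integrable lborel (\<lambda>x. indicator K x *\<^sub>R f x)"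
    by (intro borel_integrable_compact assms continuous_on_subset[OF assms(1)]) auto
  moreover have "(\<lambda>x. indicator K x *\<^sub>R f x) = f"
    using assms(3) by (auto simp: indicator_def fun_eq_iff)
  ultimately show ?thesis by simp
qed

text \<open>Difference quotients of an integrable function have integral zero, because Lebesgue
  measure is translation invariant; dominated convergence carries this over to the derivative. The
  mean value theorem bounds the quotients by a bound for the derivative, so no iterated integrals
  enter.\<close>

lemma integral_directional_derivative_zero:
  fixes g :: "'a::euclidean_space \<Rightarrow> real"
  assumes der: "\<And>x. (g has_derivative Dg x) (at x)"
    and cont: "continuous_on UNIV (\<lambda>x. Dg x b)"
    and K: "compact K" and supp: "\<And>x. x \<notin> K \<Longrightarrow> g x = 0"
  shows "(LINT x|lborel. Dg x b) = 0"
proof -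
  have contg: "continuous_on UNIV g"
    using der by (meson continuous_at_imp_continuous_on has_derivative_continuous)
  then have [measurable]: "g \<in> borel_measurable borel"
    by (rule borel_measurable_continuous_onI)
  have [measurable]: "(\<lambda>x. Dg x b) \<in> borel_measurable borel"
    using cont by (rule borel_measurable_continuous_onI)
  have D0: "Dg x b = 0" if "x \<notin> K" for x
    using zero_derivative_off_support[OF der compact_imp_closed[OF K] supp that] by simp
  obtain r where "\<forall>x\<in>K. norm x \<le> r"
    using compact_imp_bounded[OF K] unfolding bounded_iff ..
  then have r: "K \<subseteq> cball 0 r" by auto
  have "compact ((\<lambda>x. Dg x b) ` K)"
    by (intro compact_continuous_image K continuous_on_subset[OF cont]) auto
  then have "bounded ((\<lambda>x. Dg x b) ` K)" by (rule compact_imp_bounded)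
  then obtain M0 where M0: "\<forall>y\<in>(\<lambda>x. Dg x b) ` K. norm y \<le> M0"
    unfolding bounded_iff ..
  define M where "M = max M0 0"
  have M: "\<bar>Dg x b\<bar> \<le> M" for x
  proof (cases "x \<in> K")
    case True
    then have "norm (Dg x b) \<le> M0" using M0 by blast
    then show ?thesis unfolding M_def by simp
  next
    case False
    then show ?thesis using D0 unfolding M_def by simp
  qed
  define h where "h = (\<lambda>n::nat. 1 / real (Suc n))"
  have h: "h n > 0" "h n \<le> 1" for n by (auto simp: h_def)
  define s where "s = (\<lambda>n x. (g (x + h n *\<^sub>R b) - g x) / h n)"
  have curve: "((\<lambda>t. g (x + t *\<^sub>R b)) has_field_derivative Dg (x + t *\<^sub>R b) b) (at t)" for x t
  proof -
    have "((\<lambda>t. g (x + t *\<^sub>R b)) has_derivative (\<lambda>y. Dg (x + t *\<^sub>R b) (y *\<^sub>R b))) (at t)"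
      by (rule has_derivative_compose[of "\<lambda>t. x + t *\<^sub>R b" "\<lambda>y. y *\<^sub>R b" t UNIV g])
         (auto intro!: derivative_eq_intros der)
    moreover have "Dg (x + t *\<^sub>R b) (y *\<^sub>R b) = y * Dg (x + t *\<^sub>R b) b" for y
      using linear_cmul[OF has_derivative_linear[OF der]] by auto
    ultimately show ?thesis
      by (simp add: has_field_derivative_def mult_commute_abs)
  qed
  \<comment> \<open>Steps of length at most 1 keep all quotients inside one fixed ball, which makes
    the dominating function integrable.\<close>
  have bound: "\<bar>s n x\<bar> \<le> M * indicator (cball 0 (r + norm b)) x" for n x
  proof -
    obtain z where z: "0 < z" "z < h n" "g (x + h n *\<^sub>R b) - g (x + 0 *\<^sub>R b) = (h n - 0) * Dg (x + z *\<^sub>R b) b"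
      using MVT2[of 0 "h n" "\<lambda>t. g (x + t *\<^sub>R b)" "\<lambda>t. Dg (x + t *\<^sub>R b) b"] h curve by blast
    then have 1: "s n x = Dg (x + z *\<^sub>R b) b"
      using h[of n] by (simp add: s_def)
    show ?thesis
    proof (cases "x \<in> cball 0 (r + norm b)")
      case True then show ?thesis using 1 M by simp
    next
      case False
      then have "norm x > r + norm b" by simp
      moreover have "norm (z *\<^sub>R b) \<le> norm b"
        using z h[of n] mult_right_mono[of z 1 "norm b"] by simp
      ultimately have "norm (x + z *\<^sub>R b) > r"
        using norm_triangle_ineq4[of "x + z *\<^sub>R b" "z *\<^sub>R b"] by simp
      then have "x + z *\<^sub>R b \<notin> K" using r by auto
      then show ?thesis using 1 D0 False by simp
    qed
  qed
  have lim: "(\<lambda>n. s n x) \<longlonglongrightarrow> Dg x b" for x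
  proof -
    have "((\<lambda>t. (g (x + t *\<^sub>R b) - g x) / t) \<longlongrightarrow> Dg x b) (at 0)"
      using curve[of x 0] by (simp add: has_field_derivative_iff)
    moreover have "filterlim h (at 0) sequentially"
      unfolding filterlim_at using h LIMSEQ_inverse_real_of_nat
      by (auto simp: h_def inverse_eq_divide intro!: always_eventually)
    ultimately show ?thesis
      unfolding s_def by (rule filterlim_compose)
  qed
  have "(\<lambda>n. LINT x|lborel. s n x) \<longlonglongrightarrow> (LINT x|lborel. Dg x b)"
  proof (rule integral_dominated_convergence[where w = "\<lambda>x. M * indicator (cball 0 (r + norm b)) x"])
    show "integrable lborel (\<lambda>x. M * indicator (cball 0 (r + norm b)) (x::'a))"
      by (intro integrable_mult_right integrable_real_indicator)
         (use emeasure_bounded_finite[OF bounded_cball, of 0 "r + norm b"] in auto)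
  qed (use lim bound in \<open>auto simp: s_def\<close>)
  moreover have "(LINT x|lborel. s n x) = 0" for n
  proof -
    have ig: "integrable lborel g"
      by (rule integrable_continuous_compact_support[OF contg K supp])
    have "integrable lborel (\<lambda>x. g (h n *\<^sub>R b + x))"
    proof (rule integrable_continuous_compact_support)
      show "continuous_on UNIV (\<lambda>x. g (h n *\<^sub>R b + x))"
        by (intro continuous_on_compose2[OF contg] continuous_intros) auto
      show "compact ((+) (- (h n *\<^sub>R b)) ` K)" by (intro compact_translation K)
      show "g (h n *\<^sub>R b + x) = 0" if "x \<notin> (+) (- (h n *\<^sub>R b)) ` K" for x
        using that by (intro supp) (force simp: image_iff)
    qed
    then have "(LINT x|lborel. s n x) = ((LINT x|lborel. g (h n *\<^sub>R b + x)) - (LINT x|lborel. g x)) / h n"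
      unfolding s_def using ig by (simp add: add.commute)
    then show ?thesis by (simp add: lborel_integral_translation)
  qed
  ultimately have "(\<lambda>n. 0::real) \<longlonglongrightarrow> (LINT x|lborel. Dg x b)" by simp
  then show ?thesis by (simp add: LIMSEQ_const_iff)
qed

lemma continuous_on_extend_by_zero:
  fixes h :: "'a::euclidean_space \<Rightarrow> real"
  assumes "open U" and "compact K" and "K \<subseteq> U" and "continuous_on U h" and "\<And>x. x \<notin> K \<Longrightarrow> h x = 0"
  shows "continuous_on UNIV h"
proof -
  have "continuous_on (- K) h"
    by (rule continuous_on_eq[OF continuous_on_const[of _ 0]]) (use assms(5) in auto)
  then have "continuous_on (U \<union> - K) h"
    using assms by (intro continuous_on_open_Un) (auto simp: compact_imp_closed open_Compl)
  moreover have "U \<union> - K = UNIV" using assms(3) by auto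
  ultimately show ?thesis by simp
qed

text \<open>The integrand is the divergence of \<open>\<phi>\<^sup>2 W\<close>. The field is
  controlled on \<open>U\<close> only and may blow up at the boundary, but \<open>\<phi>\<close>
  vanishes near that boundary, so each component of \<open>\<phi>\<^sup>2 W\<close> is
  differentiable on the whole space.\<close>

lemma field_divergence_identity:
  fixes \<phi> :: "'a::euclidean_space \<Rightarrow> real" and W :: "'a \<Rightarrow> 'a"
  assumes U: "open U" and K: "compact K" "K \<subseteq> U"
    and \<phi>: "\<And>x. (\<phi> has_derivative (\<lambda>h. G x \<bullet> h)) (at x)" and G: "continuous_on UNIV G"
    and supp: "\<And>x. x \<notin> K \<Longrightarrow> \<phi> x = 0"
    and W: "\<And>x. x \<in> U \<Longrightarrow> (W has_derivative DW x) (at x)"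
    and DW: "\<And>b. b \<in> Basis \<Longrightarrow> continuous_on U (\<lambda>x. DW x b)"
  shows "integrable lborel (\<lambda>x. 2 * \<phi> x * (G x \<bullet> W x) + (\<phi> x)\<^sup>2 * (\<Sum>b\<in>Basis. DW x b \<bullet> b))"
    and "(LINT x|lborel. 2 * \<phi> x * (G x \<bullet> W x) + (\<phi> x)\<^sup>2 * (\<Sum>b\<in>Basis. DW x b \<bullet> b)) = 0"
proof -
  have cont\<phi>: "continuous_on UNIV \<phi>"
    using \<phi> by (meson continuous_at_imp_continuous_on has_derivative_continuous)
  have contW: "continuous_on U W"
    using W by (meson continuous_at_imp_continuous_on has_derivative_continuous)
  \<comment> \<open>Nothing is known about \<open>DW\<close> off \<open>U\<close>, hence the case
    distinction in the derivative.\<close>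
  define Dg where "Dg = (\<lambda>b x h. if x \<in> U then 2 * \<phi> x * (G x \<bullet> h) * (W x \<bullet> b) + (\<phi> x)\<^sup>2 * (DW x h \<bullet> b) else 0)"
  have der: "((\<lambda>x. (\<phi> x)\<^sup>2 * (W x \<bullet> b)) has_derivative Dg b x) (at x)" for b x
  proof (cases "x \<in> U")
    case True
    show ?thesis
      unfolding Dg_def using True
      by (auto intro!: derivative_eq_intros \<phi> W[OF True] simp: algebra_simps power2_eq_square)
  next
    case False
    then have "x \<in> - K" using K by auto
    have "((\<lambda>_. 0) has_derivative (\<lambda>_. 0)) (at x)" by simp
    then have "((\<lambda>x. (\<phi> x)\<^sup>2 * (W x \<bullet> b)) has_derivative (\<lambda>_. 0)) (at x)"
      by (rule has_derivative_transform_within_open[of _ _ _ _ "- K"])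
         (use \<open>x \<in> - K\<close> K supp in \<open>auto simp: compact_imp_closed open_Compl\<close>)
    then show ?thesis using False by (simp add: Dg_def)
  qed
  have Dg0: "Dg b x h = 0" if "x \<notin> K" for b x h
    using that zero_derivative_off_support[OF der[of b x] compact_imp_closed[OF K(1)]] supp by auto
  have contDg: "continuous_on UNIV (\<lambda>x. Dg b x b)" if "b \<in> Basis" for b
  proof (rule continuous_on_extend_by_zero[OF U K])
    have "continuous_on U (\<lambda>x. 2 * \<phi> x * (G x \<bullet> b) * (W x \<bullet> b) + (\<phi> x)\<^sup>2 * (DW x b \<bullet> b))"
      by (intro continuous_intros contW DW[OF that] continuous_on_subset[OF cont\<phi>] continuous_on_subset[OF G]) auto
    then show "continuous_on U (\<lambda>x. Dg b x b)"
      by (rule continuous_on_eq) (simp add: Dg_def)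
  qed (use Dg0 in auto)
  have int: "integrable lborel (\<lambda>x. Dg b x b)" if "b \<in> Basis" for b
    by (rule integrable_continuous_compact_support[OF contDg[OF that] K(1) Dg0])
  have eq: "2 * \<phi> x * (G x \<bullet> W x) + (\<phi> x)\<^sup>2 * (\<Sum>b\<in>Basis. DW x b \<bullet> b) = (\<Sum>b\<in>Basis. Dg b x b)" for x
  proof (cases "x \<in> U")
    case True
    have "(\<Sum>b\<in>Basis. Dg b x b) = 2 * \<phi> x * (\<Sum>b\<in>Basis. (G x \<bullet> b) * (W x \<bullet> b)) + (\<phi> x)\<^sup>2 * (\<Sum>b\<in>Basis. DW x b \<bullet> b)"
      using True by (simp add: Dg_def sum.distrib sum_distrib_left algebra_simps)
    then show ?thesis by (simp add: euclidean_inner[symmetric])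
  next
    case False
    then have "\<phi> x = 0" using K supp by blast
    then show ?thesis using False by (simp add: Dg_def)
  qed
  show "integrable lborel (\<lambda>x. 2 * \<phi> x * (G x \<bullet> W x) + (\<phi> x)\<^sup>2 * (\<Sum>b\<in>Basis. DW x b \<bullet> b))"
    unfolding eq by (intro Bochner_Integration.integrable_sum int)
  have "(LINT x|lborel. (\<Sum>b\<in>Basis. Dg b x b)) = (\<Sum>b\<in>Basis. LINT x|lborel. Dg b x b)"
    by (intro Bochner_Integration.integral_sum int)
  also have "\<dots> = 0"
  proof (rule sum.neutral, rule ballI)
    fix b :: 'a assume b: "b \<in> Basis"
    show "(LINT x|lborel. Dg b x b) = 0"
      by (rule integral_directional_derivative_zero[OF der contDg[OF b] K(1)]) (use supp in auto)
  qed
  finally show "(LINT x|lborel. 2 * \<phi> x * (G x \<bullet> W x) + (\<phi> x)\<^sup>2 * (\<Sum>b\<in>Basis. DW x b \<bullet> b)) = 0"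
    by (simp add: eq)
qed

text \<open>Integrate \<open>|G + \<phi> W|\<^sup>2 \<ge> 0\<close> and remove the cross term by the
  divergence identity. For \<open>W = - \<nabla>v / v\<close> with \<open>v > 0\<close> the quantity
  \<open>div W - |W|\<^sup>2\<close> equals \<open>- \<Delta>v / v\<close>, so this is Picone's
  inequality for a supersolution \<open>v\<close> of \<open>- \<Delta>v = w v\<close>.\<close>

lemma dirichlet_integral_ge:
  fixes \<phi> :: "'a::euclidean_space \<Rightarrow> real" and W :: "'a \<Rightarrow> 'a"
  assumes U: "open U" and K: "compact K" "K \<subseteq> U"
    and \<phi>: "\<And>x. (\<phi> has_derivative (\<lambda>h. G x \<bullet> h)) (at x)" and G: "continuous_on UNIV G"
    and supp: "\<And>x. x \<notin> K \<Longrightarrow> \<phi> x = 0"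
    and W: "\<And>x. x \<in> U \<Longrightarrow> (W has_derivative DW x) (at x)"
    and DW: "\<And>b. b \<in> Basis \<Longrightarrow> continuous_on U (\<lambda>x. DW x b)"
    and w: "continuous_on U w"
    and ge: "\<And>x. x \<in> U \<Longrightarrow> (\<Sum>b\<in>Basis. DW x b \<bullet> b) - (norm (W x))\<^sup>2 \<ge> w x"
  shows "integrable lborel (\<lambda>x. w x * (\<phi> x)\<^sup>2)"
    and "(LINT x|lborel. (norm (G x))\<^sup>2) \<ge> (LINT x|lborel. w x * (\<phi> x)\<^sup>2)"
proof -
  have cont\<phi>: "continuous_on UNIV \<phi>"
    using \<phi> by (meson continuous_at_imp_continuous_on has_derivative_continuous)
  have "continuous_on UNIV (\<lambda>x. w x * (\<phi> x)\<^sup>2)"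
    by (rule continuous_on_extend_by_zero[OF U K])
       (use supp in \<open>auto intro!: continuous_intros w continuous_on_subset[OF cont\<phi>]\<close>)
  then show int1: "integrable lborel (\<lambda>x. w x * (\<phi> x)\<^sup>2)"
    by (rule integrable_continuous_compact_support[OF _ K(1)]) (use supp in auto)
  have G0: "G x = 0" if "x \<notin> K" for x
  proof -
    have "(\<lambda>h. G x \<bullet> h) = (\<lambda>_. 0)"
      using zero_derivative_off_support[OF \<phi> compact_imp_closed[OF K(1)] supp that] .
    from fun_cong[OF this, of "G x"] have "G x \<bullet> G x = 0" by simp
    then show ?thesis by simp
  qed
  have int2: "integrable lborel (\<lambda>x. (norm (G x))\<^sup>2)"
    by (rule integrable_continuous_compact_support[OF _ K(1)]) (use G0 in \<open>auto intro!: continuous_intros G\<close>)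
  note id = field_divergence_identity[OF U K \<phi> G supp W DW]
  let ?E = "\<lambda>x. 2 * \<phi> x * (G x \<bullet> W x) + (\<phi> x)\<^sup>2 * (\<Sum>b\<in>Basis. DW x b \<bullet> b)"
  have iE: "integrable lborel ?E" by (rule id(1))
  have "(LINT x|lborel. w x * (\<phi> x)\<^sup>2) \<le> (LINT x|lborel. (norm (G x))\<^sup>2 + ?E x)"
  proof (rule integral_mono[OF int1 Bochner_Integration.integrable_add[OF int2 iE]])
    fix x
    show "w x * (\<phi> x)\<^sup>2 \<le> (norm (G x))\<^sup>2 + ?E x"
    proof (cases "x \<in> U")
      case True
      have "0 \<le> (norm (G x + \<phi> x *\<^sub>R W x))\<^sup>2" by simp
      also have "\<dots> = (norm (G x))\<^sup>2 + 2 * \<phi> x * (G x \<bullet> W x) + (\<phi> x)\<^sup>2 * (norm (W x))\<^sup>2"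
          unfolding power2_norm_eq_inner
        by (simp add: inner_add_left inner_add_right inner_commute power2_eq_square algebra_simps)
      finally have 1: "0 \<le> (norm (G x))\<^sup>2 + 2 * \<phi> x * (G x \<bullet> W x) + (\<phi> x)\<^sup>2 * (norm (W x))\<^sup>2" .
      have "(\<phi> x)\<^sup>2 * w x \<le> (\<phi> x)\<^sup>2 * ((\<Sum>b\<in>Basis. DW x b \<bullet> b) - (norm (W x))\<^sup>2)"
        using ge[OF True] by (intro mult_left_mono) auto
      then show ?thesis using 1 by (simp add: algebra_simps)
    next
      case False
      then have "\<phi> x = 0" using supp K by auto
      then show ?thesis by simp
    qed
  qed
  also have "\<dots> = (LINT x|lborel. (norm (G x))\<^sup>2)"
    using int2 iE id(2) by simp
  finally show "(LINT x|lborel. (norm (G x))\<^sup>2) \<ge> (LINT x|lborel. w x * (\<phi> x)\<^sup>2)" .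
qed

section \<open>Soft distance functions\<close>

text \<open>\<open>\<delta>\<close> below is the log-sum-exp form of the minimum of the affine
  functions \<open>l i\<close>, from which it differs by at most
  \<open>ln (card I) / \<beta>\<close>. The \<open>p i\<close> are the corresponding Gibbs weights,
  so the gradient \<open>N\<close> is a convex combination of the unit vectors
  \<open>- \<nu> i\<close>.\<close>

locale soft_distance =
  fixes I :: "'i set" and \<nu> :: "'i \<Rightarrow> 'a::euclidean_space" and a :: "'i \<Rightarrow> real" and \<beta> :: real
  assumes finI: "finite I" and neI: "I \<noteq> {}" and unit: "\<And>i. i \<in> I \<Longrightarrow> norm (\<nu> i) = 1"
    and beta: "\<beta> > 0"
begin

definition l :: "'i \<Rightarrow> 'a \<Rightarrow> real" where "l i x = a i - \<nu> i \<bullet> x"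
definition S :: "'a \<Rightarrow> real" where "S x = (\<Sum>i\<in>I. exp (- \<beta> * l i x))"
definition p :: "'i \<Rightarrow> 'a \<Rightarrow> real" where "p i x = exp (- \<beta> * l i x) / S x"
definition \<delta> :: "'a \<Rightarrow> real" where "\<delta> x = - ln (S x) / \<beta>"
definition N :: "'a \<Rightarrow> 'a" where "N x = - (\<Sum>i\<in>I. p i x *\<^sub>R \<nu> i)"
definition DN :: "'a \<Rightarrow> 'a \<Rightarrow> 'a" where
  "DN x h = (\<Sum>i\<in>I. (- \<beta> * p i x * ((\<nu> i + N x) \<bullet> h)) *\<^sub>R \<nu> i)"

lemma S_pos: "S x > 0"
  unfolding S_def by (intro sum_pos finI neI) auto

lemma p_pos: "p i x > 0"
  unfolding p_def using S_pos by simp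

lemma sum_p: "(\<Sum>i\<in>I. p i x) = 1"
  unfolding p_def using S_pos[of x] by (simp add: sum_divide_distrib[symmetric]) (simp add: S_def)

lemma S_mult_p: "S x * p i x = exp (- \<beta> * l i x)"
  unfolding p_def using S_pos[of x] by simp

lemma l_derivative: "(l i has_derivative (\<lambda>h. - (\<nu> i \<bullet> h))) (at x)"
  unfolding l_def[abs_def] by (auto intro!: derivative_eq_intros)

lemma S_derivative: "(S has_derivative (\<lambda>h. - \<beta> * S x * (N x \<bullet> h))) (at x)"
proof -
  have "(S has_derivative (\<lambda>h. \<Sum>i\<in>I. exp (- \<beta> * l i x) * (- \<beta> * (- (\<nu> i \<bullet> h))))) (at x)"
    unfolding S_def[abs_def] by (auto intro!: derivative_eq_intros l_derivative simp: fun_eq_iff mult_ac)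
  moreover have "(\<Sum>i\<in>I. exp (- \<beta> * l i x) * (- \<beta> * (- (\<nu> i \<bullet> h)))) = - \<beta> * S x * (N x \<bullet> h)" for h
  proof -
    have "- \<beta> * S x * (N x \<bullet> h) = (\<Sum>i\<in>I. \<beta> * ((S x * p i x) * (\<nu> i \<bullet> h)))"
      by (simp add: N_def inner_sum_left sum_distrib_left sum_negf mult_ac)
    then show ?thesis by (simp add: S_mult_p mult_ac)
  qed
  ultimately show ?thesis by simp
qed

lemma delta_derivative: "(\<delta> has_derivative (\<lambda>h. N x \<bullet> h)) (at x)"
proof -
  have "(ln has_derivative (\<lambda>y. inverse (S x) * y)) (at (S x))"
    using DERIV_ln[OF S_pos] by (simp add: has_field_derivative_def)
  from has_derivative_compose[OF S_derivative this]
  have "((\<lambda>x. ln (S x)) has_derivative (\<lambda>h. - \<beta> * (N x \<bullet> h))) (at x)"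
    using S_pos[of x] by (simp add: field_simps)
  from has_derivative_mult_right[OF this, of "- 1 / \<beta>"]
  show ?thesis
    using beta by (simp add: \<delta>_def[abs_def])
qed

text \<open>The logarithm of a Gibbs weight changes at a rate given by the deviation of
  \<open>\<nu> i\<close> from its weighted mean, and that mean is \<open>- N x\<close>.\<close>

lemma p_derivative: "(p i has_derivative (\<lambda>h. \<beta> * p i x * ((\<nu> i + N x) \<bullet> h))) (at x)"
proof -
  let ?E = "\<lambda>x. exp (- \<beta> * l i x)"
  have E: "(?E has_derivative (\<lambda>h. ?E x * (\<beta> * (\<nu> i \<bullet> h)))) (at x)"
    by (auto intro!: derivative_eq_intros l_derivative simp: fun_eq_iff mult_ac)
  have "((\<lambda>x. ?E x / S x) has_derivative
      (\<lambda>h. (?E x * (\<beta> * (\<nu> i \<bullet> h)) * S x - ?E x * (- \<beta> * S x * (N x \<bullet> h))) / (S x * S x))) (at x)"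
    by (rule has_derivative_divide'[OF E S_derivative]) (use S_pos[of x] in simp)
  moreover have "(?E x * (\<beta> * (\<nu> i \<bullet> h)) * S x - ?E x * (- \<beta> * S x * (N x \<bullet> h))) / (S x * S x)
     = \<beta> * p i x * ((\<nu> i + N x) \<bullet> h)" for h
  proof -
    have "?E x * (\<beta> * (\<nu> i \<bullet> h)) * S x - ?E x * (- \<beta> * S x * (N x \<bullet> h)) = \<beta> * ?E x * ((\<nu> i + N x) \<bullet> h) * S x"
      by (simp add: inner_add_left algebra_simps)
    then show ?thesis unfolding p_def using S_pos[of x] by simp
  qed
  ultimately show ?thesis by (simp add: p_def[abs_def])
qed

lemma N_derivative: "(N has_derivative DN x) (at x)"
proof -
  have "((\<lambda>x. - (\<Sum>i\<in>I. p i x *\<^sub>R \<nu> i)) has_derivative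
      (\<lambda>h. - (\<Sum>i\<in>I. (\<beta> * p i x * ((\<nu> i + N x) \<bullet> h)) *\<^sub>R \<nu> i))) (at x)"
    by (intro derivative_intros p_derivative)
  then show ?thesis
    unfolding N_def[symmetric] by (simp add: DN_def[abs_def] sum_negf N_def[abs_def, symmetric])
qed

lemma continuous_delta: "continuous_on A \<delta>"
  by (rule has_derivative_continuous_on[OF has_derivative_at_withinI[OF delta_derivative]])

lemma continuous_N: "continuous_on A N"
  by (rule has_derivative_continuous_on[OF has_derivative_at_withinI[OF N_derivative]])

lemma continuous_DN: "continuous_on A (\<lambda>x. DN x h)"
proof -
  have "continuous_on A (p i)" for i
    by (rule has_derivative_continuous_on[OF has_derivative_at_withinI[OF p_derivative]])
  then show ?thesis
    unfolding DN_def by (intro continuous_on_sum continuous_on_scaleR continuous_on_mult continuous_on_inner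
        continuous_on_add continuous_on_const continuous_N)
qed

text \<open>Where the gradient has norm one the soft distance behaves like a distance to a single
  hyperplane; every defect in its norm is paid for by a \<open>\<beta>\<close>-fold gain in \<open>-\<Delta>\<delta>\<close>.\<close>

lemma div_N: "(\<Sum>b\<in>Basis. DN x b \<bullet> b) = - \<beta> * (1 - (norm (N x))\<^sup>2)"
proof -
  have "(\<Sum>b\<in>Basis. DN x b \<bullet> b) = (\<Sum>b\<in>Basis. \<Sum>i\<in>I. - \<beta> * p i x * (((\<nu> i + N x) \<bullet> b) * (\<nu> i \<bullet> b)))"
    unfolding DN_def by (simp add: inner_sum_left mult.assoc)
  also have "\<dots> = (\<Sum>i\<in>I. - \<beta> * p i x * (\<Sum>b\<in>Basis. ((\<nu> i + N x) \<bullet> b) * (\<nu> i \<bullet> b)))"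
    by (subst sum.swap) (simp add: sum_distrib_left)
  also have "\<dots> = (\<Sum>i\<in>I. - \<beta> * p i x * ((\<nu> i + N x) \<bullet> \<nu> i))"
    by (intro sum.cong refl arg_cong2[where f = "(*)"] euclidean_inner[symmetric])
  also have "\<dots> = (\<Sum>i\<in>I. - \<beta> * p i x + \<beta> * (N x \<bullet> (- (p i x *\<^sub>R \<nu> i))))"
  proof (intro sum.cong refl)
    fix i assume "i \<in> I"
    then have "\<nu> i \<bullet> \<nu> i = 1" using unit by (simp add: dot_square_norm)
    then show "- \<beta> * p i x * ((\<nu> i + N x) \<bullet> \<nu> i) = - \<beta> * p i x + \<beta> * (N x \<bullet> (- (p i x *\<^sub>R \<nu> i)))"
      by (simp add: inner_add_left algebra_simps)
  qed
  also have "\<dots> = - \<beta> * (\<Sum>i\<in>I. p i x) + \<beta> * (N x \<bullet> (\<Sum>i\<in>I. - (p i x *\<^sub>R \<nu> i)))"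
    by (simp only: sum.distrib sum_distrib_left inner_sum_right)
  also have "(\<Sum>i\<in>I. - (p i x *\<^sub>R \<nu> i)) = N x"
    by (simp add: N_def sum_negf)
  finally show ?thesis
    by (simp add: sum_p power2_norm_eq_inner algebra_simps)
qed

lemma norm_N_le: "norm (N x) \<le> 1"
proof -
  have "norm (N x) \<le> (\<Sum>i\<in>I. norm (p i x *\<^sub>R \<nu> i))"
    unfolding N_def norm_minus_cancel by (rule norm_sum)
  also have "\<dots> = (\<Sum>i\<in>I. p i x)"
    using unit p_pos by (intro sum.cong refl) (simp add: less_imp_le)
  finally show ?thesis by (simp add: sum_p)
qed

lemma delta_le: "i \<in> I \<Longrightarrow> \<delta> x \<le> l i x"
proof -
  assume i: "i \<in> I"
  have "exp (- \<beta> * l i x) \<le> S x"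
    unfolding S_def by (rule member_le_sum[OF i]) (use finI in auto)
  then have "- \<beta> * l i x \<le> ln (S x)"
    using S_pos[of x] by (simp add: ln_ge_iff)
  then show ?thesis unfolding \<delta>_def using beta by (simp add: field_simps)
qed

lemma delta_ge:
  assumes "\<And>i. i \<in> I \<Longrightarrow> l i x \<ge> c"
  shows "\<delta> x \<ge> c - ln (card I) / \<beta>"
proof -
  have "S x \<le> (\<Sum>i\<in>I. exp (- \<beta> * c))"
    unfolding S_def using assms beta by (intro sum_mono) auto
  then have "ln (S x) \<le> ln (real (card I) * exp (- \<beta> * c))"
    using S_pos[of x] by simp
  also have "\<dots> = ln (card I) - \<beta> * c"
    using finI neI by (simp add: ln_mult card_gt_0_iff)
  finally have "ln (S x) / \<beta> \<le> (ln (card I) - \<beta> * c) / \<beta>"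
    using beta by (intro divide_right_mono) auto
  then show ?thesis unfolding \<delta>_def using beta by (simp add: diff_divide_distrib)
qed

text \<open>The \<open>l i\<close> are affine, so the left-hand side is the weighted mean of
  \<open>l i x - l i x\<^sub>0\<close>, where every \<open>l i x\<close> is at least
  \<open>\<delta> x\<close>. This controls the interaction of the profile with a Gaussian centred at
  \<open>x\<^sub>0\<close>.\<close>

lemma N_inner_ge:
  assumes "\<And>i. i \<in> I \<Longrightarrow> l i x\<^sub>0 \<le> R"
  shows "N x \<bullet> (x - x\<^sub>0) \<ge> \<delta> x - R"
proof -
  have "N x \<bullet> (x - x\<^sub>0) = (\<Sum>i\<in>I. p i x * (l i x - l i x\<^sub>0))"
    unfolding N_def l_def inner_minus_left inner_sum_left sum_negf[symmetric]
    by (intro sum.cong refl) (simp add: inner_diff_right algebra_simps)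
  also have "\<dots> \<ge> (\<Sum>i\<in>I. p i x * (\<delta> x - R))"
  proof (intro sum_mono mult_left_mono)
    fix i assume i: "i \<in> I"
    show "\<delta> x - R \<le> l i x - l i x\<^sub>0"
      using assms[OF i] delta_le[OF i, of x] by linarith
    show "0 \<le> p i x" using p_pos[of i x] by simp
  qed
  moreover have "(\<Sum>i\<in>I. p i x * (\<delta> x - R)) = \<delta> x - R"
    by (simp add: sum_distrib_right[symmetric] sum_p)
  ultimately show ?thesis by linarith
qed

text \<open>With \<open>\<Phi> = f'/f\<close> this is \<open>- \<nabla>v / v\<close> for \<open>v x
  = f (\<delta> x) * exp (- \<epsilon> |x - x\<^sub>0|\<^sup>2 / 2)\<close>.\<close>

definition W :: "(real \<Rightarrow> real) \<Rightarrow> real \<Rightarrow> 'a \<Rightarrow> 'a \<Rightarrow> 'a" where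
  "W \<Phi> \<epsilon> x\<^sub>0 x = - (\<Phi> (\<delta> x) *\<^sub>R N x) + \<epsilon> *\<^sub>R (x - x\<^sub>0)"

definition DW :: "(real \<Rightarrow> real) \<Rightarrow> (real \<Rightarrow> real) \<Rightarrow> real \<Rightarrow> 'a \<Rightarrow> 'a \<Rightarrow> 'a" where
  "DW \<Phi> \<Phi>' \<epsilon> x h = - (\<Phi> (\<delta> x) *\<^sub>R DN x h + (\<Phi>' (\<delta> x) * (N x \<bullet> h)) *\<^sub>R N x) + \<epsilon> *\<^sub>R h"

lemma W_derivative:
  assumes "(\<Phi> has_real_derivative \<Phi>' (\<delta> x)) (at (\<delta> x))"
  shows "(W \<Phi> \<epsilon> x\<^sub>0 has_derivative DW \<Phi> \<Phi>' \<epsilon> x) (at x)"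
proof -
  have "((\<lambda>x. \<Phi> (\<delta> x)) has_derivative (\<lambda>h. \<Phi>' (\<delta> x) * (N x \<bullet> h))) (at x)"
    using has_derivative_compose[OF delta_derivative, of \<Phi> "\<lambda>y. \<Phi>' (\<delta> x) * y"]
      assms by (simp add: has_field_derivative_def)
  then show ?thesis
    unfolding W_def[abs_def] DW_def[abs_def]
    by (auto intro!: derivative_eq_intros N_derivative)
qed

lemma div_W:
  "(\<Sum>b\<in>Basis. DW \<Phi> \<Phi>' \<epsilon> x b \<bullet> b)
     = \<beta> * \<Phi> (\<delta> x) * (1 - (norm (N x))\<^sup>2) - \<Phi>' (\<delta> x) * (norm (N x))\<^sup>2 + \<epsilon> * DIM('a)"
proof -
  have "(\<Sum>b\<in>Basis. DW \<Phi> \<Phi>' \<epsilon> x b \<bullet> b)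
     = - \<Phi> (\<delta> x) * (\<Sum>b\<in>Basis. DN x b \<bullet> b) - \<Phi>' (\<delta> x) * (\<Sum>b\<in>Basis. (N x \<bullet> b) * (N x \<bullet> b)) + \<epsilon> * DIM('a)"
    unfolding DW_def
    by (simp add: inner_add_left inner_diff_left sum.distrib sum_subtractf sum_distrib_left sum_negf algebra_simps)
  then show ?thesis
    by (simp only: div_N euclidean_inner[symmetric] power2_norm_eq_inner) (simp add: algebra_simps)
qed

lemma norm_W:
  "(norm (W \<Phi> \<epsilon> x\<^sub>0 x))\<^sup>2
     = (\<Phi> (\<delta> x))\<^sup>2 * (norm (N x))\<^sup>2 - 2 * \<epsilon> * \<Phi> (\<delta> x) * (N x \<bullet> (x - x\<^sub>0)) + \<epsilon>\<^sup>2 * (norm (x - x\<^sub>0))\<^sup>2"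
  unfolding W_def power2_norm_eq_inner
  by (simp add: inner_add_left inner_add_right inner_commute power2_eq_square algebra_simps)

lemma continuous_DW:
  assumes "continuous_on (\<delta> ` A) \<Phi>" and "continuous_on (\<delta> ` A) \<Phi>'"
  shows "continuous_on A (\<lambda>x. DW \<Phi> \<Phi>' \<epsilon> x h)"
  unfolding DW_def
  by (intro continuous_on_add continuous_on_minus continuous_on_scaleR continuous_on_mult continuous_on_inner
      continuous_on_const continuous_DN continuous_N continuous_on_compose2[OF assms(1)]
      continuous_on_compose2[OF assms(2)] continuous_delta order_refl)

end

section \<open>Energy estimates and averages for functions of the soft distance\<close>

context soft_distance
begin

text \<open>Put \<open>s = |N|\<^sup>2\<close> and \<open>c = - (\<Phi>' + \<Phi>\<^sup>2)\<close>,
  which is \<open>- f''/f\<close> when \<open>\<Phi> = f'/f\<close>. The profile contributes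
  \<open>\<beta> \<Phi> (1 - s) + c s\<close> to \<open>div W - |W|\<^sup>2\<close>, an average of
  \<open>\<beta> \<Phi>\<close> and \<open>c\<close>, so \<open>beta_ge\<close> makes it at least
  \<open>c\<close>. The Gaussian adds \<open>\<epsilon>\<close> times the dimension and costs at
  most the cross term \<open>2 \<epsilon> \<Phi> (R - t)\<close> and
  \<open>\<epsilon>\<^sup>2 D\<^sup>2\<close>.\<close>

lemma dirichlet_ge_profile:
  fixes \<phi> :: "'a \<Rightarrow> real"
  assumes K: "compact K" "K \<subseteq> B" "open B" and pos: "\<And>x. x \<in> K \<Longrightarrow> \<delta> x > 0" and le: "\<And>x. \<delta> x \<le> R"
    and \<phi>: "\<And>x. (\<phi> has_derivative (\<lambda>h. G x \<bullet> h)) (at x)" and G: "continuous_on UNIV G"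
    and supp: "\<And>x. x \<notin> K \<Longrightarrow> \<phi> x = 0"
    and \<Phi>: "\<And>t. 0 < t \<Longrightarrow> t \<le> R \<Longrightarrow> (\<Phi> has_real_derivative \<Phi>' t) (at t)"
    and \<Phi>': "continuous_on {0<..R} \<Phi>'" and \<Phi>_pos: "\<And>t. 0 < t \<Longrightarrow> t \<le> R \<Longrightarrow> \<Phi> t \<ge> 0"
    and beta_ge: "\<And>t. 0 < t \<Longrightarrow> t \<le> R \<Longrightarrow> \<beta> * \<Phi> t \<ge> - (\<Phi>' t + (\<Phi> t)\<^sup>2)"
    and w: "\<And>t. 0 < t \<Longrightarrow> t \<le> R \<Longrightarrow> w t \<le> - (\<Phi>' t + (\<Phi> t)\<^sup>2) - 2 * \<epsilon> * \<Phi> t * (R - t)"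
    and wc: "continuous_on {0<..R} w"
    and \<epsilon>: "\<epsilon> \<ge> 0" and center: "\<And>i. \<epsilon> > 0 \<Longrightarrow> i \<in> I \<Longrightarrow> l i x\<^sub>0 \<le> R"
    and D: "\<And>x. x \<in> B \<Longrightarrow> norm (x - x\<^sub>0) \<le> D"
  shows "integrable lborel (\<lambda>x. (w (\<delta> x) + (\<epsilon> * DIM('a) - \<epsilon>\<^sup>2 * D\<^sup>2)) * (\<phi> x)\<^sup>2)"
    and "(LINT x|lborel. (norm (G x))\<^sup>2) \<ge> (LINT x|lborel. (w (\<delta> x) + (\<epsilon> * DIM('a) - \<epsilon>\<^sup>2 * D\<^sup>2)) * (\<phi> x)\<^sup>2)"
proof -
  define U where "U = B \<inter> {x. 0 < \<delta> x}"
  have "open {x. 0 < \<delta> x}"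
    using open_Collect_less[OF continuous_on_const[of UNIV 0] continuous_delta[of UNIV]] by simp
  then have U: "open U" unfolding U_def using K by blast
  have KU: "K \<subseteq> U" unfolding U_def using K pos by blast
  have img: "\<delta> ` U \<subseteq> {0<..R}" unfolding U_def using le by auto
  have contPhi: "continuous_on {0<..R} \<Phi>"
    by (rule has_real_derivative_imp_continuous_on[of _ _ \<Phi>']) (use \<Phi> in \<open>auto intro: has_field_derivative_at_within\<close>)
  have ge: "(\<Sum>b\<in>Basis. DW \<Phi> \<Phi>' \<epsilon> x b \<bullet> b) - (norm (W \<Phi> \<epsilon> x\<^sub>0 x))\<^sup>2 \<ge> w (\<delta> x) + (\<epsilon> * DIM('a) - \<epsilon>\<^sup>2 * D\<^sup>2)"
    if "x \<in> U" for x
  proof -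
    define t s c where "t = \<delta> x" and "s = (norm (N x))\<^sup>2" and "c = - (\<Phi>' t + (\<Phi> t)\<^sup>2)"
    have t: "0 < t" "t \<le> R" using that le by (auto simp: U_def t_def)
    have s: "0 \<le> s" "s \<le> 1" unfolding s_def using norm_N_le[of x] by (auto simp: power_le_one)
    have "(1 - s) * (\<beta> * \<Phi> t - c) \<ge> 0"
      using s beta_ge[OF t] by (intro mult_nonneg_nonneg) (auto simp: c_def)
    then have 1: "\<beta> * \<Phi> t * (1 - s) + c * s \<ge> c" by (simp add: algebra_simps)
    \<comment> \<open>The bound on the \<open>l i\<close> at \<open>x\<^sub>0\<close> is at hand
      only for \<open>\<epsilon> > 0\<close>; for \<open>\<epsilon> = 0\<close> both sides
      vanish.\<close>
    have 2: "2 * \<epsilon> * \<Phi> t * (N x \<bullet> (x - x\<^sub>0)) \<ge> 2 * \<epsilon> * \<Phi> t * (t - R)"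
    proof (cases "\<epsilon> = 0")
      case False
      then have "N x \<bullet> (x - x\<^sub>0) \<ge> t - R"
        unfolding t_def using \<epsilon> by (intro N_inner_ge center) auto
      then show ?thesis using \<epsilon> \<Phi>_pos[OF t] by (intro mult_left_mono) auto
    qed simp
    have "norm (x - x\<^sub>0) \<le> D" using that D by (auto simp: U_def)
    then have 3: "\<epsilon>\<^sup>2 * (norm (x - x\<^sub>0))\<^sup>2 \<le> \<epsilon>\<^sup>2 * D\<^sup>2"
      by (intro mult_left_mono power_mono) auto
    have "(\<Sum>b\<in>Basis. DW \<Phi> \<Phi>' \<epsilon> x b \<bullet> b) - (norm (W \<Phi> \<epsilon> x\<^sub>0 x))\<^sup>2
        = \<beta> * \<Phi> t * (1 - s) + c * s + \<epsilon> * DIM('a) + 2 * \<epsilon> * \<Phi> t * (N x \<bullet> (x - x\<^sub>0)) - \<epsilon>\<^sup>2 * (norm (x - x\<^sub>0))\<^sup>2"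
      unfolding div_W norm_W t_def[symmetric] s_def[symmetric] c_def by (simp add: algebra_simps)
    moreover have "2 * \<epsilon> * \<Phi> t * (t - R) = - (2 * \<epsilon> * \<Phi> t * (R - t))" by (simp add: algebra_simps)
    moreover have "w t \<le> c - 2 * \<epsilon> * \<Phi> t * (R - t)" unfolding c_def by (rule w[OF t])
    ultimately show ?thesis using 1 2 3 unfolding t_def by linarith
  qed
  have contw: "continuous_on U (\<lambda>x. w (\<delta> x) + (\<epsilon> * DIM('a) - \<epsilon>\<^sup>2 * D\<^sup>2))"
    by (intro continuous_on_add continuous_on_const continuous_on_compose2[OF wc] continuous_delta img)
  have derW: "(W \<Phi> \<epsilon> x\<^sub>0 has_derivative DW \<Phi> \<Phi>' \<epsilon> x) (at x)" if "x \<in> U" for x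
    using that le by (intro W_derivative \<Phi>) (auto simp: U_def)
  have contDW: "continuous_on U (\<lambda>x. DW \<Phi> \<Phi>' \<epsilon> x b)" for b
    by (intro continuous_DW continuous_on_subset[OF contPhi] continuous_on_subset[OF \<Phi>'] img)
  note * = dirichlet_integral_ge[OF U K(1) KU \<phi> G supp derW contDW contw ge]
  show "integrable lborel (\<lambda>x. (w (\<delta> x) + (\<epsilon> * DIM('a) - \<epsilon>\<^sup>2 * D\<^sup>2)) * (\<phi> x)\<^sup>2)"
    by (rule *(1))
  show "(LINT x|lborel. (norm (G x))\<^sup>2) \<ge> (LINT x|lborel. (w (\<delta> x) + (\<epsilon> * DIM('a) - \<epsilon>\<^sup>2 * D\<^sup>2)) * (\<phi> x)\<^sup>2)"
    by (rule *(2))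
qed

text \<open>The field \<open>P(\<delta>) N\<close> has compact support, so its divergence integrates
  to zero. With \<open>P' = g\<close> and \<open>s = |N|\<^sup>2\<close> that divergence is
  \<open>g - (1 - s) (g + \<beta> P)\<close>, which \<open>neg\<close> bounds from below by
  \<open>g\<close>.\<close>

lemma integral_profile_nonpos:
  assumes K: "compact K" and off: "\<And>x. x \<notin> K \<Longrightarrow> \<delta> x \<le> 0" and le: "\<And>x. \<delta> x \<le> R"
    and g: "continuous_on UNIV g" and g0: "\<And>t. t \<le> 0 \<Longrightarrow> g t = 0"
    and P: "\<And>t. (P has_real_derivative g t) (at t)" and P0: "\<And>t. t \<le> 0 \<Longrightarrow> P t = 0"
    and neg: "\<And>t. 0 < t \<Longrightarrow> t \<le> R \<Longrightarrow> g t + \<beta> * P t \<le> 0"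
  shows "integrable lborel (\<lambda>x. g (\<delta> x))" and "(LINT x|lborel. g (\<delta> x)) \<le> 0"
proof -
  have contP: "continuous_on UNIV P"
    by (rule has_real_derivative_imp_continuous_on[of _ _ g]) (use P in auto)
  define Dg where "Dg = (\<lambda>b x h. P (\<delta> x) * (DN x h \<bullet> b) + g (\<delta> x) * (N x \<bullet> h) * (N x \<bullet> b))"
  have der: "((\<lambda>x. P (\<delta> x) * (N x \<bullet> b)) has_derivative Dg b x) (at x)" for b x
  proof -
    have 1: "((\<lambda>x. P (\<delta> x)) has_derivative (\<lambda>h. g (\<delta> x) * (N x \<bullet> h))) (at x)"
      using has_derivative_compose[OF delta_derivative, of P "\<lambda>y. g (\<delta> x) * y"]
        P[of "\<delta> x"] by (simp add: has_field_derivative_def)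
    show ?thesis
      unfolding Dg_def by (rule has_derivative_eq_rhs[OF has_derivative_mult[OF 1 has_derivative_inner_left[OF N_derivative]]]) auto
  qed
  have contgd: "continuous_on UNIV (\<lambda>x. g (\<delta> x))"
    by (rule continuous_on_compose2[OF g continuous_delta]) auto
  have contPd: "continuous_on UNIV (\<lambda>x. P (\<delta> x))"
    by (rule continuous_on_compose2[OF contP continuous_delta]) auto
  have contDg: "continuous_on UNIV (\<lambda>x. Dg b x h)" for b h
    unfolding Dg_def by (intro continuous_on_add continuous_on_mult continuous_on_inner continuous_on_const
        continuous_N continuous_DN contgd contPd)
  have supp: "P (\<delta> x) * (N x \<bullet> b) = 0" if "x \<notin> K" for b x
    using P0[OF off[OF that]] by simp
  have Dg0: "Dg b x h = 0" if "x \<notin> K" for b x h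
    unfolding Dg_def using P0[OF off[OF that]] g0[OF off[OF that]] by simp
  have int: "integrable lborel (\<lambda>x. Dg b x h)" for b h
    by (rule integrable_continuous_compact_support[OF contDg K Dg0])
  show intg: "integrable lborel (\<lambda>x. g (\<delta> x))"
    by (rule integrable_continuous_compact_support[OF contgd K]) (use g0 off in auto)
  have eq: "(\<Sum>b\<in>Basis. Dg b x b) \<ge> g (\<delta> x)" for x
  proof (cases "\<delta> x \<le> 0")
    case True
    then show ?thesis using P0 g0 by (simp add: Dg_def)
  next
    case False
    define s where "s = (norm (N x))\<^sup>2"
    have s: "0 \<le> s" "s \<le> 1" unfolding s_def using norm_N_le[of x] by (auto simp: power_le_one)
    have "(\<Sum>b\<in>Basis. Dg b x b) = P (\<delta> x) * (\<Sum>b\<in>Basis. DN x b \<bullet> b) + g (\<delta> x) * (\<Sum>b\<in>Basis. (N x \<bullet> b) * (N x \<bullet> b))"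
      unfolding Dg_def by (simp add: sum.distrib sum_distrib_left mult.assoc)
    also have "\<dots> = P (\<delta> x) * (- \<beta> * (1 - s)) + g (\<delta> x) * s"
      by (simp only: div_N euclidean_inner[symmetric] s_def power2_norm_eq_inner)
    also have "\<dots> = g (\<delta> x) - (1 - s) * (g (\<delta> x) + \<beta> * P (\<delta> x))" by (simp add: algebra_simps)
    also have "\<dots> \<ge> g (\<delta> x)"
      using mult_nonneg_nonpos[of "1 - s" "g (\<delta> x) + \<beta> * P (\<delta> x)"] s neg[of "\<delta> x"] le[of x] False by auto
    finally show ?thesis .
  qed
  have "(LINT x|lborel. g (\<delta> x)) \<le> (LINT x|lborel. (\<Sum>b\<in>Basis. Dg b x b))"
    by (rule integral_mono[OF intg Bochner_Integration.integrable_sum[OF int] eq])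
  also have "\<dots> = (\<Sum>b\<in>Basis. LINT x|lborel. Dg b x b)"
    by (intro Bochner_Integration.integral_sum int)
  also have "\<dots> = 0"
    by (intro sum.neutral ballI integral_directional_derivative_zero[OF der contDg K supp])
  finally show "(LINT x|lborel. g (\<delta> x)) \<le> 0" .
qed

end

text \<open>\<open>ramp \<tau>\<close> is a continuous substitute for the indicator of the positive half line.\<close>

definition ramp :: "real \<Rightarrow> real \<Rightarrow> real" where "ramp \<tau> t = max 0 (min 1 (t / \<tau>))"

lemma continuous_ramp: "continuous_on A (ramp \<tau>)"
  unfolding ramp_def divide_inverse by (intro continuous_intros)

text \<open>Starting the integral at -1 makes 0 an interior point of the interval of integration, so
  the derivative there is two-sided. Left of -1 the interval is empty and the value is again
  zero.\<close>

lemma antiderivative_vanishing_left: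
  fixes g :: "real \<Rightarrow> real"
  assumes g: "continuous_on UNIV g" and g0: "\<And>t. t \<le> 0 \<Longrightarrow> g t = 0"
  defines "P \<equiv> \<lambda>t. integral {-1..t} g"
  shows "\<And>t. t \<le> 0 \<Longrightarrow> P t = 0" and "\<And>t. (P has_real_derivative g t) (at t)"
proof -
  show P0: "P t = 0" if "t \<le> 0" for t
    unfolding P_def using integral_cong[of "{-1..t}" g "\<lambda>_. 0"] that g0 by simp
  show "(P has_real_derivative g t) (at t)" for t
  proof (cases "t < 0")
    case True
    have "((\<lambda>_. 0) has_real_derivative 0) (at t)" by simp
    then have "(P has_real_derivative 0) (at t)"
      by (rule has_field_derivative_transform_within_open[of _ _ _ "{..<0}"]) (use True P0 in auto)
    then show ?thesis using g0[of t] True by simp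
  next
    case False
    have "((\<lambda>x. integral {-1..x} g) has_real_derivative g t) (at t within {-1..t+1})"
      by (rule integral_has_real_derivative[OF continuous_on_subset[OF g]]) (use False in auto)
    then have "((\<lambda>x. integral {-1..x} g) has_real_derivative g t) (at t within {-1<..<t+1})"
      by (rule DERIV_subset) auto
    then show ?thesis
      using False by (subst (asm) at_within_open) (auto simp: P_def)
  qed
qed

text \<open>Running averages of an increasing function increase: \<open>m t\<close> lies between the
  average over \<open>{0..t}\<close> and the average over \<open>{t..R}\<close>.\<close>

lemma integral_mono_fun_le:
  fixes m :: "real \<Rightarrow> real"
  assumes mono: "mono m" and cont: "continuous_on UNIV m" and "0 < t" and "t \<le> R"
  shows "integral {0..t} m \<le> t * ((1 / R) * integral {0..R} m)"
proof -
  have int: "m integrable_on {a..b}" for a b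
    by (intro integrable_continuous_real continuous_on_subset[OF cont]) auto
  have "integral {0..t} m \<le> integral {0..t} (\<lambda>_. m t)"
    by (intro integral_le int) (auto intro: monoD[OF mono])
  then have 1: "integral {0..t} m \<le> t * m t" using assms by simp
  have "integral {t..R} (\<lambda>_. m t) \<le> integral {t..R} m"
    by (intro integral_le int) (auto intro: monoD[OF mono])
  then have 2: "(R - t) * m t \<le> integral {t..R} m" using assms by simp
  have "integral {0..R} m = integral {0..t} m + integral {t..R} m"
    using Henstock_Kurzweil_Integration.integral_combine[OF _ _ int, of 0 t R] assms by auto
  then have "t * integral {0..R} m \<ge> t * integral {0..t} m + t * ((R - t) * m t)"
    using 2 assms by (simp add: distrib_left)
  moreover have "(R - t) * (t * m t) \<ge> (R - t) * integral {0..t} m"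
    using 1 assms by (intro mult_left_mono) auto
  ultimately have "t * integral {0..R} m \<ge> R * integral {0..t} m"
    by (simp add: algebra_simps)
  then show ?thesis using assms by (simp add: field_simps)
qed

text \<open>The profile is compared with a constant \<open>A\<close> exceeding its average over
  \<open>{0..R}\<close>. The integrals of \<open>m - A\<close> over \<open>{0..t}\<close> are
  negative, because running averages of \<open>m\<close> increase. The slack \<open>\<eta>\<close>
  keeps them away from zero for \<open>t\<close> away from zero, so that a large
  \<open>\<beta>\<close> lets them outweigh the integrand; near zero the integrand is itself
  nonpositive. The ramp makes the integrand continuous across zero.\<close>

lemma (in soft_distance) integral_increasing_profile_le:
  fixes m :: "real \<Rightarrow> real"
  assumes K: "compact K" and off: "\<And>x. x \<notin> K \<Longrightarrow> \<delta> x \<le> 0" and le: "\<And>x. \<delta> x \<le> R" and R: "R > 0"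
    and mono: "mono m" and cont: "continuous_on UNIV m" and m0: "\<And>t. t \<le> 0 \<Longrightarrow> m t = 0"
    and \<Lambda>: "\<And>t. 0 \<le> t \<Longrightarrow> m t \<le> \<Lambda> * t" "\<Lambda> > 0"
    and A: "A \<ge> (1 / R) * integral {0..R} m + \<eta>" and \<eta>: "\<eta> > 0"
    and beta_ge: "\<beta> \<ge> 2 * m R / (\<eta> * (A / (2 * \<Lambda>)))"
  shows "(LINT x|lborel. m (\<delta> x)) \<le> A * measure lborel {x. 0 < \<delta> x}"
proof -
  have mpos: "m t \<ge> 0" for t
    using m0[of "min t 0"] monoD[OF mono, of "min t 0" t] by simp
  have intm: "m integrable_on {a..b}" for a b
    by (intro integrable_continuous_real continuous_on_subset[OF cont]) auto
  have "0 \<le> integral {0..R} m"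
    by (intro integral_nonneg intm) (use mpos in auto)
  then have Apos: "A > 0" using A \<eta> R by (smt (verit) divide_nonneg_pos mult_nonneg_nonneg)
  \<comment> \<open>Up to this point \<open>m\<close> is at most \<open>A / 2\<close>.\<close>
  define t0 where "t0 = A / (2 * \<Lambda>)"
  have t0: "t0 > 0" using Apos \<Lambda> by (simp add: t0_def)
  \<comment> \<open>The first bound keeps \<open>m\<close> below \<open>A\<close> times the ramp
    while the ramp climbs; the second limits what the ramp costs in the integral to half of
    \<open>\<eta> * t0\<close>.\<close>
  define \<tau> where "\<tau> = min (A / \<Lambda>) (\<eta> * t0 / (2 * A))"
  have \<tau>: "\<tau> > 0" "\<tau> \<le> A / \<Lambda>" "A * \<tau> \<le> \<eta> * t0 / 2"
  proof -
    show "\<tau> > 0" "\<tau> \<le> A / \<Lambda>" unfolding \<tau>_def using Apos \<Lambda> \<eta> t0 by auto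
    have "A * \<tau> \<le> A * (\<eta> * t0 / (2 * A))" unfolding \<tau>_def using Apos by (intro mult_left_mono) auto
    then show "A * \<tau> \<le> \<eta> * t0 / 2" using Apos by simp
  qed
  define c where "c = ramp \<tau>"
  have c: "continuous_on UNIV c" "\<And>t. 0 \<le> c t" "\<And>t. c t \<le> 1" "\<And>t. t \<le> 0 \<Longrightarrow> c t = 0"
    "\<And>t. t \<ge> \<tau> \<Longrightarrow> c t = 1" "\<And>t. 0 \<le> t \<Longrightarrow> t \<le> \<tau> \<Longrightarrow> c t = t / \<tau>"
    unfolding c_def using \<tau> by (auto simp: continuous_ramp) (auto simp: ramp_def divide_nonpos_pos max_def min_def zero_le_divide_iff)
  define g where "g = (\<lambda>t. m t - A * c t)"
  have g: "continuous_on UNIV g" unfolding g_def by (intro continuous_intros cont c)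
  have g0: "g t = 0" if "t \<le> 0" for t unfolding g_def using m0 c that by simp
  define P where "P = (\<lambda>t. integral {-1..t} g)"
  have P: "P t = 0" if "t \<le> 0" for t
    unfolding P_def by (rule antiderivative_vanishing_left(1)[OF g g0 that])
  have P': "(P has_real_derivative g t) (at t)" for t
    unfolding P_def by (rule antiderivative_vanishing_left(2)[OF g g0])
  have intg: "g integrable_on {a..b}" and intc: "c integrable_on {a..b}" for a b
    by (intro integrable_continuous_real continuous_on_subset[OF g] continuous_on_subset[OF c(1)]; simp)+
  have gneg: "g t \<le> 0" if "t \<le> t0" for t
  proof -
    consider "t \<le> 0" | "0 < t" "t \<le> \<tau>" | "\<tau> < t" by linarith
    then show ?thesis
    proof cases
      case 2
      have "\<Lambda> * \<tau> \<le> A" using \<tau>(2) \<Lambda> by (simp add: field_simps)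
      then have "\<Lambda> * t \<le> A * (t / \<tau>)"
        using 2 \<tau>(1) by (simp add: field_simps)
      then show ?thesis using \<Lambda>(1)[of t] 2 c(6)[of t] by (simp add: g_def)
    next
      case 3
      have "m t \<le> \<Lambda> * t0" using \<Lambda>(1)[of t0] monoD[OF mono that] t0 by linarith
      also have "\<dots> = A / 2" using \<Lambda> by (simp add: t0_def)
      finally show ?thesis using 3 c(5)[of t] Apos by (simp add: g_def)
    qed (use g0 in simp)
  qed
  have neg: "g t + \<beta> * P t \<le> 0" if t: "0 < t" "t \<le> R" for t
  proof (cases "t \<le> t0")
    case True
    have "integral {-1..t} g \<le> integral {-1..t} (\<lambda>_. 0)"
      by (intro integral_le intg) (use gneg True in auto)
    then have "P t \<le> 0" by (simp add: P_def)
    then show ?thesis using gneg[OF True] beta by (smt (verit) mult_pos_neg mult_eq_0_iff mult_nonneg_nonpos)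
  next
    case False
    have 1: "integral {-1..t} m = integral {0..t} m"
    proof -
      have "integral {-1..t} m = integral {-1..0} m + integral {0..t} m"
        using Henstock_Kurzweil_Integration.integral_combine[OF _ _ intm, of "-1" 0 t] t by auto
      moreover have "integral {-1..0} m = 0"
        using integral_cong[of "{-1..0}" m "\<lambda>_. 0"] m0 by simp
      ultimately show ?thesis by simp
    qed
    have 2: "integral {-1..t} c \<ge> t - \<tau>"
    proof (cases "\<tau> \<le> t")
      case True
      have "integral {-1..t} c = integral {-1..\<tau>} c + integral {\<tau>..t} c"
        using Henstock_Kurzweil_Integration.integral_combine[OF _ _ intc, of "-1" \<tau> t] True \<tau> by auto
      moreover have "integral {-1..\<tau>} c \<ge> 0" by (intro integral_nonneg intc) (use c in auto)
      moreover have "integral {\<tau>..t} c = t - \<tau>"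
        using integral_cong[of "{\<tau>..t}" c "\<lambda>_. 1"] c True by simp
      ultimately show ?thesis by simp
    next
      case False
      moreover have "integral {-1..t} c \<ge> 0" by (intro integral_nonneg intc) (use c in auto)
      ultimately show ?thesis by simp
    qed
    have "P t = integral {-1..t} m - A * integral {-1..t} c"
      unfolding P_def g_def by (subst integral_diff) (auto intro!: intm intc integrable_on_mult_right)
    also have "\<dots> \<le> t * ((1 / R) * integral {0..R} m) - A * (t - \<tau>)"
      unfolding 1 using integral_mono_fun_le[OF mono cont t] mult_left_mono[OF 2, of A] Apos by linarith
    also have "\<dots> \<le> t * (A - \<eta>) - A * (t - \<tau>)"
      using A t by (intro diff_right_mono mult_left_mono) auto
    also have "\<dots> = A * \<tau> - \<eta> * t" by (simp add: algebra_simps)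
    \<comment> \<open>Past \<open>t0\<close> the slack \<open>\<eta> * t\<close> is at least
      \<open>\<eta> * t0\<close>, twice the cost of the ramp.\<close>
    also have "\<dots> \<le> - (\<eta> * t0 / 2)" using \<tau>(3) mult_left_mono[of t0 t \<eta>] False \<eta> by linarith
    finally have 3: "P t \<le> - (\<eta> * t0 / 2)" .
    have "2 * m R / (\<eta> * t0) \<le> \<beta>" using beta_ge unfolding t0_def .
    then have "m R \<le> \<beta> * (\<eta> * t0 / 2)"
      using \<eta> t0 by (simp add: field_simps)
    moreover have "\<beta> * P t \<le> \<beta> * (- (\<eta> * t0 / 2))" using 3 beta by (intro mult_left_mono) auto
    moreover have "g t \<le> m R"
      using monoD[OF mono t(2)] c(2)[of t] Apos unfolding g_def by (smt (verit) mult_nonneg_nonneg)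
    ultimately show ?thesis by simp
  qed
  note res = integral_profile_nonpos[OF K off le g g0 P' P neg]
  have contd: "continuous_on UNIV (\<lambda>x. c (\<delta> x))"
    by (rule continuous_on_compose2[OF c(1) continuous_delta]) auto
  have intcd: "integrable lborel (\<lambda>x. c (\<delta> x))"
    by (rule integrable_continuous_compact_support[OF contd K]) (use c off in auto)
  have opn: "open {x. 0 < \<delta> x}"
    using open_Collect_less[OF continuous_on_const[of UNIV 0] continuous_delta[of UNIV]] by simp
  have sub: "{x. 0 < \<delta> x} \<subseteq> K" using off by (force simp: not_le)
  have fin: "emeasure lborel {x. 0 < \<delta> x} < \<infinity>"
    using emeasure_mono[OF sub, of lborel] emeasure_compact_finite[OF K] K
    by (simp add: compact_imp_closed borel_closed order.strict_trans1)
  have "(LINT x|lborel. m (\<delta> x)) = (LINT x|lborel. g (\<delta> x) + A * c (\<delta> x))"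
    by (simp add: g_def)
  also have "\<dots> = (LINT x|lborel. g (\<delta> x)) + A * (LINT x|lborel. c (\<delta> x))"
    using res(1) intcd by simp
  also have "\<dots> \<le> A * (LINT x|lborel. c (\<delta> x))" using res(2) by simp
  also have "(LINT x|lborel. c (\<delta> x)) \<le> (LINT x|lborel. indicator {x. 0 < \<delta> x} x)"
  proof (rule integral_mono[OF intcd])
    show "integrable lborel (indicat_real {x. 0 < \<delta> x})"
      using fin opn by (intro integrable_real_indicator) auto
    show "c (\<delta> x) \<le> indicat_real {x. 0 < \<delta> x} x" for x
      using c(3,4)[of "\<delta> x"] by (auto simp: indicator_def)
  qed
  then have "A * (LINT x|lborel. c (\<delta> x)) \<le> A * measure lborel {x. 0 < \<delta> x}"
    using Apos by (intro mult_left_mono) auto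
  finally show ?thesis .
qed

section \<open>Smooth functions\<close>

text \<open>Smoothness is proved coinductively: it suffices to exhibit a class closed under partial
  derivatives, and no formula for higher derivatives is needed.\<close>

lemma Ck_coinduct:
  fixes X :: "('a::euclidean_space \<Rightarrow> real) set"
  assumes "\<And>f. f \<in> X \<Longrightarrow> \<exists>f'. (\<forall>x. (f has_derivative f' x) (at x)) \<and> (\<forall>b\<in>Basis. (\<lambda>x. f' x b) \<in> X)"
  shows "f \<in> X \<Longrightarrow> smooth f"
proof -
  have "f \<in> X \<Longrightarrow> Ck k f" for f k
  proof (induction k arbitrary: f)
    case 0
    then obtain f' where "\<And>x. (f has_derivative f' x) (at x)" using assms by blast
    then show ?case by (auto intro!: continuous_at_imp_continuous_on has_derivative_continuous)
  next
    case (Suc k)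
    then obtain f' where f': "\<And>x. (f has_derivative f' x) (at x)" "\<And>b. b \<in> Basis \<Longrightarrow> (\<lambda>x. f' x b) \<in> X"
      using assms by meson
    have "frechet_derivative f (at x) = f' x" for x using frechet_derivative_at[OF f'(1)] by simp
    then show ?case using Suc.IH[OF f'(2)] f'(1) by (auto simp: differentiable_def)
  qed
  then show "f \<in> X \<Longrightarrow> smooth f" by (simp add: smooth_def)
qed

lemma Ck_Suc_imp_Ck: "Ck (Suc k) f \<Longrightarrow> Ck k f"
proof (induction k arbitrary: f)
  case 0
  then show ?case by (auto intro!: continuous_at_imp_continuous_on differentiable_imp_continuous_within)
next
  case (Suc k)
  then show ?case by (simp only: Ck.simps) blast
qed

lemma smooth_derivative:
  fixes f :: "'a::euclidean_space \<Rightarrow> real"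
  assumes "smooth f"
  shows "(f has_derivative frechet_derivative f (at x)) (at x)"
    and "b \<in> Basis \<Longrightarrow> smooth (\<lambda>x. frechet_derivative f (at x) b)" and "continuous_on A f"
proof -
  have "Ck (Suc k) f" for k using assms by (simp add: smooth_def)
  then show "(f has_derivative frechet_derivative f (at x)) (at x)"
    "b \<in> Basis \<Longrightarrow> smooth (\<lambda>x. frechet_derivative f (at x) b)"
    by (auto simp: smooth_def frechet_derivative_works)
  have "Ck 0 f" using assms unfolding smooth_def by blast
  then show "continuous_on A f" by (auto intro: continuous_on_subset)
qed

lemma smooth_real_coinduct:
  fixes X :: "(real \<Rightarrow> real) set"
  assumes "\<And>f. f \<in> X \<Longrightarrow> \<exists>f'\<in>X. \<forall>x. (f has_real_derivative f' x) (at x)"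
  shows "f \<in> X \<Longrightarrow> smooth f"
proof (rule Ck_coinduct[of X])
  fix f assume "f \<in> X"
  then obtain f' where f': "f' \<in> X" "\<And>x. (f has_real_derivative f' x) (at x)" using assms by blast
  then show "\<exists>f'. (\<forall>x. (f has_derivative f' x) (at x)) \<and> (\<forall>b\<in>Basis. (\<lambda>x. f' x b) \<in> X)"
    by (intro exI[of _ "\<lambda>x h. f' x * h"]) (auto simp: has_field_derivative_def)
qed

lemma smooth_real_derivative:
  fixes f :: "real \<Rightarrow> real"
  assumes "smooth f"
  shows "(f has_real_derivative deriv f x) (at x)" and "smooth (deriv f)"
proof -
  have d: "(f has_real_derivative deriv f x) (at x)" for x
    using smooth_derivative(1)[OF assms, of x] DERIV_deriv_iff_real_differentiable differentiableI by blast
  then show "(f has_real_derivative deriv f x) (at x)" .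
  have "frechet_derivative f (at x) 1 = deriv f x" for x
  proof -
    have "(*) (deriv f x) = frechet_derivative f (at x)"
      using d[of x] by (intro frechet_derivative_at) (simp add: has_field_derivative_def)
    from fun_cong[OF this, of 1] show ?thesis by simp
  qed
  then show "smooth (deriv f)" using smooth_derivative(2)[OF assms, of 1] by simp
qed

lemma smooth_of_derivative:
  fixes f :: "real \<Rightarrow> real"
  assumes "\<And>x. (f has_real_derivative f' x) (at x)" and "smooth f'"
  shows "smooth f"
proof (rule smooth_real_coinduct[of "insert f (Collect smooth)"])
  fix h assume "h \<in> insert f (Collect smooth)"
  then consider "h = f" | "smooth h" by blast
  then show "\<exists>f'\<in>insert f (Collect smooth). \<forall>x. (h has_real_derivative f' x) (at x)"
  proof cases
    case 1
    then show ?thesis using assms by (intro bexI[of _ f']) auto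
  next
    case 2
    then show ?thesis using smooth_real_derivative[OF 2] by (intro bexI[of _ "deriv h"]) auto
  qed
qed simp

lemma test_functionsI:
  assumes "smooth f" and "compact K" and "K \<subseteq> \<Omega>" and "\<And>x. x \<notin> K \<Longrightarrow> f x = 0"
  shows "f \<in> test_functions \<Omega>"
proof -
  have sub: "closure {x. f x \<noteq> 0} \<subseteq> K"
  proof (rule closure_minimal)
    show "{x. f x \<noteq> 0} \<subseteq> K" using assms(4) by blast
  qed (rule compact_imp_closed[OF assms(2)])
  moreover have "compact (closure {x. f x \<noteq> 0})"
    using compact_Int_closed[OF assms(2) closed_closure[of "{x. f x \<noteq> 0}"]] sub by (simp add: Int_absorb1)
  ultimately show ?thesis using assms(1,3) unfolding test_functions_def by auto
qed

lemma deriv_zero_off_interval: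
  fixes f :: "real \<Rightarrow> real"
  assumes "\<And>t. t \<notin> {a..b} \<Longrightarrow> f t = 0" and "t \<notin> {a..b}"
  shows "deriv f t = 0"
proof (rule DERIV_imp_deriv)
  have "((\<lambda>_. 0) has_real_derivative 0) (at t)" by simp
  then show "(f has_real_derivative 0) (at t)"
    by (rule has_field_derivative_transform_within_open[of _ _ _ "- {a..b}"]) (use assms in \<open>auto simp: open_Compl\<close>)
qed

lemma Ck_add: "Ck k f \<Longrightarrow> Ck k g \<Longrightarrow> Ck k (\<lambda>x. f x + g x)"
proof (induction k arbitrary: f g)
  case (Suc k)
  have d: "f differentiable (at x)" "g differentiable (at x)" for x using Suc.prems by auto
  then have "frechet_derivative (\<lambda>x. f x + g x) (at x) = (\<lambda>h. frechet_derivative f (at x) h + frechet_derivative g (at x) h)" for x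
    by (intro frechet_derivative_at[symmetric] has_derivative_add) (auto simp: frechet_derivative_works[symmetric])
  then show ?case using Suc d by auto
qed (auto intro: continuous_on_add)

lemma Ck_mult: "Ck k f \<Longrightarrow> Ck k g \<Longrightarrow> Ck k (\<lambda>x. f x * g x)"
proof (induction k arbitrary: f g)
  case (Suc k)
  have d: "f differentiable (at x)" "g differentiable (at x)" for x using Suc.prems by auto
  then have "frechet_derivative (\<lambda>x. f x * g x) (at x) = (\<lambda>h. f x * frechet_derivative g (at x) h + frechet_derivative f (at x) h * g x)" for x
    by (intro frechet_derivative_at[symmetric] has_derivative_mult) (auto simp: frechet_derivative_works[symmetric])
  moreover have "Ck k f" "Ck k g" using Suc.prems by (auto intro: Ck_Suc_imp_Ck)
  ultimately show ?case using Suc d by (auto intro!: Ck_add Suc.IH)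
qed (auto intro: continuous_on_mult)

lemma smooth_mult: "smooth f \<Longrightarrow> smooth g \<Longrightarrow> smooth (\<lambda>x. f x * g x)"
  by (simp add: smooth_def Ck_mult)

text \<open>The factor \<open>C\<close> serves the coinduction: each derivative produces another
  factor \<open>a\<close>.\<close>

lemma smooth_affine:
  fixes f :: "real \<Rightarrow> real"
  assumes "smooth f"
  shows "smooth (\<lambda>x. C * f (a * x + c))"
proof (rule smooth_real_coinduct[of "{\<lambda>x. C * f (a * x + c) | C f. smooth f}"])
  fix h assume "h \<in> {\<lambda>x. C * f (a * x + c) | C f. smooth f}"
  then obtain C f where h: "h = (\<lambda>x. C * f (a * x + c))" "smooth f" by blast
  have "((\<lambda>x. f (a * x + c)) has_real_derivative deriv f (a * x + c) * a) (at x)" for x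
    by (rule DERIV_chain2[of f]) (auto intro!: derivative_eq_intros smooth_real_derivative h)
  then have "(h has_real_derivative (C * a) * deriv f (a * x + c)) (at x)" for x
    unfolding h(1) using DERIV_cmult[of "\<lambda>x. f (a * x + c)" "deriv f (a * x + c) * a" x UNIV C]
    by (simp add: mult.assoc mult.commute[of a])
  then show "\<exists>f'\<in>{\<lambda>x. C * f (a * x + c) | C f. smooth f}. \<forall>x. (h has_real_derivative f' x) (at x)"
    by (intro bexI[of _ "\<lambda>x. (C * a) * deriv f (a * x + c)"] allI CollectI exI[of _ "C * a"] exI[of _ "deriv f"] conjI
        refl smooth_real_derivative(2)[OF h(2)])
next
  show "(\<lambda>x. C * f (a * x + c)) \<in> {\<lambda>x. C * f (a * x + c) | C f. smooth f}"
    by (intro CollectI exI[of _ C] exI[of _ f] conjI refl assms)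
qed

text \<open>Induction on the order with \<open>g\<close> arbitrary: the derivative is
  \<open>g'\<close> composed with \<open>\<psi>\<close>, times \<open>\<psi>'\<close>, and products
  of functions of class \<open>Ck\<close> are again of that class.\<close>

lemma smooth_compose:
  fixes g \<psi> :: "real \<Rightarrow> real"
  assumes "smooth g" and "smooth \<psi>"
  shows "smooth (\<lambda>x. g (\<psi> x))"
proof -
  have "Ck k (\<lambda>x. g (\<psi> x))" if "smooth g" for k g
    using that
  proof (induction k arbitrary: g)
    case 0
    then show ?case
      by (auto intro!: continuous_on_compose2[OF smooth_derivative(3)[OF 0] smooth_derivative(3)[OF assms(2)]])
  next
    case (Suc k)
    have D: "((\<lambda>x. g (\<psi> x)) has_real_derivative deriv g (\<psi> x) * deriv \<psi> x) (at x)" for x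
      by (rule DERIV_chain2[OF smooth_real_derivative(1)[OF Suc.prems] smooth_real_derivative(1)[OF assms(2)]])
    then have "frechet_derivative (\<lambda>x. g (\<psi> x)) (at x) = (\<lambda>h. deriv g (\<psi> x) * deriv \<psi> x * h)" for x
      by (intro frechet_derivative_at[symmetric]) (simp add: has_field_derivative_def)
    moreover have "Ck k (\<lambda>x. deriv g (\<psi> x) * deriv \<psi> x)"
      using Suc.IH[OF smooth_real_derivative(2)[OF Suc.prems]] smooth_real_derivative(2)[OF assms(2)]
      by (intro Ck_mult) (auto simp: smooth_def)
    ultimately show ?case using D by (auto intro: differentiableI simp: has_field_derivative_def)
  qed
  then show ?thesis using assms(1) by (simp add: smooth_def)
qed

text \<open>Carrying a polynomial in \<open>1 / x\<close> makes this class closed under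
  differentiation: in terms of \<open>y = 1/x\<close> the polynomial \<open>p\<close> turns into
  \<open>y\<^sup>2 (p - p')\<close>.\<close>

definition flat :: "real poly \<Rightarrow> real \<Rightarrow> real" where
  "flat p x = (if x > 0 then poly p (1 / x) * exp (- (1 / x)) else 0)"

lemma poly_exp_tendsto_0: "((\<lambda>y. poly p y * exp (- y)) \<longlongrightarrow> 0) (at_top :: real filter)"
proof -
  have "((\<lambda>y::real. \<Sum>i\<le>degree p. coeff p i * (y ^ i / exp y)) \<longlongrightarrow> (\<Sum>i\<le>degree p. coeff p i * 0)) at_top"
    by (intro tendsto_intros tendsto_power_div_exp_0)
  then show ?thesis
    by (simp add: poly_altdef exp_minus sum_distrib_right divide_inverse mult.assoc)
qed

lemma flat_derivative: "(flat p has_real_derivative flat ([:0, 0, 1:] * (p - pderiv p)) x) (at x)"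
proof -
  consider "x < 0" | "x = 0" | "x > 0" by linarith
  then show ?thesis
  proof cases
    case 1
    have "((\<lambda>_. 0) has_real_derivative 0) (at x)" by simp
    then have "(flat p has_real_derivative 0) (at x)"
      by (rule has_field_derivative_transform_within_open[of _ _ _ "{..<0}"]) (use 1 in \<open>auto simp: flat_def\<close>)
    then show ?thesis using 1 by (simp add: flat_def)
  next
    case 3
    have "((\<lambda>x. poly p (1 / x) * exp (- (1 / x))) has_real_derivative
        poly (pderiv p) (1 / x) * (- (1 / x ^ 2)) * exp (- (1 / x)) + poly p (1 / x) * (exp (- (1 / x)) * (1 / x ^ 2))) (at x)"
      using 3 by (auto intro!: derivative_eq_intros DERIV_chain2[OF poly_DERIV] simp: power2_eq_square field_simps)
    then have "(flat p has_real_derivative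
        poly (pderiv p) (1 / x) * (- (1 / x ^ 2)) * exp (- (1 / x)) + poly p (1 / x) * (exp (- (1 / x)) * (1 / x ^ 2))) (at x)"
      by (rule has_field_derivative_transform_within_open[of _ _ _ "{0<..}"]) (use 3 in \<open>auto simp: flat_def\<close>)
    moreover have "poly (pderiv p) (1 / x) * (- (1 / x ^ 2)) * exp (- (1 / x)) + poly p (1 / x) * (exp (- (1 / x)) * (1 / x ^ 2))
       = flat ([:0, 0, 1:] * (p - pderiv p)) x"
      using 3 by (simp add: flat_def field_simps power2_eq_square)
    ultimately show ?thesis by simp
  next
    case 2
    \<comment> \<open>\<open>pCons 0 p\<close> is \<open>y * p(y)\<close>; the additional factor
      \<open>y = 1/h\<close> is the division by \<open>h\<close> in the difference quotient at
      0.\<close>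
    have lim: "((\<lambda>y. poly (pCons 0 p) y * exp (- y)) \<longlongrightarrow> 0) (at_top :: real filter)" by (rule poly_exp_tendsto_0)
    have "((\<lambda>h. poly (pCons 0 p) (inverse h) * exp (- inverse h)) \<longlongrightarrow> 0) (at_right (0::real))"
      by (rule filterlim_compose[OF lim filterlim_inverse_at_top_right])
    then have "((\<lambda>h. flat p h / h) \<longlongrightarrow> 0) (at_right 0)"
      by (rule Lim_transform_eventually)
         (auto simp: eventually_at_right_field flat_def field_simps intro!: exI[of _ 1])
    moreover have "((\<lambda>h. flat p h / h) \<longlongrightarrow> 0) (at_left 0)"
      by (rule Lim_transform_eventually[OF tendsto_const])
         (auto simp: eventually_at_left_field flat_def intro!: exI[of _ "-1"])
    ultimately have "((\<lambda>h. flat p h / h) \<longlongrightarrow> 0) (at 0)" by (simp add: filterlim_split_at)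
    then show ?thesis using 2 by (simp add: has_field_derivative_iff flat_def)
  qed
qed

lemma smooth_flat: "smooth (flat p)"
proof (rule smooth_real_coinduct[of "range flat"])
  fix f assume "f \<in> range flat"
  then obtain p where "f = flat p" by blast
  then show "\<exists>f'\<in>range flat. \<forall>x. (f has_real_derivative f' x) (at x)"
    by (intro bexI[of _ "flat ([:0, 0, 1:] * (p - pderiv p))"] rangeI) (simp only: flat_derivative simp_thms)
qed (rule rangeI)

definition bump :: "real \<Rightarrow> real" where "bump x = flat 1 x * flat 1 (1 - x)"

lemma smooth_bump: "smooth bump"
  unfolding bump_def[abs_def]
  using smooth_mult[OF smooth_flat smooth_affine[OF smooth_flat, of 1 _ "-1" 1]] by simp

lemma bump_pos: "0 < x \<Longrightarrow> x < 1 \<Longrightarrow> bump x > 0"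
  by (simp add: bump_def flat_def)

lemma bump_zero: "x \<le> 0 \<or> 1 \<le> x \<Longrightarrow> bump x = 0"
  by (auto simp: bump_def flat_def)

lemma bump_nonneg: "bump x \<ge> 0"
  using bump_pos[of x] bump_zero[of x] by (cases "0 < x \<and> x < 1") auto

text \<open>The primitive of \<open>bump\<close>, divided by its total mass
  \<open>P 1\<close>.\<close>

lemma smooth_step_exists:
  obtains S :: "real \<Rightarrow> real" where "smooth S" "\<And>x. x \<le> 0 \<Longrightarrow> S x = 0" "\<And>x. x \<ge> 1 \<Longrightarrow> S x = 1" "mono S"
    "\<And>x. 0 \<le> S x" "\<And>x. S x \<le> 1"
proof -
  have cont: "continuous_on A bump" for A by (rule smooth_derivative(3)[OF smooth_bump])
  define P where "P = (\<lambda>t. integral {-1..t} bump)"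
  have P0: "P t = 0" if "t \<le> 0" for t
    unfolding P_def by (rule antiderivative_vanishing_left(1)[OF cont _ that]) (simp add: bump_zero)
  have P': "(P has_real_derivative bump t) (at t)" for t
    unfolding P_def by (rule antiderivative_vanishing_left(2)[OF cont]) (simp add: bump_zero)
  have monoP: "mono P"
  proof (rule monoI)
    fix x y :: real assume "x \<le> y"
    then show "P x \<le> P y"
      by (rule DERIV_nonneg_imp_nondecreasing) (rule exI, rule conjI[OF P' bump_nonneg])
  qed
  obtain z where z: "0 < z" "z < 1" "P 1 - P 0 = (1 - 0) * bump z"
    using MVT2[of 0 1 P bump] P' by auto
  then have P1: "P 1 > 0" using P0[of 0] bump_pos[of z] by simp
  have Pge: "P x = P 1" if x: "x \<ge> 1" for x
  proof (cases "x = 1")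
    case False
    then have "1 < x" using x by simp
    from MVT2[OF this, of P bump] P' obtain z where z: "1 < z" "z < x" "P x - P 1 = (x - 1) * bump z"
      by blast
    then show ?thesis using bump_zero[of z] by simp
  qed simp
  define S where "S = (\<lambda>x. P x / P 1)"
  have le1: "P x \<le> P 1" for x using monoD[OF monoP, of x 1] Pge[of x] by (cases "x \<le> 1") auto
  have ge0: "0 \<le> P x" for x using monoD[OF monoP, of 0 x] P0[of 0] P0[of x] by (cases "x \<le> 0") auto
  have "smooth P" by (rule smooth_of_derivative[OF P' smooth_bump])
  from smooth_affine[OF this, of "1 / P 1" 1 0] have sm: "smooth S" by (simp add: S_def)
  have mn: "mono S"
    unfolding S_def using P1 by (intro monoI divide_right_mono monoD[OF monoP]) simp_all
  show ?thesis
  proof (rule that[OF sm _ _ mn])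
    show "S x = 0" if "x \<le> 0" for x using P0[OF that] by (simp add: S_def)
    show "S x = 1" if "x \<ge> 1" for x using Pge[OF that] P1 by (simp add: S_def)
    show "0 \<le> S x" for x using ge0[of x] P1 by (simp add: S_def)
    show "S x \<le> 1" for x using le1[of x] P1 by (simp add: S_def)
  qed
qed

text \<open>Differentiating in direction \<open>b\<^sub>0\<close> replaces a single factor by its
  derivative, so products of smooth functions of one coordinate form a class closed under partial
  derivatives.\<close>

lemma smooth_coordinate_product:
  fixes g :: "'a::euclidean_space \<Rightarrow> real \<Rightarrow> real"
  assumes "\<And>b. b \<in> Basis \<Longrightarrow> smooth (g b)"
  shows "smooth (\<lambda>x. \<Prod>b\<in>Basis. g b (x \<bullet> b))"
    and "b\<^sub>0 \<in> Basis \<Longrightarrow> frechet_derivative (\<lambda>x. \<Prod>b\<in>Basis. g b (x \<bullet> b)) (at x) b\<^sub>0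
      = (\<Prod>b\<in>Basis. (if b = b\<^sub>0 then deriv (g b) else g b) (x \<bullet> b))"
proof -
  define X where "X = {\<lambda>x::'a. \<Prod>b\<in>Basis. g b (x \<bullet> b) | g. \<forall>b\<in>Basis. smooth (g b)}"
  have der: "((\<lambda>x::'a. \<Prod>b\<in>Basis. g b (x \<bullet> b)) has_derivative
      (\<lambda>h. \<Sum>i\<in>Basis. (deriv (g i) (x \<bullet> i) * (h \<bullet> i)) * (\<Prod>j\<in>Basis - {i}. g j (x \<bullet> j)))) (at x)"
    if g: "\<forall>b\<in>Basis. smooth (g b)" for g x
  proof (rule has_derivative_prod)
    fix i :: 'a assume "i \<in> Basis"
    then have "(g i has_derivative (*) (deriv (g i) (x \<bullet> i))) (at (x \<bullet> i))"
      using smooth_real_derivative(1)[of "g i" "x \<bullet> i"] g by (simp add: has_field_derivative_def)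
    from has_derivative_compose[OF has_derivative_inner_left[OF has_derivative_ident] this]
    show "((\<lambda>x. g i (x \<bullet> i)) has_derivative (\<lambda>h. deriv (g i) (x \<bullet> i) * (h \<bullet> i))) (at x)" by simp
  qed
  have val: "(\<Sum>i\<in>Basis. (deriv (g i) (x \<bullet> i) * (b\<^sub>0 \<bullet> i)) * (\<Prod>j\<in>Basis - {i}. g j (x \<bullet> j)))
      = (\<Prod>b\<in>Basis. (if b = b\<^sub>0 then deriv (g b) else g b) (x \<bullet> b))" if b0: "b\<^sub>0 \<in> Basis" for g b\<^sub>0 and x :: 'a
  proof -
    have "(\<Sum>i\<in>Basis. (deriv (g i) (x \<bullet> i) * (b\<^sub>0 \<bullet> i)) * (\<Prod>j\<in>Basis - {i}. g j (x \<bullet> j)))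
        = (\<Sum>i\<in>Basis. if i = b\<^sub>0 then deriv (g b\<^sub>0) (x \<bullet> b\<^sub>0) * (\<Prod>j\<in>Basis - {b\<^sub>0}. g j (x \<bullet> j)) else 0)"
      using b0 by (intro sum.cong) (auto simp: inner_Basis)
    also have "\<dots> = deriv (g b\<^sub>0) (x \<bullet> b\<^sub>0) * (\<Prod>j\<in>Basis - {b\<^sub>0}. g j (x \<bullet> j))" using b0 by simp
    also have "(\<Prod>j\<in>Basis - {b\<^sub>0}. g j (x \<bullet> j)) = (\<Prod>j\<in>Basis - {b\<^sub>0}. (if j = b\<^sub>0 then deriv (g j) else g j) (x \<bullet> j))"
      by (intro prod.cong) auto
    finally show ?thesis using b0 by (subst (2) prod.remove[of _ b\<^sub>0]) auto
  qed
  have g: "\<forall>b\<in>Basis. smooth (g b)" using assms by blast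
  show "smooth (\<lambda>x. \<Prod>b\<in>Basis. g b (x \<bullet> b))"
  proof (rule Ck_coinduct[of X])
    show "(\<lambda>x. \<Prod>b\<in>Basis. g b (x \<bullet> b)) \<in> X" unfolding X_def using g by blast
    fix f assume "f \<in> X"
    then obtain g where f: "f = (\<lambda>x. \<Prod>b\<in>Basis. g b (x \<bullet> b))" and g: "\<forall>b\<in>Basis. smooth (g b)"
      unfolding X_def by blast
    show "\<exists>f'. (\<forall>x. (f has_derivative f' x) (at x)) \<and> (\<forall>b\<in>Basis. (\<lambda>x. f' x b) \<in> X)"
    proof (intro exI conjI allI ballI)
      show "(f has_derivative (\<lambda>h. \<Sum>i\<in>Basis. (deriv (g i) (x \<bullet> i) * (h \<bullet> i)) * (\<Prod>j\<in>Basis - {i}. g j (x \<bullet> j)))) (at x)" for x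
        unfolding f by (rule der[OF g])
      fix b\<^sub>0 :: 'a assume b0: "b\<^sub>0 \<in> Basis"
      have "\<forall>b\<in>Basis. smooth (if b = b\<^sub>0 then deriv (g b) else g b)" using g smooth_real_derivative(2) by auto
      then have "(\<lambda>x. \<Prod>b\<in>Basis. (if b = b\<^sub>0 then deriv (g b) else g b) (x \<bullet> b)) \<in> X"
        unfolding X_def by (intro CollectI exI[of _ "\<lambda>b. if b = b\<^sub>0 then deriv (g b) else g b"]) simp
      then show "(\<lambda>x. \<Sum>i\<in>Basis. (deriv (g i) (x \<bullet> i) * (b\<^sub>0 \<bullet> i)) * (\<Prod>j\<in>Basis - {i}. g j (x \<bullet> j))) \<in> X"
        by (simp only: val[OF b0])
    qed
  qed
  assume b0: "b\<^sub>0 \<in> Basis"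
  show "frechet_derivative (\<lambda>x. \<Prod>b\<in>Basis. g b (x \<bullet> b)) (at x) b\<^sub>0
      = (\<Prod>b\<in>Basis. (if b = b\<^sub>0 then deriv (g b) else g b) (x \<bullet> b))"
    using fun_cong[OF frechet_derivative_at[OF der[OF g, of x]], of b\<^sub>0] val[OF b0, of g x] by (simp only:)
qed

section \<open>The distance to the boundary of a convex set\<close>

lemma ball_infdist_subset: "ball x (infdist x (- \<Omega>)) \<subseteq> \<Omega>"
  using infdist_le[of _ "- \<Omega>" x] by (force simp: not_le)

lemma infdist_ge_ball:
  fixes \<Omega> :: "'a::euclidean_space set"
  assumes "ball x r \<subseteq> \<Omega>" and "- \<Omega> \<noteq> {}"
  shows "r \<le> infdist x (- \<Omega>)"
  unfolding infdist_notempty[OF assms(2)]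
proof (rule cINF_greatest[OF assms(2)])
  fix y assume "y \<in> - \<Omega>"
  then show "r \<le> dist x y" using assms(1) by (meson ComplD mem_ball not_le subsetD)
qed

lemma bounded_complement_nonempty:
  fixes \<Omega> :: "'a::euclidean_space set"
  shows "bounded \<Omega> \<Longrightarrow> - \<Omega> \<noteq> {}"
  using not_bounded_UNIV by (metis compl_bot_eq double_complement)

text \<open>Balls about \<open>x\<close> fit into the set exactly up to the radius
  \<open>infdist x (- \<Omega>)\<close>, so the inradius is the maximum of this continuous function,
  attained on the compact closure.\<close>

lemma inradius_attained:
  fixes \<Omega> :: "'a::euclidean_space set"
  assumes "\<Omega> \<noteq> {}" and "open \<Omega>" and "bounded \<Omega>"
  obtains x\<^sub>0 where "x\<^sub>0 \<in> \<Omega>" "infdist x\<^sub>0 (- \<Omega>) = inradius \<Omega>" "inradius \<Omega> > 0" "\<And>x. infdist x (- \<Omega>) \<le> inradius \<Omega>"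
    "ball x\<^sub>0 (inradius \<Omega>) \<subseteq> \<Omega>"
proof -
  note ne = bounded_complement_nonempty[OF assms(3)]
  have "\<exists>x\<in>closure \<Omega>. \<forall>y\<in>closure \<Omega>. infdist y (- \<Omega>) \<le> infdist x (- \<Omega>)"
    by (intro continuous_attains_sup continuous_on_infdist continuous_on_id) (use assms in auto)
  then obtain x\<^sub>0 where x0: "\<And>y. y \<in> closure \<Omega> \<Longrightarrow> infdist y (- \<Omega>) \<le> infdist x\<^sub>0 (- \<Omega>)" by blast
  obtain z where z: "z \<in> \<Omega>" using assms by blast
  then obtain e where "e > 0" "ball z e \<subseteq> \<Omega>" using assms(2) open_contains_ball by blast
  then have "infdist z (- \<Omega>) > 0" using infdist_ge_ball[OF _ ne] by fastforce
  moreover have "infdist z (- \<Omega>) \<le> infdist x\<^sub>0 (- \<Omega>)" using z closure_subset by (intro x0) blast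
  ultimately have pos: "infdist x\<^sub>0 (- \<Omega>) > 0" by linarith
  have all: "infdist y (- \<Omega>) \<le> infdist x\<^sub>0 (- \<Omega>)" for y
  proof (cases "y \<in> \<Omega>")
    case True then show ?thesis using closure_subset by (intro x0) blast
  next
    case False then show ?thesis using pos by simp
  qed
  have "inradius \<Omega> = infdist x\<^sub>0 (- \<Omega>)"
    unfolding inradius_def
  proof (rule cSup_eq_maximum)
    show "infdist x\<^sub>0 (- \<Omega>) \<in> {r. r > 0 \<and> (\<exists>x. ball x r \<subseteq> \<Omega>)}"
      using pos ball_infdist_subset by blast
  qed (use infdist_ge_ball[OF _ ne] all order_trans in blast)
  moreover have "x\<^sub>0 \<in> \<Omega>"
    using pos infdist_zero[of x\<^sub>0 "- \<Omega>"] by (cases "x\<^sub>0 \<in> \<Omega>") auto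
  ultimately show ?thesis using that[of x\<^sub>0] pos all ball_infdist_subset by metis
qed

lemma inradius_ge:
  fixes \<Omega> :: "'a::euclidean_space set"
  assumes "\<Omega> \<noteq> {}" and "open \<Omega>" and "bounded \<Omega>" and "ball x r \<subseteq> \<Omega>"
  shows "r \<le> inradius \<Omega>"
proof -
  have "infdist x (- \<Omega>) \<le> inradius \<Omega>" using inradius_attained[OF assms(1-3)] by metis
  then show ?thesis
    using infdist_ge_ball[OF assms(4) bounded_complement_nonempty[OF assms(3)]] by linarith
qed

lemma halfspace_separating_point:
  fixes S :: "'a::euclidean_space set"
  assumes "convex S" and "closed S" and "S \<noteq> {}" and "z \<notin> S"
  obtains v c where "norm v = 1" "\<And>x. x \<in> S \<Longrightarrow> v \<bullet> x < c" "v \<bullet> z > c"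
proof -
  obtain a b where ab: "a \<bullet> z < b" "\<And>x. x \<in> S \<Longrightarrow> a \<bullet> x > b"
    using separating_hyperplane_closed_point[OF assms(1,2,4)] by blast
  have "a \<noteq> 0" using ab assms(3) by fastforce
  then show ?thesis
    using that[of "(- 1 / norm a) *\<^sub>R a" "- b / norm a"] ab by (auto simp: divide_strict_right_mono)
qed

text \<open>The copy \<open>\<Omega>'\<close> of \<open>\<Omega>\<close>, enlarged about
  \<open>x\<^sub>0\<close>, contains the closure of \<open>\<Omega>\<close>. Each point of its
  compact frontier is cut off from that closure by a half-space, and finitely many of these suffice.
  Their intersection is connected, contains \<open>x\<^sub>0\<close> and misses the frontier, so it
  stays inside \<open>\<Omega>'\<close>.\<close>

lemma polytope_between:
  fixes \<Omega> :: "'a::euclidean_space set"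
  assumes \<Omega>: "open \<Omega>" "bounded \<Omega>" "convex \<Omega>" "x\<^sub>0 \<in> \<Omega>" and \<eta>: "\<eta> > 0"
  obtains I :: "('a \<times> real) set" where "finite I" "I \<noteq> {}" "\<And>i. i \<in> I \<Longrightarrow> norm (fst i) = 1"
    "\<And>i x. i \<in> I \<Longrightarrow> x \<in> \<Omega> \<Longrightarrow> fst i \<bullet> x < snd i"
    "\<And>x. (\<And>i. i \<in> I \<Longrightarrow> fst i \<bullet> x \<le> snd i) \<Longrightarrow> x\<^sub>0 + (1 / (1 + \<eta>)) *\<^sub>R (x - x\<^sub>0) \<in> \<Omega>"
proof -
  define T where "T = (\<lambda>x. x\<^sub>0 + (1 / (1 + \<eta>)) *\<^sub>R (x - x\<^sub>0))"
  define \<Omega>' where "\<Omega>' = T -` \<Omega>"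
  have contT: "continuous_on UNIV T" unfolding T_def by (intro continuous_intros)
  have open': "open \<Omega>'"
    unfolding \<Omega>'_def by (rule open_vimage[OF \<Omega>(1) contT])
  have inv: "T x = y \<longleftrightarrow> x = x\<^sub>0 + (1 + \<eta>) *\<^sub>R (y - x\<^sub>0)" for x y
  proof -
    have "x\<^sub>0 + (1 + \<eta>) *\<^sub>R (T x - x\<^sub>0) = x" "T (x\<^sub>0 + (1 + \<eta>) *\<^sub>R (y - x\<^sub>0)) = y"
      unfolding T_def using \<eta> by auto
    then show ?thesis by auto
  qed
  have "\<Omega>' = (\<lambda>y. x\<^sub>0 + (1 + \<eta>) *\<^sub>R (y - x\<^sub>0)) ` \<Omega>"
    unfolding \<Omega>'_def using inv by (auto simp: image_iff)
  also have "\<dots> = (\<lambda>y. x\<^sub>0 + y) ` ((\<lambda>y. (1 + \<eta>) *\<^sub>R y) ` ((\<lambda>y. - x\<^sub>0 + y) ` \<Omega>))"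
    by (simp add: image_image)
  finally have img: "\<Omega>' = (\<lambda>y. x\<^sub>0 + y) ` ((\<lambda>y. (1 + \<eta>) *\<^sub>R y) ` ((\<lambda>y. - x\<^sub>0 + y) ` \<Omega>))" .
  have bounded': "bounded \<Omega>'"
    unfolding img by (intro bounded_translation bounded_scaling \<Omega>(2))
  have x0': "x\<^sub>0 \<in> \<Omega>'" using \<Omega> by (simp add: \<Omega>'_def T_def)
  \<comment> \<open>Shrinking towards the interior point \<open>x\<^sub>0\<close> moves the closure
    of a convex set into its interior.\<close>
  have clos: "closure \<Omega> \<subseteq> \<Omega>'"
  proof
    fix x assume x: "x \<in> closure \<Omega>"
    have "x - (\<eta> / (1 + \<eta>)) *\<^sub>R (x - x\<^sub>0) \<in> interior \<Omega>"
      by (rule mem_interior_closure_convex_shrink[OF \<Omega>(3) _ x]) (use \<Omega> \<eta> in \<open>auto simp: interior_open\<close>)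
    moreover have "x - (\<eta> / (1 + \<eta>)) *\<^sub>R (x - x\<^sub>0) = T x"
    proof -
      have "T x - (x - (\<eta> / (1 + \<eta>)) *\<^sub>R (x - x\<^sub>0)) = (1 / (1 + \<eta>) + \<eta> / (1 + \<eta>) - 1) *\<^sub>R (x - x\<^sub>0)"
        unfolding T_def by (simp add: algebra_simps)
      also have "1 / (1 + \<eta>) + \<eta> / (1 + \<eta>) - 1 = 0" using \<eta> by (simp add: field_simps)
      finally show ?thesis by simp
    qed
    ultimately show "x \<in> \<Omega>'" using interior_subset by (auto simp: \<Omega>'_def)
  qed
  have cF: "compact (frontier \<Omega>')" by (rule compact_frontier_bounded[OF bounded'])
  have disj: "frontier \<Omega>' \<inter> \<Omega>' = {}" using open' by (simp add: frontier_disjoint_eq)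
  have neF: "frontier \<Omega>' \<noteq> {}"
    using x0' bounded' not_bounded_UNIV frontier_eq_empty by (metis empty_iff)
  have "\<exists>v c. norm v = 1 \<and> (\<forall>x\<in>closure \<Omega>. v \<bullet> x < c) \<and> v \<bullet> z > c" if "z \<in> frontier \<Omega>'" for z
  proof -
    have "z \<notin> closure \<Omega>" using that disj clos by blast
    moreover have "closure \<Omega> \<noteq> {}" using \<Omega>(4) closure_subset by blast
    ultimately show ?thesis
      using halfspace_separating_point[of "closure \<Omega>" z] \<Omega>(3) by (metis closed_closure convex_closure)
  qed
  then obtain v c where vc: "\<And>z. z \<in> frontier \<Omega>' \<Longrightarrow> norm (v z) = 1 \<and> (\<forall>x\<in>closure \<Omega>. v z \<bullet> x < c z) \<and> v z \<bullet> z > c z"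
    by metis
  have "\<exists>C'\<subseteq>frontier \<Omega>'. finite C' \<and> frontier \<Omega>' \<subseteq> (\<Union>z\<in>C'. {x. v z \<bullet> x > c z})"
    by (rule compactE_image[OF cF, of "frontier \<Omega>'" "\<lambda>z. {x. v z \<bullet> x > c z}"])
       (use vc in \<open>auto intro: open_halfspace_gt\<close>)
  then obtain Z where Z: "Z \<subseteq> frontier \<Omega>'" "finite Z" "frontier \<Omega>' \<subseteq> (\<Union>z\<in>Z. {x. v z \<bullet> x > c z})" by blast
  define I where "I = (\<lambda>z. (v z, c z)) ` Z"
  show ?thesis
  proof (rule that[of I])
    show "finite I" "I \<noteq> {}" using Z neF by (auto simp: I_def)
    show "norm (fst i) = 1" if "i \<in> I" for i using that Z vc by (auto simp: I_def)
    show "fst i \<bullet> x < snd i" if "i \<in> I" "x \<in> \<Omega>" for i x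
    proof -
      have "x \<in> closure \<Omega>" using that closure_subset by blast
      then show ?thesis using that Z vc by (auto simp: I_def)
    qed
    fix x assume x: "\<And>i. i \<in> I \<Longrightarrow> fst i \<bullet> x \<le> snd i"
    define P where "P = (\<Inter>z\<in>Z. {x. v z \<bullet> x \<le> c z})"
    have "convex P" unfolding P_def by (intro convex_INT convex_halfspace_le)
    then have "connected P" by (rule convex_connected)
    moreover have "x\<^sub>0 \<in> P"
      using \<Omega>(4) closure_subset vc Z by (force simp: P_def)
    moreover have "P \<inter> frontier \<Omega>' = {}" using Z by (fastforce simp: P_def)
    moreover have "x \<in> P" using x by (auto simp: P_def I_def)
    ultimately have "x \<in> \<Omega>'"
      using connected_Int_frontier[of P \<Omega>'] x0' by blast
    then show "x\<^sub>0 + (1 / (1 + \<eta>)) *\<^sub>R (x - x\<^sub>0) \<in> \<Omega>" by (simp add: \<Omega>'_def T_def)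
  qed
qed

text \<open>The polytope is fixed before \<open>\<beta>\<close>, so that \<open>\<beta>\<close> may
  later be chosen in terms of \<open>card I\<close> and of the support of a test function. The upper
  bounds for \<open>\<delta>\<close> come from the homothety that maps the polytope into
  \<open>\<Omega>\<close>, the lower bound from the faces lying outside
  \<open>\<Omega>\<close>.\<close>

lemma soft_distance_approximation:
  fixes \<Omega> :: "'a::euclidean_space set"
  assumes \<Omega>: "open \<Omega>" "bounded \<Omega>" "convex \<Omega>" "x\<^sub>0 \<in> \<Omega>" and \<eta>: "\<eta> > 0" "\<eta> \<le> 1"
    and D: "\<And>x. x \<in> \<Omega> \<Longrightarrow> norm (x - x\<^sub>0) \<le> D"
  obtains I :: "('a \<times> real) set" where
    "\<And>\<beta>. \<beta> > 0 \<Longrightarrow> soft_distance I fst \<beta>"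
    "\<And>\<beta> x. \<beta> > 0 \<Longrightarrow> soft_distance.\<delta> I fst snd \<beta> x \<le> (1 + \<eta>) * inradius \<Omega>"
    "\<And>\<beta> x. \<beta> > 0 \<Longrightarrow> soft_distance.\<delta> I fst snd \<beta> x \<ge> 0 \<Longrightarrow> x\<^sub>0 + (1 / (1 + \<eta>)) *\<^sub>R (x - x\<^sub>0) \<in> \<Omega>"
    "\<And>\<beta> x. \<beta> > 0 \<Longrightarrow> x \<in> \<Omega> \<Longrightarrow> infdist x (- \<Omega>) - ln (card I) / \<beta> \<le> soft_distance.\<delta> I fst snd \<beta> x"
    "\<And>\<beta> x. \<beta> > 0 \<Longrightarrow> x \<in> \<Omega> \<Longrightarrow> soft_distance.\<delta> I fst snd \<beta> x \<le> infdist x (- \<Omega>) + \<eta> * (inradius \<Omega> + 2 * D)"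
proof -
  obtain I :: "('a \<times> real) set" where I: "finite I" "I \<noteq> {}" "\<And>i. i \<in> I \<Longrightarrow> norm (fst i) = 1"
    and sub: "\<And>i x. i \<in> I \<Longrightarrow> x \<in> \<Omega> \<Longrightarrow> fst i \<bullet> x < snd i"
    and sup: "\<And>x. (\<And>i. i \<in> I \<Longrightarrow> fst i \<bullet> x \<le> snd i) \<Longrightarrow> x\<^sub>0 + (1 / (1 + \<eta>)) *\<^sub>R (x - x\<^sub>0) \<in> \<Omega>"
    using polytope_between[OF \<Omega> \<eta>(1)] by blast
  have ne: "\<Omega> \<noteq> {}" using \<Omega> by blast
  note cne = bounded_complement_nonempty[OF \<Omega>(2)]
  obtain z where z: "inradius \<Omega> > 0" "\<And>x. infdist x (- \<Omega>) \<le> inradius \<Omega>"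
    using inradius_attained[OF ne \<Omega>(1,2)] by metis
  define T where "T = (\<lambda>x. x\<^sub>0 + (1 / (1 + \<eta>)) *\<^sub>R (x - x\<^sub>0))"
  have sd: "soft_distance I fst \<beta>" if "\<beta> > 0" for \<beta>
    using that I by unfold_locales auto
  \<comment> \<open>A point at distance at least \<open>r\<close> from all faces is the centre of a
    ball of radius \<open>r\<close> in the polytope; the homothety \<open>T\<close> carries it to a
    ball of radius \<open>r / (1 + \<eta>)\<close> in \<open>\<Omega>\<close>.\<close>
  have inside: "ball (T x) (r / (1 + \<eta>)) \<subseteq> \<Omega>" if "\<And>i. i \<in> I \<Longrightarrow> snd i - fst i \<bullet> x \<ge> r" for x r
  proof
    fix y assume y: "y \<in> ball (T x) (r / (1 + \<eta>))"
    define w where "w = x\<^sub>0 + (1 + \<eta>) *\<^sub>R (y - x\<^sub>0)"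
    have yw: "y = T w" using \<eta> by (simp add: w_def T_def)
    have "dist (T x) (T w) = norm ((1 / (1 + \<eta>)) *\<^sub>R (x - w))"
      unfolding dist_norm T_def by (simp add: algebra_simps)
    also have "\<dots> = norm (x - w) / (1 + \<eta>)" using \<eta> by simp
    finally have "norm (x - w) / (1 + \<eta>) < r / (1 + \<eta>)" using y yw by simp
    then have w: "norm (w - x) < r" using \<eta> by (simp add: divide_less_cancel norm_minus_commute)
    have "T w \<in> \<Omega>"
      unfolding T_def
    proof (rule sup)
      fix i assume i: "i \<in> I"
      have "fst i \<bullet> w = fst i \<bullet> x + fst i \<bullet> (w - x)" by (simp add: inner_diff_right)
      also have "fst i \<bullet> (w - x) \<le> norm (w - x)"
        using norm_cauchy_schwarz[of "fst i" "w - x"] I(3)[OF i] by simp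
      finally show "fst i \<bullet> w \<le> snd i" using w that[OF i] by linarith
    qed
    then show "y \<in> \<Omega>" using yw by simp
  qed
  have le: "r \<le> (1 + \<eta>) * infdist (T x) (- \<Omega>)" if "\<And>i. i \<in> I \<Longrightarrow> snd i - fst i \<bullet> x \<ge> r" for x r
    using infdist_ge_ball[OF inside[OF that] cne] \<eta> by (simp add: pos_divide_le_eq mult.commute)
  show ?thesis
  proof (rule that[of I])
    fix \<beta> :: real assume \<beta>: "\<beta> > 0"
    interpret soft_distance I fst snd \<beta> using sd[OF \<beta>] .
    have ld: "snd i - fst i \<bullet> x \<ge> \<delta> x" if "i \<in> I" for i x
      using delta_le[OF that, of x] by (simp add: l_def)
    show "soft_distance I fst \<beta>" by (rule sd[OF \<beta>])
    show "\<delta> x \<le> (1 + \<eta>) * inradius \<Omega>" for x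
    proof -
      have "(1 + \<eta>) * infdist (T x) (- \<Omega>) \<le> (1 + \<eta>) * inradius \<Omega>"
        using z(2) \<eta> by (intro mult_left_mono) auto
      then show ?thesis using le[OF ld, of x] by simp
    qed
    show "x\<^sub>0 + (1 / (1 + \<eta>)) *\<^sub>R (x - x\<^sub>0) \<in> \<Omega>" if "\<delta> x \<ge> 0" for x
      using ld[of _ x] that by (intro sup) fastforce
    show "infdist x (- \<Omega>) - ln (card I) / \<beta> \<le> \<delta> x" if x: "x \<in> \<Omega>" for x
    proof (rule delta_ge)
      fix i assume i: "i \<in> I"
      show "infdist x (- \<Omega>) \<le> l i x"
      \<comment> \<open>The ball about \<open>x\<close> is open, so its radius
        \<open>infdist x (- \<Omega>)\<close> is approached by smaller ones.\<close>
      proof (rule field_le_epsilon)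
        fix e :: real assume e: "e > 0"
        define t where "t = infdist x (- \<Omega>) - e"
        show "infdist x (- \<Omega>) \<le> l i x + e"
        proof (cases "t \<ge> 0")
          case True
          have "x + t *\<^sub>R fst i \<in> \<Omega>"
          proof -
            have "dist x (x + t *\<^sub>R fst i) = t" using True I(3)[OF i] by (simp add: dist_norm)
            moreover have "t < infdist x (- \<Omega>)" using e by (simp add: t_def)
            ultimately have "x + t *\<^sub>R fst i \<in> ball x (infdist x (- \<Omega>))" by simp
            then show ?thesis by (rule subsetD[OF ball_infdist_subset])
          qed
          then have "fst i \<bullet> (x + t *\<^sub>R fst i) < snd i" by (rule sub[OF i])
          moreover have "fst i \<bullet> fst i = 1" using I(3)[OF i] by (simp add: dot_square_norm)
          ultimately show ?thesis by (simp add: l_def t_def inner_add_right)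
        next
          case False
          then show ?thesis using sub[OF i x] by (simp add: l_def t_def)
        qed
      qed
    qed
    show "\<delta> x \<le> infdist x (- \<Omega>) + \<eta> * (inradius \<Omega> + 2 * D)" if x: "x \<in> \<Omega>" for x
    proof -
      have "infdist (T x) (- \<Omega>) \<le> infdist x (- \<Omega>) + dist (T x) x"
        using infdist_triangle[of "T x" "- \<Omega>" x] by simp
      also have "dist (T x) x = norm ((1 / (1 + \<eta>) - 1) *\<^sub>R (x - x\<^sub>0))"
        unfolding dist_norm T_def by (simp add: algebra_simps)
      also have "1 / (1 + \<eta>) - 1 = - (\<eta> / (1 + \<eta>))"
        using \<eta> by (simp add: field_simps)
      also have "norm (- (\<eta> / (1 + \<eta>)) *\<^sub>R (x - x\<^sub>0)) = \<eta> / (1 + \<eta>) * norm (x - x\<^sub>0)"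
        using \<eta> by simp
      also have "\<dots> \<le> \<eta> * D"
        using D[OF x] \<eta> by (intro mult_mono) (auto simp: field_simps)
      finally have "(1 + \<eta>) * infdist (T x) (- \<Omega>) \<le> (1 + \<eta>) * (infdist x (- \<Omega>) + \<eta> * D)"
        using \<eta> by (intro mult_left_mono) auto
      moreover have "\<eta> * infdist x (- \<Omega>) \<le> \<eta> * inradius \<Omega>"
        using z(2)[of x] \<eta> by (intro mult_left_mono) auto
      moreover have "D \<ge> 0" using D[OF \<Omega>(4)] by simp
      then have "\<eta> * (\<eta> * D) \<le> 1 * (\<eta> * D)"
        using \<eta> by (intro mult_right_mono) auto
      ultimately have "(1 + \<eta>) * infdist (T x) (- \<Omega>) \<le> infdist x (- \<Omega>) + \<eta> * (inradius \<Omega> + 2 * D)"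
        by (simp add: algebra_simps)
      then show ?thesis using le[OF ld, of x] by simp
    qed
  qed
qed

section \<open>Averages of increasing functions of the distance\<close>

definition lipschitz_profile :: "(real \<Rightarrow> real) \<Rightarrow> real \<Rightarrow> bool" where
  "lipschitz_profile m \<Lambda> \<longleftrightarrow> \<Lambda> > 0 \<and> mono m \<and> (\<forall>t\<le>0. m t = 0) \<and> (\<forall>s t. s \<le> t \<longrightarrow> m t - m s \<le> \<Lambda> * (t - s))"

lemma lipschitz_profileD:
  assumes "lipschitz_profile m \<Lambda>"
  shows "\<Lambda> > 0" and "mono m" and "t \<le> 0 \<Longrightarrow> m t = 0" and "s \<le> t \<Longrightarrow> m t \<le> m s + \<Lambda> * (t - s)"
    and "m t \<ge> 0" and "0 \<le> t \<Longrightarrow> m t \<le> \<Lambda> * t" and "continuous_on A m"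
proof -
  show 1: "\<Lambda> > 0" "mono m" "t \<le> 0 \<Longrightarrow> m t = 0" using assms by (auto simp: lipschitz_profile_def)
  have 2: "m t - m s \<le> \<Lambda> * (t - s)" if "s \<le> t" for s t using that assms by (auto simp: lipschitz_profile_def)
  have 0: "m s = 0" if "s \<le> 0" for s using that assms by (auto simp: lipschitz_profile_def)
  show "s \<le> t \<Longrightarrow> m t \<le> m s + \<Lambda> * (t - s)" using 2[of s t] by simp
  show "m t \<ge> 0" using monoD[OF 1(2), of "min t 0" t] 0[of "min t 0"] by simp
  show "0 \<le> t \<Longrightarrow> m t \<le> \<Lambda> * t" using 2[of 0 t] 0[of 0] by simp
  have "\<bar>m x - m y\<bar> \<le> \<Lambda> * \<bar>x - y\<bar>" for x y
    using 2[of x y] 2[of y x] monoD[OF 1(2), of x y] monoD[OF 1(2), of y x] by (cases "x \<le> y") auto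
  then show "continuous_on A m"
    using 1(1) by (intro lipschitz_on_continuous_on[of \<Lambda>] lipschitz_onI) (auto simp: dist_real_def)
qed

lemma integrable_profile_infdist:
  fixes \<Omega> :: "'a::euclidean_space set"
  assumes "bounded \<Omega>" and m: "lipschitz_profile m \<Lambda>"
  shows "integrable lborel (\<lambda>x. m (infdist x (- \<Omega>)))"
proof (rule integrable_continuous_compact_support)
  show "continuous_on UNIV (\<lambda>x. m (infdist x (- \<Omega>)))"
    by (rule continuous_on_compose2[OF lipschitz_profileD(7)[OF m, of UNIV]])
       (auto intro!: continuous_on_infdist continuous_on_id)
  show "compact (closure \<Omega>)" using assms(1) by simp
  show "m (infdist x (- \<Omega>)) = 0" if "x \<notin> closure \<Omega>" for x
    using that closure_subset[of \<Omega>] lipschitz_profileD(3)[OF m, of 0] by (subst infdist_zero) auto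
qed

lemma homothety_image_eq_vimage:
  fixes \<Omega> :: "'a::real_vector set"
  assumes "c \<noteq> 0"
  shows "(\<lambda>y. x\<^sub>0 + c *\<^sub>R (y - x\<^sub>0)) ` \<Omega> = (\<lambda>y. x\<^sub>0 + (1 / c) *\<^sub>R (y - x\<^sub>0)) -` \<Omega>"
proof (intro set_eqI iffI)
  fix x assume "x \<in> (\<lambda>y. x\<^sub>0 + (1 / c) *\<^sub>R (y - x\<^sub>0)) -` \<Omega>"
  then show "x \<in> (\<lambda>y. x\<^sub>0 + c *\<^sub>R (y - x\<^sub>0)) ` \<Omega>"
    using assms by (intro image_eqI[of _ _ "x\<^sub>0 + (1 / c) *\<^sub>R (x - x\<^sub>0)"]) auto
qed (use assms in auto)

lemma measure_homothety:
  fixes \<Omega> :: "'a::euclidean_space set"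
  assumes "open \<Omega>" and "c > 0"
  shows "measure lborel ((\<lambda>y. x\<^sub>0 + c *\<^sub>R (y - x\<^sub>0)) ` \<Omega>) = c ^ DIM('a) * measure lborel \<Omega>"
proof -
  have img: "(\<lambda>y. x\<^sub>0 + c *\<^sub>R (y - x\<^sub>0)) ` \<Omega> = (\<lambda>x. c *\<^sub>R x + (x\<^sub>0 - c *\<^sub>R x\<^sub>0)) ` \<Omega>"
    by (intro image_cong refl) (simp add: algebra_simps)
  have "(\<lambda>y. x\<^sub>0 + c *\<^sub>R (y - x\<^sub>0)) ` \<Omega> = (\<lambda>y. x\<^sub>0 + (1 / c) *\<^sub>R (y - x\<^sub>0)) -` \<Omega>"
    using assms(2) by (intro homothety_image_eq_vimage) auto
  moreover have "open ((\<lambda>y. x\<^sub>0 + (1 / c) *\<^sub>R (y - x\<^sub>0)) -` \<Omega>)"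
    by (intro open_vimage assms continuous_intros)
  ultimately have "open ((\<lambda>y. x\<^sub>0 + c *\<^sub>R (y - x\<^sub>0)) ` \<Omega>)" by simp
  then have "measure lborel ((\<lambda>y. x\<^sub>0 + c *\<^sub>R (y - x\<^sub>0)) ` \<Omega>) = measure lebesgue ((\<lambda>y. x\<^sub>0 + c *\<^sub>R (y - x\<^sub>0)) ` \<Omega>)"
    by (simp add: measure_completion)
  also have "\<dots> = c ^ DIM('a) * measure lebesgue \<Omega>"
    unfolding img using measure_lebesgue_affine[of c "x\<^sub>0 - c *\<^sub>R x\<^sub>0" \<Omega>] assms(2) by simp
  also have "measure lebesgue \<Omega> = measure lborel \<Omega>"
    using assms(1) by (simp add: measure_completion)
  finally show ?thesis .
qed

text \<open>Level sets of the distance shrink at least linearly; this is that fact, integrated against \<open>m\<close>.\<close>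

theorem integral_profile_infdist_le:
  fixes \<Omega> :: "'a::euclidean_space set"
  assumes \<Omega>: "\<Omega> \<noteq> {}" "open \<Omega>" "bounded \<Omega>" "convex \<Omega>" and m: "lipschitz_profile m \<Lambda>"
  shows "(LINT x|lborel. m (infdist x (- \<Omega>)))
    \<le> (1 / inradius \<Omega>) * integral {0..inradius \<Omega>} m * measure lborel \<Omega>"
proof -
  note mD = lipschitz_profileD[OF m]
  define R where "R = inradius \<Omega>"
  obtain x\<^sub>0 where x0: "x\<^sub>0 \<in> \<Omega>" and R: "R > 0" "\<And>x. infdist x (- \<Omega>) \<le> R"
    unfolding R_def using inradius_attained[OF \<Omega>(1-3)] by metis
  have "bounded ((\<lambda>x. - x\<^sub>0 + x) ` \<Omega>)" by (intro bounded_translation \<Omega>)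
  then obtain D where D: "\<And>x. x \<in> \<Omega> \<Longrightarrow> norm (x - x\<^sub>0) \<le> D"
    unfolding bounded_iff by auto
  define V where "V = measure lborel \<Omega>"
  define A0 where "A0 = (1 / R) * integral {0..R} m"
  define J where "J = (LINT x|lborel. m (infdist x (- \<Omega>)))"
  have intm: "m integrable_on {a..b}" for a b
    by (intro integrable_continuous_real mD)
  \<comment> \<open>All errors of the approximation are collected for a fixed \<open>\<eta>\<close>;
    the claim is the limit as \<open>\<eta>\<close> tends to 0.\<close>
  have bound: "J \<le> (A0 + \<eta> * (2 * \<Lambda> * R + 1)) * ((1 + \<eta>) ^ DIM('a) * V) + \<eta> * V"
    if \<eta>: "\<eta> > 0" "\<eta> \<le> 1" for \<eta>
  proof -
    obtain I :: "('a \<times> real) set" where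
      sd: "\<And>\<beta>. \<beta> > 0 \<Longrightarrow> soft_distance I fst \<beta>" and
      le: "\<And>\<beta> x. \<beta> > 0 \<Longrightarrow> soft_distance.\<delta> I fst snd \<beta> x \<le> (1 + \<eta>) * R" and
      ins: "\<And>\<beta> x. \<beta> > 0 \<Longrightarrow> soft_distance.\<delta> I fst snd \<beta> x \<ge> 0 \<Longrightarrow> x\<^sub>0 + (1 / (1 + \<eta>)) *\<^sub>R (x - x\<^sub>0) \<in> \<Omega>" and
      low: "\<And>\<beta> x. \<beta> > 0 \<Longrightarrow> x \<in> \<Omega> \<Longrightarrow> infdist x (- \<Omega>) - ln (card I) / \<beta> \<le> soft_distance.\<delta> I fst snd \<beta> x"
      unfolding R_def by (rule soft_distance_approximation[OF \<Omega>(2-4) x0 \<eta> D]) blast+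
    define R1 where "R1 = (1 + \<eta>) * R"
    have R1: "R1 > 0" "R \<le> R1" "R1 \<le> 2 * R" "R1 - R = \<eta> * R" using R(1) \<eta> by (auto simp: R1_def field_simps add_pos_pos)
    \<comment> \<open>Passing from \<open>{0..R}\<close> to \<open>{0..R1}\<close> raises the
      average by at most \<open>\<eta> * (2 * \<Lambda> * R)\<close>, since \<open>m\<close> is at
      most \<open>2 * \<Lambda> * R\<close> on the added piece of length \<open>\<eta> * R\<close>;
      the remaining \<open>\<eta>\<close> is the slack required by the comparison with a
      constant.\<close>
    define A where "A = A0 + \<eta> * (2 * \<Lambda> * R + 1)"
    have A: "A \<ge> (1 / R1) * integral {0..R1} m + \<eta>"
    proof -
      have "integral {R..R1} m \<le> integral {R..R1} (\<lambda>_. m R1)"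
        by (intro integral_le intm) (auto intro: monoD[OF mD(2)])
      also have "\<dots> = \<eta> * R * m R1" using R1 by simp
      also have "\<dots> \<le> \<eta> * R * (2 * \<Lambda> * R)"
      proof (rule mult_left_mono)
        have "m R1 \<le> \<Lambda> * R1" using mD(6)[of R1] R1 by simp
        also have "\<dots> \<le> \<Lambda> * (2 * R)" using R1 mD(1) by (intro mult_left_mono) auto
        finally show "m R1 \<le> 2 * \<Lambda> * R" by simp
      qed (use R \<eta> in auto)
      finally have "integral {0..R1} m \<le> integral {0..R} m + \<eta> * R * (2 * \<Lambda> * R)"
        using Henstock_Kurzweil_Integration.integral_combine[OF _ _ intm, of 0 R R1] R R1 by auto
      then have "(1 / R) * integral {0..R1} m \<le> (1 / R) * (integral {0..R} m + \<eta> * R * (2 * \<Lambda> * R))"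
        using R by (intro mult_left_mono) auto
      also have "\<dots> = A0 + \<eta> * (2 * \<Lambda> * R)" using R by (simp add: A0_def field_simps)
      finally have "(1 / R) * integral {0..R1} m \<le> A0 + \<eta> * (2 * \<Lambda> * R)" .
      moreover have "(1 / R1) * integral {0..R1} m \<le> (1 / R) * integral {0..R1} m"
        using R R1 mD(5) by (intro mult_right_mono integral_nonneg intm) (auto simp: frac_le)
      ultimately show ?thesis by (simp add: A_def algebra_simps)
    qed
    have "0 \<le> integral {0..R1} m"
      by (intro integral_nonneg intm) (use mD(5) in auto)
    then have Apos: "A > 0" using A \<eta> R1 by (smt (verit) divide_nonneg_pos mult_nonneg_nonneg)
    \<comment> \<open>The second entry is the requirement of the comparison with a constant; the
      third reduces the logarithmic error of the soft distance to at most \<open>\<eta>\<close>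
      after applying the Lipschitz function \<open>m\<close>.\<close>
    define \<beta> where "\<beta> = max 1 (max (2 * m R1 / (\<eta> * (A / (2 * \<Lambda>)))) (\<Lambda> * ln (card I) / \<eta>))"
    have \<beta>: "\<beta> > 0" "\<beta> \<ge> 2 * m R1 / (\<eta> * (A / (2 * \<Lambda>)))" "\<beta> \<ge> \<Lambda> * ln (card I) / \<eta>"
      by (auto simp: \<beta>_def)
    interpret soft_distance I fst snd \<beta> by (rule sd[OF \<beta>(1)])
    define h where "h = (\<lambda>y. x\<^sub>0 + (1 + \<eta>) *\<^sub>R (y - x\<^sub>0))"
    have conth: "continuous_on S h" for S unfolding h_def by (intro continuous_intros)
    have hT: "x \<in> h ` \<Omega>" if "\<delta> x \<ge> 0" for x
      using ins[OF \<beta>(1) that] \<eta> by (intro image_eqI[of _ _ "x\<^sub>0 + (1 / (1 + \<eta>)) *\<^sub>R (x - x\<^sub>0)"]) (auto simp: h_def)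
    have K: "compact (h ` closure \<Omega>)"
      by (intro compact_continuous_image conth) (use \<Omega> in simp)
    have off: "\<delta> x \<le> 0" if "x \<notin> h ` closure \<Omega>" for x
      using hT[of x] that closure_subset[of \<Omega>] by (cases "\<delta> x \<le> 0") auto
    have main: "(LINT x|lborel. m (\<delta> x)) \<le> A * measure lborel {x. 0 < \<delta> x}"
      by (rule integral_increasing_profile_le[OF K off le[OF \<beta>(1), folded R1_def] R1(1) mD(2,7,3,6,1) A \<eta>(1) \<beta>(2)])
    have openh: "open (h ` \<Omega>)"
    proof -
      have "h ` \<Omega> = (\<lambda>y. x\<^sub>0 + (1 / (1 + \<eta>)) *\<^sub>R (y - x\<^sub>0)) -` \<Omega>"
        unfolding h_def using \<eta> by (intro homothety_image_eq_vimage) auto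
      then show ?thesis by (simp only:) (intro open_vimage \<Omega> continuous_intros)
    qed
    have fin: "h ` \<Omega> \<in> fmeasurable lborel"
    proof (rule fmeasurableI)
      show "h ` \<Omega> \<in> sets lborel" using openh by simp
      have "emeasure lborel (h ` \<Omega>) \<le> emeasure lborel (h ` closure \<Omega>)"
        using K closure_subset[of \<Omega>] by (intro emeasure_mono) (auto simp: compact_imp_closed borel_closed)
      then show "emeasure lborel (h ` \<Omega>) < \<infinity>"
        using emeasure_compact_finite[OF K] by (simp add: order.strict_trans1)
    qed
    have "measure lborel {x. 0 < \<delta> x} \<le> measure lborel (h ` \<Omega>)"
    proof (rule measure_mono_fmeasurable[OF _ _ fin])
      show "{x. 0 < \<delta> x} \<subseteq> h ` \<Omega>" using hT by force
      show "{x. 0 < \<delta> x} \<in> sets lborel"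
        using open_Collect_less[OF continuous_on_const[of UNIV 0] continuous_delta[of UNIV]] by simp
    qed
    also have "\<dots> = (1 + \<eta>) ^ DIM('a) * V"
      unfolding h_def V_def by (rule measure_homothety) (use \<Omega> \<eta> in auto)
    finally have vol: "A * measure lborel {x. 0 < \<delta> x} \<le> A * ((1 + \<eta>) ^ DIM('a) * V)"
      using Apos by (intro mult_left_mono) auto
    have contd: "continuous_on UNIV (\<lambda>x. m (\<delta> x))"
      by (rule continuous_on_compose2[OF mD(7)[of UNIV] continuous_delta]) auto
    have intmd: "integrable lborel (\<lambda>x. m (\<delta> x))"
      by (rule integrable_continuous_compact_support[OF contd K]) (use off mD(3) in auto)
    have intO: "integrable lborel (indicat_real \<Omega>)"
      using \<Omega> emeasure_bounded_finite[of \<Omega>] by (intro integrable_real_indicator) auto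
    have "J \<le> (LINT x|lborel. m (\<delta> x) + \<eta> * indicator \<Omega> x)"
      unfolding J_def
    proof (rule integral_mono[OF integrable_profile_infdist[OF \<Omega>(3) m]])
      show "integrable lborel (\<lambda>x. m (\<delta> x) + \<eta> * indicator \<Omega> x)"
        using intmd intO by auto
      fix x
      show "m (infdist x (- \<Omega>)) \<le> m (\<delta> x) + \<eta> * indicator \<Omega> x"
      proof (cases "x \<in> \<Omega>")
        case True
        have "m (infdist x (- \<Omega>)) \<le> m (\<delta> x + ln (card I) / \<beta>)"
          using low[OF \<beta>(1) True] by (intro monoD[OF mD(2)]) simp
        also have "\<dots> \<le> m (\<delta> x) + \<Lambda> * (ln (card I) / \<beta>)"
        proof -
          have "card I \<ge> 1" using finI neI by (simp add: Suc_le_eq card_gt_0_iff)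
          then have "ln (card I) / \<beta> \<ge> 0" using \<beta>(1) by simp
          then show ?thesis using mD(4)[of "\<delta> x" "\<delta> x + ln (card I) / \<beta>"] by simp
        qed
        also have "\<Lambda> * (ln (card I) / \<beta>) \<le> \<eta>"
          using \<beta>(1,3) \<eta> by (simp add: field_simps)
        finally show ?thesis using True by simp
      next
        case False
        then show ?thesis using mD(3)[of 0] mD(5) by simp
      qed
    qed
    also have "\<dots> = (LINT x|lborel. m (\<delta> x)) + \<eta> * V"
      using intmd intO \<Omega> by (simp add: V_def)
    finally show ?thesis using main vol by (simp add: A_def)
  qed
  have "((\<lambda>\<eta>. (A0 + \<eta> * (2 * \<Lambda> * R + 1)) * ((1 + \<eta>) ^ DIM('a) * V) + \<eta> * V)
      \<longlongrightarrow> (A0 + 0 * (2 * \<Lambda> * R + 1)) * ((1 + 0) ^ DIM('a) * V) + 0 * V) (at_right 0)"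
    by (intro tendsto_intros)
  moreover have "eventually (\<lambda>\<eta>. J \<le> (A0 + \<eta> * (2 * \<Lambda> * R + 1)) * ((1 + \<eta>) ^ DIM('a) * V) + \<eta> * V) (at_right 0)"
    using bound by (intro eventually_at_rightI[of 0 1]) auto
  ultimately have "J \<le> (A0 + 0 * (2 * \<Lambda> * R + 1)) * ((1 + 0) ^ DIM('a) * V) + 0 * V"
    by (intro tendsto_lowerbound) auto
  then show ?thesis by (simp add: J_def A0_def V_def R_def)
qed

section \<open>Linear changes of variables and strict comparison of averages\<close>

lemma nn_integral_lborel_shift:
  fixes f :: "'a::euclidean_space \<Rightarrow> ennreal"
  assumes [measurable]: "f \<in> borel_measurable borel"
  shows "(\<integral>\<^sup>+x. f (c + x) \<partial>lborel) = (\<integral>\<^sup>+x. f x \<partial>lborel)"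
proof -
  have "(\<integral>\<^sup>+x. f x \<partial>lborel) = (\<integral>\<^sup>+x. f x \<partial>(distr lborel borel ((+) c)))"
    by (simp add: lborel_distr_plus)
  also have "\<dots> = (\<integral>\<^sup>+x. f (c + x) \<partial>lborel)"
    by (subst nn_integral_distr) auto
  finally show ?thesis by simp
qed

lemma nn_integral_lborel_reflect:
  fixes f :: "'a::euclidean_space \<Rightarrow> ennreal"
  assumes [measurable]: "f \<in> borel_measurable borel"
  shows "(\<integral>\<^sup>+x. f (c - x) \<partial>lborel) = (\<integral>\<^sup>+x. f x \<partial>lborel)"
proof -
  have "(\<integral>\<^sup>+x. f x \<partial>lborel) = (\<integral>\<^sup>+x. f x \<partial>(density (distr lborel borel (\<lambda>x. c + (-1) *\<^sub>R x)) (\<lambda>_. \<bar>-1::real\<bar> ^ DIM('a))))"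
    using lborel_affine[of "-1" c] by simp
  also have "\<dots> = (\<integral>\<^sup>+x. f (c - x) \<partial>lborel)"
    by (simp add: nn_integral_density nn_integral_distr)
  finally show ?thesis by simp
qed

text \<open>Both sides equal \<open>\<integral>\<integral> f (A x) g (A x + y)\<close>. This is uniqueness of Haar measure, and replaces the
  determinant in the change of variables.\<close>

lemma linear_change_of_variables_cross:
  fixes f g :: "'a::euclidean_space \<Rightarrow> ennreal" and A B :: "'a \<Rightarrow> 'a"
  assumes f[measurable]: "f \<in> borel_measurable borel" and g[measurable]: "g \<in> borel_measurable borel"
    and A: "linear A" and AB: "\<And>y. A (B y) = y"
  shows "(\<integral>\<^sup>+x. f (A x) \<partial>lborel) * (\<integral>\<^sup>+x. g x \<partial>lborel) = (\<integral>\<^sup>+x. g (A x) \<partial>lborel) * (\<integral>\<^sup>+x. f x \<partial>lborel)"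
proof -
  have [measurable]: "A \<in> borel_measurable borel"
    by (intro borel_measurable_continuous_onI linear_continuous_on) (use A in \<open>simp add: linear_linear\<close>)
  have Am[measurable]: "A \<in> lborel \<rightarrow>\<^sub>M borel" by simp
  have "(\<integral>\<^sup>+x. f (A x) \<partial>lborel) * (\<integral>\<^sup>+x. g x \<partial>lborel) = (\<integral>\<^sup>+x. \<integral>\<^sup>+y. f (A x) * g (A x + y) \<partial>lborel \<partial>lborel)"
    by (simp add: nn_integral_cmult nn_integral_multc nn_integral_lborel_shift)
  also have "\<dots> = (\<integral>\<^sup>+y. \<integral>\<^sup>+x. f (A x) * g (A x + y) \<partial>lborel \<partial>lborel)"
    by (rule lborel_pair.Fubini'[symmetric]) measurable
  also have "\<dots> = (\<integral>\<^sup>+y. \<integral>\<^sup>+x. f (A x - y) * g (A x) \<partial>lborel \<partial>lborel)"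
  proof (rule nn_integral_cong)
    fix y :: 'a
    have "(\<integral>\<^sup>+x. f (A x - y) * g (A x) \<partial>lborel) = (\<integral>\<^sup>+x. f (A (B y + x) - y) * g (A (B y + x)) \<partial>lborel)"
      by (rule nn_integral_lborel_shift[symmetric]) measurable
    then show "(\<integral>\<^sup>+x. f (A x) * g (A x + y) \<partial>lborel) = (\<integral>\<^sup>+x. f (A x - y) * g (A x) \<partial>lborel)"
      by (simp add: linear_add[OF A] AB add.commute)
  qed
  also have "\<dots> = (\<integral>\<^sup>+x. \<integral>\<^sup>+y. f (A x - y) * g (A x) \<partial>lborel \<partial>lborel)"
    by (rule lborel_pair.Fubini') measurable
  also have "\<dots> = (\<integral>\<^sup>+x. g (A x) \<partial>lborel) * (\<integral>\<^sup>+x. f x \<partial>lborel)"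
    by (simp add: nn_integral_multc nn_integral_cmult nn_integral_lborel_reflect mult.commute)
  finally show ?thesis .
qed

text \<open>With equal integrals the two functions would agree almost everywhere, but
  \<open>{x. f x < g x}\<close> is open and nonempty.\<close>

lemma continuous_integral_less:
  fixes f g :: "'a::euclidean_space \<Rightarrow> real"
  assumes f: "integrable lborel f" "continuous_on UNIV f" and g: "integrable lborel g" "continuous_on UNIV g"
    and le: "\<And>x. f x \<le> g x" and less: "f z < g z"
  shows "(LINT x|lborel. f x) < (LINT x|lborel. g x)"
proof (rule ccontr)
  assume "\<not> ?thesis"
  moreover have "(LINT x|lborel. f x) \<le> (LINT x|lborel. g x)" by (rule integral_mono[OF f(1) g(1) le])
  ultimately have "(LINT x|lborel. g x - f x) = 0" using f g by simp
  then have "AE x in lborel. g x - f x = 0"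
    using integral_nonneg_eq_0_iff_AE[of lborel "\<lambda>x. g x - f x"] f g le by auto
  then have "AE x in lborel. x \<notin> {x. f x < g x}" by (rule AE_mp) (auto intro!: AE_I2)
  moreover have opn: "open {x. f x < g x}" by (rule open_Collect_less[OF f(2) g(2)])
  ultimately have "{x. f x < g x} \<in> null_sets lborel"
    by (subst (asm) AE_iff_null_sets[symmetric]) auto
  then have "negligible {x. f x < g x}"
    by (simp add: negligible_iff_null_sets null_sets_completionI)
  then show False using open_not_negligible[OF opn] less by blast
qed

text \<open>The morphological opening: it removes the corners that balls of radius \<open>s\<close>
  cannot reach, and keeps the points at distance at least \<open>s\<close> from the complement,
  together with their distances.\<close>

definition ball_opening :: "real \<Rightarrow> 'a::euclidean_space set \<Rightarrow> 'a set" where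
  "ball_opening s \<Omega> = \<Union>{ball y s |y. ball y s \<subseteq> \<Omega>}"

text \<open>A displacement that stays in the convex set from two centres also stays in it from every
  centre between them.\<close>

lemma convex_ball_centers:
  fixes \<Omega> :: "'a::euclidean_space set"
  assumes "convex \<Omega>"
  shows "convex {y. ball y s \<subseteq> \<Omega>}"
proof (rule convexI)
  fix y z and u v :: real
  assume yz: "y \<in> {y. ball y s \<subseteq> \<Omega>}" "z \<in> {y. ball y s \<subseteq> \<Omega>}" and uv: "0 \<le> u" "0 \<le> v" "u + v = 1"
  have "w \<in> \<Omega>" if w: "w \<in> ball (u *\<^sub>R y + v *\<^sub>R z) s" for w
  proof -
    define p where "p = w - (u *\<^sub>R y + v *\<^sub>R z)"
    have "norm p < s" using w by (simp add: p_def dist_norm norm_minus_commute)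
    then have "y + p \<in> \<Omega>" "z + p \<in> \<Omega>" using yz by (auto simp: subset_iff dist_norm)
    then have "u *\<^sub>R (y + p) + v *\<^sub>R (z + p) \<in> \<Omega>" using assms uv by (simp add: convex_def)
    moreover have "u *\<^sub>R (y + p) + v *\<^sub>R (z + p) = w"
    proof -
      have "u *\<^sub>R (y + p) + v *\<^sub>R (z + p) = u *\<^sub>R y + v *\<^sub>R z + (u + v) *\<^sub>R p" by (simp add: algebra_simps)
      then show ?thesis using uv by (simp add: p_def)
    qed
    ultimately show ?thesis by simp
  qed
  then show "u *\<^sub>R y + v *\<^sub>R z \<in> {y. ball y s \<subseteq> \<Omega>}" by blast
qed

lemma convex_ball_opening:
  fixes \<Omega> :: "'a::euclidean_space set"
  assumes "convex \<Omega>"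
  shows "convex (ball_opening s \<Omega>)"
proof (rule convexI)
  fix a b and u v :: real
  assume "a \<in> ball_opening s \<Omega>" "b \<in> ball_opening s \<Omega>" and uv: "0 \<le> u" "0 \<le> v" "u + v = 1"
  then obtain y z where y: "ball y s \<subseteq> \<Omega>" "dist y a < s" and z: "ball z s \<subseteq> \<Omega>" "dist z b < s"
    by (auto simp: ball_opening_def)
  have "ball (u *\<^sub>R y + v *\<^sub>R z) s \<subseteq> \<Omega>"
    using convex_ball_centers[OF assms, of s] y(1) z(1) uv unfolding convex_def by blast
  moreover have "dist (u *\<^sub>R y + v *\<^sub>R z) (u *\<^sub>R a + v *\<^sub>R b) < s"
  proof -
    have "convex (ball 0 s :: 'a set)" by (rule convex_ball)
    then have "u *\<^sub>R (y - a) + v *\<^sub>R (z - b) \<in> ball 0 s"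
      using y(2) z(2) uv by (intro convexD) (auto simp: dist_norm norm_minus_commute)
    then have "norm (u *\<^sub>R (y - a) + v *\<^sub>R (z - b)) < s" by (simp only: mem_ball_0)
    also have "u *\<^sub>R (y - a) + v *\<^sub>R (z - b) = (u *\<^sub>R y + v *\<^sub>R z) - (u *\<^sub>R a + v *\<^sub>R b)"
      by (simp add: algebra_simps)
    finally show ?thesis by (simp only: dist_norm)
  qed
  ultimately show "u *\<^sub>R a + v *\<^sub>R b \<in> ball_opening s \<Omega>"
    unfolding ball_opening_def by (auto intro!: exI[of _ "ball (u *\<^sub>R y + v *\<^sub>R z) s"])
qed

lemma open_ball_opening: "open (ball_opening s \<Omega>)"
  unfolding ball_opening_def by auto

lemma ball_opening_subset: "ball_opening s \<Omega> \<subseteq> \<Omega>"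
  unfolding ball_opening_def by auto

lemma ball_subset_ball_opening:
  fixes \<Omega> :: "'a::euclidean_space set"
  assumes "ball x r \<subseteq> \<Omega>" and "0 < s" and "s \<le> r"
  shows "ball x r \<subseteq> ball_opening s \<Omega>"
proof
  fix y assume y: "y \<in> ball x r"
  \<comment> \<open>With the ratio \<open>(r - s) / r\<close> the ball of radius \<open>s\<close>
    about \<open>z\<close> stays inside \<open>ball x r\<close>, while \<open>y\<close> is at
    distance \<open>(s / r) * norm (y - x) < s\<close> from \<open>z\<close>.\<close>
  define z where "z = x + ((r - s) / r) *\<^sub>R (y - x)"
  have r: "r > 0" using assms by simp
  have nyx: "norm (y - x) < r" using y by (simp add: dist_norm norm_minus_commute)
  have "norm (z - x) = (r - s) / r * norm (y - x)" unfolding z_def using assms r by simp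
  also have "\<dots> \<le> (r - s) / r * r" using nyx assms r by (intro mult_left_mono) auto
  finally have zx: "norm (z - x) \<le> r - s" using r by simp
  have "y - z = (s / r) *\<^sub>R (y - x)"
  proof -
    have "y - z = (1 - (r - s) / r) *\<^sub>R (y - x)" unfolding z_def by (simp add: algebra_simps)
    also have "1 - (r - s) / r = s / r" using r by (simp add: field_simps)
    finally show ?thesis .
  qed
  then have "norm (y - z) = s / r * norm (y - x)" using assms r by simp
  also have "\<dots> < s / r * r" using nyx assms r by (intro mult_strict_left_mono) auto
  finally have yz: "norm (y - z) < s" using r by simp
  have "ball z s \<subseteq> ball x r"
  proof
    fix w assume "w \<in> ball z s"
    then have "norm (w - z) < s" by (simp add: dist_norm norm_minus_commute)
    moreover have "norm (w - x) \<le> norm (w - z) + norm (z - x)" using norm_triangle_ineq[of "w - z" "z - x"] by simp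
    ultimately show "w \<in> ball x r" using zx by (simp add: dist_norm norm_minus_commute)
  qed
  then have "ball z s \<subseteq> \<Omega>" using assms(1) by blast
  moreover have "y \<in> ball z s" using yz by (simp add: dist_norm norm_minus_commute)
  ultimately show "y \<in> ball_opening s \<Omega>" unfolding ball_opening_def by blast
qed

text \<open>The two truncations add up to \<open>m\<close>; the first is constant beyond
  \<open>s\<close>, the second vanishes up to \<open>s\<close>.\<close>

lemma profile_truncations:
  assumes m: "lipschitz_profile m \<Lambda>"
  shows "lipschitz_profile (\<lambda>t. min (m t) (m s)) \<Lambda>" and "lipschitz_profile (\<lambda>t. max 0 (m t - m s)) \<Lambda>"
proof -
  note mD = lipschitz_profileD[OF m]
  have L: "0 \<le> \<Lambda> * (t - s)" if "s \<le> t" for s t using mD(1) that by simp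
  show "lipschitz_profile (\<lambda>t. min (m t) (m s)) \<Lambda>"
    unfolding lipschitz_profile_def
  proof (intro conjI allI impI)
    show "mono (\<lambda>t. min (m t) (m s))" using monoD[OF mD(2)] by (intro monoI) (simp add: min.coboundedI1)
    show "min (m t) (m s) = 0" if "t \<le> 0" for t using mD(3)[OF that] mD(5)[of s] by simp
    show "min (m t) (m s) - min (m r) (m s) \<le> \<Lambda> * (t - r)" if "r \<le> t" for r t
      using mD(4)[OF that] L[OF that] by linarith
  qed (rule mD(1))
  show "lipschitz_profile (\<lambda>t. max 0 (m t - m s)) \<Lambda>"
    unfolding lipschitz_profile_def
  proof (intro conjI allI impI)
    show "mono (\<lambda>t. max 0 (m t - m s))" using monoD[OF mD(2)] by (intro monoI max.mono diff_right_mono) auto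
    show "max 0 (m t - m s) = 0" if "t \<le> 0" for t using mD(3)[OF that] mD(5)[of s] by simp
    show "max 0 (m t - m s) - max 0 (m r - m s) \<le> \<Lambda> * (t - r)" if "r \<le> t" for r t
      using mD(4)[OF that] L[OF that] by linarith
  qed (rule mD(1))
qed

text \<open>The excess of \<open>m\<close> over the level \<open>m s\<close> sees only points at
  distance above \<open>s\<close>, where passing from \<open>\<Omega>\<close> to its opening
  \<open>Q\<close> does not decrease the distance. So its integral obeys the bound for
  \<open>Q\<close>, which has the same inradius but less volume; the part of \<open>m\<close> below
  that level obeys the bound for \<open>\<Omega>\<close>.\<close>

lemma profile_infdist_less_of_opening:
  fixes \<Omega> :: "'a::euclidean_space set"
  assumes \<Omega>: "\<Omega> \<noteq> {}" "open \<Omega>" "bounded \<Omega>" "convex \<Omega>" and m: "lipschitz_profile m \<Lambda>"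
    and strict: "strict_mono_on {0..inradius \<Omega>} m"
    and s: "0 < s" "s < inradius \<Omega>" and less: "measure lborel (ball_opening s \<Omega>) < measure lborel \<Omega>"
  shows "(LINT x|lborel. m (infdist x (- \<Omega>)))
    < (1 / inradius \<Omega>) * integral {0..inradius \<Omega>} m * measure lborel \<Omega>"
proof -
  note mD = lipschitz_profileD[OF m]
  define R where "R = inradius \<Omega>"
  obtain x\<^sub>0 where x0: "x\<^sub>0 \<in> \<Omega>" "ball x\<^sub>0 R \<subseteq> \<Omega>" and R: "R > 0"
    unfolding R_def using inradius_attained[OF \<Omega>(1-3)] by metis
  define Q where "Q = ball_opening s \<Omega>"
  have Qball: "ball x\<^sub>0 R \<subseteq> Q" unfolding Q_def by (rule ball_subset_ball_opening) (use x0 s R_def in auto)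
  then have "x\<^sub>0 \<in> Q" using R by auto
  then have Q: "Q \<noteq> {}" "open Q" "bounded Q" "convex Q" "Q \<subseteq> \<Omega>"
    unfolding Q_def using bounded_subset[OF \<Omega>(3) ball_opening_subset]
    by (auto simp: open_ball_opening ball_opening_subset convex_ball_opening[OF \<Omega>(4)])
  obtain z where z: "ball z (inradius Q) \<subseteq> Q" using inradius_attained[OF Q(1-3)] by metis
  have "inradius Q \<le> R" unfolding R_def by (rule inradius_ge[OF \<Omega>(1-3), of z]) (use z Q in auto)
  moreover have "R \<le> inradius Q" by (rule inradius_ge[OF Q(1-3) Qball])
  ultimately have RQ: "inradius Q = R" by simp
  define m1 m2 where "m1 = (\<lambda>t. min (m t) (m s))" and "m2 = (\<lambda>t. max 0 (m t - m s))"
  have m1: "lipschitz_profile m1 \<Lambda>" and m2: "lipschitz_profile m2 \<Lambda>"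
    unfolding m1_def m2_def by (rule profile_truncations[OF m])+
  note m2D = lipschitz_profileD[OF m2]
  have sum: "m t = m1 t + m2 t" for t by (auto simp: m1_def m2_def)
  have int: "m1 integrable_on {a..b}" "m2 integrable_on {a..b}" for a b
    by (intro integrable_continuous_real lipschitz_profileD(7)[OF m1] lipschitz_profileD(7)[OF m2])+
  have le: "m2 (infdist x (- \<Omega>)) \<le> m2 (infdist x (- Q))" for x
  proof (cases "s \<le> infdist x (- \<Omega>)")
    case True
    have "ball x (infdist x (- \<Omega>)) \<subseteq> Q"
      unfolding Q_def by (rule ball_subset_ball_opening[OF ball_infdist_subset s(1) True])
    then have "infdist x (- \<Omega>) \<le> infdist x (- Q)"
      by (rule infdist_ge_ball) (rule bounded_complement_nonempty[OF Q(3)])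
    then show ?thesis by (rule monoD[OF m2D(2)])
  next
    case False
    then have "m (infdist x (- \<Omega>)) \<le> m s" by (intro monoD[OF mD(2)]) simp
    then show ?thesis using m2D(5) by (simp add: m2_def)
  qed
  have pos: "integral {0..R} m2 > 0"
  proof -
    define s' where "s' = (s + R) / 2"
    have s': "s < s'" "s' < R" using s by (auto simp: s'_def R_def)
    have "m s < m s'" using strict s s' by (auto simp: strict_mono_on_def R_def)
    then have "0 < (R - s') * m2 s'" using s' by (simp add: m2_def)
    also have "\<dots> = integral {s'..R} (\<lambda>_. m2 s')" using s' by simp
    also have "\<dots> \<le> integral {s'..R} m2"
      by (intro integral_le int) (auto intro: monoD[OF m2D(2)])
    also have "\<dots> \<le> integral {0..R} m2"
      by (intro integral_subset_le int) (use s s' m2D(5) in auto)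
    finally show ?thesis .
  qed
  have "(LINT x|lborel. m (infdist x (- \<Omega>))) = (LINT x|lborel. m1 (infdist x (- \<Omega>))) + (LINT x|lborel. m2 (infdist x (- \<Omega>)))"
    unfolding sum by (intro Bochner_Integration.integral_add integrable_profile_infdist[OF \<Omega>(3) m1] integrable_profile_infdist[OF \<Omega>(3) m2])
  also have "(LINT x|lborel. m2 (infdist x (- \<Omega>))) \<le> (LINT x|lborel. m2 (infdist x (- Q)))"
    by (intro integral_mono integrable_profile_infdist[OF \<Omega>(3) m2] integrable_profile_infdist[OF Q(3) m2] le)
  also have "\<dots> \<le> (1 / R) * integral {0..R} m2 * measure lborel Q"
    using integral_profile_infdist_le[OF Q(1-4) m2] by (simp add: RQ)
  also have "\<dots> < (1 / R) * integral {0..R} m2 * measure lborel \<Omega>"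
    using pos R less by (intro mult_strict_left_mono) (auto simp: Q_def)
  also have "(LINT x|lborel. m1 (infdist x (- \<Omega>))) \<le> (1 / R) * integral {0..R} m1 * measure lborel \<Omega>"
    using integral_profile_infdist_le[OF \<Omega> m1] by (simp add: R_def)
  also have "(1 / R) * integral {0..R} m1 * measure lborel \<Omega> + (1 / R) * integral {0..R} m2 * measure lborel \<Omega>
      = (1 / R) * integral {0..R} m * measure lborel \<Omega>"
    unfolding sum using int by (simp add: Henstock_Kurzweil_Integration.integral_add algebra_simps)
  finally show ?thesis by (simp add: R_def)
qed

text \<open>If no opening loses volume then \<open>\<Omega>\<close> is the \<open>R\<close>-neighbourhood of its flat high ridge, hence lies
  in a slab of width \<open>2R\<close>, and stretching \<open>\<Omega>\<close> along the slab improves the distance without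
  changing the inradius.\<close>

lemma high_ridge_covers:
  fixes \<Omega> :: "'a::euclidean_space set"
  assumes \<Omega>: "\<Omega> \<noteq> {}" "open \<Omega>" "bounded \<Omega>" "convex \<Omega>"
    and all: "\<And>s. 0 < s \<Longrightarrow> s < inradius \<Omega> \<Longrightarrow> measure lborel (ball_opening s \<Omega>) \<ge> measure lborel \<Omega>"
    and x: "x \<in> \<Omega>"
  obtains y where "ball y (inradius \<Omega>) \<subseteq> \<Omega>" "dist x y \<le> inradius \<Omega>"
proof -
  define R where "R = inradius \<Omega>"
  have R: "R > 0" unfolding R_def using inradius_attained[OF \<Omega>(1-3)] by metis
  note cne = bounded_complement_nonempty[OF \<Omega>(3)]
  \<comment> \<open>An open piece of \<open>\<Omega>\<close> outside the closure of the opening has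
    positive volume, which the opening would lose.\<close>
  have clos: "x \<in> closure (ball_opening s \<Omega>)" if s: "0 < s" "s < R" for s
  proof (rule ccontr)
    assume no: "x \<notin> closure (ball_opening s \<Omega>)"
    define Q where "Q = ball_opening s \<Omega>"
    define U where "U = \<Omega> - closure Q"
    have U: "open U" "x \<in> U" using no x \<Omega> by (auto simp: U_def Q_def)
    have fin: "emeasure lborel \<Omega> < \<infinity>" by (rule emeasure_bounded_finite[OF \<Omega>(3)])
    have Q: "open Q" "Q \<subseteq> \<Omega>" unfolding Q_def by (rule open_ball_opening, rule ball_opening_subset)
    have sub: "Q \<union> U \<subseteq> \<Omega>" "Q \<inter> U = {}" using Q closure_subset[of Q] by (auto simp: U_def)
    have fQ: "Q \<in> fmeasurable lborel" and fU: "U \<in> fmeasurable lborel" and fO: "\<Omega> \<in> fmeasurable lborel"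
      using Q U \<Omega> bounded_subset[OF \<Omega>(3)] sub
      by (auto intro!: fmeasurableI emeasure_bounded_finite)
    have "measure lborel (Q \<union> U) = measure lborel Q + measure lborel U"
      using sub(2) fQ fU by (intro measure_Un3[THEN trans]) auto
    moreover have "measure lborel (Q \<union> U) \<le> measure lborel \<Omega>"
      by (rule measure_mono_fmeasurable[OF sub(1) _ fO]) (use Q U in auto)
    moreover have "measure lborel \<Omega> \<le> measure lborel Q" using all[OF s(1)] s by (simp add: Q_def R_def)
    ultimately have "measure lborel U \<le> 0" by linarith
    then have "emeasure lborel U = 0"
      using fU by (simp add: emeasure_eq_measure2 measure_le_0_iff)
    then have "U \<in> null_sets lborel" using U by (auto intro: null_setsI)
    then have "negligible U" by (simp add: negligible_iff_null_sets null_sets_completionI)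
    then show False using open_not_negligible[OF U(1)] U(2) by blast
  qed
  \<comment> \<open>\<open>F y \<le> 0\<close> says that \<open>y\<close> is the centre of an
    inscribed ball of radius \<open>R\<close> and has distance at most \<open>R\<close> from
    \<open>x\<close>. Openings with \<open>s\<close> close to \<open>R\<close> provide points where
    \<open>F\<close> is as small as desired, and the minimum of \<open>F\<close> is attained by
    compactness.\<close>
  define F where "F = (\<lambda>y. max (R - infdist y (- \<Omega>)) (dist x y - R))"
  have "\<exists>y\<in>closure \<Omega>. \<forall>z\<in>closure \<Omega>. F y \<le> F z"
    unfolding F_def
    by (intro continuous_attains_inf) (use \<Omega> in \<open>auto intro!: continuous_intros continuous_on_infdist\<close>)
  then obtain y where y: "\<And>z. z \<in> closure \<Omega> \<Longrightarrow> F y \<le> F z" by blast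
  have "F y \<le> 0"
  proof (rule field_le_epsilon)
    fix e :: real assume e: "e > 0"
    define s where "s = R - min e (R / 2)"
    have s: "0 < s" "s < R" "R - e \<le> s" using R e by (auto simp: s_def min_def)
    obtain w where w: "w \<in> ball_opening s \<Omega>" "dist w x < e"
      using clos[OF s(1,2)] e unfolding closure_approachable by blast
    then obtain z where z: "ball z s \<subseteq> \<Omega>" "dist z w < s" by (auto simp: ball_opening_def)
    have "z \<in> \<Omega>" using z s by (auto simp: subset_iff)
    then have "F y \<le> F z" using closure_subset by (intro y) blast
    also have "F z \<le> e"
    proof -
      have "s \<le> infdist z (- \<Omega>)" by (rule infdist_ge_ball[OF z(1) cne])
      moreover have "dist x z \<le> dist w x + dist z w" by (metis dist_commute dist_triangle)
      ultimately show ?thesis using s w z by (simp add: F_def)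
    qed
    finally show "F y \<le> 0 + e" by simp
  qed
  then have "R \<le> infdist y (- \<Omega>)" "dist x y \<le> R" by (auto simp: F_def)
  then show ?thesis using that[of y] ball_infdist_subset[of y \<Omega>] by (auto simp: R_def subset_iff)
qed

text \<open>The average bound holds for the stretched set \<open>\<Omega>'\<close>, whose inradius
  is at most \<open>R\<close>, and \<open>linear_change_of_variables_cross\<close> moves it back to
  \<open>\<Omega>\<close> as a bound for the integral of \<open>f (A x)\<close>. The distance in
  \<open>\<Omega>'\<close> at \<open>A x\<close> is nowhere smaller than the distance in
  \<open>\<Omega>\<close> at \<open>x\<close>, and it is larger near one end of the ridge, whence
  strictness.\<close>

lemma profile_infdist_less_of_ridge:
  fixes \<Omega> :: "'a::euclidean_space set"
  assumes \<Omega>: "\<Omega> \<noteq> {}" "open \<Omega>" "bounded \<Omega>" "convex \<Omega>" and m: "lipschitz_profile m \<Lambda>"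
    and strict: "strict_mono_on {0..inradius \<Omega>} m" and dim: "DIM('a) \<ge> 2"
    and cover: "\<And>x. x \<in> \<Omega> \<Longrightarrow> \<exists>y. ball y (inradius \<Omega>) \<subseteq> \<Omega> \<and> dist x y \<le> inradius \<Omega>"
  shows "(LINT x|lborel. m (infdist x (- \<Omega>)))
    < (1 / inradius \<Omega>) * integral {0..inradius \<Omega>} m * measure lborel \<Omega>"
proof -
  note mD = lipschitz_profileD[OF m]
  define R where "R = inradius \<Omega>"
  obtain c where c: "ball c R \<subseteq> \<Omega>" and R: "R > 0"
    unfolding R_def using inradius_attained[OF \<Omega>(1-3)] by metis
  define H where "H = {y. ball y R \<subseteq> \<Omega>}"
  have Heq: "H = {y. R \<le> infdist y (- \<Omega>)}"
  proof (intro set_eqI iffI; simp add: H_def)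
    fix y show "ball y R \<subseteq> \<Omega> \<Longrightarrow> R \<le> infdist y (- \<Omega>)"
      by (rule infdist_ge_ball[OF _ bounded_complement_nonempty[OF \<Omega>(3)]])
    show "R \<le> infdist y (- \<Omega>) \<Longrightarrow> ball y R \<subseteq> \<Omega>"
      using ball_infdist_subset[of y \<Omega>] by (auto simp: subset_iff)
  qed
  have H: "convex H" unfolding H_def by (rule convex_ball_centers[OF \<Omega>(4)])
  have HO: "H \<subseteq> \<Omega>" unfolding H_def using R by (auto simp: subset_iff)
  have "closed H" unfolding Heq
    by (intro closed_Collect_le continuous_on_const continuous_on_infdist continuous_on_id)
  then have "compact H" using bounded_subset[OF \<Omega>(3) HO] by (simp add: compact_eq_bounded_closed)
  \<comment> \<open>A ball of radius \<open>e\<close> filled with centres would produce an inscribed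
    ball of radius \<open>R + e\<close>.\<close>
  have "interior H = {}"
  proof (rule ccontr)
    assume "interior H \<noteq> {}"
    then obtain y e where e: "e > 0" "ball y e \<subseteq> H" using mem_interior by blast
    have "ball y (R + e) \<subseteq> \<Omega>"
    proof
      fix w assume "w \<in> ball y (R + e)"
      then have w: "norm (w - y) < R + e" by (simp add: dist_norm norm_minus_commute)
      define z where "z = y + (e / (R + e)) *\<^sub>R (w - y)"
      have "norm (z - y) = e / (R + e) * norm (w - y)" unfolding z_def using R e by simp
      also have "\<dots> < e / (R + e) * (R + e)" using w R e by (intro mult_strict_left_mono) auto
      finally have "z \<in> ball y e" using R e by (simp add: dist_norm norm_minus_commute)
      then have zH: "ball z R \<subseteq> \<Omega>" using e by (auto simp: H_def)
      have "w - z = (R / (R + e)) *\<^sub>R (w - y)"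
      proof -
        have "w - z = (1 - e / (R + e)) *\<^sub>R (w - y)" unfolding z_def by (simp add: algebra_simps)
        also have "1 - e / (R + e) = R / (R + e)" using R e by (simp add: field_simps)
        finally show ?thesis .
      qed
      then have "norm (w - z) = R / (R + e) * norm (w - y)" using R e by simp
      also have "\<dots> < R / (R + e) * (R + e)" using w R e by (intro mult_strict_left_mono) auto
      finally have "w \<in> ball z R" using R e by (simp add: dist_norm norm_minus_commute)
      then show "w \<in> \<Omega>" using zH by blast
    qed
    then have "R + e \<le> R" unfolding R_def by (rule inradius_ge[OF \<Omega>(1-3)])
    then show False using e by simp
  qed
  then obtain a b where a: "a \<noteq> 0" "H \<subseteq> {x. a \<bullet> x = b}"
    by (rule empty_interior_subset_hyperplane[OF H])
  \<comment> \<open>Here dimension at least two enters: the hyperplane containing the ridge has a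
    direction along which to stretch.\<close>
  obtain u0 where u0: "u0 \<noteq> 0" "orthogonal a u0" by (rule orthogonal_to_vector_exists[OF dim])
  define u where "u = u0 /\<^sub>R norm u0"
  have u: "u \<bullet> u = 1" "a \<bullet> u = 0"
    using u0 by (auto simp: u_def orthogonal_def dot_square_norm power2_eq_square)
  have "\<exists>x\<in>H. \<forall>y\<in>H. u \<bullet> y \<le> u \<bullet> x"
    by (intro continuous_attains_sup) (use \<open>compact H\<close> c in \<open>auto simp: H_def intro!: continuous_intros\<close>)
  then obtain x\<^sub>0 where x0: "x\<^sub>0 \<in> H" "\<And>y. y \<in> H \<Longrightarrow> u \<bullet> y \<le> u \<bullet> x\<^sub>0" by blast
  \<comment> \<open>\<open>A\<close> doubles the component along \<open>u\<close>, and its inverse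
    \<open>B\<close> halves it. \<open>B\<close> does not increase norms, and \<open>A\<close>
    preserves the slab around the hyperplane.\<close>
  define A B where "A = (\<lambda>x. x + (u \<bullet> x) *\<^sub>R u)" and "B = (\<lambda>y. y - (1 / 2) *\<^sub>R ((u \<bullet> y) *\<^sub>R u))"
  have linA: "linear A" and linB: "linear B"
    unfolding A_def B_def by (auto intro!: linearI simp: algebra_simps inner_add_right add_divide_distrib)
  have uA: "u \<bullet> A x = 2 * (u \<bullet> x)" and uB: "u \<bullet> B x = (u \<bullet> x) / 2" and aA: "a \<bullet> A x = a \<bullet> x" for x
    using u by (auto simp: A_def B_def inner_add_right inner_diff_right)
  have AB: "A (B y) = y" and BA: "B (A y) = y" for y
  proof -
    show "A (B y) = y" using uB[of y] by (simp add: A_def) (simp add: B_def)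
    show "B (A y) = y" using uA[of y] by (simp add: B_def) (simp add: A_def)
  qed
  have normB: "(norm (B v))\<^sup>2 = (norm v)\<^sup>2 - 3 / 4 * (u \<bullet> v)\<^sup>2" for v
    unfolding B_def power2_norm_eq_inner using u(1)
    by (simp add: inner_diff_left inner_diff_right inner_commute power2_eq_square algebra_simps)
  have normB_le: "norm (B v) \<le> norm v" for v
  proof (rule power2_le_imp_le)
    show "(norm (B v))\<^sup>2 \<le> (norm v)\<^sup>2" unfolding normB by simp
  qed simp
  have contA: "continuous_on S A" and contB: "continuous_on S B" for S
    unfolding A_def B_def by (intro continuous_intros)+
  define \<Omega>' where "\<Omega>' = A ` \<Omega>"
  have mem: "A x \<in> \<Omega>' \<longleftrightarrow> x \<in> \<Omega>" for x
  proof
    assume "A x \<in> \<Omega>'"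
    then obtain y where y: "y \<in> \<Omega>" "A x = A y" by (auto simp: \<Omega>'_def)
    have "B (A x) = B (A y)" by (rule arg_cong[OF y(2)])
    then have "x = y" by (simp only: BA)
    then show "x \<in> \<Omega>" using y(1) by simp
  qed (simp add: \<Omega>'_def)
  have vim: "\<Omega>' = B -` \<Omega>"
  proof (intro set_eqI)
    show "y \<in> \<Omega>' \<longleftrightarrow> y \<in> B -` \<Omega>" for y using mem[of "B y"] by (simp add: AB)
  qed
  have O': "\<Omega>' \<noteq> {}" "open \<Omega>'" "bounded \<Omega>'" "convex \<Omega>'"
  proof -
    show "\<Omega>' \<noteq> {}" using \<Omega> by (simp add: \<Omega>'_def)
    show "open \<Omega>'" unfolding vim by (rule open_vimage[OF \<Omega>(2) contB])
    show "bounded \<Omega>'" unfolding \<Omega>'_def by (rule bounded_linear_image[OF \<Omega>(3)]) (use linA in \<open>simp add: linear_linear\<close>)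
    show "convex \<Omega>'" unfolding \<Omega>'_def by (rule convex_linear_image[OF linA \<Omega>(4)])
  qed
  have slab: "\<bar>a \<bullet> y - b\<bar> \<le> norm a * R" if y: "y \<in> \<Omega>'" for y
  proof -
    obtain x where x: "x \<in> \<Omega>" "y = A x" using y unfolding \<Omega>'_def by blast
    obtain k where k: "ball k R \<subseteq> \<Omega>" "dist x k \<le> R" using cover[OF x(1)] by (auto simp: R_def)
    have "a \<bullet> k = b" using a k by (auto simp: H_def)
    then have "a \<bullet> y - b = a \<bullet> (x - k)" using aA x by (simp add: inner_diff_right)
    also have "\<bar>a \<bullet> (x - k)\<bar> \<le> norm a * norm (x - k)" by (rule Cauchy_Schwarz_ineq2)
    also have "\<dots> \<le> norm a * R" using k by (intro mult_left_mono) (auto simp: dist_norm)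
    finally show ?thesis .
  qed
  define R' where "R' = inradius \<Omega>'"
  obtain z where z: "ball z R' \<subseteq> \<Omega>'" and R': "R' > 0"
    unfolding R'_def using inradius_attained[OF O'(1-3)] by metis
  \<comment> \<open>The stretched set stays in a slab of half-width \<open>R\<close>, which bounds
    its inscribed balls.\<close>
  have R'R: "R' \<le> R"
  proof (rule ccontr)
    assume "\<not> R' \<le> R"
    then obtain t where t: "R < t" "t < R'" using dense not_le by metis
    have "z + (t / norm a) *\<^sub>R a \<in> \<Omega>'" "z - (t / norm a) *\<^sub>R a \<in> \<Omega>'"
      using t R a by (intro subsetD[OF z]; simp add: dist_norm)+
    from slab[OF this(1)] slab[OF this(2)]
    have "\<bar>a \<bullet> z - b + t * norm a\<bar> \<le> norm a * R" "\<bar>a \<bullet> z - b - t * norm a\<bar> \<le> norm a * R"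
      using a by (auto simp: inner_add_right inner_diff_right dot_square_norm power2_eq_square algebra_simps)
    then have "t * norm a \<le> norm a * R" by linarith
    then show False using t a by (simp add: mult.commute)
  qed
  have cne: "- \<Omega> \<noteq> {}" "- \<Omega>' \<noteq> {}" using bounded_complement_nonempty \<Omega>(3) O'(3) by blast+
  have dle: "infdist x (- \<Omega>) \<le> infdist (A x) (- \<Omega>')" for x
  proof (rule infdist_ge_ball[OF _ cne(2)], rule subsetI)
    fix y assume "y \<in> ball (A x) (infdist x (- \<Omega>))"
    moreover have "norm (B y - x) \<le> norm (y - A x)"
      using normB_le[of "y - A x"] by (simp add: linear_diff[OF linB] BA)
    ultimately have "B y \<in> ball x (infdist x (- \<Omega>))" by (simp add: dist_norm norm_minus_commute)
    then show "y \<in> \<Omega>'" unfolding vim using ball_infdist_subset by blast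
  qed
  \<comment> \<open>\<open>x\<^sub>0\<close> is extreme in the ridge in direction \<open>u\<close>,
    and \<open>\<Omega>\<close> reaches at most \<open>R\<close> beyond it. So \<open>x1\<close>,
    half-way out, has distance at most \<open>R / 2\<close> to the complement of
    \<open>\<Omega>\<close>, but its image has distance at least \<open>4 / 5 * R\<close> in the
    stretched set.\<close>
  define x1 where "x1 = x\<^sub>0 + (R / 2) *\<^sub>R u"
  have d1: "infdist x1 (- \<Omega>) \<le> R / 2"
  proof (rule ccontr)
    assume "\<not> ?thesis"
    then obtain t where t: "R / 2 < t" "t < infdist x1 (- \<Omega>)" using dense not_le by metis
    have "norm u = 1" using u(1) by (simp add: norm_eq_1)
    have "dist x1 (x1 + t *\<^sub>R u) = \<bar>t\<bar> * norm u" by (simp add: dist_norm)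
    also have "\<dots> = t" using \<open>norm u = 1\<close> t(1) R by simp
    finally have "x1 + t *\<^sub>R u \<in> ball x1 (infdist x1 (- \<Omega>))" using t(2) by simp
    then have "x1 + t *\<^sub>R u \<in> \<Omega>" by (rule subsetD[OF ball_infdist_subset])
    from cover[OF this] obtain k where k: "ball k R \<subseteq> \<Omega>" "dist (x1 + t *\<^sub>R u) k \<le> R"
      unfolding R_def by blast
    have "u \<bullet> (x1 + t *\<^sub>R u - k) \<le> norm u * norm (x1 + t *\<^sub>R u - k)" by (rule norm_cauchy_schwarz)
    then have "u \<bullet> (x1 + t *\<^sub>R u - k) \<le> R" using k \<open>norm u = 1\<close> by (simp add: dist_norm)
    moreover have "u \<bullet> (x1 + t *\<^sub>R u - k) = u \<bullet> x\<^sub>0 - u \<bullet> k + R / 2 + t"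
      using u by (simp add: x1_def inner_add_right inner_diff_right)
    moreover have "u \<bullet> k \<le> u \<bullet> x\<^sub>0" using k by (intro x0) (simp add: H_def)
    ultimately show False using t by linarith
  qed
  have d2: "4 / 5 * R \<le> infdist (A x1) (- \<Omega>')"
  proof (rule infdist_ge_ball[OF _ cne(2)], rule subsetI)
    fix y assume y: "y \<in> ball (A x1) (4 / 5 * R)"
    define v where "v = y - A x1"
    define q where "q = u \<bullet> v"
    have v: "norm v < 4 / 5 * R" using y by (simp add: v_def dist_norm norm_minus_commute)
    have "B y - x\<^sub>0 = B v + (R / 2) *\<^sub>R u"
      by (simp add: v_def linear_diff[OF linB] BA x1_def)
    then have "(norm (B y - x\<^sub>0))\<^sup>2 = (norm (B v))\<^sup>2 + R * (u \<bullet> B v) + R\<^sup>2 / 4"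
      unfolding power2_norm_eq_inner using u(1)
      by (simp add: inner_add_left inner_add_right inner_commute power2_eq_square algebra_simps)
    also have "\<dots> = (norm v)\<^sup>2 - 3 / 4 * q\<^sup>2 + R * q / 2 + R\<^sup>2 / 4"
      by (simp add: normB uB q_def)
    \<comment> \<open>\<open>- 3 / 4 * q\<^sup>2 + R * q / 2\<close> is largest at
      \<open>q = R / 3\<close>, with value \<open>R\<^sup>2 / 12\<close>. The radius
      \<open>4 / 5 * R\<close> works because \<open>16 / 25 + 1 / 12 + 1 / 4 < 1\<close>.\<close>
    also have "\<dots> \<le> (norm v)\<^sup>2 + R\<^sup>2 / 12 + R\<^sup>2 / 4"
      using zero_le_power2[of "q - R / 3"] by (simp add: power2_eq_square algebra_simps)
    also have "(norm v)\<^sup>2 < (4 / 5 * R)\<^sup>2" using v by (intro power_strict_mono) auto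
    finally have "(norm (B y - x\<^sub>0))\<^sup>2 < (4 / 5 * R)\<^sup>2 + R\<^sup>2 / 12 + R\<^sup>2 / 4" by simp
    also have "\<dots> \<le> R\<^sup>2" by (simp add: power2_eq_square)
    finally have "norm (B y - x\<^sub>0) < R" by (rule power2_less_imp_less) (use R in simp)
    then have "B y \<in> ball x\<^sub>0 R" by (simp add: dist_norm norm_minus_commute)
    moreover have "ball x\<^sub>0 R \<subseteq> \<Omega>" using x0(1) by (simp add: H_def)
    ultimately show "y \<in> \<Omega>'" unfolding vim by blast
  qed
  have intm: "m integrable_on {p..q}" for p q by (rule integrable_continuous_real[OF mD(7)])
  define f where "f = (\<lambda>y. m (infdist y (- \<Omega>')))"
  define A0 where "A0 = (1 / R) * integral {0..R} m"
  have contf: "continuous_on UNIV f" unfolding f_def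
    by (rule continuous_on_compose2[OF mD(7)[of UNIV]]) (auto intro!: continuous_on_infdist continuous_on_id)
  have contF: "continuous_on UNIV (\<lambda>x. f (A x))" by (rule continuous_on_compose2[OF contf contA]) auto
  have f0: "f y \<ge> 0" for y unfolding f_def by (rule mD(5))
  have intf: "integrable lborel f" unfolding f_def by (rule integrable_profile_infdist[OF O'(3) m])
  have intF: "integrable lborel (\<lambda>x. f (A x))"
  proof (rule integrable_continuous_compact_support[OF contF])
    show "compact (closure \<Omega>)" using \<Omega> by simp
    fix x assume "x \<notin> closure \<Omega>"
    then have "x \<notin> \<Omega>" using closure_subset by blast
    then have "A x \<in> - \<Omega>'" by (simp add: mem)
    then show "f (A x) = 0" unfolding f_def using mD(3)[of 0] by simp
  qed
  have fO: "\<Omega> \<in> fmeasurable lborel" "\<Omega>' \<in> fmeasurable lborel"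
    using \<Omega> O' by (auto intro!: fmeasurableI emeasure_bounded_finite)
  have nni: "(\<integral>\<^sup>+x. indicator S x \<partial>lborel) = ennreal (measure lborel S)" if S: "S \<in> fmeasurable lborel" for S :: "'a set"
    using fmeasurableD[OF S] emeasure_eq_measure2[OF S] by simp
  \<comment> \<open>With the indicator of \<open>\<Omega>'\<close> as second function the formula
    expresses the ratio of the integrals through the ratio of the volumes.\<close>
  have "(\<integral>\<^sup>+x. ennreal (f (A x)) \<partial>lborel) * (\<integral>\<^sup>+x. indicator \<Omega>' x \<partial>lborel)
      = (\<integral>\<^sup>+x. indicator \<Omega>' (A x) \<partial>lborel) * (\<integral>\<^sup>+x. ennreal (f x) \<partial>lborel)"
    by (rule linear_change_of_variables_cross[OF _ _ linA AB])
       (use borel_measurable_continuous_onI[OF contf] O' in auto)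
  moreover have "(\<integral>\<^sup>+x. ennreal (f (A x)) \<partial>lborel) = ennreal (LINT x|lborel. f (A x))"
    by (rule nn_integral_eq_integral[OF intF]) (use f0 in auto)
  moreover have "(\<integral>\<^sup>+x. ennreal (f x) \<partial>lborel) = ennreal (LINT x|lborel. f x)"
    by (rule nn_integral_eq_integral[OF intf]) (use f0 in auto)
  moreover have "(\<lambda>x. indicator \<Omega>' (A x) :: ennreal) = indicator \<Omega>"
    using mem by (auto simp: indicator_def)
  moreover have "(\<integral>\<^sup>+x. indicator \<Omega> x \<partial>lborel) = ennreal (measure lborel \<Omega>)"
    "(\<integral>\<^sup>+x. indicator \<Omega>' x \<partial>lborel) = ennreal (measure lborel \<Omega>')"
    by (rule nni[OF fO(1)], rule nni[OF fO(2)])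
  ultimately have "ennreal ((LINT x|lborel. f (A x)) * measure lborel \<Omega>') = ennreal (measure lborel \<Omega> * (LINT x|lborel. f x))"
    using f0 by (simp add: ennreal_mult integral_nonneg)
  then have cross: "(LINT x|lborel. f (A x)) * measure lborel \<Omega>' = measure lborel \<Omega> * (LINT x|lborel. f x)"
    using f0 by (simp add: integral_nonneg ennreal_inj)
  have posO': "measure lborel \<Omega>' > 0"
  proof (rule ccontr)
    assume "\<not> ?thesis"
    then have "emeasure lborel \<Omega>' = 0" using fO(2) measure_nonneg[of lborel \<Omega>'] by (simp add: emeasure_eq_measure2)
    then have "\<Omega>' \<in> null_sets lborel" using O' by (auto intro: null_setsI)
    then have "negligible \<Omega>'" by (simp add: negligible_iff_null_sets null_sets_completionI)
    then show False using open_not_negligible O' by blast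
  qed
  have "(LINT x|lborel. f x) \<le> (1 / R') * integral {0..R'} m * measure lborel \<Omega>'"
    unfolding f_def R'_def by (rule integral_profile_infdist_le[OF O' m])
  also have "\<dots> \<le> A0 * measure lborel \<Omega>'"
  proof (rule mult_right_mono)
    show "(1 / R') * integral {0..R'} m \<le> A0"
      using integral_mono_fun_le[OF mD(2) mD(7) R' R'R] R' by (simp add: A0_def field_simps)
  qed simp
  finally have "(LINT x|lborel. f (A x)) * measure lborel \<Omega>' \<le> measure lborel \<Omega> * (A0 * measure lborel \<Omega>')"
    unfolding cross by (intro mult_left_mono) auto
  then have le: "(LINT x|lborel. f (A x)) \<le> A0 * measure lborel \<Omega>"
    using posO' by (simp add: mult.left_commute mult.assoc[symmetric])
  have "(LINT x|lborel. m (infdist x (- \<Omega>))) < (LINT x|lborel. f (A x))"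
  proof (rule continuous_integral_less[OF integrable_profile_infdist[OF \<Omega>(3) m] _ intF contF])
    show "continuous_on UNIV (\<lambda>x. m (infdist x (- \<Omega>)))"
      by (rule continuous_on_compose2[OF mD(7)[of UNIV]]) (auto intro!: continuous_on_infdist continuous_on_id)
    show "m (infdist x (- \<Omega>)) \<le> f (A x)" for x
      unfolding f_def by (rule monoD[OF mD(2) dle])
    have "m (infdist x1 (- \<Omega>)) \<le> m (R / 2)" by (rule monoD[OF mD(2) d1])
    also have "\<dots> < m (4 / 5 * R)" using strict R by (auto simp: strict_mono_on_def R_def)
    also have "\<dots> \<le> f (A x1)" unfolding f_def by (rule monoD[OF mD(2) d2])
    finally show "m (infdist x1 (- \<Omega>)) < f (A x1)" .
  qed
  then show ?thesis using le by (simp add: A0_def R_def)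
qed

text \<open>Either some opening loses volume, which lowers the bound, or none does, and then
  stretching raises the integral.\<close>

theorem integral_profile_infdist_less:
  fixes \<Omega> :: "'a::euclidean_space set"
  assumes \<Omega>: "\<Omega> \<noteq> {}" "open \<Omega>" "bounded \<Omega>" "convex \<Omega>" and m: "lipschitz_profile m \<Lambda>"
    and strict: "strict_mono_on {0..inradius \<Omega>} m" and dim: "DIM('a) \<ge> 2"
  shows "(LINT x|lborel. m (infdist x (- \<Omega>)))
    < (1 / inradius \<Omega>) * integral {0..inradius \<Omega>} m * measure lborel \<Omega>"
proof (cases "\<exists>s. 0 < s \<and> s < inradius \<Omega> \<and> measure lborel (ball_opening s \<Omega>) < measure lborel \<Omega>")
  case True
  then show ?thesis using profile_infdist_less_of_opening[OF \<Omega> m strict] by blast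
next
  case False
  then have all: "measure lborel (ball_opening s \<Omega>) \<ge> measure lborel \<Omega>" if "0 < s" "s < inradius \<Omega>" for s
    using that False by (meson not_less)
  show ?thesis
    by (rule profile_infdist_less_of_ridge[OF \<Omega> m strict dim]) (metis high_ridge_covers[OF \<Omega> all])
qed

section \<open>The one-dimensional profile\<close>

text \<open>The extremal of the one-dimensional problem solves \<open>f'' = - (q/2) f\<^sup>q\<^sup>-\<^sup>1\<close>, i.e. \<open>f'\<^sup>2 = 1 - f\<^sup>q\<close>,
  and is the inverse of \<open>u \<mapsto> \<integral>\<^sub>0\<^sup>u (1 - s\<^sup>q)\<^sup>-\<^sup>1\<^sup>/\<^sup>2 ds\<close>. Stopping it at height \<open>u < 1\<close> avoids the singular
  end point at a small loss in the constant.\<close>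

lemma profile_ode_solution:
  fixes q u :: real
  assumes q: "1 \<le> q" and u: "0 < u" "u < 1"
  obtains f T T2 where "0 < T" "T < T2" "f T = u" "continuous_on UNIV f" "\<And>t. t \<le> 0 \<Longrightarrow> f t = 0" "mono f"
    "\<And>t. 0 < t \<Longrightarrow> t < T2 \<Longrightarrow> 0 < f t \<and> f t < 1 \<and> (f has_real_derivative sqrt (1 - f t powr q)) (at t)"
proof -
  \<comment> \<open>A height between \<open>u\<close> and 1 leaves room to the right of
    \<open>T\<close>, so that \<open>f\<close> is differentiable at \<open>T\<close> itself while
    the singularity at height 1 stays out of reach.\<close>
  define u2 where "u2 = (1 + u) / 2"
  have u2: "u < u2" "u2 < 1" "0 < u2" using u by (auto simp: u2_def)
  define h where "h = (\<lambda>s. 1 / sqrt (1 - s powr q))"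
  have pq: "s powr q < 1" if "0 \<le> s" "s \<le> u2" for s
    using powr_less_mono2[of q s 1] that q u2 by simp
  have conth: "continuous_on {0..u2} h"
    unfolding h_def using q pq by (intro continuous_intros continuous_on_powr') (auto simp: less_le)
  have h1: "h s \<ge> 1" if "0 \<le> s" "s \<le> u2" for s
  proof -
    have "sqrt (1 - s powr q) \<le> 1" "sqrt (1 - s powr q) > 0" using pq[OF that] by auto
    then show ?thesis by (simp add: h_def)
  qed
  define P where "P = (\<lambda>x. integral {0..x} h)"
  have P': "(P has_real_derivative h x) (at x within {0..u2})" if "x \<in> {0..u2}" for x
    unfolding P_def by (rule integral_has_real_derivative[OF conth that])
  have contP: "continuous_on {0..u2} P"
    by (rule DERIV_continuous_on[OF P'])
  have P'i: "(P has_real_derivative h x) (at x)" if "0 < x" "x < u2" for x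
    using P'[of x] that by (simp add: at_within_Icc_at)
  have incr: "P x + (y - x) \<le> P y" if xy: "0 \<le> x" "x < y" "y \<le> u2" for x y
  proof -
    have "\<exists>z\<in>{x<..<y}. P y - P x = (y - x) * h z"
    proof (rule mvt_simple[OF xy(2), of P "\<lambda>z v. v * h z"])
      show "(P has_derivative (\<lambda>v. v * h z)) (at z within {x..y})" if "x \<le> z" "z \<le> y" for z
        using DERIV_subset[OF P'[of z], of "{x..y}"] that xy by (simp add: has_field_derivative_def mult_commute_abs)
    qed
    then obtain z where z: "x < z" "z < y" "P y - P x = (y - x) * h z" by auto
    have "(y - x) * 1 \<le> (y - x) * h z" using z xy by (intro mult_left_mono h1) auto
    then have "(y - x) * 1 \<le> P y - P x" unfolding z(3) .
    then show ?thesis by simp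
  qed
  have P0: "P 0 = 0" by (simp add: P_def)
  define T2 where "T2 = P u2"
  have inj: "inj_on P {0..u2}"
  proof (rule linorder_inj_onI')
    fix x y assume "x \<in> {0..u2}" "y \<in> {0..u2}" "x < y"
    then show "P x \<noteq> P y" using incr[of x y] by auto
  qed
  have img: "P ` {0..u2} = {0..T2}"
  proof (intro equalityI subsetI)
    fix t assume "t \<in> P ` {0..u2}"
    then obtain x where x: "0 \<le> x" "x \<le> u2" "t = P x" by auto
    then show "t \<in> {0..T2}" using incr[of 0 x] incr[of x u2] P0 unfolding T2_def
      by (cases "x = 0"; cases "x = u2") auto
  next
    fix t assume "t \<in> {0..T2}"
    then have "\<exists>x\<ge>0. x \<le> u2 \<and> P x = t"
      by (intro IVT' contP) (use P0 u2 in \<open>auto simp: T2_def\<close>)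
    then show "t \<in> P ` {0..u2}" by auto
  qed
  define g where "g = inv_into {0..u2} P"
  have gP: "g (P x) = x" if "x \<in> {0..u2}" for x unfolding g_def by (rule inv_into_f_f[OF inj that])
  have Pg: "P (g t) = t" and g_in: "g t \<in> {0..u2}" if "t \<in> {0..T2}" for t
    using that f_inv_into_f[of t P "{0..u2}"] inv_into_into[of t P "{0..u2}"] by (auto simp: g_def img)
  have contg: "continuous_on {0..T2} g"
    using continuous_on_inv[OF contP compact_Icc, of g] gP by (simp add: img)
  have T2: "T2 > 0" using incr[of 0 u2] u2 P0 by (simp add: T2_def)
  have g0: "g 0 = 0" using gP[of 0] P0 u2 by simp
  have gT2: "g T2 = u2" using gP[of u2] u2 by (simp add: T2_def)
  have gmono: "g s < g t" if "0 \<le> s" "s < t" "t \<le> T2" for s t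
  proof (rule ccontr)
    assume "\<not> g s < g t"
    then have "P (g t) \<le> P (g s)"
      using incr[of "g t" "g s"] g_in[of s] g_in[of t] that by (cases "g t = g s") auto
    then show False using Pg that by auto
  qed
  \<comment> \<open>Clamping the argument extends \<open>g\<close> by constants to a continuous
    increasing function on the whole line.\<close>
  define f where "f = (\<lambda>t. g (max 0 (min t T2)))"
  have contf: "continuous_on UNIV f"
    unfolding f_def by (intro continuous_on_compose2[OF contg] continuous_intros) (use T2 in auto)
  have monof: "mono f"
  proof (rule monoI)
    fix s t :: real assume "s \<le> t"
    then have "max 0 (min s T2) \<le> max 0 (min t T2)" by simp
    moreover have "g a \<le> g b" if "0 \<le> a" "a \<le> b" "b \<le> T2" for a b
      using gmono[of a b] that by (cases "a = b") auto
    ultimately show "f s \<le> f t" unfolding f_def using T2 by auto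
  qed
  have fg: "f t = g t" if "0 \<le> t" "t \<le> T2" for t using that by (simp add: f_def)
  define T where "T = P u"
  have T: "0 < T" "T < T2" using incr[of 0 u] incr[of u u2] u u2 P0 by (auto simp: T_def T2_def)
  show ?thesis
  proof (rule that[of T T2 f])
    show "f T = u" using fg[of T] T gP[of u] u u2 by (simp add: T_def)
    show "f t = 0" if "t \<le> 0" for t using that T2 g0 by (simp add: f_def)
    show "0 < f t \<and> f t < 1 \<and> (f has_real_derivative sqrt (1 - f t powr q)) (at t)" if t: "0 < t" "t < T2" for t
    proof (intro conjI)
      have gt: "0 < g t" "g t < u2" using gmono[of 0 t] gmono[of t T2] t g0 gT2 by auto
      then show "0 < f t" "f t < 1" using fg[of t] t u2 by auto
      have "isCont f t" using contf by (simp add: continuous_on_eq_continuous_at)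
      have "(f has_real_derivative inverse (h (f t))) (at t)"
      proof (rule DERIV_inverse_function[where f = P and a = 0 and b = T2])
        show "(P has_real_derivative h (f t)) (at (f t))" using P'i gt fg[of t] t by simp
        show "h (f t) \<noteq> 0" using h1[of "f t"] gt fg[of t] t by auto
        show "P (f y) = y" if "0 < y" "y < T2" for y using Pg[of y] fg[of y] that by simp
      qed (use t \<open>isCont f t\<close> in auto)
      then show "(f has_real_derivative sqrt (1 - f t powr q)) (at t)" by (simp add: h_def)
    qed
  qed (use T contf monof in auto)
qed

text \<open>The tent \<open>2 * T * min x (1 - x)\<close> runs through \<open>{0..T}\<close> up and
  down at constant speed, so averages over \<open>{0..1}\<close> and over \<open>{0..T}\<close>
  agree.\<close>

lemma has_integral_tent:
  fixes F :: "real \<Rightarrow> real"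
  assumes F: "continuous_on {0..T} F" and T: "T > 0"
  shows "((\<lambda>x. F (2 * T * min x (1 - x))) has_integral (1 / T) * integral {0..T} F) {0..1}"
proof -
  define P where "P = (\<lambda>x. integral {0..x} F)"
  have P': "(P has_real_derivative F x) (at x within {0..T})" if "x \<in> {0..T}" for x
    unfolding P_def by (rule integral_has_real_derivative[OF F that])
  have P0: "P 0 = 0" by (simp add: P_def)
  have 1: "((\<lambda>x. F (2 * T * min x (1 - x))) has_integral (P (2 * T * (1 / 2)) / (2 * T) - P (2 * T * 0) / (2 * T))) {0..1/2}"
  proof (rule fundamental_theorem_of_calculus)
    fix x :: real assume x: "x \<in> {0..1/2}"
    have "((\<lambda>x. P (2 * T * x)) has_real_derivative F (2 * T * x) * (2 * T)) (at x within {0..1/2})"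
    proof (rule DERIV_image_chain[where f = P and g = "\<lambda>x. 2 * T * x", unfolded o_def])
      have "(\<lambda>x. 2 * T * x) ` {0..1/2} \<subseteq> {0..T}" using T by auto
      then show "(P has_real_derivative F (2 * T * x)) (at (2 * T * x) within (\<lambda>x. 2 * T * x) ` {0..1/2})"
        by (rule DERIV_subset[OF P', rotated]) (use x T in auto)
    qed (auto intro!: derivative_eq_intros)
    from DERIV_cdivide[OF this, of "2 * T"]
    have "((\<lambda>x. P (2 * T * x) / (2 * T)) has_real_derivative F (2 * T * x)) (at x within {0..1/2})"
      using T by simp
    moreover have "min x (1 - x) = x" using x by auto
    ultimately show "((\<lambda>x. P (2 * T * x) / (2 * T)) has_vector_derivative F (2 * T * min x (1 - x))) (at x within {0..1/2})"
      by (simp add: has_real_derivative_iff_has_vector_derivative)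
  qed simp
  have 2: "((\<lambda>x. F (2 * T * min x (1 - x))) has_integral (- P (2 * T * (1 - 1)) / (2 * T) - (- P (2 * T * (1 - 1 / 2)) / (2 * T)))) {1/2..1}"
  proof (rule fundamental_theorem_of_calculus)
    fix x :: real assume x: "x \<in> {1/2..1}"
    have "((\<lambda>x. P (2 * T * (1 - x))) has_real_derivative F (2 * T * (1 - x)) * (- (2 * T))) (at x within {1/2..1})"
    proof (rule DERIV_image_chain[where f = P and g = "\<lambda>x. 2 * T * (1 - x)", unfolded o_def])
      have "(\<lambda>x. 2 * T * (1 - x)) ` {1/2..1} \<subseteq> {0..T}" using T by auto
      then show "(P has_real_derivative F (2 * T * (1 - x))) (at (2 * T * (1 - x)) within (\<lambda>x. 2 * T * (1 - x)) ` {1/2..1})"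
        by (rule DERIV_subset[OF P', rotated]) (use x T in auto)
    qed (auto intro!: derivative_eq_intros)
    from DERIV_cdivide[OF this, of "- (2 * T)"]
    have "((\<lambda>x. - P (2 * T * (1 - x)) / (2 * T)) has_real_derivative F (2 * T * (1 - x))) (at x within {1/2..1})"
      using T by simp
    moreover have "min x (1 - x) = 1 - x" using x by auto
    ultimately show "((\<lambda>x. - P (2 * T * (1 - x)) / (2 * T)) has_vector_derivative F (2 * T * min x (1 - x))) (at x within {1/2..1})"
      by (simp add: has_real_derivative_iff_has_vector_derivative)
  qed simp
  have "((\<lambda>x. F (2 * T * min x (1 - x))) has_integral
     ((P (2 * T * (1 / 2)) / (2 * T) - P (2 * T * 0) / (2 * T)) + (- P (2 * T * (1 - 1)) / (2 * T) - (- P (2 * T * (1 - 1 / 2)) / (2 * T))))) {0..1}"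
    by (rule has_integral_combine[OF _ _ 1 2]) auto
  moreover have "(P (2 * T * (1 / 2)) / (2 * T) - P (2 * T * 0) / (2 * T)) + (- P (2 * T * (1 - 1)) / (2 * T) - (- P (2 * T * (1 - 1 / 2)) / (2 * T))) = (1 / T) * P T"
    using T P0 by (simp add: field_simps)
  ultimately show ?thesis by (simp add: P_def)
qed

lemma set_integrable_bounded_unit:
  fixes f :: "real \<Rightarrow> real"
  assumes "f \<in> borel_measurable borel" and "\<And>x. x \<in> {0<..<1} \<Longrightarrow> \<bar>f x\<bar> \<le> C"
  shows "set_integrable lebesgue {0<..<1} f"
  unfolding set_integrable_def
proof (rule Bochner_Integration.integrable_bound[of lebesgue "\<lambda>x. C * indicator {0<..<1} x"])
  have "integrable lborel (\<lambda>x. C * indicat_real {0<..<1} (x::real))"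
    by (intro integrable_mult_right integrable_real_indicator) auto
  then show "integrable lebesgue (\<lambda>x. C * indicat_real {0<..<1} (x::real))"
    by (simp add: integrable_completion)
  show "(\<lambda>x. indicat_real {0<..<1} x *\<^sub>R f x) \<in> borel_measurable lebesgue"
    using assms(1) by (intro measurable_completion) (simp add: borel_measurable_indicator)
  have "C \<ge> 0" using assms(2)[of "1/2"] by auto
  then show "AE x in lebesgue. norm (indicat_real {0<..<1} x *\<^sub>R f x) \<le> norm (C * indicat_real {0<..<1} x)"
    using assms(2) by (intro AE_I2) (auto simp: indicator_def)
qed

lemma set_integral_unit_eq:
  fixes f :: "real \<Rightarrow> real"
  assumes "set_integrable lebesgue {0<..<1} f" and "(f has_integral I) {0..1}"
  shows "(LINT x:{0<..<1}|lebesgue. f x) = I"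
proof -
  have "(LINT x:{0<..<1}|lebesgue. f x) = integral {0<..<1} f"
    by (rule set_lebesgue_integral_eq_integral(2)[OF assms(1)])
  also have "\<dots> = integral {0..1} f" using integral_open_interval[of 0 1 f] by simp
  finally show ?thesis using assms(2) by (simp add: integral_unique)
qed

lemma set_integral_unit_continuous:
  fixes f :: "real \<Rightarrow> real"
  assumes c: "continuous_on {0..1} f"
  shows "(LINT x:{0<..<1}|lebesgue. f x) = integral {0..1} f" and "set_integrable lebesgue {0<..<1} f"
proof -
  have "set_integrable lborel {0<..<1} f"
    by (rule set_integrable_subset[OF borel_integrable_atLeastAtMost'[OF c]]) auto
  then show int: "set_integrable lebesgue {0<..<1} f"
    unfolding set_integrable_def
    by (subst integrable_completion) (auto dest: borel_measurable_integrable)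
  show "(LINT x:{0<..<1}|lebesgue. f x) = integral {0..1} f"
    by (rule set_integral_unit_eq[OF int]) (intro integrable_integral integrable_continuous_real c)
qed

lemma test_function_unit_derivative:
  assumes "\<psi> \<in> test_functions {0<..<1::real}"
  shows "(\<psi> has_real_derivative deriv \<psi> x) (at x)" and "continuous_on A \<psi>" and "continuous_on A (deriv \<psi>)"
proof -
  have "smooth \<psi>" using assms by (simp add: test_functions_def)
  then show "(\<psi> has_real_derivative deriv \<psi> x) (at x)" "continuous_on A \<psi>" "continuous_on A (deriv \<psi>)"
    by (auto intro: smooth_real_derivative smooth_derivative(3))
qed

lemma pi2_le:
  assumes "W12 \<phi> \<phi>'" and "continuous_on {0..1} \<phi>" and "\<phi> 0 = 0" and "\<phi> 1 = 0" and "x \<in> {0<..<1}" and "\<phi> x \<noteq> 0"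
  shows "pi2 q \<le> Lp_norm 2 {0<..<1} \<phi>' / Lp_norm q {0<..<1} \<phi>"
  unfolding pi2_def
proof (rule cInf_lower)
  show "bdd_below {Lp_norm 2 {0<..<1} \<phi>' / Lp_norm q {0<..<1} \<phi> | \<phi> \<phi>'. W12 \<phi> \<phi>' \<and> continuous_on {0..1} \<phi> \<and> \<phi> 0 = 0 \<and> \<phi> 1 = 0 \<and> (\<exists>x\<in>{0<..<1}. \<phi> x \<noteq> 0)}"
    by (rule bdd_belowI[of _ 0]) (auto simp: Lp_norm_def)
qed (use assms in blast)

lemma pi2_nonneg_if:
  assumes "W12 \<phi> \<phi>'" and "continuous_on {0..1} \<phi>" and "\<phi> 0 = 0" and "\<phi> 1 = 0" and "x \<in> {0<..<1}" and "\<phi> x \<noteq> 0"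
  shows "pi2 q \<ge> 0"
  unfolding pi2_def
proof (rule cInf_greatest)
  show "{Lp_norm 2 {0<..<1} \<phi>' / Lp_norm q {0<..<1} \<phi> | \<phi> \<phi>'. W12 \<phi> \<phi>' \<and> continuous_on {0..1} \<phi> \<and> \<phi> 0 = 0 \<and> \<phi> 1 = 0 \<and> (\<exists>x\<in>{0<..<1}. \<phi> x \<noteq> 0)} \<noteq> {}"
    using assms by blast
qed (auto simp: Lp_norm_def)

text \<open>Differentiate \<open>f'\<^sup>2 = 1 - f\<^sup>q\<close> and cancel
  \<open>f' > 0\<close>.\<close>

lemma profile_second_derivative:
  fixes f :: "real \<Rightarrow> real"
  assumes q: "1 \<le> q" and ft: "0 < f t \<and> f t < 1 \<and> (f has_real_derivative sqrt (1 - f t powr q)) (at t)"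
  shows "((\<lambda>t. sqrt (1 - f t powr q)) has_real_derivative - (q / 2) * f t powr (q - 1)) (at t)"
proof -
  define g where "g = (\<lambda>t. sqrt (1 - f t powr q))"
  have lt1: "f t powr q < 1" using powr_less_mono2[of q "f t" 1] ft q by simp
  have "((\<lambda>t. f t powr q) has_real_derivative q * f t powr (q - 1) * g t) (at t)"
    by (rule DERIV_chain2[of "\<lambda>z. z powr q"]) (use ft in \<open>auto intro: has_real_derivative_powr simp: g_def\<close>)
  from DERIV_chain2[OF DERIV_real_sqrt DERIV_diff[OF DERIV_const[of 1] this]]
  have "(g has_real_derivative inverse (sqrt (1 - f t powr q)) / 2 * (0 - q * f t powr (q - 1) * g t)) (at t)"
    using lt1 by (simp add: g_def[abs_def])
  moreover have "inverse (sqrt (1 - f t powr q)) / 2 * (0 - q * f t powr (q - 1) * g t) = - (q / 2) * f t powr (q - 1)"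
  proof -
    have "g t > 0" using lt1 by (simp add: g_def)
    then have "inverse (g t) / 2 * (0 - q * f t powr (q - 1) * g t) = - (q / 2) * f t powr (q - 1)" by simp
    then show ?thesis by (simp only: g_def)
  qed
  ultimately show ?thesis by (simp only: g_def[abs_def])
qed

text \<open>Lower bounds that do not degenerate as the end height tends to \<open>1\<close>.\<close>

lemma profile_growth:
  fixes f :: "real \<Rightarrow> real"
  assumes q: "1 \<le> q" "q \<le> 2" and T: "0 < T" "T < T2" and fT: "1 / 2 \<le> f T"
    and cont: "continuous_on UNIV f" and f0: "f 0 = 0" and mono: "mono f"
    and f: "\<And>t. 0 < t \<Longrightarrow> t < T2 \<Longrightarrow> 0 < f t \<and> f t < 1 \<and> (f has_real_derivative sqrt (1 - f t powr q)) (at t)"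
  shows "1 / 2 \<le> T" and "T \<le> 2"
    and "\<And>s. 0 < s \<Longrightarrow> s < T \<Longrightarrow> q * f s powr (q - 1) * sqrt (1 - f s powr q) \<ge> s\<^sup>2 * (T - s) / 32"
proof -
  define g where "g = (\<lambda>t. sqrt (1 - f t powr q))"
  have contA: "continuous_on A f" for A using continuous_on_subset[OF cont] by auto
  have f': "(f has_real_derivative g t) (at t)" if "0 < t" "t < T2" for t using f[OF that] by (simp add: g_def)
  have g1: "g t \<le> 1" for t by (simp add: g_def)
  have mvtf: "\<exists>z>a. z < b \<and> f b - f a = (b - a) * g z" if ab: "0 \<le> a" "a < b" "b < T2" for a b
  proof -
    have "f differentiable (at z)" if "a < z" "z < b" for z
      using f'[of z] that ab by (auto simp: real_differentiable_def)
    then obtain l z where z: "a < z" "z < b" "(f has_real_derivative l) (at z)" "f b - f a = (b - a) * l"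
      using MVT[OF ab(2) contA] by blast
    then have "l = g z" using DERIV_unique[OF z(3) f'[of z]] ab by simp
    then show ?thesis using z by blast
  qed
  have Tdiff: "f T \<le> T"
  proof -
    obtain z where "f T - f 0 = (T - 0) * g z" using mvtf[of 0 T] T by auto
    then show ?thesis using f0 mult_left_mono[OF g1[of z], of T] T by simp
  qed
  then show T12: "1 / 2 \<le> T" using fT by linarith
  have ganti: "g t \<le> g s" if "s \<le> t" "0 \<le> f s" for s t
    unfolding g_def using powr_mono2[of q "f s" "f t"] monoD[OF mono that(1)] that q by simp
  show T2: "T \<le> 2"
  proof -
    \<comment> \<open>The derivative \<open>f' / sqrt (1 - f)\<close> of \<open>k\<close> is at
      least 1, as \<open>f\<^sup>q \<le> f\<close>. Since \<open>k\<close> rises from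
      \<open>-2\<close> to at most 0, \<open>T\<close> is at most 2.\<close>
    define k where "k = (\<lambda>t. - 2 * sqrt (1 - f t))"
    have "k 0 + (T - 0) \<le> k T"
    proof -
      have ck: "continuous_on {0..T} k" unfolding k_def by (intro continuous_intros contA)
      have k': "(k has_real_derivative g t / sqrt (1 - f t)) (at t)" if "0 < t" "t < T" for t
      proof -
        have ft: "0 < f t" "f t < 1" using f[of t] that T by auto
        have "((\<lambda>t. sqrt (1 - f t)) has_real_derivative inverse (sqrt (1 - f t)) / 2 * (0 - g t)) (at t)"
          by (rule DERIV_chain2[OF DERIV_real_sqrt DERIV_diff[OF DERIV_const f']]) (use ft that T in auto)
        from DERIV_cmult[OF this, of "- 2"] show ?thesis by (simp add: k_def[abs_def] field_simps)
      qed
      obtain l z where z: "0 < z" "z < T" "(k has_real_derivative l) (at z)" "k T - k 0 = (T - 0) * l"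
        using MVT[OF T(1) ck] k' real_differentiable_def by blast
      have l: "l = g z / sqrt (1 - f z)" using DERIV_unique[OF z(3) k'[OF z(1,2)]] .
      have fz: "0 < f z" "f z < 1" using f[of z] z T by auto
      have "f z powr q \<le> f z powr 1" using fz q by (intro powr_mono') auto
      then have "sqrt (1 - f z) \<le> g z" unfolding g_def using fz by simp
      then have "1 \<le> l" unfolding l using fz by (simp add: le_divide_eq)
      then have "T * 1 \<le> T * l" using T by (intro mult_left_mono) auto
      then show ?thesis using z(4) by simp
    qed
    moreover have "k T \<le> 0" using f[of T] T by (simp add: k_def)
    moreover have "k 0 = - 2" by (simp add: k_def f0)
    ultimately show ?thesis by simp
  qed
  fix s assume s: "0 < s" "s < T"
  have fs: "0 < f s" "f s < 1" using f[of s] s T by auto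
  \<comment> \<open>\<open>f\<close> is concave, since its slope \<open>g\<close> decreases; hence
    it lies above its chord, \<open>f s \<ge> s * f T / T\<close>, where
    \<open>f T \<ge> 1 / 2\<close> and \<open>T \<le> 2\<close>.\<close>
  have low: "s / 4 \<le> f s"
  proof -
    obtain z1 where z1: "z1 < s" "0 < z1" "f s - f 0 = (s - 0) * g z1" using mvtf[of 0 s] s T by auto
    obtain z2 where z2: "s < z2" "z2 < T" "f T - f s = (T - s) * g z2" using mvtf[of s T] s T by auto
    have "g z2 \<le> g z1" by (rule ganti) (use z1 z2 f[of z1] s T in auto)
    then have "s * (T - s) * g z2 \<le> s * (T - s) * g z1" using s by (intro mult_left_mono) auto
    moreover have "s * (f T - f s) = s * (T - s) * g z2" unfolding z2(3) by (simp only: mult.assoc)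
    moreover have "(T - s) * f s = s * (T - s) * g z1"
    proof -
      have "f s = s * g z1" using z1(3) f0 by simp
      then show ?thesis by (simp only: mult_ac)
    qed
    ultimately have "s * (f T - f s) \<le> (T - s) * f s" by (simp only:)
    then have "s * f T \<le> T * f s" by (simp add: algebra_simps)
    moreover have "s * (1 / 2) \<le> s * f T" using s fT by (intro mult_left_mono) auto
    moreover have "T * f s \<le> 2 * f s" using T2 fs by (intro mult_right_mono) auto
    ultimately show ?thesis by simp
  qed
  \<comment> \<open>This is where \<open>q \<le> 2\<close> enters: the exponent \<open>q - 1\<close>
    is at most 1.\<close>
  have pow: "x \<le> x powr (q - 1)" if "0 < x" "x < 1" for x :: real
    using powr_mono'[of "q - 1" 1 x] that q by simp
  \<comment> \<open>\<open>- g'\<close> equals \<open>(q / 2) f\<^sup>q\<^sup>-\<^sup>1\<close>,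
    which is at least \<open>f s / 2\<close> between \<open>s\<close> and \<open>T\<close>, and
    \<open>g T\<close> is nonnegative.\<close>
  have gs: "g s \<ge> (T - s) * (f s / 2)"
  proof -
    have g': "(g has_real_derivative - (q / 2) * f t powr (q - 1)) (at t)" if "s \<le> t" "t \<le> T" for t
      unfolding g_def by (rule profile_second_derivative[OF q(1)]) (use f[of t] that s T in auto)
    obtain z where z: "s < z" "z < T" "g T - g s = (T - s) * (- (q / 2) * f z powr (q - 1))"
      using MVT2[OF s(2) g'] by blast
    have fz: "0 < f z" "f z < 1" using f[of z] z s T by auto
    have "f s \<le> f z" using monoD[OF mono, of s z] z by simp
    also have "\<dots> \<le> f z powr (q - 1)" by (rule pow[OF fz])
    finally have "1 / 2 * f s \<le> q / 2 * f z powr (q - 1)" using q fs by (intro mult_mono) auto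
    then have a: "(T - s) * (f s / 2) \<le> (T - s) * (q / 2 * f z powr (q - 1))" using s by (intro mult_left_mono) auto
    have gT: "g T \<ge> 0" using f[of T] T powr_le1[of q "f T"] q by (simp add: g_def)
    have b: "g s = g T + (T - s) * (q / 2 * f z powr (q - 1))" using z(3) by (simp add: algebra_simps)
    show ?thesis unfolding b using a gT by linarith
  qed
  have "s\<^sup>2 * (T - s) / 32 = (s / 4) * ((T - s) * ((s / 4) / 2))" by (simp add: power2_eq_square)
  also have "\<dots> \<le> f s * ((T - s) * (f s / 2))" using low s fs by (intro mult_mono) auto
  also have "\<dots> \<le> (q * f s powr (q - 1)) * g s"
  proof (rule mult_mono[OF _ gs])
    show "f s \<le> q * f s powr (q - 1)" using pow[OF fs] q mult_right_mono[of 1 q "f s powr (q - 1)"] by simp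
  qed (use s fs q in auto)
  finally show "q * f s powr (q - 1) * sqrt (1 - f s powr q) \<ge> s\<^sup>2 * (T - s) / 32" by (simp add: g_def)
qed

text \<open>The competitor is the profile run up to the middle of the interval and reflected.\<close>

lemma pi2_le_profile:
  fixes f :: "real \<Rightarrow> real"
  assumes q: "1 \<le> q" and T: "0 < T" "T < T2" and fT: "f T = u" and u: "0 < u" "u < 1"
    and cont: "continuous_on UNIV f" and f0: "\<And>t. t \<le> 0 \<Longrightarrow> f t = 0"
    and f: "\<And>t. 0 < t \<Longrightarrow> t < T2 \<Longrightarrow> 0 < f t \<and> f t < 1 \<and> (f has_real_derivative sqrt (1 - f t powr q)) (at t)"
  defines "J \<equiv> integral {0..T} (\<lambda>t. f t powr q)"
  shows "(pi2 q)\<^sup>2 \<le> 4 * T * (u * sqrt (1 - u powr q) + q / 2 * J) / (J / T) powr (2 / q)" and "J \<ge> u powr (q + 1) / (q + 1)"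
    and "J > 0" and "pi2 q \<ge> 0"
proof -
  have f_nn: "0 \<le> f t" "f t \<le> 1" if "t \<le> T" for t
    using f[of t] f0[of t] that T by (cases "t \<le> 0"; force)+
  define g where "g = (\<lambda>t. sqrt (1 - f t powr q))"
  have contf: "continuous_on A f" for A using continuous_on_subset[OF cont] by auto
  have contfq: "continuous_on {..T} (\<lambda>t. f t powr q)"
    using q f_nn by (intro continuous_on_powr' contf continuous_on_const) auto
  have contg: "continuous_on {..T} g"
    unfolding g_def by (intro continuous_intros contfq)
  have fq1: "0 \<le> f t powr q" "f t powr q \<le> 1" if "t \<le> T" for t
    using f_nn[OF that] q powr_mono2[of q "f t" 1] by auto
  have intfq: "(\<lambda>t. f t powr q) integrable_on {0..T}"
    by (intro integrable_continuous_real continuous_on_subset[OF contfq]) auto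
  have Dg: "(g has_real_derivative - (q / 2) * f t powr (q - 1)) (at t)" if t: "0 < t" "t < T2" for t
    unfolding g_def by (rule profile_second_derivative[where f = f, OF q f[OF t]])
  \<comment> \<open>\<open>f\<^sup>q f'\<close> is at most \<open>f\<^sup>q\<close> because
    \<open>f' \<le> 1\<close>, and it is the derivative of
    \<open>f\<^sup>q\<^sup>+\<^sup>1 / (q + 1)\<close>.\<close>
  show Jlow: "J \<ge> u powr (q + 1) / (q + 1)"
  proof -
    have "((\<lambda>t. f t powr q * g t) has_integral (f T powr (q + 1) / (q + 1) - f 0 powr (q + 1) / (q + 1))) {0..T}"
    proof (rule fundamental_theorem_of_calculus_interior)
      show "continuous_on {0..T} (\<lambda>t. f t powr (q + 1) / (q + 1))"
        using q f_nn by (intro continuous_intros continuous_on_powr' contf) auto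
      fix t assume "t \<in> {0<..<T}"
      then have t: "0 < t" "t < T2" using T by auto
      have "((\<lambda>t. f t powr (q + 1)) has_real_derivative (q + 1) * f t powr (q + 1 - 1) * g t) (at t)"
        by (rule DERIV_chain2[of "\<lambda>z. z powr (q + 1)"])
           (use f[OF t] has_real_derivative_powr[of "f t" "q + 1"] in \<open>auto simp: g_def\<close>)
      from DERIV_cdivide[OF this, of "q + 1"]
      show "((\<lambda>t. f t powr (q + 1) / (q + 1)) has_vector_derivative f t powr q * g t) (at t)"
        using q by (simp add: has_real_derivative_iff_has_vector_derivative[symmetric])
    qed (use T in simp)
    then have hi: "((\<lambda>t. f t powr q * g t) has_integral u powr (q + 1) / (q + 1)) {0..T}"
      using fT f0[of 0] q by simp
    show ?thesis unfolding J_def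
    proof (rule has_integral_le[OF hi integrable_integral[OF intfq]])
      fix t assume "t \<in> {0..T}"
      then have "g t \<le> 1" using fq1[of t] by (simp add: g_def)
      then show "f t powr q * g t \<le> f t powr q" using mult_left_mono[of "g t" 1 "f t powr q"] by simp
    qed
  qed
  moreover have "u powr (q + 1) / (q + 1) > 0" using u q by simp
  ultimately show Jpos: "J > 0" by linarith
  \<comment> \<open>From \<open>(f f')' = f'\<^sup>2 + f f'' = f'\<^sup>2 - (q / 2)
    f\<^sup>q\<close>. The boundary term \<open>u * g T\<close> would vanish for the full
    extremal.\<close>
  have Jg: "integral {0..T} (\<lambda>t. (g t)\<^sup>2) = u * g T + q / 2 * J"
  proof -
    have "((\<lambda>t. (g t)\<^sup>2 - q / 2 * f t powr q) has_integral (f T * g T - f 0 * g 0)) {0..T}"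
    proof (rule fundamental_theorem_of_calculus_interior)
      show "continuous_on {0..T} (\<lambda>t. f t * g t)"
        by (intro continuous_intros contf continuous_on_subset[OF contg]) auto
      fix t assume "t \<in> {0<..<T}"
      then have t: "0 < t" "t < T2" using T by auto
      have fd: "(f has_real_derivative g t) (at t)" using f[OF t] by (simp add: g_def)
      have "((\<lambda>t. f t * g t) has_real_derivative (g t * g t + - (q / 2) * f t powr (q - 1) * f t)) (at t)"
        by (rule DERIV_mult[OF fd Dg[OF t]])
      moreover have "f t powr (q - 1) * f t = f t powr q"
        using f[OF t] powr_add[of "f t" "q - 1" 1] by simp
      ultimately show "((\<lambda>t. f t * g t) has_vector_derivative (g t)\<^sup>2 - q / 2 * f t powr q) (at t)"
        by (simp add: has_real_derivative_iff_has_vector_derivative[symmetric] power2_eq_square mult.assoc)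
    qed (use T in simp)
    then have "integral {0..T} (\<lambda>t. (g t)\<^sup>2 - q / 2 * f t powr q) = u * g T"
      using fT f0[of 0] by (simp add: integral_unique)
    moreover have "(\<lambda>t. (g t)\<^sup>2) integrable_on {0..T}"
      by (intro integrable_continuous_real continuous_intros continuous_on_subset[OF contg]) auto
    ultimately show ?thesis
      using intfq by (simp add: Henstock_Kurzweil_Integration.integral_diff J_def integrable_on_mult_right)
  qed
  define \<phi> where "\<phi> = (\<lambda>x. f (2 * T * min x (1 - x)))"
  define \<sigma> :: "real \<Rightarrow> real" where "\<sigma> = (\<lambda>x. if x \<le> 1 / 2 then 1 else - 1)"
  define \<phi>' where "\<phi>' = (\<lambda>x. 2 * T * \<sigma> x * g (2 * T * min x (1 - x)))"
  have minT: "2 * T * min x (1 - x) \<le> T" for x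
  proof -
    have "min x (1 - x) \<le> 1 / 2" by linarith
    then show ?thesis using T mult_left_mono[of "min x (1 - x)" "1 / 2" "2 * T"] by simp
  qed
  have min0: "2 * T * min x (1 - x) > 0" if "x \<in> {0<..<1}" for x
    using that T by (intro mult_pos_pos) auto
  have conttent: "continuous_on A (\<lambda>x. 2 * T * min x (1 - x))" for A
    by (intro continuous_intros)
  have cont\<phi>: "continuous_on A \<phi>" for A
    unfolding \<phi>_def by (rule continuous_on_compose2[OF cont conttent]) auto
  have m\<phi>[measurable]: "\<phi> \<in> borel_measurable borel" by (rule borel_measurable_continuous_onI[OF cont\<phi>])
  have "continuous_on UNIV (\<lambda>x. g (2 * T * min x (1 - x)))"
    by (rule continuous_on_compose2[OF contg conttent]) (use minT in auto)
  then have mg[measurable]: "(\<lambda>x. g (2 * T * min x (1 - x))) \<in> borel_measurable borel" by (rule borel_measurable_continuous_onI)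
  have m\<phi>'[measurable]: "\<phi>' \<in> borel_measurable borel" unfolding \<phi>'_def \<sigma>_def by measurable
  have g1: "0 \<le> g t" "g t \<le> 1" if "t \<le> T" for t using fq1[OF that] by (auto simp: g_def)
  have \<phi>1: "0 \<le> \<phi> x" "\<phi> x \<le> 1" for x unfolding \<phi>_def using f_nn[OF minT] by auto
  have \<phi>'1: "\<bar>\<phi>' x\<bar> \<le> 2 * T" for x
    unfolding \<phi>'_def \<sigma>_def using g1[OF minT[of x]] T by (auto simp: abs_mult mult_le_cancel_left1)
  have \<phi>'sq: "(\<phi>' x)\<^sup>2 = 4 * T\<^sup>2 * (g (2 * T * min x (1 - x)))\<^sup>2" for x
    by (simp add: \<phi>'_def \<sigma>_def power_mult_distrib)
  have L\<phi>: "in_Lp 2 {0<..<1} \<phi>"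
    unfolding in_Lp_def
  proof
    show "set_borel_measurable lebesgue {0<..<1} \<phi>"
      unfolding set_borel_measurable_def by (intro measurable_completion) measurable
    show "set_integrable lebesgue {0<..<1} (\<lambda>x. \<bar>\<phi> x\<bar> powr 2)"
      by (rule set_integrable_bounded_unit[of _ 1]) (use \<phi>1 in \<open>auto simp: power_le_one\<close>)
  qed
  have L\<phi>': "in_Lp 2 {0<..<1} \<phi>'"
    unfolding in_Lp_def
  proof
    show "set_borel_measurable lebesgue {0<..<1} \<phi>'"
      unfolding set_borel_measurable_def by (intro measurable_completion) measurable
    show "set_integrable lebesgue {0<..<1} (\<lambda>x. \<bar>\<phi>' x\<bar> powr 2)"
    proof (rule set_integrable_bounded_unit[of _ "(2 * T)\<^sup>2"])
      show "\<bar>\<bar>\<phi>' x\<bar> powr 2\<bar> \<le> (2 * T)\<^sup>2" for x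
        using power_mono[OF \<phi>'1[of x], of 2] by simp
    qed measurable
  qed
  have der\<phi>: "(\<phi> has_real_derivative \<phi>' x) (at x)" if x: "x \<in> {0<..<1}" "x \<noteq> 1 / 2" for x
  proof (cases "x < 1 / 2")
    case True
    have t: "0 < 2 * T * x" "2 * T * x < T2"
    proof -
      show "0 < 2 * T * x" using x T by simp
      have "2 * T * x < 2 * T * (1 / 2)" using T True by (intro mult_strict_left_mono) auto
      then show "2 * T * x < T2" using T(2) by linarith
    qed
    have "((\<lambda>x. f (2 * T * x)) has_real_derivative g (2 * T * x) * (2 * T)) (at x)"
      by (rule DERIV_chain2[of f]) (use f[OF t] in \<open>auto simp: g_def intro!: derivative_eq_intros\<close>)
    then have "(\<phi> has_real_derivative g (2 * T * x) * (2 * T)) (at x)"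
      by (rule has_field_derivative_transform_within_open[of _ _ _ "{..<1/2}"]) (use True in \<open>auto simp: \<phi>_def min_def\<close>)
    then show ?thesis using True by (simp add: \<phi>'_def \<sigma>_def min_def mult_ac)
  next
    case False
    have t: "0 < 2 * T * (1 - x)" "2 * T * (1 - x) < T2"
    proof -
      show "0 < 2 * T * (1 - x)" using x T by simp
      have "2 * T * (1 - x) < 2 * T * (1 / 2)" using T x False by (intro mult_strict_left_mono) auto
      then show "2 * T * (1 - x) < T2" using T(2) by linarith
    qed
    have "((\<lambda>x. f (2 * T * (1 - x))) has_real_derivative g (2 * T * (1 - x)) * (- (2 * T))) (at x)"
      by (rule DERIV_chain2[of f]) (use f[OF t] in \<open>auto simp: g_def intro!: derivative_eq_intros\<close>)
    then have "(\<phi> has_real_derivative g (2 * T * (1 - x)) * (- (2 * T))) (at x)"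
      by (rule has_field_derivative_transform_within_open[of _ _ _ "{1/2<..}"]) (use False x in \<open>auto simp: \<phi>_def min_def\<close>)
    then show ?thesis using False x by (simp add: \<phi>'_def \<sigma>_def min_def mult_ac)
  qed
  have \<phi>0: "\<phi> 0 = 0" "\<phi> 1 = 0" using f0[of 0] by (auto simp: \<phi>_def)
  \<comment> \<open>The competitor has a kink at \<open>1 / 2\<close>, so integration by parts is
    carried out on the two halves, and the boundary terms at the kink cancel.\<close>
  have weak: "(LINT x:{0<..<1}|lebesgue. \<phi> x * deriv \<psi> x) = - (LINT x:{0<..<1}|lebesgue. \<phi>' x * \<psi> x)"
    if \<psi>: "\<psi> \<in> test_functions {0<..<1}" for \<psi>
  proof -
    note t\<psi> = test_function_unit_derivative[OF \<psi>]
    have [measurable]: "\<psi> \<in> borel_measurable borel" "deriv \<psi> \<in> borel_measurable borel"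
      using t\<psi>(2,3)[of UNIV] by (auto intro: borel_measurable_continuous_onI)
    have bdd: "\<exists>C. \<forall>x\<in>{0..1}. \<bar>h x\<bar> \<le> C" if h: "continuous_on {0..1::real} h" for h :: "real \<Rightarrow> real"
    proof -
      have "bounded (h ` {0..1})" by (rule compact_imp_bounded[OF compact_continuous_image[OF h compact_Icc]])
      then obtain C where "\<forall>y\<in>h ` {0..1}. norm y \<le> C" unfolding bounded_iff ..
      then show ?thesis by (intro exI[of _ C]) simp
    qed
    obtain C0 where C0: "\<forall>x\<in>{0..1}. \<bar>\<psi> x\<bar> \<le> C0" using bdd[OF t\<psi>(2)] ..
    obtain C1 where C1: "\<forall>x\<in>{0..1}. \<bar>deriv \<psi> x\<bar> \<le> C1" using bdd[OF t\<psi>(3)] ..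
    have C: "\<bar>\<psi> x\<bar> \<le> C0" "\<bar>deriv \<psi> x\<bar> \<le> C1" if "x \<in> {0..1}" for x using C0 C1 that by auto
    have i1: "set_integrable lebesgue {0<..<1} (\<lambda>x. \<phi> x * deriv \<psi> x)"
    proof (rule set_integrable_bounded_unit[of _ "1 * C1"])
      show "\<bar>\<phi> x * deriv \<psi> x\<bar> \<le> 1 * C1" if "x \<in> {0<..<1}" for x
        unfolding abs_mult using \<phi>1[of x] C(2)[of x] that by (intro mult_mono) auto
    qed measurable
    have i2: "set_integrable lebesgue {0<..<1} (\<lambda>x. \<phi>' x * \<psi> x)"
    proof (rule set_integrable_bounded_unit[of _ "2 * T * C0"])
      show "\<bar>\<phi>' x * \<psi> x\<bar> \<le> 2 * T * C0" if "x \<in> {0<..<1}" for x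
        unfolding abs_mult using \<phi>'1[of x] C(1)[of x] that T by (intro mult_mono) auto
    qed measurable
    have cont: "continuous_on A (\<lambda>x. \<phi> x * \<psi> x)" for A by (intro continuous_intros cont\<phi> t\<psi>)
    have d: "((\<lambda>x. \<phi> x * \<psi> x) has_vector_derivative \<phi> x * deriv \<psi> x + \<phi>' x * \<psi> x) (at x)"
      if "x \<in> {0<..<1}" "x \<noteq> 1 / 2" for x
      using DERIV_mult[OF der\<phi>[OF that] t\<psi>(1)[of x]]
      by (simp add: has_real_derivative_iff_has_vector_derivative[symmetric] algebra_simps)
    have 1: "((\<lambda>x. \<phi> x * deriv \<psi> x + \<phi>' x * \<psi> x) has_integral (\<phi> (1/2) * \<psi> (1/2) - \<phi> 0 * \<psi> 0)) {0..1/2}"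
      by (rule fundamental_theorem_of_calculus_interior[OF _ cont]) (use d in auto)
    have 2: "((\<lambda>x. \<phi> x * deriv \<psi> x + \<phi>' x * \<psi> x) has_integral (\<phi> 1 * \<psi> 1 - \<phi> (1/2) * \<psi> (1/2))) {1/2..1}"
      by (rule fundamental_theorem_of_calculus_interior[OF _ cont]) (use d in auto)
    have "((\<lambda>x. \<phi> x * deriv \<psi> x + \<phi>' x * \<psi> x) has_integral 0) {0..1}"
      using has_integral_combine[OF _ _ 1 2] \<phi>0 by simp
    then have "(LINT x:{0<..<1}|lebesgue. \<phi> x * deriv \<psi> x + \<phi>' x * \<psi> x) = 0"
      by (rule set_integral_unit_eq[OF set_integral_add(1)[OF i1 i2]])
    then show ?thesis using set_integral_add(2)[OF i1 i2] by simp
  qed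
  have W: "W12 \<phi> \<phi>'" unfolding W12_def using L\<phi> L\<phi>' weak by blast
  have mid: "1 / 2 \<in> {0<..<1::real}" "\<phi> (1 / 2) \<noteq> 0" using f[of T] T by (auto simp: \<phi>_def min_def)
  show nonneg: "pi2 q \<ge> 0" by (rule pi2_nonneg_if[OF W cont\<phi> \<phi>0 mid])
  have "pi2 q \<le> Lp_norm 2 {0<..<1} \<phi>' / Lp_norm q {0<..<1} \<phi>"
    by (rule pi2_le[OF W cont\<phi> \<phi>0 mid])
  then have "(pi2 q)\<^sup>2 \<le> (Lp_norm 2 {0<..<1} \<phi>' / Lp_norm q {0<..<1} \<phi>)\<^sup>2"
    using nonneg by (intro power_mono) auto
  also have "\<dots> = (Lp_norm 2 {0<..<1} \<phi>')\<^sup>2 / (Lp_norm q {0<..<1} \<phi>)\<^sup>2" by (rule power_divide)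
  also have "(Lp_norm 2 {0<..<1} \<phi>')\<^sup>2 = 4 * T * (u * g T + q / 2 * J)"
  proof -
    have "((\<lambda>x. (g (2 * T * min x (1 - x)))\<^sup>2) has_integral (1 / T) * integral {0..T} (\<lambda>t. (g t)\<^sup>2)) {0..1}"
      by (rule has_integral_tent[OF _ T(1)]) (intro continuous_intros continuous_on_subset[OF contg]; auto)
    from has_integral_mult_right[OF this, of "4 * T\<^sup>2"]
    have hi: "((\<lambda>x. 4 * T\<^sup>2 * (g (2 * T * min x (1 - x)))\<^sup>2) has_integral 4 * T\<^sup>2 * ((1 / T) * integral {0..T} (\<lambda>t. (g t)\<^sup>2))) {0..1}" .
    have eqv: "4 * T\<^sup>2 * ((1 / T) * integral {0..T} (\<lambda>t. (g t)\<^sup>2)) = 4 * T * (u * g T + q / 2 * J)"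
      unfolding Jg using T by (simp add: power2_eq_square)
    have eqf: "(\<lambda>x. \<bar>\<phi>' x\<bar> powr 2) = (\<lambda>x. 4 * T\<^sup>2 * (g (2 * T * min x (1 - x)))\<^sup>2)"
      by (simp add: \<phi>'sq)
    have "((\<lambda>x. \<bar>\<phi>' x\<bar> powr 2) has_integral 4 * T * (u * g T + q / 2 * J)) {0..1}"
      using hi unfolding eqf eqv .
    then have "(LINT x:{0<..<1}|lebesgue. \<bar>\<phi>' x\<bar> powr 2) = 4 * T * (u * g T + q / 2 * J)"
      using L\<phi>' by (intro set_integral_unit_eq) (auto simp: in_Lp_def)
    moreover have "4 * T * (u * g T + q / 2 * J) \<ge> 0"
      using T u g1[of T] Jpos q by (intro mult_nonneg_nonneg add_nonneg_nonneg) auto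
    ultimately show ?thesis
      by (simp add: Lp_norm_def powr_half_sqrt)
  qed
  also have "(Lp_norm q {0<..<1} \<phi>)\<^sup>2 = (J / T) powr (2 / q)"
  proof -
    have "((\<lambda>x. f (2 * T * min x (1 - x)) powr q) has_integral (1 / T) * J) {0..1}"
      unfolding J_def by (rule has_integral_tent[OF continuous_on_subset[OF contfq] T(1)]) auto
    then have hi: "((\<lambda>x. \<bar>\<phi> x\<bar> powr q) has_integral J / T) {0..1}"
      using \<phi>1 by (simp add: \<phi>_def)
    have "(LINT x:{0<..<1}|lebesgue. \<bar>\<phi> x\<bar> powr q) = J / T"
    proof (rule set_integral_unit_eq[OF set_integrable_bounded_unit[of _ 1] hi])
      show "\<bar>\<bar>\<phi> x\<bar> powr q\<bar> \<le> 1" for x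
        using \<phi>1[of x] q powr_mono2[of q "\<phi> x" 1] by simp
    qed measurable
    then show ?thesis
      using Jpos T by (simp add: Lp_norm_def powr_power)
  qed
  finally show "(pi2 q)\<^sup>2 \<le> 4 * T * (u * sqrt (1 - u powr q) + q / 2 * J) / (J / T) powr (2 / q)"
    using fT by (simp add: g_def)
qed

text \<open>As the final height \<open>u\<close> tends to 1, the boundary term \<open>u * s\<close>
  in the energy of the competitor tends to 0 while \<open>J\<close> stays at least
  \<open>1 / 24\<close>, so it is absorbed by the factor \<open>1 + \<theta>\<close>. Without it the
  squared quotient is \<open>4 T\<^sup>2 (q / 2)
  A\<^sup>1\<^sup>-\<^sup>2\<^sup>/\<^sup>q\<close>.\<close>

lemma near_extremal_profile:
  fixes q \<theta> :: real
  assumes q: "1 \<le> q" "q \<le> 2" and \<theta>: "\<theta> > 0"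
  obtains f T T2 A where "0 < T" "T < T2" "continuous_on UNIV f" "\<And>t. t \<le> 0 \<Longrightarrow> f t = 0" "mono f"
    "\<And>t. 0 < t \<Longrightarrow> t < T2 \<Longrightarrow> 0 < f t \<and> f t < 1 \<and> (f has_real_derivative sqrt (1 - f t powr q)) (at t)"
    "A = (1 / T) * integral {0..T} (\<lambda>t. f t powr q)" "A > 0"
    "(pi2 q)\<^sup>2 \<le> (1 + \<theta>) * (4 * T\<^sup>2 * (q / 2) * A powr (1 - 2 / q))" "pi2 q \<ge> 0" "1 / 2 \<le> f T"
proof -
  \<comment> \<open>\<open>\<kappa>\<close> will dominate the final slope:
    \<open>sqrt (1 - u powr q) \<le> sqrt (1 - u\<^sup>2) = \<kappa>\<close>. The 48 is
    \<open>2 * 24\<close>, from \<open>q / 2 \<ge> 1 / 2\<close> and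
    \<open>J \<ge> 1 / 24\<close>.\<close>
  define \<kappa> where "\<kappa> = min (1 / 2) (\<theta> / 48)"
  have \<kappa>: "0 < \<kappa>" "\<kappa> \<le> 1 / 2" "48 * \<kappa> \<le> \<theta>" using \<theta> by (auto simp: \<kappa>_def)
  have \<kappa>2: "\<kappa>\<^sup>2 \<le> 1 / 4" "0 < \<kappa>\<^sup>2" using power_mono[OF \<kappa>(2), of 2] \<kappa> by (auto simp: power2_eq_square)
  define u where "u = sqrt (1 - \<kappa>\<^sup>2)"
  have usq: "u\<^sup>2 = 1 - \<kappa>\<^sup>2" using \<kappa>2 by (simp add: u_def)
  have u12: "1 / 2 \<le> u" unfolding u_def using \<kappa>2 by (intro real_le_rsqrt) (simp add: power2_eq_square)
  have u1: "u < 1" using \<kappa>2 by (simp add: u_def)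
  have u0: "0 < u" using u12 by linarith
  obtain f T T2 where fT: "0 < T" "T < T2" "f T = u" "continuous_on UNIV f" "\<And>t. t \<le> 0 \<Longrightarrow> f t = 0" "mono f"
    "\<And>t. 0 < t \<Longrightarrow> t < T2 \<Longrightarrow> 0 < f t \<and> f t < 1 \<and> (f has_real_derivative sqrt (1 - f t powr q)) (at t)"
    using profile_ode_solution[OF q(1) u0 u1] by metis
  define J where "J = integral {0..T} (\<lambda>t. f t powr q)"
  define A where "A = (1 / T) * J"
  define s where "s = sqrt (1 - u powr q)"
  note * = pi2_le_profile[OF q(1) fT(1,2,3) u0 u1 fT(4,5,7), folded J_def s_def]
  have "u powr 2 \<le> u powr q" by (rule powr_mono') (use u0 u1 q in auto)
  then have "s \<le> sqrt (1 - u\<^sup>2)" unfolding s_def using u0 by (simp add: powr_numeral)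
  also have "\<dots> = \<kappa>" using \<kappa> by (simp add: usq)
  finally have s: "s \<le> \<kappa>" .
  have "(1 / 2) ^ 3 \<le> u ^ 3" using u12 by (intro power_mono) auto
  also have "u ^ 3 = u powr 3" using u0 by (simp add: powr_numeral)
  also have "\<dots> \<le> u powr (q + 1)" by (rule powr_mono') (use u0 u1 q in auto)
  finally have "1 / 8 \<le> u powr (q + 1)" by (simp add: power3_eq_cube)
  then have "(1 / 8) / 3 \<le> u powr (q + 1) / (q + 1)" using q by (intro frac_le) auto
  from order_trans[OF this *(2)] have J: "1 / 24 \<le> J" by simp
  have Apos: "A > 0" using *(3) fT by (simp add: A_def)
  have "u * s \<le> 1 * \<kappa>" using s u0 u1 \<kappa> s_def powr_le1[of q u] q by (intro mult_mono) auto
  also have "\<dots> \<le> \<theta> * (1 / 2) * (1 / 24)" using \<kappa> by simp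
  also have "\<dots> \<le> \<theta> * (q / 2) * J" using q \<theta> J by (intro mult_mono) auto
  finally have us: "u * s + q / 2 * J \<le> (1 + \<theta>) * (q / 2 * J)" by (simp add: algebra_simps)
  have "(pi2 q)\<^sup>2 \<le> 4 * T * (u * s + q / 2 * J) / (J / T) powr (2 / q)" by (rule *(1))
  also have "\<dots> \<le> 4 * T * ((1 + \<theta>) * (q / 2 * J)) / (J / T) powr (2 / q)"
    using us fT by (intro divide_right_mono mult_left_mono) auto
  also have "\<dots> = (1 + \<theta>) * (4 * T\<^sup>2 * (q / 2) * (A / A powr (2 / q)))"
    using fT by (simp add: A_def power2_eq_square)
  also have "A / A powr (2 / q) = A powr (1 - 2 / q)" using Apos by (simp add: powr_diff)
  finally have main: "(pi2 q)\<^sup>2 \<le> (1 + \<theta>) * (4 * T\<^sup>2 * (q / 2) * A powr (1 - 2 / q))" .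
  have half: "1 / 2 \<le> f T" using u12 fT(3) by simp
  show ?thesis
    by (rule that[OF fT(1,2,4,5,6,7) A_def[unfolded J_def] Apos main *(4) half])
qed

section \<open>The gap in the lower bound\<close>

text \<open>The mean value theorem gives both bounds on \<open>{0..R}\<close>, and clamping the
  argument extends the function by constants.\<close>

lemma clamped_lipschitz_profile:
  fixes h :: "real \<Rightarrow> real"
  assumes R: "R > 0" and cont: "continuous_on {0..R} h" and h0: "h 0 = 0" and \<Lambda>: "\<Lambda> > 0"
    and der: "\<And>t. 0 < t \<Longrightarrow> t < R \<Longrightarrow> (h has_real_derivative h' t) (at t)"
    and h': "\<And>t. 0 < t \<Longrightarrow> t < R \<Longrightarrow> 0 \<le> h' t" "\<And>t. 0 < t \<Longrightarrow> t < R \<Longrightarrow> h' t \<le> \<Lambda>"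
  shows "lipschitz_profile (\<lambda>t. h (max 0 (min t R))) \<Lambda>"
proof -
  have incr: "0 \<le> h b - h a \<and> h b - h a \<le> \<Lambda> * (b - a)" if ab: "0 \<le> a" "a \<le> b" "b \<le> R" for a b
  proof (cases "a = b")
    case False
    then have ab': "a < b" using ab by simp
    have "h differentiable (at z)" if "a < z" "z < b" for z
      using der[of z] that ab by (auto simp: real_differentiable_def)
    moreover have "continuous_on {a..b} h" by (rule continuous_on_subset[OF cont]) (use ab in auto)
    ultimately obtain l z where z: "a < z" "z < b" "(h has_real_derivative l) (at z)" "h b - h a = (b - a) * l"
      using MVT[OF ab'] by blast
    then have "l = h' z" using DERIV_unique[OF z(3) der[of z]] ab by simp
    then have l: "0 \<le> l" "l \<le> \<Lambda>" using h'[of z] z ab by auto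
    then have "0 \<le> (b - a) * l" "(b - a) * l \<le> (b - a) * \<Lambda>" using ab by (auto intro: mult_left_mono)
    then show ?thesis using z(4) by (simp add: mult.commute)
  qed simp
  show ?thesis
    unfolding lipschitz_profile_def
  proof (intro conjI allI impI monoI)
    fix s t :: real assume st: "s \<le> t"
    define a b where "a = max 0 (min s R)" and "b = max 0 (min t R)"
    have ab: "0 \<le> a" "a \<le> b" "b \<le> R" "b - a \<le> t - s" using st R by (auto simp: a_def b_def)
    show "h (max 0 (min s R)) \<le> h (max 0 (min t R))"
      using incr[OF ab(1-3)] by (simp add: a_def b_def)
    have "\<Lambda> * (b - a) \<le> \<Lambda> * (t - s)" using ab(4) \<Lambda> by (intro mult_left_mono) auto
    then show "h (max 0 (min t R)) - h (max 0 (min s R)) \<le> \<Lambda> * (t - s)"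
      using incr[OF ab(1-3)] by (simp add: a_def b_def)
  qed (use \<Lambda> h0 in \<open>auto simp: min_def max_def\<close>)
qed

text \<open>Young's inequality with weights \<open>\<theta>\<close> and \<open>1 - \<theta>\<close>,
  applied to the two functions normalized to integral one.\<close>

lemma holder_powr:
  fixes a b :: "'a \<Rightarrow> real"
  assumes a: "integrable M a" "\<And>x. a x \<ge> 0" "(LINT x|M. a x) > 0"
    and b: "integrable M b" "\<And>x. b x \<ge> 0" "(LINT x|M. b x) > 0"
    and \<theta>: "0 < \<theta>" "\<theta> < 1" and c: "integrable M c" "\<And>x. c x \<le> a x powr \<theta> * b x powr (1 - \<theta>)"
  shows "(LINT x|M. c x) \<le> (LINT x|M. a x) powr \<theta> * (LINT x|M. b x) powr (1 - \<theta>)"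
proof -
  define A B where "A = (LINT x|M. a x)" and "B = (LINT x|M. b x)"
  have AB: "A > 0" "B > 0" using a b by (auto simp: A_def B_def)
  define C where "C = A powr \<theta> * B powr (1 - \<theta>)"
  have C: "C > 0" using AB by (simp add: C_def)
  have pt: "c x \<le> C * (\<theta> * (a x / A) + (1 - \<theta>) * (b x / B))" for x
  proof -
    have "a x powr \<theta> * b x powr (1 - \<theta>) = C * ((a x / A) powr \<theta> * (b x / B) powr (1 - \<theta>))"
      using AB a(2)[of x] b(2)[of x] by (simp add: C_def powr_divide)
    also have "(a x / A) powr \<theta> * (b x / B) powr (1 - \<theta>) \<le> \<theta> * (a x / A) + (1 - \<theta>) * (b x / B)"
    proof (cases "a x = 0 \<or> b x = 0")
      case True
      then show ?thesis using \<theta> a(2)[of x] b(2)[of x] AB by auto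
    next
      case False
      then have "a x / A > 0" "b x / B > 0" using a(2)[of x] b(2)[of x] AB by auto
      then show ?thesis using Youngs_inequality_0[of \<theta> "1 - \<theta>" "a x / A" "b x / B"] \<theta> by simp
    qed
    finally show ?thesis using c(2)[of x] C by (meson mult_left_mono less_imp_le order_trans)
  qed
  have "(LINT x|M. c x) \<le> (LINT x|M. C * (\<theta> * (a x / A) + (1 - \<theta>) * (b x / B)))"
    by (rule integral_mono[OF c(1) _ pt]) (use a(1) b(1) in auto)
  also have "\<dots> = C * (\<theta> * (A / A) + (1 - \<theta>) * (B / B))"
    using a(1) b(1) by (simp add: A_def B_def)
  also have "\<dots> = C" using AB by simp
  finally show ?thesis by (simp add: C_def A_def B_def)
qed

lemma measure_pos_open:
  fixes \<Omega> :: "'a::euclidean_space set"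
  assumes "open \<Omega>" "bounded \<Omega>" "\<Omega> \<noteq> {}"
  shows "measure lborel \<Omega> > 0"
proof (rule ccontr)
  assume "\<not> ?thesis"
  moreover have "\<Omega> \<in> fmeasurable lborel" using assms by (auto intro!: fmeasurableI emeasure_bounded_finite)
  ultimately have "emeasure lborel \<Omega> = 0" using measure_nonneg[of lborel \<Omega>] by (simp add: emeasure_eq_measure2)
  then have "\<Omega> \<in> null_sets lborel" using assms by (auto intro: null_setsI)
  then have "negligible \<Omega>" by (simp add: negligible_iff_null_sets null_sets_completionI)
  then show False using open_not_negligible assms by blast
qed

section \<open>The case \<open>q < 2\<close>: Picone's inequality combined with Hoelder's
  inequality\<close>

locale c1_compact =
  fixes \<Omega> :: "'a::euclidean_space set" and \<phi> :: "'a \<Rightarrow> real" and G :: "'a \<Rightarrow> 'a" and K :: "'a set"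
  assumes open_domain: "open \<Omega>" and bounded_domain: "bounded \<Omega>" and convex_domain: "convex \<Omega>"
    and K: "compact K" "K \<subseteq> \<Omega>" and supp: "\<And>x. x \<notin> K \<Longrightarrow> \<phi> x = 0"
    and \<phi>: "\<And>x. (\<phi> has_derivative (\<lambda>h. G x \<bullet> h)) (at x)" and G: "continuous_on UNIV G"
    and nz: "\<exists>x. \<phi> x \<noteq> 0"
begin

lemma nonempty_domain: "\<Omega> \<noteq> {}" using nz supp K by blast

lemma continuous_phi: "continuous_on UNIV \<phi>"
  using \<phi> by (meson continuous_at_imp_continuous_on has_derivative_continuous)

lemma integrable_phi_powr: "q > 0 \<Longrightarrow> integrable lborel (\<lambda>x. \<bar>\<phi> x\<bar> powr q)"
  by (rule integrable_continuous_compact_support[OF _ K(1)])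
     (use supp in \<open>auto intro!: continuous_intros continuous_on_powr' continuous_phi\<close>)

lemma integral_phi_powr_pos:
  assumes "q > 0" shows "(LINT x|lborel. \<bar>\<phi> x\<bar> powr q) > 0"
proof -
  obtain z where z: "\<phi> z \<noteq> 0" using nz by blast
  have "(LINT x|(lborel :: 'a measure). 0) < (LINT x|lborel. \<bar>\<phi> x\<bar> powr q)"
    by (rule continuous_integral_less[where f = "\<lambda>_. 0" and z = z, OF _ _ integrable_phi_powr[OF assms]])
       (use z assms in \<open>auto intro!: continuous_intros continuous_on_powr' continuous_phi\<close>)
  then show ?thesis by simp
qed

text \<open>Picone's inequality with the profile of the soft distance, followed by the (reverse) Hoelder inequality
  with weights \<open>f\<^sup>q\<^sup>-\<^sup>2\<close> and \<open>f\<^sup>q\<close>.\<close>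

lemma dirichlet_ge_approx:
  fixes f M :: "real \<Rightarrow> real"
  assumes q: "1 \<le> q" "q < 2" and T: "0 < T" "T < T2" and mono: "mono f" and f0: "\<And>t. t \<le> 0 \<Longrightarrow> f t = 0"
    and cont: "continuous_on UNIV f"
    and f: "\<And>t. 0 < t \<Longrightarrow> t < T2 \<Longrightarrow> 0 < f t \<and> f t < 1 \<and> (f has_real_derivative sqrt (1 - f t powr q)) (at t)"
    and M: "lipschitz_profile M \<Lambda>"
    and Mf: "\<And>t. 0 < t \<Longrightarrow> t \<le> inradius \<Omega> \<Longrightarrow> f (T / inradius \<Omega> * t) powr q \<le> M t"
      "\<And>t. inradius \<Omega> < t \<Longrightarrow> f T powr q \<le> M t"
    and D: "x\<^sub>0 \<in> \<Omega>" "\<And>x. x \<in> \<Omega> \<Longrightarrow> norm (x - x\<^sub>0) \<le> D" and \<eta>: "0 < \<eta>" "\<eta> \<le> 1"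
  defines "E \<equiv> inradius \<Omega> + 2 * D"
  shows "(LINT x|lborel. (norm (G x))\<^sup>2) \<ge> (T / ((1 + \<eta>) * inradius \<Omega>))\<^sup>2 * (q / 2)
     * ((LINT x|lborel. M (infdist x (- \<Omega>))) + \<Lambda> * (\<eta> * E) * measure lborel \<Omega>) powr (1 - 2 / q)
     * (LINT x|lborel. \<bar>\<phi> x\<bar> powr q) powr (2 / q)"
proof -
  note MD = lipschitz_profileD[OF M]
  define R where "R = inradius \<Omega>"
  have R: "R > 0" unfolding R_def using inradius_attained[OF nonempty_domain open_domain bounded_domain] by metis
  have E: "E \<ge> 0" using D(2)[OF D(1)] R by (simp add: E_def R_def)
  obtain I :: "('a \<times> real) set" where
    sd: "\<And>\<beta>. \<beta> > 0 \<Longrightarrow> soft_distance I fst \<beta>" and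
    le: "\<And>\<beta> x. \<beta> > 0 \<Longrightarrow> soft_distance.\<delta> I fst snd \<beta> x \<le> (1 + \<eta>) * R" and
    low: "\<And>\<beta> x. \<beta> > 0 \<Longrightarrow> x \<in> \<Omega> \<Longrightarrow> infdist x (- \<Omega>) - ln (card I) / \<beta> \<le> soft_distance.\<delta> I fst snd \<beta> x" and
    upp: "\<And>\<beta> x. \<beta> > 0 \<Longrightarrow> x \<in> \<Omega> \<Longrightarrow> soft_distance.\<delta> I fst snd \<beta> x \<le> infdist x (- \<Omega>) + \<eta> * E"
    unfolding R_def E_def by (rule soft_distance_approximation[OF open_domain bounded_domain convex_domain D(1) \<eta> D(2)]) blast+
  define R1 where "R1 = (1 + \<eta>) * R"
  have R1: "R1 > 0" "R < R1" using R \<eta> by (auto simp: R1_def field_simps add_pos_pos)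
  \<comment> \<open>\<open>f (c * t)\<close> reaches the final height \<open>f T\<close> exactly at
    \<open>t = R1\<close>, the upper bound of the soft distance.\<close>
  define c where "c = T / R1"
  have c: "c > 0" "c * R1 = T" using R1 T by (auto simp: c_def)
  have ct: "0 < c * t" "c * t \<le> T" "c * t < T2" if "0 < t" "t \<le> R1" for t
    using that c mult_left_mono[of t R1 c] T by auto
  define g where "g = (\<lambda>t. sqrt (1 - f t powr q))"
  have contA: "continuous_on A f" for A using continuous_on_subset[OF cont] by auto
  have gT: "g T > 0" unfolding g_def using f[of T] T powr_less_mono2[of q "f T" 1] q by simp
  have g_ge: "g t \<ge> g T" if "0 < t" "t \<le> T" for t
    unfolding g_def using powr_mono2[of q "f t" "f T"] monoD[OF mono that(2)] f[of t] that T q by simp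
  \<comment> \<open>\<open>w\<close> is \<open>- v'' / v\<close> for the rescaled profile
    \<open>v t = f (c * t)\<close>, and \<open>\<Phi>\<close> below is
    \<open>v' / v\<close>.\<close>
  define w where "w = (\<lambda>t. c\<^sup>2 * (q / 2) * f (c * t) powr (q - 2))"
  define \<Phi> where "\<Phi> = (\<lambda>t. c * (g (c * t) / f (c * t)))"
  define \<Phi>' where "\<Phi>' = (\<lambda>t. - w t - (\<Phi> t)\<^sup>2)"
  have fc: "0 < f (c * t)" "f (c * t) < 1" if "0 < t" "t \<le> R1" for t using f[of "c * t"] ct[OF that] by auto
  have der: "(\<Phi> has_real_derivative \<Phi>' t) (at t)" if t: "0 < t" "t \<le> R1" for t
  proof -
    let ?s = "c * t"
    note fs = f[OF ct(1,3)[OF t]]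
    have pw: "f ?s powr (q - 1) = f ?s powr (q - 2) * f ?s"
      using fs powr_add[of "f ?s" "q - 2" 1] by simp
    have "((\<lambda>s. g s / f s) has_real_derivative ((- (q / 2) * f ?s powr (q - 1)) * f ?s - g ?s * g ?s) / (f ?s * f ?s)) (at ?s)"
      by (rule DERIV_divide) (use fs profile_second_derivative[OF q(1) fs] in \<open>auto simp: g_def\<close>)
    from DERIV_chain2[where f = "\<lambda>s. g s / f s" and g = "\<lambda>t. c * t" and x = t and s = UNIV, OF this]
    have "((\<lambda>t. g (c * t) / f (c * t)) has_real_derivative ((- (q / 2) * f ?s powr (q - 1)) * f ?s - g ?s * g ?s) / (f ?s * f ?s) * c) (at t)"
      by (auto intro!: derivative_eq_intros)
    from DERIV_cmult[OF this, of c]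
    have "(\<Phi> has_real_derivative c * (((- (q / 2) * f ?s powr (q - 1)) * f ?s - g ?s * g ?s) / (f ?s * f ?s) * c)) (at t)"
      by (simp add: \<Phi>_def)
    moreover have "c * (((- (q / 2) * f ?s powr (q - 1)) * f ?s - g ?s * g ?s) / (f ?s * f ?s) * c) = \<Phi>' t"
      using fs unfolding pw \<Phi>'_def w_def \<Phi>_def by (simp add: field_simps power2_eq_square)
    ultimately show ?thesis by (simp only:)
  qed
  have contfc: "continuous_on {0<..R1} (\<lambda>t. f (c * t))"
    by (intro continuous_on_compose2[OF cont] continuous_intros) auto
  have contw: "continuous_on {0<..R1} w"
    unfolding w_def by (intro continuous_intros contfc) (use fc in force)
  have cont\<Phi>: "continuous_on {0<..R1} \<Phi>"
    by (rule DERIV_continuous_on[of _ _ \<Phi>']) (use der in \<open>auto intro: has_field_derivative_at_within\<close>)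
  have cont\<Phi>': "continuous_on {0<..R1} \<Phi>'"
    unfolding \<Phi>'_def by (intro continuous_intros contw cont\<Phi>)
  have \<Phi>_pos: "\<Phi> t \<ge> 0" if "0 < t" "t \<le> R1" for t
    unfolding \<Phi>_def using fc[OF that] g_ge[OF ct(1,2)[OF that]] gT c by (intro mult_nonneg_nonneg divide_nonneg_nonneg) auto
  text \<open>The soft distance must be positive on the support.\<close>
  have "\<exists>e>0. \<forall>x\<in>K. e \<le> infdist x (- \<Omega>)"
  proof -
    have "K \<noteq> {}" using nz supp by blast
    then have "\<exists>x\<in>K. \<forall>y\<in>K. infdist x (- \<Omega>) \<le> infdist y (- \<Omega>)"
      by (intro continuous_attains_inf K continuous_on_infdist continuous_on_id)
    then obtain x where x: "x \<in> K" "\<And>y. y \<in> K \<Longrightarrow> infdist x (- \<Omega>) \<le> infdist y (- \<Omega>)" by blast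
    obtain e where "e > 0" "ball x e \<subseteq> \<Omega>" using x(1) K(2) open_domain open_contains_ball by blast
    then have "infdist x (- \<Omega>) > 0"
      using infdist_ge_ball[OF _ bounded_complement_nonempty[OF bounded_domain]] by fastforce
    then show ?thesis using x by blast
  qed
  then obtain e where e: "e > 0" "\<And>x. x \<in> K \<Longrightarrow> e \<le> infdist x (- \<Omega>)" by blast
  \<comment> \<open>The second entry dominates \<open>w / \<Phi>\<close>, using
    \<open>f\<^sup>q\<^sup>-\<^sup>1 \<le> 1\<close> and the positive final slope \<open>g T\<close>
    left by stopping the profile early; the third makes the soft distance positive on
    \<open>K\<close>.\<close>
  define \<beta> where "\<beta> = max 1 (max (c * (q / 2) / g T) (2 * ln (card I) / e))"
  have \<beta>: "\<beta> > 0" "\<beta> \<ge> c * (q / 2) / g T" "\<beta> \<ge> 2 * ln (card I) / e" by (auto simp: \<beta>_def)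
  interpret soft_distance I fst snd \<beta> by (rule sd[OF \<beta>(1)])
  have \<delta>R1: "\<delta> x \<le> R1" for x using le[OF \<beta>(1)] by (simp add: R1_def)
  have pos: "\<delta> x > 0" if "x \<in> K" for x
  proof -
    have "2 * ln (card I) \<le> \<beta> * e" using \<beta>(3) e by (simp add: field_simps)
    then have "ln (card I) / \<beta> \<le> e / 2" using \<beta>(1) by (simp add: field_simps)
    moreover have "x \<in> \<Omega>" using that K by blast
    ultimately show ?thesis using low[OF \<beta>(1), of x] e(1) e(2)[OF that] by linarith
  qed
  have beta_ge: "\<beta> * \<Phi> t \<ge> - (\<Phi>' t + (\<Phi> t)\<^sup>2)" if t: "0 < t" "t \<le> R1" for t
  proof -
    define y where "y = f (c * t)"
    have y: "0 < y" "y < 1" using fc[OF t] by (auto simp: y_def)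
    have "y powr (q - 1) \<le> 1" using powr_le1[of "q - 1" y] y q by simp
    moreover have "y powr (q - 2) = y powr (q - 1) / y" using y powr_diff[of y "q - 1" 1] by simp
    ultimately have "y powr (q - 2) \<le> 1 / y" using y by (simp add: divide_right_mono)
    then have "c\<^sup>2 * (q / 2) * y powr (q - 2) \<le> c\<^sup>2 * (q / 2) * (1 / y)" using q by (intro mult_left_mono) auto
    also have "\<dots> = (c * (q / 2) / g T) * (c * (g T / y))" using gT y by (simp add: field_simps power2_eq_square)
    also have "\<dots> \<le> \<beta> * (c * (g (c * t) / y))"
      using \<beta> c y gT g_ge[OF ct(1,2)[OF t]] by (intro mult_mono divide_right_mono mult_left_mono) auto
    finally show ?thesis by (simp add: \<Phi>'_def w_def \<Phi>_def y_def)
  qed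
  have D0: "norm (x - x\<^sub>0) \<le> D" if "x \<in> \<Omega>" for x using D(2) that by simp
  have wle: "w t \<le> - (\<Phi>' t + (\<Phi> t)\<^sup>2) - 2 * 0 * \<Phi> t * (R1 - t)" if "0 < t" "t \<le> R1" for t by (simp add: \<Phi>'_def)
  have "integrable lborel (\<lambda>x. (w (\<delta> x) + (0 * real DIM('a) - 0\<^sup>2 * D\<^sup>2)) * (\<phi> x)\<^sup>2)"
    by (rule dirichlet_ge_profile(1)[OF K open_domain pos \<delta>R1 \<phi> G supp der cont\<Phi>' \<Phi>_pos beta_ge wle contw _ _ D0]) auto
  then have inta: "integrable lborel (\<lambda>x. w (\<delta> x) * (\<phi> x)\<^sup>2)" by simp
  have "(LINT x|lborel. (norm (G x))\<^sup>2) \<ge> (LINT x|lborel. (w (\<delta> x) + (0 * real DIM('a) - 0\<^sup>2 * D\<^sup>2)) * (\<phi> x)\<^sup>2)"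
    by (rule dirichlet_ge_profile(2)[OF K open_domain pos \<delta>R1 \<phi> G supp der cont\<Phi>' \<Phi>_pos beta_ge wle contw _ _ D0]) auto
  then have main: "(LINT x|lborel. (norm (G x))\<^sup>2) \<ge> (LINT x|lborel. w (\<delta> x) * (\<phi> x)\<^sup>2)" by simp
  define a where "a = (\<lambda>x. w (\<delta> x) * (\<phi> x)\<^sup>2)"
  define b where "b = (\<lambda>x. M (infdist x (- \<Omega>)) + \<Lambda> * (\<eta> * E) * indicator \<Omega> x)"
  define L where "L = (LINT x|lborel. b x)"
  have intM: "integrable lborel (\<lambda>x. M (infdist x (- \<Omega>)))" by (rule integrable_profile_infdist[OF bounded_domain M])
  have intO: "integrable lborel (indicat_real \<Omega>)"
    using open_domain emeasure_bounded_finite[OF bounded_domain] by (intro integrable_real_indicator) auto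
  have intb: "integrable lborel b" unfolding b_def using intM intO by auto
  have L: "L = (LINT x|lborel. M (infdist x (- \<Omega>))) + \<Lambda> * (\<eta> * E) * measure lborel \<Omega>"
    unfolding L_def b_def using intM intO open_domain by simp
  \<comment> \<open>Enlarging the radius to \<open>R1\<close> only lowers the rescaled profile, so
    \<open>M\<close> still dominates its power; passing from \<open>\<delta>\<close> to the true
    distance costs a multiple of the Lipschitz constant.\<close>
  have fM: "f (c * \<delta> x) powr q \<le> b x" if x: "x \<in> K" for x
  proof -
    have xO: "x \<in> \<Omega>" using x K by blast
    have "f (c * \<delta> x) powr q \<le> M (\<delta> x)"
    proof (cases "\<delta> x \<le> R")
      case True
      have "c \<le> T / R" unfolding c_def using R R1 T by (simp add: frac_le)
      then have "f (c * \<delta> x) \<le> f (T / R * \<delta> x)"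
        using pos[OF x] by (intro monoD[OF mono] mult_right_mono) auto
      then have "f (c * \<delta> x) powr q \<le> f (T / R * \<delta> x) powr q"
        using fc[OF pos[OF x] \<delta>R1] q by (intro powr_mono2) auto
      then show ?thesis using Mf(1)[of "\<delta> x"] True pos[OF x] by (simp add: R_def)
    next
      case False
      have "f (c * \<delta> x) \<le> f T" using ct(2)[OF pos[OF x] \<delta>R1] by (intro monoD[OF mono]) 
      then have "f (c * \<delta> x) powr q \<le> f T powr q"
        using fc[OF pos[OF x] \<delta>R1] q by (intro powr_mono2) auto
      then show ?thesis using Mf(2)[of "\<delta> x"] False by (simp add: R_def)
    qed
    also have "\<dots> \<le> M (infdist x (- \<Omega>) + \<eta> * E)" by (rule monoD[OF MD(2) upp[OF \<beta>(1) xO]])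
    also have "\<dots> \<le> M (infdist x (- \<Omega>)) + \<Lambda> * (\<eta> * E)"
      using MD(4)[of "infdist x (- \<Omega>)" "infdist x (- \<Omega>) + \<eta> * E"] E \<eta> by simp
    finally show ?thesis using xO by (simp add: b_def)
  qed
  have b0: "b x \<ge> 0" for x unfolding b_def using MD(1,5) E \<eta> by simp
  have a0: "a x \<ge> 0" for x unfolding a_def w_def using q by (intro mult_nonneg_nonneg) auto
  define \<kappa> where "\<kappa> = (c\<^sup>2 * (q / 2)) powr (q / 2)"
  have \<kappa>: "\<kappa> > 0" unfolding \<kappa>_def using c q by simp
  \<comment> \<open>The powers of the profile in the two factors cancel, as
    \<open>(q - 2) * (q / 2) + q * (1 - q / 2) = 0\<close>.\<close>
  have pt: "\<kappa> * \<bar>\<phi> x\<bar> powr q \<le> a x powr (q / 2) * b x powr (1 - q / 2)" for x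
  proof (cases "x \<in> K")
    case False
    then show ?thesis using supp by simp
  next
    case True
    define y where "y = f (c * \<delta> x)"
    have y: "0 < y" using fc[OF pos[OF True] \<delta>R1] by (simp add: y_def)
    have "a x powr (q / 2) = \<kappa> * (y powr (q - 2)) powr (q / 2) * ((\<phi> x)\<^sup>2) powr (q / 2)"
    proof -
      have pm: "((A * B) * C) powr r = A powr r * B powr r * C powr r" if "A \<ge> 0" "B \<ge> 0" "C \<ge> 0" for A B C r :: real
        using that by (simp add: powr_mult)
      show ?thesis unfolding a_def w_def \<kappa>_def y_def[symmetric] by (rule pm) (use q in auto)
    qed
    also have "((\<phi> x)\<^sup>2) powr (q / 2) = \<bar>\<phi> x\<bar> powr q"
    proof -
      have "((\<phi> x)\<^sup>2) powr (q / 2) = (\<bar>\<phi> x\<bar> powr 2) powr (q / 2)" by simp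
      then show ?thesis by (simp only: powr_powr) simp
    qed
    finally have 1: "a x powr (q / 2) = \<kappa> * y powr ((q - 2) * (q / 2)) * \<bar>\<phi> x\<bar> powr q" by (simp add: powr_powr)
    have "(y powr q) powr (1 - q / 2) \<le> b x powr (1 - q / 2)"
      using fM[OF True] q by (intro powr_mono2) (auto simp: y_def)
    then have "a x powr (q / 2) * (y powr q) powr (1 - q / 2) \<le> a x powr (q / 2) * b x powr (1 - q / 2)"
      by (intro mult_left_mono) auto
    moreover have "(q - 2) * (q / 2) + q * (1 - q / 2) = 0" by (simp add: algebra_simps add_divide_distrib diff_divide_distrib)
    then have "y powr ((q - 2) * (q / 2)) * (y powr q) powr (1 - q / 2) = 1"
      using y by (simp only: powr_powr powr_add[symmetric]) simp
    then have "a x powr (q / 2) * (y powr q) powr (1 - q / 2) = \<kappa> * \<bar>\<phi> x\<bar> powr q" unfolding 1 by (simp add: mult_ac)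
    ultimately show ?thesis by simp
  qed
  have q0: "q > 0" using q by simp
  define Nq where "Nq = (LINT x|lborel. \<bar>\<phi> x\<bar> powr q)"
  have Nq: "Nq > 0" unfolding Nq_def by (rule integral_phi_powr_pos[OF q0])
  have apos: "(LINT x|lborel. a x) > 0" and bpos: "L > 0"
  proof -
    obtain z where z: "\<phi> z \<noteq> 0" using nz by blast
    then have zK: "z \<in> K" using supp by blast
    have pzz: "a z > 0" unfolding a_def w_def using z c q fc[OF pos[OF zK] \<delta>R1] by simp
    have conta: "continuous_on UNIV a"
    proof -
      have U: "open (\<Omega> \<inter> {x. 0 < \<delta> x})"
        using open_domain open_Collect_less[OF continuous_on_const[of UNIV 0] continuous_delta[of UNIV]] by blast
      show ?thesis
        unfolding a_def
      proof (rule continuous_on_extend_by_zero[OF U K(1)])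
        show "continuous_on (\<Omega> \<inter> {x. 0 < \<delta> x}) (\<lambda>x. w (\<delta> x) * (\<phi> x)\<^sup>2)"
          by (intro continuous_on_mult continuous_on_power continuous_on_compose2[OF contw] continuous_delta
              continuous_on_subset[OF continuous_phi]) (use \<delta>R1 in auto)
      qed (use K pos supp in auto)
    qed
    have "(LINT x|(lborel :: 'a measure). 0) < (LINT x|lborel. a x)"
      by (rule continuous_integral_less[where f = "\<lambda>_. 0" and z = z, OF _ _ inta[folded a_def] conta]) (use a0 pzz in auto)
    then show apos: "(LINT x|lborel. a x) > 0" by simp
    \<comment> \<open>If \<open>b\<close> vanished almost everywhere, the pointwise bound
      \<open>pt\<close> would force \<open>\<phi>\<close> to vanish almost everywhere.\<close>
    show "L > 0"
    proof (rule ccontr)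
      assume "\<not> ?thesis"
      moreover have "0 \<le> L" unfolding L_def by (rule Bochner_Integration.integral_nonneg) (rule b0)
      ultimately have "L = 0" by simp
      then have "AE x in lborel. b x = 0" unfolding L_def
        using integral_nonneg_eq_0_iff_AE[OF intb] b0 by auto
      then have "AE x in lborel. \<kappa> * \<bar>\<phi> x\<bar> powr q = 0"
      proof (rule AE_mp, intro AE_I2 impI)
        fix x assume "b x = 0"
        then have "\<kappa> * \<bar>\<phi> x\<bar> powr q \<le> 0" using pt[of x] by simp
        moreover have "\<kappa> * \<bar>\<phi> x\<bar> powr q \<ge> 0" using \<kappa> by simp
        ultimately show "\<kappa> * \<bar>\<phi> x\<bar> powr q = 0" by (rule antisym)
      qed
      then have "(LINT x|lborel. \<kappa> * \<bar>\<phi> x\<bar> powr q) = 0" by (rule integral_eq_zero_AE)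
      then show False using Nq \<kappa> by (simp add: Nq_def)
    qed
  qed
  have "(LINT x|lborel. \<kappa> * \<bar>\<phi> x\<bar> powr q) \<le> (LINT x|lborel. a x) powr (q / 2) * (LINT x|lborel. b x) powr (1 - q / 2)"
    by (rule holder_powr[OF inta[folded a_def] a0 apos intb b0 bpos[unfolded L_def]])
       (use q pt integrable_phi_powr[OF q0] in auto)
  then have H: "\<kappa> * Nq \<le> (LINT x|lborel. a x) powr (q / 2) * L powr (1 - q / 2)" by (simp add: Nq_def L_def)
  have "(\<kappa> * Nq) powr (2 / q) \<le> ((LINT x|lborel. a x) powr (q / 2) * L powr (1 - q / 2)) powr (2 / q)"
    using H \<kappa> Nq q by (intro powr_mono2) auto
  also have "\<dots> = (LINT x|lborel. a x) * L powr (2 / q - 1)"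
  proof -
    have e: "(q / 2) * (2 / q) = 1" "(1 - q / 2) * (2 / q) = 2 / q - 1" using q by (auto simp: field_simps)
    have "((LINT x|lborel. a x) powr (q / 2) * L powr (1 - q / 2)) powr (2 / q)
        = ((LINT x|lborel. a x) powr (q / 2)) powr (2 / q) * (L powr (1 - q / 2)) powr (2 / q)"
      by (simp add: powr_mult)
    then show ?thesis unfolding powr_powr e using apos by simp
  qed
  finally have "(\<kappa> * Nq) powr (2 / q) * L powr (1 - 2 / q) \<le> (LINT x|lborel. a x) * L powr (2 / q - 1) * L powr (1 - 2 / q)"
    by (intro mult_right_mono) auto
  also have "\<dots> = (LINT x|lborel. a x)"
    using bpos by (simp add: mult.assoc powr_add[symmetric])
  finally have "(\<kappa> * Nq) powr (2 / q) * L powr (1 - 2 / q) \<le> (LINT x|lborel. (norm (G x))\<^sup>2)"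
    using main by (simp add: a_def)
  moreover have "(\<kappa> * Nq) powr (2 / q) = c\<^sup>2 * (q / 2) * Nq powr (2 / q)"
    using Nq \<kappa> c q by (simp add: powr_mult \<kappa>_def powr_powr)
  ultimately show ?thesis
    unfolding L Nq_def c_def R1_def R_def by (simp add: mult_ac)
qed

end

text \<open>The limit as \<open>\<eta>\<close> tends to 0. The exponent \<open>1 - 2 / q\<close> is
  negative, so positivity of the integral of \<open>M\<close> is what makes the power continuous
  there.\<close>

lemma (in c1_compact) dirichlet_ge_volume:
  fixes f M :: "real \<Rightarrow> real"
  assumes q: "1 \<le> q" "q < 2" and T: "0 < T" "T < T2" and mono: "mono f" and f0: "\<And>t. t \<le> 0 \<Longrightarrow> f t = 0"
    and cont: "continuous_on UNIV f"
    and f: "\<And>t. 0 < t \<Longrightarrow> t < T2 \<Longrightarrow> 0 < f t \<and> f t < 1 \<and> (f has_real_derivative sqrt (1 - f t powr q)) (at t)"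
    and M: "lipschitz_profile M \<Lambda>"
    and Mf: "\<And>t. 0 < t \<Longrightarrow> t \<le> inradius \<Omega> \<Longrightarrow> f (T / inradius \<Omega> * t) powr q \<le> M t"
      "\<And>t. inradius \<Omega> < t \<Longrightarrow> f T powr q \<le> M t"
    and L: "(LINT x|lborel. M (infdist x (- \<Omega>))) > 0"
  shows "(LINT x|lborel. (norm (G x))\<^sup>2) \<ge> (T / inradius \<Omega>)\<^sup>2 * (q / 2)
     * (LINT x|lborel. M (infdist x (- \<Omega>))) powr (1 - 2 / q) * (LINT x|lborel. \<bar>\<phi> x\<bar> powr q) powr (2 / q)"
proof -
  define R where "R = inradius \<Omega>"
  obtain x\<^sub>0 where x0: "x\<^sub>0 \<in> \<Omega>" and R: "R > 0"
    unfolding R_def using inradius_attained[OF nonempty_domain open_domain bounded_domain] by metis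
  have "bounded ((\<lambda>x. - x\<^sub>0 + x) ` \<Omega>)" by (intro bounded_translation bounded_domain)
  then obtain D where D: "\<And>x. x \<in> \<Omega> \<Longrightarrow> norm (x - x\<^sub>0) \<le> D"
    unfolding bounded_iff by auto
  define F where "F = (\<lambda>\<eta>. (T / ((1 + \<eta>) * R))\<^sup>2 * (q / 2)
     * ((LINT x|lborel. M (infdist x (- \<Omega>))) + \<Lambda> * (\<eta> * (R + 2 * D)) * measure lborel \<Omega>) powr (1 - 2 / q)
     * (LINT x|lborel. \<bar>\<phi> x\<bar> powr q) powr (2 / q))"
  have "(F \<longlongrightarrow> (T / ((1 + 0) * R))\<^sup>2 * (q / 2)
     * ((LINT x|lborel. M (infdist x (- \<Omega>))) + \<Lambda> * (0 * (R + 2 * D)) * measure lborel \<Omega>) powr (1 - 2 / q)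
     * (LINT x|lborel. \<bar>\<phi> x\<bar> powr q) powr (2 / q)) (at_right 0)"
    unfolding F_def using R L by (intro tendsto_intros) auto
  moreover have "eventually (\<lambda>\<eta>. F \<eta> \<le> (LINT x|lborel. (norm (G x))\<^sup>2)) (at_right 0)"
  proof (rule eventually_at_rightI[of 0 1])
    fix \<eta> :: real assume "\<eta> \<in> {0<..<1}"
    then show "F \<eta> \<le> (LINT x|lborel. (norm (G x))\<^sup>2)"
      unfolding F_def R_def
      by (intro dirichlet_ge_approx[OF q T mono f0 cont f M Mf x0 D]) auto
  qed simp
  ultimately show ?thesis
    unfolding R_def by (auto dest!: tendsto_upperbound)
qed

text \<open>The gain must not depend on the nearly extremal profile, whose accuracy is chosen in
  terms of it. Therefore a multiple of \<open>ms\<close>, determined by the inradius alone, is split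
  off from \<open>M\<close>: the strict comparison is applied to \<open>ms\<close>, the non-strict
  one to the increasing rest \<open>M2\<close>. The gain lowers the integral of \<open>M\<close> by
  a factor \<open>1 - \<gamma>\<close>, and the negative power \<open>p\<close> turns this into a
  factor \<open>\<rho> > 1\<close> in the constant.\<close>

theorem subquadratic_gap:
  fixes \<Omega> :: "'a::euclidean_space set"
  assumes q: "1 \<le> q" "q < 2" and dim: "DIM('a) \<ge> 2"
    and \<Omega>: "\<Omega> \<noteq> {}" "open \<Omega>" "bounded \<Omega>" "convex \<Omega>"
  obtains C where "C > (pi2 q / (2 * inradius \<Omega>))\<^sup>2 * measure lborel \<Omega> powr (1 - 2 / q)"
    "\<And>\<phi> G K. c1_compact \<Omega> \<phi> G K \<Longrightarrow>
      (LINT x|lborel. (norm (G x))\<^sup>2) \<ge> C * (LINT x|lborel. \<bar>\<phi> x\<bar> powr q) powr (2 / q)"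
proof -
  define R where "R = inradius \<Omega>"
  obtain x\<^sub>0 where x0: "infdist x\<^sub>0 (- \<Omega>) = R" and R: "R > 0"
    unfolding R_def using inradius_attained[OF \<Omega>(1-3)] by metis
  define V where "V = measure lborel \<Omega>"
  have V: "V > 0" unfolding V_def by (rule measure_pos_open[OF \<Omega>(2,3,1)])
  define clamp where "clamp = (\<lambda>t. max 0 (min t R))"
  \<comment> \<open>The derivative of \<open>P\<close> is, up to a factor, the lower bound
    \<open>s\<^sup>2 (T - s) / 32\<close> for the derivative of \<open>f\<^sup>q\<close>,
    transported to the segment of length \<open>R\<close>.\<close>
  define P where "P = (\<lambda>t. R * t ^ 3 / 3 - t ^ 4 / 4)"
  define P' where "P' = (\<lambda>t. t\<^sup>2 * (R - t))"
  have derP: "(P has_real_derivative P' t) (at t)" for t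
    unfolding P_def P'_def by (auto intro!: derivative_eq_intros simp: power2_eq_square power3_eq_cube power4_eq_xxxx algebra_simps)
  have contP: "continuous_on A P" for A unfolding P_def by (intro continuous_intros) auto
  have P'_nn: "0 \<le> P' t" and P'_le: "P' t \<le> R ^ 3" if "0 < t" "t < R" for t
  proof -
    show "0 \<le> P' t" unfolding P'_def using that by simp
    have "t\<^sup>2 * (R - t) \<le> R\<^sup>2 * R" using that by (intro mult_mono power_mono) auto
    then show "P' t \<le> R ^ 3" by (simp add: P'_def power2_eq_square power3_eq_cube)
  qed
  \<comment> \<open>Here \<open>512 = 16 * 32\<close>: the growth bound has the constant
    \<open>1 / 32\<close>, and \<open>T \<ge> 1 / 2\<close> gives
    \<open>c ^ 4 \<ge> 1 / (16 * R ^ 4)\<close>.\<close>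
  define \<kappa> where "\<kappa> = 1 / (512 * R ^ 4)"
  have \<kappa>: "\<kappa> > 0" using R by (simp add: \<kappa>_def)
  define ms where "ms = (\<lambda>t. P (clamp t))"
  have ms: "lipschitz_profile ms (R ^ 3)"
    unfolding ms_def clamp_def
    by (rule clamped_lipschitz_profile[OF R contP _ _ derP P'_nn P'_le]) (use R in \<open>auto simp: P_def\<close>)
  have "strict_mono_on {0..R} ms"
  proof (rule strict_mono_onI)
    fix a b assume ab: "a \<in> {0..R}" "b \<in> {0..R}" "a < b"
    obtain z where z: "a < z" "z < b" "P b - P a = (b - a) * P' z"
      using MVT2[OF ab(3) derP] by blast
    have "P' z > 0" unfolding P'_def using z ab by simp
    then have "P a < P b" using z(3) ab(3) by (metis diff_gt_0_iff_gt mult_pos_pos)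
    then show "ms a < ms b" using ab by (simp add: ms_def clamp_def)
  qed
  then have gap: "(LINT x|lborel. ms (infdist x (- \<Omega>))) < (1 / R) * integral {0..R} ms * V"
    unfolding V_def R_def by (intro integral_profile_infdist_less[OF \<Omega> ms _ dim]) (simp add: R_def)
  define g where "g = (1 / R) * integral {0..R} ms * V - (LINT x|lborel. ms (infdist x (- \<Omega>)))"
  define \<gamma> where "\<gamma> = min (1 / 2) (\<kappa> * g / V)"
  have \<gamma>: "0 < \<gamma>" "\<gamma> < 1" "\<gamma> * V \<le> \<kappa> * g"
  proof -
    have "g > 0" using gap by (simp add: g_def)
    then show "0 < \<gamma>" using \<kappa> V by (simp add: \<gamma>_def)
    show "\<gamma> < 1" by (simp add: \<gamma>_def)
    have "\<gamma> \<le> \<kappa> * g / V" by (simp add: \<gamma>_def)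
    then show "\<gamma> * V \<le> \<kappa> * g" using V by (simp add: field_simps)
  qed
  define p where "p = 1 - 2 / q"
  have p: "p < 0" using q by (simp add: p_def field_simps)
  define \<rho> where "\<rho> = (1 - \<gamma>) powr p"
  have \<rho>: "\<rho> > 1" using powr_less_mono2_neg[OF p, of "1 - \<gamma>" 1] \<gamma> by (simp add: \<rho>_def)
  \<comment> \<open>The accuracy \<open>(\<rho> - 1) / 2\<close> is affordable because
    \<open>1 + (\<rho> - 1) / 2 < \<rho>\<close>.\<close>
  obtain f T T2 A where T: "0 < T" "T < T2" and contf: "continuous_on UNIV f" and f0: "\<And>t. t \<le> 0 \<Longrightarrow> f t = 0" and mono: "mono f"
    and f: "\<And>t. 0 < t \<Longrightarrow> t < T2 \<Longrightarrow> 0 < f t \<and> f t < 1 \<and> (f has_real_derivative sqrt (1 - f t powr q)) (at t)"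
    and A: "A = (1 / T) * integral {0..T} (\<lambda>t. f t powr q)" "A > 0"
    and pi: "(pi2 q)\<^sup>2 \<le> (1 + (\<rho> - 1) / 2) * (4 * T\<^sup>2 * (q / 2) * A powr p)" and fT: "1 / 2 \<le> f T"
    unfolding p_def by (rule near_extremal_profile[of q "(\<rho> - 1) / 2"]) (use q \<rho> in auto)
  have T12: "1 / 2 \<le> T" by (rule profile_growth(1)[OF q(1) less_imp_le[OF q(2)] T fT contf f0[OF order_refl] mono f])
  have growth: "q * f s powr (q - 1) * sqrt (1 - f s powr q) \<ge> s\<^sup>2 * (T - s) / 32" if "0 < s" "s < T" for s
    by (rule profile_growth[OF q(1) less_imp_le[OF q(2)] T fT contf f0[OF order_refl] mono f]) (use that in auto)
  define c where "c = T / R"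
  have c: "c > 0" "c * R = T" using T R by (auto simp: c_def)
  have ct: "0 < c * t" "c * t < T" if "0 < t" "t < R" for t using that c mult_strict_left_mono[of t R c] by auto
  have q0: "q > 0" using q by simp
  have fnn: "0 \<le> f t" "f t \<le> 1" if "t \<le> T" for t using f[of t] f0[of t] that T by (cases "t \<le> 0"; force)+
  define h where "h = (\<lambda>t. f (c * t) powr q)"
  define h' where "h' = (\<lambda>t. c * (q * f (c * t) powr (q - 1) * sqrt (1 - f (c * t) powr q)))"
  have conth: "continuous_on {0..R} h"
  proof -
    have "c * t \<le> T" if "t \<in> {0..R}" for t using that c mult_left_mono[of t R c] by auto
    then show ?thesis unfolding h_def using fnn q0
      by (intro continuous_on_powr' continuous_on_compose2[OF contf] continuous_intros) auto
  qed
  have derh: "(h has_real_derivative h' t) (at t)" if t: "0 < t" "t < R" for t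
  proof -
    have fs: "0 < f (c * t)" "(f has_real_derivative sqrt (1 - f (c * t) powr q)) (at (c * t))"
      using f[of "c * t"] ct[OF t] T by auto
    have 1: "((\<lambda>t. f (c * t)) has_real_derivative sqrt (1 - f (c * t) powr q) * c) (at t)"
      by (rule DERIV_chain2[of f]) (use fs in \<open>auto intro!: derivative_eq_intros\<close>)
    have "(h has_real_derivative (q * f (c * t) powr (q - 1)) * (sqrt (1 - f (c * t) powr q) * c)) (at t)"
      unfolding h_def by (rule DERIV_chain2[of "\<lambda>z. z powr q", OF has_real_derivative_powr[OF fs(1)] 1])
    then show ?thesis by (simp add: h'_def mult_ac)
  qed
  have h'_bounds: "\<kappa> * P' t \<le> h' t" "0 \<le> h' t" "h' t \<le> q * c" if t: "0 < t" "t < R" for t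
  proof -
    have fs: "0 < f (c * t)" "f (c * t) < 1" using f[of "c * t"] ct[OF t] T by auto
    have s: "0 \<le> sqrt (1 - f (c * t) powr q)" "sqrt (1 - f (c * t) powr q) \<le> 1"
      using powr_le1[of q "f (c * t)"] fs q by auto
    have pw: "0 \<le> f (c * t) powr (q - 1)" "f (c * t) powr (q - 1) \<le> 1" using powr_le1[of "q - 1" "f (c * t)"] fs q by auto
    show "0 \<le> h' t" unfolding h'_def using c q s pw by simp
    have "f (c * t) powr (q - 1) * sqrt (1 - f (c * t) powr q) \<le> 1 * 1" using s pw by (intro mult_mono) auto
    then have "c * q * (f (c * t) powr (q - 1) * sqrt (1 - f (c * t) powr q)) \<le> c * q * 1" using c q by (intro mult_left_mono) auto
    then show "h' t \<le> q * c" by (simp add: h'_def mult_ac)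
    have "1 / (2 * R) \<le> c" unfolding c_def using T12 R by (simp add: field_simps)
    then have "(1 / (2 * R)) ^ 4 \<le> c ^ 4" using R by (intro power_mono) auto
    then have "\<kappa> \<le> c ^ 4 / 32" by (simp add: \<kappa>_def power_divide power_mult_distrib)
    then have "\<kappa> * P' t \<le> c ^ 4 / 32 * P' t" using P'_nn[OF t] by (intro mult_right_mono)
    also have "\<dots> = c * ((c * t)\<^sup>2 * (T - c * t) / 32)"
      unfolding P'_def c(2)[symmetric] by (simp add: power2_eq_square power4_eq_xxxx algebra_simps)
    also have "\<dots> \<le> h' t" unfolding h'_def using growth[OF ct[OF t]] c by (intro mult_left_mono) auto
    finally show "\<kappa> * P' t \<le> h' t" .
  qed
  have h0: "h 0 = 0" using f0[of 0] q by (simp add: h_def)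
  define M where "M = (\<lambda>t. h (clamp t))"
  have M: "lipschitz_profile M (q * c)"
    unfolding M_def clamp_def
    by (rule clamped_lipschitz_profile[OF R conth h0 _ derh h'_bounds(2,3)]) (use q c in auto)
  \<comment> \<open>\<open>M2\<close> is still increasing because \<open>\<kappa> * P'\<close> stays
    below \<open>h'\<close>.\<close>
  define M2 where "M2 = (\<lambda>t. h (clamp t) - \<kappa> * P (clamp t))"
  have M2: "lipschitz_profile M2 (q * c)"
    unfolding M2_def clamp_def
  proof (rule clamped_lipschitz_profile[where h = "\<lambda>t. h t - \<kappa> * P t" and h' = "\<lambda>t. h' t - \<kappa> * P' t"])
    show "continuous_on {0..R} (\<lambda>t. h t - \<kappa> * P t)" by (intro continuous_intros conth contP)
    show "((\<lambda>t. h t - \<kappa> * P t) has_real_derivative h' t - \<kappa> * P' t) (at t)" if "0 < t" "t < R" for t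
      by (intro DERIV_diff derh that DERIV_cmult derP)
    show "0 \<le> h' t - \<kappa> * P' t" "h' t - \<kappa> * P' t \<le> q * c" if "0 < t" "t < R" for t
    proof -
      have "0 \<le> \<kappa> * P' t" using P'_nn[OF that] \<kappa> by simp
      then show "0 \<le> h' t - \<kappa> * P' t" "h' t - \<kappa> * P' t \<le> q * c" using h'_bounds[OF that] by linarith+
    qed
  qed (use R q c h0 in \<open>auto simp: P_def\<close>)
  have M_eq: "M t = M2 t + \<kappa> * ms t" for t by (simp add: M_def M2_def ms_def)
  have int: "m integrable_on {0..R}" if "lipschitz_profile m l" for m l
    by (rule integrable_continuous_real[OF lipschitz_profileD(7)[OF that]])
  have avg: "(1 / R) * integral {0..R} M = A"
  proof -
    have "continuous_on {0..T} (\<lambda>t. f t powr q)"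
      using fnn q0 by (intro continuous_on_powr' continuous_on_subset[OF contf] continuous_intros) auto
    then have "((\<lambda>t. f t powr q) has_integral (A * T)) {0..T}"
      using A(1) T integrable_integral[OF integrable_continuous_real] by auto
    from has_integral_stretch_real[OF this, of c]
    have "((\<lambda>t. f (c * t) powr q) has_integral (1 / \<bar>c\<bar>) * (A * T)) ((\<lambda>x. x / c) ` {0..T})" using c by simp
    moreover have "(\<lambda>x. x / c) ` {0..T} = {0..R}"
      using image_divide_atLeastAtMost[of c 0 T] c T by (simp add: c_def R less_imp_neq[OF R])
    moreover have "(1 / \<bar>c\<bar>) * (A * T) = A * R" using c T R by (simp add: c_def)
    ultimately have "(h has_integral A * R) {0..R}" by (simp add: h_def)
    then have "(M has_integral A * R) {0..R}"
      by (rule has_integral_eq[rotated]) (auto simp: M_def clamp_def)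
    then show ?thesis using R by (simp add: integral_unique)
  qed
  define L where "L = (LINT x|lborel. M (infdist x (- \<Omega>)))"
  \<comment> \<open>With \<open>A \<le> 1\<close> the absolute gain \<open>\<gamma> * V\<close> is
    at least the relative gain \<open>\<gamma> * (A * V)\<close>.\<close>
  have A1: "A \<le> 1"
  proof -
    have "integral {0..T} (\<lambda>t. f t powr q) \<le> integral {0..T} (\<lambda>_. 1)"
    proof (rule integral_le)
      show "(\<lambda>t. f t powr q) integrable_on {0..T}"
        using fnn q0 by (intro integrable_continuous_real continuous_on_powr' continuous_on_subset[OF contf] continuous_intros) auto
      show "f t powr q \<le> 1" if "t \<in> {0..T}" for t using fnn[of t] that q powr_le1[of q "f t"] by simp
    qed auto
    then show ?thesis using T by (simp add: A(1) field_simps)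
  qed
  have Lle: "L \<le> A * V * (1 - \<gamma>)"
  proof -
    have "L = (LINT x|lborel. M2 (infdist x (- \<Omega>))) + \<kappa> * (LINT x|lborel. ms (infdist x (- \<Omega>)))"
      unfolding L_def M_eq using integrable_profile_infdist[OF \<Omega>(3) M2] integrable_profile_infdist[OF \<Omega>(3) ms] by simp
    also have "(LINT x|lborel. M2 (infdist x (- \<Omega>))) \<le> (1 / R) * integral {0..R} M2 * V"
      unfolding V_def R_def by (rule integral_profile_infdist_le[OF \<Omega> M2])
    also have "(1 / R) * integral {0..R} M2 * V + \<kappa> * (LINT x|lborel. ms (infdist x (- \<Omega>)))
        = (1 / R) * (integral {0..R} M2 + \<kappa> * integral {0..R} ms) * V - \<kappa> * g"
      by (simp add: g_def algebra_simps)
    also have "integral {0..R} M2 + \<kappa> * integral {0..R} ms = integral {0..R} M"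
      unfolding M_eq using int[OF M2] int[OF ms]
      by (simp add: Henstock_Kurzweil_Integration.integral_add integrable_on_mult_right)
    also have "(1 / R) * integral {0..R} M * V - \<kappa> * g = A * V - \<kappa> * g" by (simp only: avg)
    also have "\<dots> \<le> A * V - \<gamma> * V" using \<gamma> by simp
    also have "\<dots> \<le> A * V - A * (\<gamma> * V)" using A1 \<gamma> V mult_right_mono[of A 1 "\<gamma> * V"] by simp
    finally show ?thesis by (simp add: algebra_simps)
  qed
  have Lpos: "L > 0"
  proof -
    have contM: "continuous_on UNIV (\<lambda>x. M (infdist x (- \<Omega>)))"
      by (rule continuous_on_compose2[OF lipschitz_profileD(7)[OF M, of UNIV]]) (auto intro!: continuous_on_infdist continuous_on_id)
    have "0 < M (infdist x\<^sub>0 (- \<Omega>))" using x0 R c f[of T] T by (simp add: M_def clamp_def h_def)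
    then have "(LINT x|(lborel :: 'a measure). 0) < L" unfolding L_def
      by (intro continuous_integral_less[where f = "\<lambda>_. 0" and z = x\<^sub>0, OF _ _ integrable_profile_infdist[OF \<Omega>(3) M] contM])
         (auto intro: lipschitz_profileD(5)[OF M])
    then show ?thesis by simp
  qed
  define X where "X = (T / R)\<^sup>2 * (q / 2) * A powr p"
  have X: "X > 0" unfolding X_def using T(1) R q A(2) by (intro mult_pos_pos) auto
  define C where "C = (T / R)\<^sup>2 * (q / 2) * (A * V * (1 - \<gamma>)) powr p"
  have CX: "C = X * V powr p * \<rho>" 
  proof -
    have "(A * V * (1 - \<gamma>)) powr p = A powr p * V powr p * (1 - \<gamma>) powr p"
      using A(2) V \<gamma> by (simp add: powr_mult)
    then show ?thesis unfolding C_def X_def \<rho>_def by (simp only: mult_ac)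
  qed
  show ?thesis
  proof (rule that[of C])
    have "(pi2 q / (2 * R))\<^sup>2 = (pi2 q)\<^sup>2 / (4 * R\<^sup>2)" by (simp add: power_divide power_mult_distrib)
    also have "\<dots> \<le> ((1 + (\<rho> - 1) / 2) * (4 * T\<^sup>2 * (q / 2) * A powr p)) / (4 * R\<^sup>2)"
      using pi by (intro divide_right_mono) auto
    also have "\<dots> = (1 + (\<rho> - 1) / 2) * X" using R by (simp add: X_def power_divide field_simps)
    also have "1 + (\<rho> - 1) / 2 < \<rho>" using \<rho> by (simp add: field_simps)
    then have "(1 + (\<rho> - 1) / 2) * X < \<rho> * X" using X by (intro mult_strict_right_mono)
    finally have "(pi2 q / (2 * R))\<^sup>2 * V powr p < \<rho> * X * V powr p" using V by (intro mult_strict_right_mono) auto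
    then show "C > (pi2 q / (2 * inradius \<Omega>))\<^sup>2 * measure lborel \<Omega> powr (1 - 2 / q)"
      by (simp add: CX R_def V_def p_def mult_ac)
    fix \<phi> G K assume "c1_compact \<Omega> \<phi> G K"
    then interpret c1_compact \<Omega> \<phi> G K .
    have "f (T / R * t) powr q \<le> M t" if "0 < t" "t \<le> R" for t
      using that by (simp add: M_def clamp_def h_def c_def)
    moreover have "f T powr q \<le> M t" if "R < t" for t
      using that R c by (simp add: M_def clamp_def h_def)
    ultimately have "(LINT x|lborel. (norm (G x))\<^sup>2) \<ge> (T / R)\<^sup>2 * (q / 2) * L powr p * (LINT x|lborel. \<bar>\<phi> x\<bar> powr q) powr (2 / q)"
      unfolding R_def L_def p_def
      by (intro dirichlet_ge_volume[OF q T mono f0 contf f M]) (use Lpos in \<open>auto simp: L_def\<close>)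
    moreover have "(A * V * (1 - \<gamma>)) powr p \<le> L powr p"
      using Lle Lpos p by (intro powr_mono2') auto
    then have "C * (LINT x|lborel. \<bar>\<phi> x\<bar> powr q) powr (2 / q) \<le> (T / R)\<^sup>2 * (q / 2) * L powr p * (LINT x|lborel. \<bar>\<phi> x\<bar> powr q) powr (2 / q)"
      unfolding C_def using q by (intro mult_right_mono mult_left_mono) auto
    ultimately show "(LINT x|lborel. (norm (G x))\<^sup>2) \<ge> C * (LINT x|lborel. \<bar>\<phi> x\<bar> powr q) powr (2 / q)" by linarith
  qed
qed

section \<open>The case \<open>q = 2\<close>: contact normals at an incentre and a Gaussian
  factor\<close>

lemma contact_normals:
  fixes \<Omega> :: "'a::euclidean_space set"
  assumes \<Omega>: "\<Omega> \<noteq> {}" "open \<Omega>" "bounded \<Omega>" "convex \<Omega>" and ball: "ball x\<^sub>0 (inradius \<Omega>) \<subseteq> \<Omega>"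
  obtains S u where "finite S" "\<And>v. v \<in> S \<Longrightarrow> norm v = 1" "\<And>v x. v \<in> S \<Longrightarrow> x \<in> \<Omega> \<Longrightarrow> v \<bullet> (x - x\<^sub>0) \<le> inradius \<Omega>"
    "\<And>v. v \<in> S \<Longrightarrow> 0 \<le> u v" "sum u S = 1" "(\<Sum>v\<in>S. u v *\<^sub>R v) = (0::'a)"
proof -
  define R where "R = inradius \<Omega>"
  have R: "R > 0" "\<And>x. infdist x (- \<Omega>) \<le> R"
    unfolding R_def using inradius_attained[OF \<Omega>(1-3)] by metis+
  note cne = bounded_complement_nonempty[OF \<Omega>(3)]
  define C where "C = {v. norm v = 1 \<and> (\<forall>x\<in>\<Omega>. v \<bullet> (x - x\<^sub>0) \<le> R)}"
  have "C = sphere 0 1 \<inter> (\<Inter>x\<in>\<Omega>. {v. (x - x\<^sub>0) \<bullet> v \<le> R})"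
    by (auto simp: C_def inner_commute)
  then have "compact C"
    by (simp only:) (intro compact_Int_closed compact_sphere closed_INT ballI closed_halfspace_le)
  then have hull: "compact (convex hull C)" by (rule compact_convex_hull)
  \<comment> \<open>Otherwise some \<open>a\<close> has positive product with all contact normals,
    and moving the incentre along \<open>- a\<close> leads away from all contact hyperplanes. The
    contradiction comes from supporting hyperplanes at the points of the complement nearest to the
    moved centres: their normals subconverge to a contact normal \<open>l\<close> with
    \<open>l \<bullet> a \<le> 0\<close>.\<close>
  have "0 \<in> convex hull C"
  proof (rule ccontr)
    assume "0 \<notin> convex hull C"
    then obtain a b where a: "a \<noteq> 0" "0 < b" "\<And>v. v \<in> convex hull C \<Longrightarrow> a \<bullet> v > b"
      using separating_hyperplane_closed_0[of "convex hull C"] hull by (auto simp: compact_imp_closed)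
    define e where "e = (\<lambda>k::nat. 1 / real (Suc k))"
    have e: "e k > 0" for k by (simp add: e_def)
    have "\<exists>v. norm v = 1 \<and> v \<bullet> a \<le> 0 \<and> (\<forall>x\<in>\<Omega>. v \<bullet> (x - x\<^sub>0) \<le> R - e k * (v \<bullet> a))" for k
    proof -
      define xk where "xk = x\<^sub>0 - e k *\<^sub>R a"
      have "closed (- \<Omega>)" using \<Omega>(2) by (simp add: closed_Compl)
      then obtain z where z: "z \<in> - \<Omega>" "infdist xk (- \<Omega>) = dist xk z"
        using infdist_attains_inf[OF _ cne] by blast
      have dz: "norm (z - xk) \<le> R" using R(2)[of xk] z by (simp add: dist_norm norm_minus_commute)
      have "{z} \<inter> \<Omega> = {}" using z by auto
      then obtain w c where w: "w \<noteq> 0" "\<And>x. x \<in> {z} \<Longrightarrow> w \<bullet> x \<le> c" "\<And>x. x \<in> \<Omega> \<Longrightarrow> w \<bullet> x \<ge> c"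
        using separating_hyperplane_sets[of "{z}" \<Omega>] \<Omega> by auto
      define v where "v = (- 1 / norm w) *\<^sub>R w"
      have v1: "norm v = 1" using w by (simp add: v_def)
      have vz: "v \<bullet> x \<le> v \<bullet> z" if "x \<in> \<Omega>" for x
      proof -
        have "w \<bullet> z \<le> w \<bullet> x" using w(2)[of z] w(3)[OF that] by simp
        then show ?thesis using w(1) by (simp add: v_def divide_right_mono)
      qed
      have vv: "v \<bullet> v = 1" using v1 by (simp add: dot_square_norm)
      \<comment> \<open>The open ball of radius \<open>R\<close> about the incentre lies in
        \<open>\<Omega>\<close>, hence on the inner side of the hyperplane through
        \<open>z\<close>.\<close>
      have "v \<bullet> x\<^sub>0 + R \<le> v \<bullet> z"
      proof (rule field_le_epsilon)
        fix d :: real assume d: "d > 0"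
        define t where "t = R - min d R"
        have t: "0 \<le> t" "t < R" "R - d \<le> t" using d R by (auto simp: t_def min_def)
        have "dist x\<^sub>0 (x\<^sub>0 + t *\<^sub>R v) = t" using t v1 by (simp add: dist_norm)
        then have "x\<^sub>0 + t *\<^sub>R v \<in> ball x\<^sub>0 R" using t by simp
        then have "x\<^sub>0 + t *\<^sub>R v \<in> \<Omega>" using ball by (auto simp: R_def)
        from vz[OF this] show "v \<bullet> x\<^sub>0 + R \<le> v \<bullet> z + d" using t by (simp add: inner_add_right vv)
      qed
      moreover have zle: "v \<bullet> z \<le> v \<bullet> x\<^sub>0 - e k * (v \<bullet> a) + R"
      proof -
        have "v \<bullet> (z - xk) \<le> norm v * norm (z - xk)" by (rule norm_cauchy_schwarz)
        then have "v \<bullet> (z - xk) \<le> R" using v1 dz by simp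
        then show ?thesis by (simp add: xk_def inner_diff_right algebra_simps)
      qed
      ultimately have "e k * (v \<bullet> a) \<le> 0" by linarith
      then have "v \<bullet> a \<le> 0" using e[of k] by (simp add: mult_le_0_iff)
      moreover have "\<forall>x\<in>\<Omega>. v \<bullet> (x - x\<^sub>0) \<le> R - e k * (v \<bullet> a)"
      proof
        fix x assume "x \<in> \<Omega>"
        from vz[OF this] zle show "v \<bullet> (x - x\<^sub>0) \<le> R - e k * (v \<bullet> a)" by (simp add: inner_diff_right)
      qed
      ultimately show ?thesis using v1 by blast
    qed
    then obtain v where v: "\<And>k. norm (v k) = 1" "\<And>k. v k \<bullet> a \<le> 0" "\<And>k x. x \<in> \<Omega> \<Longrightarrow> v k \<bullet> (x - x\<^sub>0) \<le> R - e k * (v k \<bullet> a)"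
      by metis
    have "\<forall>k. v k \<in> sphere 0 1" using v by simp
    then obtain l r where l: "l \<in> sphere 0 1" "strict_mono r" "(v \<circ> r) \<longlonglongrightarrow> l"
      using compact_sphere[of "0::'a" 1, unfolded compact_def] by blast
    have lim: "(\<lambda>k. v (r k)) \<longlonglongrightarrow> l" using l(3) by (simp add: o_def)
    have e0: "(\<lambda>k. e (r k)) \<longlonglongrightarrow> 0"
    proof -
      have "e \<longlonglongrightarrow> 0" unfolding e_def using LIMSEQ_inverse_real_of_nat by (simp add: inverse_eq_divide)
      then show ?thesis using LIMSEQ_subseq_LIMSEQ[OF _ l(2), of e 0] by (simp add: o_def)
    qed
    have la: "l \<bullet> a \<le> 0"
      by (rule LIMSEQ_le_const2[OF tendsto_inner[OF lim tendsto_const]]) (use v(2) in blast)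
    have "l \<bullet> (x - x\<^sub>0) \<le> R" if "x \<in> \<Omega>" for x
    proof -
      have "(\<lambda>k. R - e (r k) * (v (r k) \<bullet> a)) \<longlonglongrightarrow> R - 0 * (l \<bullet> a)"
        by (intro tendsto_intros e0 lim)
      moreover have "(\<lambda>k. v (r k) \<bullet> (x - x\<^sub>0)) \<longlonglongrightarrow> l \<bullet> (x - x\<^sub>0)" by (intro tendsto_intros lim)
      ultimately have "l \<bullet> (x - x\<^sub>0) \<le> R - 0 * (l \<bullet> a)" using v(3)[OF that] by (intro LIMSEQ_le) auto
      then show ?thesis by simp
    qed
    then have "l \<in> C" using l(1) by (simp add: C_def)
    then have "a \<bullet> l > b" by (intro a hull_inc)
    then show False using la a(2) by (simp add: inner_commute)
  qed
  then obtain S u where "finite S" "S \<subseteq> C" "\<forall>x\<in>S. 0 \<le> u x" "sum u S = 1" "(\<Sum>v\<in>S. u v *\<^sub>R v) = 0"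
    unfolding convex_hull_explicit by auto
  then show ?thesis using that[of S u] by (auto simp: C_def R_def subset_iff)
qed

text \<open>Multiplying the comparison function by a Gaussian centred at the incentre gains \<open>\<epsilon> (n - 1)\<close>: the
  Gaussian contributes \<open>\<epsilon> n\<close>, and since all contact hyperplanes have the same distance \<open>R\<close> to the incentre,
  the interaction with the profile costs only \<open>\<epsilon>\<close>.\<close>

theorem quadratic_gap:
  fixes \<Omega> :: "'a::euclidean_space set"
  assumes dim: "DIM('a) \<ge> 2" and \<Omega>: "\<Omega> \<noteq> {}" "open \<Omega>" "bounded \<Omega>" "convex \<Omega>"
  obtains C where "C > (pi2 2 / (2 * inradius \<Omega>))\<^sup>2"
    "\<And>\<phi> G K. c1_compact \<Omega> \<phi> G K \<Longrightarrow> (LINT x|lborel. (norm (G x))\<^sup>2) \<ge> C * (LINT x|lborel. (\<phi> x)\<^sup>2)"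
proof -
  define R where "R = inradius \<Omega>"
  obtain x\<^sub>0 where ball: "ball x\<^sub>0 R \<subseteq> \<Omega>" and R: "R > 0"
    unfolding R_def using inradius_attained[OF \<Omega>(1-3)] by metis
  have "bounded ((\<lambda>x. - x\<^sub>0 + x) ` \<Omega>)" by (intro bounded_translation \<Omega>)
  then obtain D0 where D0: "\<And>x. x \<in> \<Omega> \<Longrightarrow> norm (x - x\<^sub>0) \<le> D0"
    unfolding bounded_iff by auto
  define D where "D = max D0 1"
  have D: "D \<ge> 1" "\<And>x. x \<in> \<Omega> \<Longrightarrow> norm (x - x\<^sub>0) \<le> D" using D0 by (auto simp: D_def intro: le_max_iff_disj[THEN iffD2])
  obtain S u where S: "finite S" "\<And>v. v \<in> S \<Longrightarrow> norm v = 1" "\<And>v x. v \<in> S \<Longrightarrow> x \<in> \<Omega> \<Longrightarrow> v \<bullet> (x - x\<^sub>0) \<le> R"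
    and u: "\<And>v. v \<in> S \<Longrightarrow> 0 \<le> u v" "sum u S = 1" "(\<Sum>v\<in>S. u v *\<^sub>R v) = (0::'a)"
    using contact_normals[OF \<Omega> ball[unfolded R_def]] unfolding R_def by blast
  have neS: "S \<noteq> {}" using u(2) by auto
  \<comment> \<open>The first bound gives \<open>\<epsilon> \<le> c\<^sup>2 / 2\<close>, which keeps
    \<open>\<Phi>\<close> above \<open>\<Psi> / 2\<close>; the second makes the loss
    \<open>\<epsilon>\<^sup>2 D\<^sup>2\<close> at most \<open>\<epsilon> / 2\<close>.\<close>
  define \<epsilon> where "\<epsilon> = min (1 / (8 * R\<^sup>2)) (1 / (2 * D\<^sup>2))"
  have \<epsilon>: "\<epsilon> > 0" "\<epsilon> \<le> 1 / (8 * R\<^sup>2)" "\<epsilon> * D\<^sup>2 \<le> 1 / 2"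
  proof -
    show "\<epsilon> > 0" "\<epsilon> \<le> 1 / (8 * R\<^sup>2)" using R D by (auto simp: \<epsilon>_def)
    have "\<epsilon> * D\<^sup>2 \<le> 1 / (2 * D\<^sup>2) * D\<^sup>2" by (intro mult_right_mono) (auto simp: \<epsilon>_def)
    then show "\<epsilon> * D\<^sup>2 \<le> 1 / 2" using D by simp
  qed
  obtain f T T2 A where T: "0 < T" "T < T2" and contf: "continuous_on UNIV f" and f0: "\<And>t. t \<le> 0 \<Longrightarrow> f t = 0" and mono: "mono f"
    and f: "\<And>t. 0 < t \<Longrightarrow> t < T2 \<Longrightarrow> 0 < f t \<and> f t < 1 \<and> (f has_real_derivative sqrt (1 - f t powr 2)) (at t)"
    and "A = (1 / T) * integral {0..T} (\<lambda>t. f t powr 2)"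
    and A: "A > 0" and pi: "(pi2 2)\<^sup>2 \<le> (1 + \<epsilon> * R\<^sup>2 / 16) * (4 * T\<^sup>2 * (2 / 2) * A powr (1 - 2 / 2))"
    and "pi2 2 \<ge> 0" and fT: "1 / 2 \<le> f T"
  proof -
    have h: "1 \<le> (2::real)" "(2::real) \<le> 2" "0 < \<epsilon> * R\<^sup>2 / 16" using \<epsilon> R by auto
    show ?thesis by (rule near_extremal_profile[OF h]) (rule that; assumption)
  qed
  have T12: "1 / 2 \<le> T" by (rule profile_growth(1)[OF _ _ T fT contf f0[OF order_refl] mono f]) auto
  have Tle2: "T \<le> 2" by (rule profile_growth(2)[OF _ _ T fT contf f0[OF order_refl] mono f]) auto
  define c where "c = T / R"
  have c: "c > 0" "c * R = T" using T R by (auto simp: c_def)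
  have ct: "0 < c * t" "c * t \<le> T" "c * t < T2" if "0 < t" "t \<le> R" for t
    using that c mult_left_mono[of t R c] T by auto
  have c_ge: "\<epsilon> \<le> c\<^sup>2 / 2"
  proof -
    have "1 / (2 * R) \<le> c" unfolding c_def using T12 R by (simp add: field_simps)
    then have "(1 / (2 * R))\<^sup>2 \<le> c\<^sup>2" using R by (intro power_mono) auto
    then have "1 / (8 * R\<^sup>2) \<le> c\<^sup>2 / 2" by (simp add: power_divide power_mult_distrib)
    then show ?thesis using \<epsilon> by linarith
  qed
  define g where "g = (\<lambda>t. sqrt (1 - f t powr 2))"
  define \<Psi> where "\<Psi> = (\<lambda>t. c * (g (c * t) / f (c * t)))"
  have der\<Psi>: "(\<Psi> has_real_derivative - c\<^sup>2 - (\<Psi> t)\<^sup>2) (at t)" if t: "0 < t" "t \<le> R" for t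
  proof -
    let ?s = "c * t"
    note fs = f[OF ct(1,3)[OF t]]
    have "((\<lambda>s. g s / f s) has_real_derivative ((- (2 / 2) * f ?s powr (2 - 1)) * f ?s - g ?s * g ?s) / (f ?s * f ?s)) (at ?s)"
      by (rule DERIV_divide) (use fs profile_second_derivative[OF _ fs] in \<open>auto simp: g_def\<close>)
    from DERIV_chain2[where f = "\<lambda>s. g s / f s" and g = "\<lambda>t. c * t" and x = t and s = UNIV, OF this]
    have "((\<lambda>t. g (c * t) / f (c * t)) has_real_derivative ((- (2 / 2) * f ?s powr (2 - 1)) * f ?s - g ?s * g ?s) / (f ?s * f ?s) * c) (at t)"
      by (auto intro!: derivative_eq_intros)
    from DERIV_cmult[OF this, of c]
    have "(\<Psi> has_real_derivative c * (((- (2 / 2) * f ?s powr (2 - 1)) * f ?s - g ?s * g ?s) / (f ?s * f ?s) * c)) (at t)"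
      by (simp add: \<Psi>_def)
    moreover have "c * (((- (2 / 2) * f ?s powr (2 - 1)) * f ?s - g ?s * g ?s) / (f ?s * f ?s) * c) = - c\<^sup>2 - (\<Psi> t)\<^sup>2"
      using fs unfolding \<Psi>_def by (simp add: field_simps power2_eq_square)
    ultimately show ?thesis by (simp only:)
  qed
  define \<psi>\<^sub>R where "\<psi>\<^sub>R = \<Psi> R"
  have \<psi>R: "\<psi>\<^sub>R > 0"
  proof -
    have "0 < f T" "f T < 1" using f[of T] T by auto
    moreover have "f T powr 2 < 1" using powr_less_mono2[of 2 "f T" 1] calculation by simp
    ultimately show ?thesis using c by (simp add: \<psi>\<^sub>R_def \<Psi>_def g_def)
  qed
  have \<Psi>_ge: "\<Psi> t \<ge> \<psi>\<^sub>R + c\<^sup>2 * (R - t)" if t: "0 < t" "t \<le> R" for t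
  proof (cases "t = R")
    case False
    then have "t < R" using t by simp
    then obtain z where z: "t < z" "z < R" "\<Psi> R - \<Psi> t = (R - t) * (- c\<^sup>2 - (\<Psi> z)\<^sup>2)"
      using MVT2[of t R \<Psi> "\<lambda>t. - c\<^sup>2 - (\<Psi> t)\<^sup>2"] der\<Psi> t by auto
    have "(R - t) * (\<Psi> z)\<^sup>2 \<ge> 0" using t by simp
    then show ?thesis using z(3) by (simp add: \<psi>\<^sub>R_def algebra_simps)
  qed (simp add: \<psi>\<^sub>R_def)
  \<comment> \<open>The logarithmic derivative of
    \<open>f (c * t) * exp (\<epsilon> * (R - t)\<^sup>2 / 2)\<close>. The second factor is chosen
    to cancel the cross term \<open>2 * \<epsilon> * \<Phi> t * (R - t)\<close>, which leaves
    \<open>c\<^sup>2 - \<epsilon> + \<epsilon>\<^sup>2 * (R - t)\<^sup>2\<close>.\<close>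
  define \<Phi> where "\<Phi> = (\<lambda>t. \<Psi> t - \<epsilon> * (R - t))"
  define \<Phi>' where "\<Phi>' = (\<lambda>t. - c\<^sup>2 - (\<Psi> t)\<^sup>2 + \<epsilon>)"
  have der: "(\<Phi> has_real_derivative \<Phi>' t) (at t)" if "0 < t" "t \<le> R" for t
    unfolding \<Phi>_def \<Phi>'_def by (auto intro!: derivative_eq_intros der\<Psi> that)
  have cont\<Psi>: "continuous_on {0<..R} \<Psi>"
    by (rule DERIV_continuous_on[of _ _ "\<lambda>t. - c\<^sup>2 - (\<Psi> t)\<^sup>2"]) (use der\<Psi> in \<open>auto intro: has_field_derivative_at_within\<close>)
  have cont\<Phi>': "continuous_on {0<..R} \<Phi>'" unfolding \<Phi>'_def by (intro continuous_intros cont\<Psi>)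
  have \<Phi>_half: "\<Phi> t \<ge> \<Psi> t / 2" "\<Psi> t \<ge> \<psi>\<^sub>R" if t: "0 < t" "t \<le> R" for t
  proof -
    have "0 \<le> c\<^sup>2 * (R - t)" using t by simp
    then show "\<Psi> t \<ge> \<psi>\<^sub>R" using \<Psi>_ge[OF t] by linarith
    have "\<epsilon> * (R - t) \<le> c\<^sup>2 / 2 * (R - t)" using c_ge t by (intro mult_right_mono) auto
    then show "\<Phi> t \<ge> \<Psi> t / 2" using \<Psi>_ge[OF t] \<psi>R unfolding \<Phi>_def by linarith
  qed
  have \<Phi>_pos: "\<Phi> t \<ge> 0" if "0 < t" "t \<le> R" for t using \<Phi>_half[OF that] \<psi>R by linarith
  have sq: "\<Phi>' t + (\<Phi> t)\<^sup>2 = - (c\<^sup>2 - \<epsilon>) - 2 * \<epsilon> * (R - t) * \<Psi> t + \<epsilon>\<^sup>2 * (R - t)\<^sup>2" for t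
    unfolding \<Phi>_def \<Phi>'_def by (simp add: power2_eq_square algebra_simps)
  define C where "C = c\<^sup>2 + \<epsilon> / 2"
  show ?thesis
  proof (rule that[of C])
    \<comment> \<open>As \<open>c\<^sup>2 R\<^sup>2 = T\<^sup>2 \<le> 4\<close>, the inaccuracy of
      the profile costs at most \<open>\<epsilon> / 4\<close>, less than the gain
      \<open>\<epsilon> / 2\<close>.\<close>
    have cR: "c\<^sup>2 * R\<^sup>2 \<le> 4"
    proof -
      have "(c * R)\<^sup>2 \<le> 2\<^sup>2" unfolding c(2) using Tle2 T by (intro power_mono) auto
      then show ?thesis by (simp add: power_mult_distrib)
    qed
    have "(pi2 2 / (2 * R))\<^sup>2 = (pi2 2)\<^sup>2 / (4 * R\<^sup>2)" by (simp add: power_divide power_mult_distrib)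
    also have "\<dots> \<le> ((1 + \<epsilon> * R\<^sup>2 / 16) * (4 * T\<^sup>2)) / (4 * R\<^sup>2)"
      using pi A by (intro divide_right_mono) auto
    also have "\<dots> = (1 + \<epsilon> * R\<^sup>2 / 16) * c\<^sup>2" using R by (simp add: c_def power_divide)
    also have "\<dots> = c\<^sup>2 + \<epsilon> / 16 * (c\<^sup>2 * R\<^sup>2)" by (simp add: algebra_simps)
    also have "\<dots> \<le> c\<^sup>2 + \<epsilon> / 16 * 4" using cR \<epsilon> by (intro add_left_mono mult_left_mono) auto
    also have "\<dots> < C" using \<epsilon> by (simp add: C_def)
    finally show "C > (pi2 2 / (2 * inradius \<Omega>))\<^sup>2" by (simp add: R_def)
    fix \<phi> G K assume "c1_compact \<Omega> \<phi> G K"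
    then interpret c1_compact \<Omega> \<phi> G K .
    have "\<exists>e>0. \<forall>x\<in>K. e \<le> infdist x (- \<Omega>)"
    proof -
      have "K \<noteq> {}" using nz supp by blast
      then have "\<exists>x\<in>K. \<forall>y\<in>K. infdist x (- \<Omega>) \<le> infdist y (- \<Omega>)"
        by (intro continuous_attains_inf K continuous_on_infdist continuous_on_id)
      then obtain x where x: "x \<in> K" "\<And>y. y \<in> K \<Longrightarrow> infdist x (- \<Omega>) \<le> infdist y (- \<Omega>)" by blast
      obtain e where "e > 0" "ball x e \<subseteq> \<Omega>" using x(1) K(2) open_domain open_contains_ball by blast
      then have "infdist x (- \<Omega>) > 0"
        using infdist_ge_ball[OF _ bounded_complement_nonempty[OF bounded_domain]] by fastforce
      then show ?thesis using x by blast
    qed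
    then obtain e where e: "e > 0" "\<And>x. x \<in> K \<Longrightarrow> e \<le> infdist x (- \<Omega>)" by blast
    \<comment> \<open>On \<open>{0<..R}\<close> the function \<open>\<Psi>\<close> is at least
      \<open>\<psi>\<^sub>R > 0\<close> and at most \<open>2 \<Phi>\<close>, so
      \<open>c\<^sup>2\<close> and \<open>2 \<epsilon> R \<Psi>\<close> are bounded by multiples of
      \<open>\<Phi>\<close>. The last entry makes \<open>\<delta>\<close> positive on
      \<open>K\<close>.\<close>
    define \<beta> where "\<beta> = max 1 (max (2 * (c\<^sup>2 / \<psi>\<^sub>R + 2 * \<epsilon> * R)) (2 * ln (card S) / e))"
    have \<beta>: "\<beta> > 0" "\<beta> \<ge> 2 * (c\<^sup>2 / \<psi>\<^sub>R + 2 * \<epsilon> * R)" "\<beta> \<ge> 2 * ln (card S) / e" by (auto simp: \<beta>_def)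
    \<comment> \<open>Instead of a polytope close to \<open>\<Omega>\<close>, only the half-spaces
      bounded by contact hyperplanes are used. Their soft distance is at most \<open>R\<close>
      everywhere, because a convex combination of the normals vanishes.\<close>
    interpret soft_distance S "\<lambda>v. v" "\<lambda>v. R + v \<bullet> x\<^sub>0" \<beta>
      using S neS \<beta> by unfold_locales auto
    have l: "l v x = R - v \<bullet> (x - x\<^sub>0)" for v x by (simp add: l_def inner_diff_right)
    have \<delta>R: "\<delta> x \<le> R" for x
    proof -
      have "\<delta> x = (\<Sum>v\<in>S. u v * \<delta> x)" by (simp add: sum_distrib_right[symmetric] u)
      also have "\<dots> \<le> (\<Sum>v\<in>S. u v * l v x)" using delta_le u by (intro sum_mono mult_left_mono) auto
      also have "\<dots> = R - (\<Sum>v\<in>S. u v *\<^sub>R v) \<bullet> (x - x\<^sub>0)"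
        using u(2) by (simp add: l right_diff_distrib sum_subtractf sum_distrib_right[symmetric] inner_sum_left)
      finally show ?thesis by (simp add: u)
    qed
    have pos: "\<delta> x > 0" if "x \<in> K" for x
    proof -
      have "l v x \<ge> e" if v: "v \<in> S" for v
      proof (rule field_le_epsilon)
        fix d :: real assume d: "d > 0"
        define t where "t = e - min d e"
        have t: "0 \<le> t" "t < e" "e - d \<le> t" using d e by (auto simp: t_def min_def)
        have "dist x (x + t *\<^sub>R v) = t" using t S(2)[OF v] by (simp add: dist_norm)
        then have "x + t *\<^sub>R v \<in> ball x (infdist x (- \<Omega>))" using t e(2)[OF \<open>x \<in> K\<close>] by simp
        then have "x + t *\<^sub>R v \<in> \<Omega>" by (rule subsetD[OF ball_infdist_subset])
        from S(3)[OF v this] have "v \<bullet> (x - x\<^sub>0) + t * (v \<bullet> v) \<le> R" by (simp add: inner_add_right inner_diff_right algebra_simps)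
        moreover have "v \<bullet> v = 1" using S(2)[OF v] by (simp add: dot_square_norm)
        ultimately show "e \<le> l v x + d" using t by (simp add: l)
      qed
      then have "e - ln (card S) / \<beta> \<le> \<delta> x" by (rule delta_ge)
      moreover have "2 * ln (card S) \<le> \<beta> * e" using \<beta>(3) e by (simp add: field_simps)
      then have "ln (card S) / \<beta> \<le> e / 2" using \<beta>(1) by (simp add: field_simps)
      ultimately show ?thesis using e(1) by linarith
    qed
    have beta_ge: "\<beta> * \<Phi> t \<ge> - (\<Phi>' t + (\<Phi> t)\<^sup>2)" if t: "0 < t" "t \<le> R" for t
    proof -
      note h = \<Phi>_half[OF t]
      have "c\<^sup>2 * 1 \<le> c\<^sup>2 * (\<Psi> t / \<psi>\<^sub>R)" using h(2) \<psi>R by (intro mult_left_mono) auto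
      moreover have "2 * \<epsilon> * (R - t) * \<Psi> t \<le> 2 * \<epsilon> * R * \<Psi> t" using h \<psi>R \<epsilon> t R by (intro mult_right_mono mult_left_mono) auto
      moreover have "0 \<le> \<epsilon>\<^sup>2 * (R - t)\<^sup>2" by simp
      ultimately have "- (\<Phi>' t + (\<Phi> t)\<^sup>2) \<le> c\<^sup>2 * (\<Psi> t / \<psi>\<^sub>R) + 2 * \<epsilon> * R * \<Psi> t"
        unfolding sq using \<epsilon>(1) by linarith
      also have "\<dots> = (2 * (c\<^sup>2 / \<psi>\<^sub>R + 2 * \<epsilon> * R)) * (\<Psi> t / 2)" by (simp add: algebra_simps)
      also have "\<dots> \<le> \<beta> * \<Phi> t" using \<beta> h \<psi>R by (intro mult_mono) auto
      finally show ?thesis .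
    qed
    have w: "c\<^sup>2 - \<epsilon> \<le> - (\<Phi>' t + (\<Phi> t)\<^sup>2) - 2 * \<epsilon> * \<Phi> t * (R - t)" for t
    proof -
      have "- (\<Phi>' t + (\<Phi> t)\<^sup>2) - 2 * \<epsilon> * \<Phi> t * (R - t) = c\<^sup>2 - \<epsilon> + \<epsilon>\<^sup>2 * (R - t)\<^sup>2"
        unfolding sq unfolding \<Phi>_def by (simp add: power2_eq_square algebra_simps)
      then show ?thesis by simp
    qed
    have center: "l v x\<^sub>0 \<le> R" for v by (simp add: l)
    have Dle: "norm (x - x\<^sub>0) \<le> D" if "x \<in> \<Omega>" for x using D(2)[OF that] .
    have "(LINT x|lborel. (norm (G x))\<^sup>2) \<ge> (LINT x|lborel. ((c\<^sup>2 - \<epsilon>) + (\<epsilon> * real DIM('a) - \<epsilon>\<^sup>2 * D\<^sup>2)) * (\<phi> x)\<^sup>2)"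
      by (rule dirichlet_ge_profile(2)[OF K open_domain pos \<delta>R \<phi> G supp der cont\<Phi>' \<Phi>_pos beta_ge w continuous_on_const _ center Dle]) (use \<epsilon> in auto)
    moreover have "(LINT x|lborel. ((c\<^sup>2 - \<epsilon>) + (\<epsilon> * real DIM('a) - \<epsilon>\<^sup>2 * D\<^sup>2)) * (\<phi> x)\<^sup>2)
        = ((c\<^sup>2 - \<epsilon>) + (\<epsilon> * real DIM('a) - \<epsilon>\<^sup>2 * D\<^sup>2)) * (LINT x|lborel. (\<phi> x)\<^sup>2)"
      by simp
    \<comment> \<open>In dimension \<open>n \<ge> 2\<close> the balance
      \<open>- \<epsilon> + n \<epsilon> - \<epsilon> / 2\<close> is at least
      \<open>\<epsilon> / 2\<close>.\<close>
    moreover have "C \<le> (c\<^sup>2 - \<epsilon>) + (\<epsilon> * real DIM('a) - \<epsilon>\<^sup>2 * D\<^sup>2)"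
    proof -
      have "\<epsilon> * 2 \<le> \<epsilon> * real DIM('a)" using dim \<epsilon> by (intro mult_left_mono) auto
      moreover have "\<epsilon>\<^sup>2 * D\<^sup>2 \<le> \<epsilon> * (1 / 2)" unfolding power2_eq_square[of \<epsilon>] mult.assoc using \<epsilon> by (intro mult_left_mono) auto
      ultimately show ?thesis unfolding C_def by linarith
    qed
    then have "C * (LINT x|lborel. (\<phi> x)\<^sup>2) \<le> ((c\<^sup>2 - \<epsilon>) + (\<epsilon> * real DIM('a) - \<epsilon>\<^sup>2 * D\<^sup>2)) * (LINT x|lborel. (\<phi> x)\<^sup>2)"
      by (intro mult_right_mono) auto
    ultimately show "(LINT x|lborel. (norm (G x))\<^sup>2) \<ge> C * (LINT x|lborel. (\<phi> x)\<^sup>2)" by linarith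
  qed
qed

section \<open>Smoothing Sobolev functions on the unit interval\<close>

lemma smooth_ramp_exists:
  assumes "a < b"
  obtains H :: "real \<Rightarrow> real" where "smooth H" "\<And>x. x \<le> a \<Longrightarrow> H x = 0" "\<And>x. x \<ge> b \<Longrightarrow> H x = 1"
    "\<And>x. 0 \<le> H x" "\<And>x. H x \<le> 1" "\<And>x. 0 \<le> deriv H x" "\<And>x. x < a \<or> b < x \<Longrightarrow> deriv H x = 0"
proof -
  obtain S :: "real \<Rightarrow> real" where S: "smooth S" "\<And>x. x \<le> 0 \<Longrightarrow> S x = 0" "\<And>x. x \<ge> 1 \<Longrightarrow> S x = 1" "mono S"
    "\<And>x. 0 \<le> S x" "\<And>x. S x \<le> 1" using smooth_step_exists by blast
  define H where "H = (\<lambda>x. S (x / (b - a) + - (a / (b - a))))"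
  have H: "H x = S ((x - a) / (b - a))" for x unfolding H_def by (simp add: diff_divide_distrib)
  have sm: "smooth H" unfolding H_def using smooth_affine[OF S(1), of 1 "1 / (b - a)" "- (a / (b - a))"] by simp
  have H0: "H x = 0" if "x \<le> a" for x
    unfolding H by (rule S(2)) (use that assms in \<open>simp add: divide_le_0_iff\<close>)
  have H1: "H x = 1" if "x \<ge> b" for x
    unfolding H by (rule S(3)) (use that assms in simp)
  have "mono H"
    by (intro monoI) (use assms in \<open>auto simp: H intro!: monoD[OF S(4)] divide_right_mono\<close>)
  then have nn: "deriv H x \<ge> 0" for x
    by (intro mono_on_imp_deriv_nonneg[of UNIV H _ x] smooth_real_derivative(1)[OF sm]) simp_all
  have z: "deriv H x = 0" if "x < a \<or> b < x" for x
  proof -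
    have "(H has_real_derivative 0) (at x)"
      using that
    proof
      assume "x < a"
      have "((\<lambda>_. 0) has_real_derivative 0) (at x)" by simp
      then show ?thesis
        by (rule has_field_derivative_transform_within_open[of _ _ _ "{..<a}"]) (use \<open>x < a\<close> H0 in auto)
    next
      assume "b < x"
      have "((\<lambda>_. 1) has_real_derivative 0) (at x)" by simp
      then show ?thesis
        by (rule has_field_derivative_transform_within_open[of _ _ _ "{b<..}"]) (use \<open>b < x\<close> H1 in auto)
    qed
    then show ?thesis by (rule DERIV_imp_deriv)
  qed
  show ?thesis using that[OF sm H0 H1 _ _ nn z] S(5,6) by (simp add: H)
qed

text \<open>The odd extension of a primitive of a smooth ramp from \<open>2 * \<eta>\<close> to
  \<open>3 * \<eta>\<close>. Its slope is at most 1 in absolute value, so composing with it does not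
  increase the Dirichlet energy.\<close>

lemma smooth_soft_threshold_exists:
  assumes "\<eta> > 0"
  obtains \<theta> :: "real \<Rightarrow> real" where "smooth \<theta>" "\<And>s. \<bar>s\<bar> \<le> 2 * \<eta> \<Longrightarrow> \<theta> s = 0" "\<And>s. \<bar>\<theta> s - s\<bar> \<le> 3 * \<eta>"
    "\<And>s. \<bar>deriv \<theta> s\<bar> \<le> 1"
proof -
  obtain H :: "real \<Rightarrow> real" where H: "smooth H" "\<And>x. x \<le> 2 * \<eta> \<Longrightarrow> H x = 0" "\<And>x. x \<ge> 3 * \<eta> \<Longrightarrow> H x = 1"
    "\<And>x. 0 \<le> H x" "\<And>x. H x \<le> 1"
  proof (rule smooth_ramp_exists)
    show "2 * \<eta> < 3 * \<eta>" using assms by simp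
  qed blast
  define P where "P = (\<lambda>t. integral {-1..t} H)"
  have Hz: "H t = 0" if "t \<le> 0" for t using H(2)[of t] that assms by simp
  note c = smooth_derivative(3)[OF H(1), of UNIV]
  have P0: "P t = 0" if "t \<le> 0" for t unfolding P_def by (rule antiderivative_vanishing_left(1)[OF c Hz that])
  have P': "(P has_real_derivative H t) (at t)" for t unfolding P_def by (rule antiderivative_vanishing_left(2)[OF c Hz])
  have mono: "P s \<le> P t" if "s \<le> t" for s t
    by (rule DERIV_nonneg_imp_nondecreasing[OF that]) (rule exI, rule conjI[OF P' H(4)])
  have mono2: "s - P s \<le> t - P t" if "s \<le> t" for s t
  proof (rule DERIV_nonneg_imp_nondecreasing[OF that, of "\<lambda>s. s - P s"])
    fix x
    have "((\<lambda>s. s - P s) has_real_derivative 1 - H x) (at x)" by (intro DERIV_diff DERIV_ident P')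
    then show "\<exists>y. ((\<lambda>s. s - P s) has_real_derivative y) (at x) \<and> 0 \<le> y" using H(5)[of x] by auto
  qed
  have P2: "P t = 0" if "t \<le> 2 * \<eta>" for t
  proof (cases "t \<le> 0")
    case False
    then have "0 < t" by simp
    from MVT2[OF this, of P H] P' obtain z where "0 < z" "z < t" "P t - P 0 = (t - 0) * H z" by blast
    then show ?thesis using H(2)[of z] P0[of 0] that by simp
  qed (rule P0)
  have P3: "t - P t \<le> 3 * \<eta>" for t
  proof (cases "t \<le> 3 * \<eta>")
    case True
    have "P t \<ge> 0" using mono[of "min t 0" t] P0[of "min t 0"] by simp
    then show ?thesis using True by simp
  next
    case False
    then have "3 * \<eta> < t" by simp
    from MVT2[OF this, of P H] P' obtain z where "3 * \<eta> < z" "z < t" "P t - P (3 * \<eta>) = (t - 3 * \<eta>) * H z" by blast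
    moreover have "P (3 * \<eta>) \<ge> 0" using mono[of 0 "3 * \<eta>"] P0[of 0] assms by simp
    ultimately show ?thesis using H(3)[of z] by simp
  qed
  have P4: "t - P t \<ge> 0" if "t \<ge> 0" for t using mono2[OF that] P0[of 0] by simp
  define \<theta> where "\<theta> = (\<lambda>s. P s - P (- s))"
  have "((\<lambda>s. P (- s)) has_real_derivative H (- s) * (- 1)) (at s)" for s
    by (rule DERIV_chain2[OF P']) (auto intro!: derivative_eq_intros)
  then have D: "(\<theta> has_real_derivative H s + H (- s)) (at s)" for s
    unfolding \<theta>_def using DERIV_diff[OF P'[of s]] by fastforce
  have "smooth (\<lambda>s. H s + H (- s))"
    using H(1) smooth_affine[OF H(1), of 1 "- 1" 0] by (simp add: smooth_def Ck_add)
  then have "smooth \<theta>" by (rule smooth_of_derivative[OF D])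
  moreover have "\<theta> s = 0" if "\<bar>s\<bar> \<le> 2 * \<eta>" for s unfolding \<theta>_def using P2[of s] P2[of "- s"] that by simp
  moreover have "\<bar>\<theta> s - s\<bar> \<le> 3 * \<eta>" for s
    using P0[of s] P0[of "- s"] P3[of s] P3[of "- s"] P4[of s] P4[of "- s"] unfolding \<theta>_def by (cases "s \<ge> 0") auto
  moreover have "\<bar>deriv \<theta> s\<bar> \<le> 1" for s
  proof -
    have "deriv \<theta> s = H s + H (- s)" by (rule DERIV_imp_deriv[OF D])
    then show ?thesis using H(4,5)[of s] H(4,5)[of "- s"] Hz[of s] Hz[of "- s"] by (cases "s \<le> 0") auto
  qed
  ultimately show ?thesis using that by blast
qed

text \<open>Differentiation under the integral moves the derivative to the kernel, so convolutions
  with smooth kernels form a class closed under derivatives.\<close>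

lemma smooth_convolution_unit:
  fixes \<phi> k :: "real \<Rightarrow> real"
  assumes \<phi>: "continuous_on {0..1} \<phi>" and k: "smooth k"
  shows "((\<lambda>x. integral {0..1} (\<lambda>y. \<phi> y * k (x - y))) has_real_derivative integral {0..1} (\<lambda>y. \<phi> y * deriv k (x - y))) (at x)"
    and "smooth (\<lambda>x. integral {0..1} (\<lambda>y. \<phi> y * k (x - y)))"
proof -
  have der: "((\<lambda>x. integral {0..1} (\<lambda>y. \<phi> y * k (x - y))) has_real_derivative integral {0..1} (\<lambda>y. \<phi> y * deriv k (x - y))) (at x)"
    if k: "smooth k" for k x
  proof -
    have ck: "continuous_on A (\<lambda>y. k (x - y))" for A x
      by (rule continuous_on_compose2[OF smooth_derivative(3)[OF k, of UNIV]]) (auto intro!: continuous_intros)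
    have "((\<lambda>x. integral (cbox 0 1) (\<lambda>y. \<phi> y * k (x - y))) has_real_derivative
        integral (cbox 0 1) (\<lambda>y. \<phi> y * deriv k (x - y))) (at x within UNIV)"
    proof (rule leibniz_rule_field_derivative)
      fix x t :: real
      have "((\<lambda>x. k (x - t)) has_real_derivative deriv k (x - t) * 1) (at x)"
        by (rule DERIV_chain2[OF smooth_real_derivative(1)[OF k]]) (auto intro!: derivative_eq_intros)
      then show "((\<lambda>x. \<phi> t * k (x - t)) has_real_derivative \<phi> t * deriv k (x - t)) (at x within UNIV)"
        using DERIV_cmult[of "\<lambda>x. k (x - t)" "deriv k (x - t) * 1" x UNIV "\<phi> t"] by simp
    next
      show "(\<lambda>y. \<phi> y * k (x - y)) integrable_on cbox 0 1" for x
        by (rule integrable_continuous) (use \<phi> in \<open>auto intro!: continuous_on_mult ck\<close>)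
    next
      have "continuous_on (UNIV \<times> cbox 0 1) (\<lambda>z. \<phi> (snd z) * deriv k (fst z - snd z))"
      proof (rule continuous_on_mult)
        show "continuous_on (UNIV \<times> cbox 0 1) (\<lambda>z. \<phi> (snd z))"
          by (rule continuous_on_compose2[OF \<phi>]) (auto intro!: continuous_intros)
        show "continuous_on (UNIV \<times> cbox 0 1) (\<lambda>z. deriv k (fst z - snd z))"
          by (rule continuous_on_compose2[OF smooth_derivative(3)[OF smooth_real_derivative(2)[OF k], of UNIV]])
             (auto intro!: continuous_intros)
      qed
      then show "continuous_on (UNIV \<times> cbox 0 1) (\<lambda>(x, t). \<phi> t * deriv k (x - t))"
        by (simp add: case_prod_unfold)
    qed simp_all
    then show ?thesis by simp
  qed
  show "((\<lambda>x. integral {0..1} (\<lambda>y. \<phi> y * k (x - y))) has_real_derivative integral {0..1} (\<lambda>y. \<phi> y * deriv k (x - y))) (at x)"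
    by (rule der[OF k])
  define X where "X = {\<lambda>x. integral {0..1} (\<lambda>y. \<phi> y * k (x - y)) | k. smooth k}"
  show "smooth (\<lambda>x. integral {0..1} (\<lambda>y. \<phi> y * k (x - y)))"
  proof (rule smooth_real_coinduct[of X])
    fix f assume "f \<in> X"
    then obtain k where k: "smooth k" and f: "f = (\<lambda>x. integral {0..1} (\<lambda>y. \<phi> y * k (x - y)))" unfolding X_def by blast
    show "\<exists>f'\<in>X. \<forall>x. (f has_real_derivative f' x) (at x)"
    proof (intro bexI[of _ "\<lambda>x. integral {0..1} (\<lambda>y. \<phi> y * deriv k (x - y))"] allI)
      show "(f has_real_derivative integral {0..1} (\<lambda>y. \<phi> y * deriv k (x - y))) (at x)" for x
        unfolding f by (rule der[OF k])
      show "(\<lambda>x. integral {0..1} (\<lambda>y. \<phi> y * deriv k (x - y))) \<in> X"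
        unfolding X_def by (intro CollectI exI[of _ "deriv k"] conjI refl smooth_real_derivative(2)[OF k])
    qed
  next
    show "(\<lambda>x. integral {0..1} (\<lambda>y. \<phi> y * k (x - y))) \<in> X"
      unfolding X_def by (intro CollectI exI[of _ k] conjI refl k)
  qed
qed

text \<open>The variance of \<open>h\<close> under the probability density \<open>r\<close> is
  nonnegative.\<close>

lemma square_weighted_integral_le:
  fixes h r :: "'a \<Rightarrow> real"
  assumes "integrable M (\<lambda>x. (h x)\<^sup>2 * r x)" "integrable M r" "integrable M (\<lambda>x. h x * r x)" "(\<integral>x. r x \<partial>M) = 1" "\<And>x. 0 \<le> r x"
  shows "(\<integral>x. h x * r x \<partial>M)\<^sup>2 \<le> (\<integral>x. (h x)\<^sup>2 * r x \<partial>M)"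
proof -
  define m where "m = (\<integral>x. h x * r x \<partial>M)"
  have "0 \<le> (\<integral>x. (h x - m)\<^sup>2 * r x \<partial>M)" using assms(5) by (intro integral_nonneg_AE) simp
  also have "\<dots> = (\<integral>x. (h x)\<^sup>2 * r x - 2 * m * (h x * r x) + m\<^sup>2 * r x \<partial>M)"
    by (intro Bochner_Integration.integral_cong) (auto simp: power2_eq_square algebra_simps)
  also have "\<dots> = (\<integral>x. (h x)\<^sup>2 * r x \<partial>M) - 2 * m * m + m\<^sup>2"
    using assms by (simp add: m_def)
  finally show ?thesis by (simp add: m_def power2_eq_square)
qed

text \<open>The kernel is the derivative of a smooth step, so it is nonnegative with total mass 1.
  At interior points the reflected kernel is a test function, so the derivative of the mollified
  function is the mollification of \<open>g\<close>; by Jensen's inequality and Tonelli's theorem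
  its energy there does not exceed that of \<open>g\<close>.\<close>

lemma W12_mollification:
  fixes \<phi> g :: "real \<Rightarrow> real"
  assumes W: "W12 \<phi> g" and cont: "continuous_on {0..1} \<phi>" and \<epsilon>: "0 < \<epsilon>" "\<epsilon> < 1 / 2"
  obtains \<psi> where "smooth \<psi>"
    "\<And>x \<eta>. x \<in> {\<epsilon>..1 - \<epsilon>} \<Longrightarrow> (\<And>y. y \<in> {0..1} \<Longrightarrow> \<bar>x - y\<bar> \<le> \<epsilon> \<Longrightarrow> \<bar>\<phi> y - \<phi> x\<bar> \<le> \<eta>) \<Longrightarrow> \<bar>\<psi> x - \<phi> x\<bar> \<le> \<eta>"
    "(\<integral>\<^sup>+x. indicator {\<epsilon><..<1 - \<epsilon>} x * ennreal ((deriv \<psi> x)\<^sup>2) \<partial>lborel)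
      \<le> ennreal (LINT x:{0<..<1}|lebesgue. \<bar>g x\<bar> powr 2)"
proof -
  obtain H :: "real \<Rightarrow> real" where H: "smooth H" "\<And>x. x \<le> - \<epsilon> \<Longrightarrow> H x = 0" "\<And>x. x \<ge> \<epsilon> \<Longrightarrow> H x = 1"
    "\<And>x. 0 \<le> deriv H x" "\<And>x. x < - \<epsilon> \<or> \<epsilon> < x \<Longrightarrow> deriv H x = 0"
  proof (rule smooth_ramp_exists)
    show "- \<epsilon> < \<epsilon>" using \<epsilon> by simp
  qed blast
  define \<rho> where "\<rho> = deriv H"
  have sm: "smooth \<rho>" unfolding \<rho>_def by (rule smooth_real_derivative(2)[OF H(1)])
  have \<rho>0: "\<rho> x = 0" if "\<bar>x\<bar> > \<epsilon>" for x unfolding \<rho>_def by (rule H(5)) (use that in auto)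
  have \<rho>nn: "\<rho> x \<ge> 0" for x unfolding \<rho>_def by (rule H(4))
  have c\<rho>: "continuous_on A \<rho>" for A by (rule smooth_derivative(3)[OF sm])
  have c\<rho>': "continuous_on A (deriv \<rho>)" for A by (rule smooth_derivative(3)[OF smooth_real_derivative(2)[OF sm]])
  have HD: "(H has_real_derivative \<rho> x) (at x)" for x unfolding \<rho>_def by (rule smooth_real_derivative(1)[OF H(1)])
  obtain C where C: "\<And>x. \<rho> x \<le> C" "C \<ge> 0"
  proof -
    have "bounded (\<rho> ` {- \<epsilon>..\<epsilon>})" by (intro compact_imp_bounded compact_continuous_image c\<rho>) simp
    then have "\<exists>C. \<forall>x\<in>{- \<epsilon>..\<epsilon>}. \<bar>\<rho> x\<bar> \<le> C" by (auto simp: bounded_real)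
    then obtain C where C: "\<And>x. x \<in> {- \<epsilon>..\<epsilon>} \<Longrightarrow> \<bar>\<rho> x\<bar> \<le> C" by blast
    have "C \<ge> 0" using C[of 0] \<epsilon> by auto
    moreover have "\<rho> x \<le> C" for x using C[of x] \<rho>0[of x] \<open>C \<ge> 0\<close> by (cases "\<bar>x\<bar> \<le> \<epsilon>") (auto simp: abs_le_iff)
    ultimately show ?thesis using that by blast
  qed
  have ct: "continuous_on A (\<lambda>y. \<rho> (x - y))" for A x
    by (rule continuous_on_compose2[OF c\<rho>[of UNIV]]) (auto intro!: continuous_intros)
  have int1: "((\<lambda>y. \<rho> (x - y)) has_integral 1) {0..1}" if x: "x \<in> {\<epsilon>..1 - \<epsilon>}" for x
  proof -
    have "((\<lambda>y. H (x - y)) has_real_derivative \<rho> (x - y) * (- 1)) (at y within {0..1})" for y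
      by (rule has_field_derivative_at_within, rule DERIV_chain2[OF HD]) (auto intro!: derivative_eq_intros)
    then have "((\<lambda>y. - H (x - y)) has_vector_derivative \<rho> (x - y)) (at y within {0..1})" for y
      using DERIV_minus[of "\<lambda>y. H (x - y)" "\<rho> (x - y) * (- 1)" y "{0..1}"]
      by (simp add: has_real_derivative_iff_has_vector_derivative)
    then have "((\<lambda>y. \<rho> (x - y)) has_integral (- H (x - 1) - (- H (x - 0)))) {0..1}"
      by (intro fundamental_theorem_of_calculus) auto
    then show ?thesis using H(2)[of "x - 1"] H(3)[of x] x by simp
  qed
  define \<psi> where "\<psi> = (\<lambda>x. integral {0..1} (\<lambda>y. \<phi> y * \<rho> (x - y)))"
  have s\<psi>: "smooth \<psi>" unfolding \<psi>_def by (rule smooth_convolution_unit(2)[OF cont sm])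
  have d\<psi>: "deriv \<psi> x = integral {0..1} (\<lambda>y. \<phi> y * deriv \<rho> (x - y))" for x
    unfolding \<psi>_def by (rule DERIV_imp_deriv[OF smooth_convolution_unit(1)[OF cont sm]])
  have approx: "\<bar>\<psi> x - \<phi> x\<bar> \<le> \<eta>"
    if x: "x \<in> {\<epsilon>..1 - \<epsilon>}" and h: "\<And>y. y \<in> {0..1} \<Longrightarrow> \<bar>x - y\<bar> \<le> \<epsilon> \<Longrightarrow> \<bar>\<phi> y - \<phi> x\<bar> \<le> \<eta>" for x \<eta>
  proof -
    have i1: "(\<lambda>y. \<phi> y * \<rho> (x - y)) integrable_on {0..1}"
      by (intro integrable_continuous_real continuous_on_mult cont ct)
    have i2: "((\<lambda>y. \<phi> y * \<rho> (x - y) - \<phi> x * \<rho> (x - y)) has_integral (\<psi> x - \<phi> x * 1)) {0..1}"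
      unfolding \<psi>_def by (intro has_integral_diff integrable_integral i1 has_integral_mult_right int1 x)
    have i3: "((\<lambda>y. \<eta> * \<rho> (x - y)) has_integral \<eta> * 1) {0..1}"
      by (intro has_integral_mult_right int1 x)
    have "norm (integral {0..1} (\<lambda>y. \<phi> y * \<rho> (x - y) - \<phi> x * \<rho> (x - y))) \<le> integral {0..1} (\<lambda>y. \<eta> * \<rho> (x - y))"
    proof (rule integral_norm_bound_integral[OF has_integral_integrable[OF i2] has_integral_integrable[OF i3]])
      fix y :: real assume y: "y \<in> {0..1}"
      have "\<bar>\<phi> y - \<phi> x\<bar> * \<rho> (x - y) \<le> \<eta> * \<rho> (x - y)"
        using h[OF y] \<rho>0[of "x - y"] \<rho>nn[of "x - y"] by (cases "\<bar>x - y\<bar> \<le> \<epsilon>") (auto intro: mult_right_mono)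
      then show "norm (\<phi> y * \<rho> (x - y) - \<phi> x * \<rho> (x - y)) \<le> \<eta> * \<rho> (x - y)"
        using \<rho>nn[of "x - y"] by (simp add: left_diff_distrib[symmetric] abs_mult)
    qed
    then show ?thesis using integral_unique[OF i2] integral_unique[OF i3] by (simp only: mult_1_right real_norm_def)
  qed
  define G where "G = (\<lambda>y. indicat_real {0<..<1} y * g y)"
  have mG: "G \<in> borel_measurable lebesgue"
    using W unfolding W12_def in_Lp_def set_borel_measurable_def G_def by simp
  have G2: "indicat_real {0<..<1} y *\<^sub>R \<bar>g y\<bar> powr 2 = (G y)\<^sup>2" for y
    by (auto simp: G_def indicator_def)
  have iG: "integrable lebesgue (\<lambda>y. (G y)\<^sup>2)"
    using W unfolding W12_def in_Lp_def set_integrable_def G2 by simp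
  have E: "(LINT x:{0<..<1}|lebesgue. \<bar>g x\<bar> powr 2) = (\<integral>y. (G y)\<^sup>2 \<partial>lebesgue)"
    unfolding set_lebesgue_integral_def G2 ..
  \<comment> \<open>Tonelli's theorem is applied to Borel functions; \<open>g1\<close> is a Borel
    version of the zero extension of \<open>g\<close>.\<close>
  obtain g1 where g1: "g1 \<in> borel_measurable lborel" and ae: "AE y in lborel. G y = g1 y"
    using completion_ex_borel_measurable_real[OF mG] by blast
  have pointwise: "ennreal ((deriv \<psi> x)\<^sup>2) \<le> (\<integral>\<^sup>+y. ennreal ((g1 y)\<^sup>2 * \<rho> (x - y)) \<partial>lborel)" if x: "x \<in> {\<epsilon><..<1 - \<epsilon>}" for x
  proof -
    define t where "t = (\<lambda>y. \<rho> (x - y))"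
    have st: "smooth t" unfolding t_def using smooth_affine[OF sm, of 1 "- 1" x] by simp
    have t0: "t y = 0" if "y \<notin> {x - \<epsilon>..x + \<epsilon>}" for y unfolding t_def by (rule \<rho>0) (use that in auto)
    have "t \<in> test_functions {0<..<1}"
      by (rule test_functionsI[OF st compact_Icc _ t0]) (use x in auto)
    then have "(LINT y:{0<..<1}|lebesgue. \<phi> y * deriv t y) = - (LINT y:{0<..<1}|lebesgue. g y * t y)"
      using W unfolding W12_def by blast
    moreover have "deriv t y = - deriv \<rho> (x - y)" for y
    proof (rule DERIV_imp_deriv)
      have "((\<lambda>y. \<rho> (x - y)) has_real_derivative deriv \<rho> (x - y) * (- 1)) (at y)"
        by (rule DERIV_chain2[OF smooth_real_derivative(1)[OF sm]]) (auto intro!: derivative_eq_intros)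
      then show "(t has_real_derivative - deriv \<rho> (x - y)) (at y)" unfolding t_def by simp
    qed
    moreover have "(LINT y:{0<..<1}|lebesgue. \<phi> y * deriv t y) = integral {0..1} (\<lambda>y. \<phi> y * deriv t y)"
      by (intro set_integral_unit_continuous(1) continuous_on_mult cont smooth_derivative(3)[OF smooth_real_derivative(2)[OF st]])
    ultimately have "deriv \<psi> x = (LINT y:{0<..<1}|lebesgue. g y * t y)"
      unfolding d\<psi> by simp
    also have "\<dots> = (\<integral>y. G y * t y \<partial>lebesgue)"
      unfolding set_lebesgue_integral_def G_def by (simp add: mult.assoc)
    finally have dG: "deriv \<psi> x = (\<integral>y. G y * t y \<partial>lebesgue)" .
    have ctt: "continuous_on UNIV t" by (rule smooth_derivative(3)[OF st])
    have it: "integrable lborel t"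
      by (rule integrable_continuous_compact_support[OF ctt compact_Icc t0])
    then have it': "integrable lebesgue t" by (subst integrable_completion) auto
    have "(t has_integral 1) {0..1}" using int1[of x] x unfolding t_def by simp
    then have "(t has_integral 1) UNIV" by (rule has_integral_on_superset) (use t0 x in auto)
    then have "integral UNIV t = 1" by (rule integral_unique)
    then have "(\<integral>y. t y \<partial>lborel) = 1" using integral_lborel[OF it] by simp
    then have t1: "(\<integral>y. t y \<partial>lebesgue) = 1"
      using integral_completion[OF borel_measurable_integrable[OF it]] by simp
    have mt: "t \<in> borel_measurable lebesgue" using it' by (rule borel_measurable_integrable)
    have tnn: "0 \<le> t y" "t y \<le> C" for y unfolding t_def using \<rho>nn C by auto
    have i1: "integrable lebesgue (\<lambda>y. (G y)\<^sup>2 * t y)"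
    proof (rule Bochner_Integration.integrable_bound)
      show "integrable lebesgue (\<lambda>y. (G y)\<^sup>2 * C)" using iG by simp
      show "AE y in lebesgue. norm ((G y)\<^sup>2 * t y) \<le> norm ((G y)\<^sup>2 * C)"
        using tnn C by (intro always_eventually allI) (auto simp: abs_mult intro!: mult_left_mono)
    qed (use mG mt in simp)
    have i2: "integrable lebesgue (\<lambda>y. G y * t y)"
    proof (rule Bochner_Integration.integrable_bound)
      show "integrable lebesgue (\<lambda>y. (G y)\<^sup>2 * t y + t y)" using i1 it' by simp
      have "\<bar>G y\<bar> \<le> (G y)\<^sup>2 + 1" for y
        using sum_power2_ge_zero[of "\<bar>G y\<bar> - 1" 0] zero_le_power2[of "G y"] by (simp add: power2_diff) 
      then have "\<bar>G y\<bar> * t y \<le> ((G y)\<^sup>2 + 1) * t y" for y using tnn by (intro mult_right_mono)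
      then show "AE y in lebesgue. norm (G y * t y) \<le> norm ((G y)\<^sup>2 * t y + t y)"
        using tnn by (intro always_eventually allI) (simp add: abs_mult distrib_right)
    qed (use mG mt in simp)
    have "(deriv \<psi> x)\<^sup>2 \<le> (\<integral>y. (G y)\<^sup>2 * t y \<partial>lebesgue)"
      unfolding dG by (rule square_weighted_integral_le[OF i1 it' i2 t1 tnn(1)])
    then have "ennreal ((deriv \<psi> x)\<^sup>2) \<le> ennreal (\<integral>y. (G y)\<^sup>2 * t y \<partial>lebesgue)" by (rule ennreal_leI)
    also have "\<dots> = (\<integral>\<^sup>+y. ennreal ((G y)\<^sup>2 * t y) \<partial>lebesgue)"
      using tnn by (intro nn_integral_eq_integral[symmetric] i1) auto
    also have "\<dots> = (\<integral>\<^sup>+y. ennreal ((g1 y)\<^sup>2 * \<rho> (x - y)) \<partial>lborel)"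
      unfolding nn_integral_completion t_def using ae by (intro nn_integral_cong_AE) auto
    finally show ?thesis .
  qed
  have [measurable]: "g1 \<in> borel_measurable borel" using g1 by simp
  have [measurable]: "\<rho> \<in> borel_measurable borel" using c\<rho> by (rule borel_measurable_continuous_onI)
  have "(\<integral>\<^sup>+x. indicator {\<epsilon><..<1 - \<epsilon>} x * ennreal ((deriv \<psi> x)\<^sup>2) \<partial>lborel)
      \<le> (\<integral>\<^sup>+x. \<integral>\<^sup>+y. ennreal ((g1 y)\<^sup>2 * \<rho> (x - y)) \<partial>lborel \<partial>lborel)"
    using pointwise by (intro nn_integral_mono) (auto simp: indicator_def)
  also have "\<dots> = (\<integral>\<^sup>+y. \<integral>\<^sup>+x. ennreal ((g1 y)\<^sup>2 * \<rho> (x - y)) \<partial>lborel \<partial>lborel)"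
    by (rule lborel_pair.Fubini'[symmetric]) measurable
  also have "\<dots> = (\<integral>\<^sup>+y. ennreal ((g1 y)\<^sup>2) \<partial>lborel)"
  proof (rule nn_integral_cong)
    fix y :: real
    have "((\<lambda>x. H (x - y)) has_real_derivative \<rho> (x - y) * 1) (at x within {y - \<epsilon>..y + \<epsilon>})" for x
      by (rule has_field_derivative_at_within, rule DERIV_chain2[OF HD]) (auto intro!: derivative_eq_intros)
    then have "((\<lambda>x. \<rho> (x - y)) has_integral (H (y + \<epsilon> - y) - H (y - \<epsilon> - y))) {y - \<epsilon>..y + \<epsilon>}"
      using \<epsilon> by (intro fundamental_theorem_of_calculus) (auto simp: has_real_derivative_iff_has_vector_derivative[symmetric])
    then have "((\<lambda>x. \<rho> (x - y)) has_integral 1) {y - \<epsilon>..y + \<epsilon>}"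
      using H(2)[of "- \<epsilon>"] H(3)[of \<epsilon>] by simp
    then have "((\<lambda>x. \<rho> (x - y)) has_integral 1) UNIV"
      by (rule has_integral_on_superset) (auto intro!: \<rho>0)
    from nn_integral_has_integral_lborel[OF _ \<rho>nn this] have "(\<integral>\<^sup>+x. ennreal (\<rho> (x - y)) \<partial>lborel) = 1" by simp
    then show "(\<integral>\<^sup>+x. ennreal ((g1 y)\<^sup>2 * \<rho> (x - y)) \<partial>lborel) = ennreal ((g1 y)\<^sup>2)"
      using \<rho>nn by (simp add: ennreal_mult nn_integral_cmult)
  qed
  also have "\<dots> = (\<integral>\<^sup>+y. ennreal ((G y)\<^sup>2) \<partial>lebesgue)"
    unfolding nn_integral_completion using ae by (intro nn_integral_cong_AE) auto
  also have "\<dots> = ennreal (LINT x:{0<..<1}|lebesgue. \<bar>g x\<bar> powr 2)"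
    unfolding E by (rule nn_integral_eq_integral[OF iG]) simp
  finally have fin: "(\<integral>\<^sup>+x. indicator {\<epsilon><..<1 - \<epsilon>} x * ennreal ((deriv \<psi> x)\<^sup>2) \<partial>lborel)
      \<le> ennreal (LINT x:{0<..<1}|lebesgue. \<bar>g x\<bar> powr 2)" .
  show ?thesis
  proof (rule that[OF s\<psi> _ fin])
    fix x \<eta>
    assume x: "x \<in> {\<epsilon>..1 - \<epsilon>}" and h: "\<And>y. y \<in> {0..1} \<Longrightarrow> \<bar>x - y\<bar> \<le> \<epsilon> \<Longrightarrow> \<bar>\<phi> y - \<phi> x\<bar> \<le> \<eta>"
    show "\<bar>\<psi> x - \<phi> x\<bar> \<le> \<eta>" by (rule approx[OF x h])
  qed
qed

text \<open>The mollified function is small, but not zero, near the end points. Composing it with the soft threshold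
  \<open>\<theta>\<close> makes it vanish there, so that the cutoff \<open>\<zeta>\<close> does not contribute to the derivative.\<close>

lemma W12_approx_test_function:
  fixes \<phi> g :: "real \<Rightarrow> real"
  assumes W: "W12 \<phi> g" and cont: "continuous_on {0..1} \<phi>" and bd: "\<phi> 0 = 0" "\<phi> 1 = 0" and \<tau>: "\<tau> > 0"
  obtains \<psi> where "\<psi> \<in> test_functions {0<..<1}" "\<And>x. x \<in> {0<..<1} \<Longrightarrow> \<bar>\<psi> x - \<phi> x\<bar> \<le> \<tau>"
    "(\<integral>x. (deriv \<psi> x)\<^sup>2 \<partial>lborel) \<le> (LINT x:{0<..<1}|lebesgue. \<bar>g x\<bar> powr 2)"
proof -
  \<comment> \<open>The threshold shifts values by at most \<open>3 * \<eta>\<close> and the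
    mollification by at most \<open>\<eta>\<close>, which together stay below
    \<open>\<tau>\<close>.\<close>
  define \<eta> where "\<eta> = \<tau> / 5"
  have \<eta>: "\<eta> > 0" "\<tau> = 5 * \<eta>" using \<tau> by (auto simp: \<eta>_def)
  have "uniformly_continuous_on {0..1} \<phi>" by (intro compact_uniformly_continuous cont compact_Icc)
  then obtain d where d: "d > 0" "\<And>x y. x \<in> {0..1} \<Longrightarrow> y \<in> {0..1} \<Longrightarrow> dist y x < d \<Longrightarrow> dist (\<phi> y) (\<phi> x) < \<eta>"
    unfolding uniformly_continuous_on_def using \<eta>(1) by blast
  have near: "\<bar>\<phi> y - \<phi> x\<bar> \<le> \<eta>" if "x \<in> {0..1}" "y \<in> {0..1}" "\<bar>x - y\<bar> < d" for x y
    using d(2)[OF that(1,2)] that(3) by (simp add: dist_real_def abs_minus_commute)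
  \<comment> \<open>As \<open>3 * \<epsilon> < d\<close>, the function \<open>\<phi>\<close> is at
    most \<open>\<eta>\<close> in absolute value on end strips of width
    \<open>3 * \<epsilon>\<close>, and its mollification at most \<open>2 * \<eta>\<close> where it
    is controlled; there the threshold makes it vanish.\<close>
  define \<epsilon> where "\<epsilon> = min (d / 4) (1 / 8)"
  have \<epsilon>: "0 < \<epsilon>" "\<epsilon> < 1 / 2" "3 * \<epsilon> < d" "\<epsilon> \<le> 1 / 8" using d(1) by (auto simp: \<epsilon>_def min_def)
  obtain u where u: "smooth u"
    "\<And>x \<eta>. x \<in> {\<epsilon>..1 - \<epsilon>} \<Longrightarrow> (\<And>y. y \<in> {0..1} \<Longrightarrow> \<bar>x - y\<bar> \<le> \<epsilon> \<Longrightarrow> \<bar>\<phi> y - \<phi> x\<bar> \<le> \<eta>) \<Longrightarrow> \<bar>u x - \<phi> x\<bar> \<le> \<eta>"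
    "(\<integral>\<^sup>+x. indicator {\<epsilon><..<1 - \<epsilon>} x * ennreal ((deriv u x)\<^sup>2) \<partial>lborel)
      \<le> ennreal (LINT x:{0<..<1}|lebesgue. \<bar>g x\<bar> powr 2)"
    by (rule W12_mollification[OF W cont \<epsilon>(1,2)]) blast
  have u\<phi>: "\<bar>u x - \<phi> x\<bar> \<le> \<eta>" if x: "x \<in> {\<epsilon>..1 - \<epsilon>}" for x
  proof (rule u(2)[OF x])
    fix y :: real assume "y \<in> {0..1}" "\<bar>x - y\<bar> \<le> \<epsilon>"
    then show "\<bar>\<phi> y - \<phi> x\<bar> \<le> \<eta>" using x \<epsilon> by (intro near) auto
  qed
  have small: "\<bar>\<phi> x\<bar> \<le> \<eta>" if "x \<in> {0..1}" "x \<le> 3 * \<epsilon> \<or> 1 - 3 * \<epsilon> \<le> x" for x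
    using that(2)
  proof
    assume "x \<le> 3 * \<epsilon>"
    then show ?thesis using near[of 0 x] that(1) \<epsilon> bd by auto
  next
    assume "1 - 3 * \<epsilon> \<le> x"
    then show ?thesis using near[of 1 x] that(1) \<epsilon> bd by auto
  qed
  obtain \<theta> :: "real \<Rightarrow> real" where \<theta>: "smooth \<theta>" "\<And>s. \<bar>s\<bar> \<le> 2 * \<eta> \<Longrightarrow> \<theta> s = 0" "\<And>s. \<bar>\<theta> s - s\<bar> \<le> 3 * \<eta>"
    "\<And>s. \<bar>deriv \<theta> s\<bar> \<le> 1"
    using smooth_soft_threshold_exists[OF \<eta>(1)] by blast
  obtain H :: "real \<Rightarrow> real" where H: "smooth H" "\<And>x. x \<le> 2 * \<epsilon> \<Longrightarrow> H x = 0" "\<And>x. x \<ge> 3 * \<epsilon> \<Longrightarrow> H x = 1"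
    "\<And>x. 0 \<le> H x" "\<And>x. H x \<le> 1" "\<And>x. x < 2 * \<epsilon> \<or> 3 * \<epsilon> < x \<Longrightarrow> deriv H x = 0"
  proof (rule smooth_ramp_exists)
    show "2 * \<epsilon> < 3 * \<epsilon>" using \<epsilon> by simp
  qed blast
  define \<zeta> where "\<zeta> = (\<lambda>x. H x * H (1 - x))"
  have s\<zeta>: "smooth \<zeta>" unfolding \<zeta>_def
    using smooth_mult[OF H(1) smooth_affine[OF H(1), of 1 "- 1" 1]] by simp
  have \<zeta>01: "0 \<le> \<zeta> x" "\<zeta> x \<le> 1" for x unfolding \<zeta>_def by (rule mult_nonneg_nonneg[OF H(4) H(4)], rule mult_le_one[OF H(5) H(4) H(5)])
  have \<zeta>1: "\<zeta> x = 1" if "3 * \<epsilon> \<le> x" "x \<le> 1 - 3 * \<epsilon>" for x unfolding \<zeta>_def using H(3)[of x] H(3)[of "1 - x"] that by simp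
  have \<zeta>0: "\<zeta> x = 0" if "x \<notin> {2 * \<epsilon>..1 - 2 * \<epsilon>}" for x
  proof (cases "x \<le> 2 * \<epsilon>")
    case False
    then show ?thesis unfolding \<zeta>_def using H(2)[of "1 - x"] that by simp
  qed (simp add: \<zeta>_def H(2))
  define \<psi> where "\<psi> = (\<lambda>x. \<zeta> x * \<theta> (u x))"
  have s\<psi>: "smooth \<psi>" unfolding \<psi>_def by (rule smooth_mult[OF s\<zeta> smooth_compose[OF \<theta>(1) u(1)]])
  have \<psi>0: "\<psi> x = 0" if "x \<notin> {2 * \<epsilon>..1 - 2 * \<epsilon>}" for x unfolding \<psi>_def using \<zeta>0[OF that] by simp
  have test: "\<psi> \<in> test_functions {0<..<1}"
    by (rule test_functionsI[OF s\<psi> compact_Icc _ \<psi>0]) (use \<epsilon> in auto)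
  have u_small: "\<theta> (u x) = 0" if "x \<in> {\<epsilon>..1 - \<epsilon>}" "x \<le> 3 * \<epsilon> \<or> 1 - 3 * \<epsilon> \<le> x" for x
    using u\<phi>[OF that(1)] small[OF _ that(2)] that(1) \<epsilon> by (intro \<theta>(2)) auto
  have close: "\<bar>\<psi> x - \<phi> x\<bar> \<le> \<tau>" if x: "x \<in> {0<..<1}" for x
  proof (cases "x \<le> 3 * \<epsilon> \<or> 1 - 3 * \<epsilon> \<le> x")
    case True
    have "\<psi> x = 0"
    proof (cases "x \<in> {\<epsilon>..1 - \<epsilon>}")
      case h: True
      show ?thesis unfolding \<psi>_def using u_small[OF h True] by simp
    next
      case False
      then show ?thesis using \<epsilon> by (intro \<psi>0) auto
    qed
    then show ?thesis using small[OF _ True] x \<eta> by simp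
  next
    case False
    then have "\<psi> x = \<theta> (u x)" unfolding \<psi>_def using \<zeta>1[of x] by simp
    then show ?thesis using \<theta>(3)[of "u x"] u\<phi>[of x] False \<epsilon> \<eta> by auto
  qed
  have D: "deriv \<psi> x = deriv \<zeta> x * \<theta> (u x) + \<zeta> x * (deriv \<theta> (u x) * deriv u x)" for x
  proof (rule DERIV_imp_deriv)
    have "((\<lambda>x. \<theta> (u x)) has_real_derivative deriv \<theta> (u x) * deriv u x) (at x)"
      by (rule DERIV_chain2[OF smooth_real_derivative(1)[OF \<theta>(1)] smooth_real_derivative(1)[OF u(1)]])
    from DERIV_mult[OF smooth_real_derivative(1)[OF s\<zeta>, of x] this]
    show "(\<psi> has_real_derivative deriv \<zeta> x * \<theta> (u x) + \<zeta> x * (deriv \<theta> (u x) * deriv u x)) (at x)"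
      unfolding \<psi>_def by (simp add: algebra_simps)
  qed
  have D0: "deriv \<psi> x = 0" if "x \<notin> {2 * \<epsilon>..1 - 2 * \<epsilon>}" for x
    by (rule deriv_zero_off_interval[of "2 * \<epsilon>" "1 - 2 * \<epsilon>"]) (rule \<psi>0, assumption, rule that)
  have \<zeta>D0: "deriv \<zeta> x = 0" if "3 * \<epsilon> < x" "x < 1 - 3 * \<epsilon>" for x
  proof (rule DERIV_imp_deriv)
    have "((\<lambda>_. 1) has_real_derivative 0) (at x)" by simp
    then show "(\<zeta> has_real_derivative 0) (at x)"
      by (rule has_field_derivative_transform_within_open[of _ _ _ "{3 * \<epsilon><..<1 - 3 * \<epsilon>}"])
         (use that \<zeta>1 in auto)
  qed
  \<comment> \<open>On the support of the cutoff, either the thresholded function is zero or the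
    cutoff is locally constant, so its derivative never contributes; the other two factors are at
    most 1.\<close>
  have bound: "\<bar>deriv \<psi> x\<bar> \<le> \<bar>deriv u x\<bar>" for x
  proof (cases "x \<in> {2 * \<epsilon>..1 - 2 * \<epsilon>}")
    case True
    have "deriv \<zeta> x * \<theta> (u x) = 0"
    proof (cases "x \<le> 3 * \<epsilon> \<or> 1 - 3 * \<epsilon> \<le> x")
      case h: True
      have "\<theta> (u x) = 0" by (rule u_small[OF _ h]) (use True \<epsilon> in auto)
      then show ?thesis by simp
    next
      case False
      then show ?thesis using \<zeta>D0[of x] by simp
    qed
    then have "deriv \<psi> x = \<zeta> x * (deriv \<theta> (u x) * deriv u x)" by (simp only: D add_0)
    then have "\<bar>deriv \<psi> x\<bar> = \<zeta> x * \<bar>deriv \<theta> (u x)\<bar> * \<bar>deriv u x\<bar>" using \<zeta>01[of x] by (simp add: abs_mult)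
    also have "\<dots> \<le> 1 * \<bar>deriv u x\<bar>"
      using \<zeta>01[of x] \<theta>(4)[of "u x"] by (intro mult_right_mono mult_le_one) auto
    finally show ?thesis by simp
  qed (simp add: D0)
  have "(\<integral>\<^sup>+x. ennreal ((deriv \<psi> x)\<^sup>2) \<partial>lborel) \<le> (\<integral>\<^sup>+x. indicator {\<epsilon><..<1 - \<epsilon>} x * ennreal ((deriv u x)\<^sup>2) \<partial>lborel)"
  proof (rule nn_integral_mono)
    fix x
    show "ennreal ((deriv \<psi> x)\<^sup>2) \<le> indicator {\<epsilon><..<1 - \<epsilon>} x * ennreal ((deriv u x)\<^sup>2)"
    proof (cases "x \<in> {\<epsilon><..<1 - \<epsilon>}")
      case True
      have "(deriv \<psi> x)\<^sup>2 \<le> (deriv u x)\<^sup>2" using bound[of x] by (simp add: abs_le_square_iff)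
      then show ?thesis using True by (simp add: ennreal_leI)
    next
      case False
      then have "x \<notin> {2 * \<epsilon>..1 - 2 * \<epsilon>}" using \<epsilon> by auto
      then show ?thesis using D0[of x] by simp
    qed
  qed
  also note u(3)
  finally have fin: "(\<integral>x. (deriv \<psi> x)\<^sup>2 \<partial>lborel) \<le> (LINT x:{0<..<1}|lebesgue. \<bar>g x\<bar> powr 2)"
    by (intro integral_real_bounded) (auto simp: set_lebesgue_integral_def)
  show ?thesis by (rule that[OF test _ fin]) (rule close)
qed

section \<open>Rayleigh quotients of product functions\<close>

lemma test_function_gradient:
  fixes \<phi> :: "'a::euclidean_space \<Rightarrow> real"
  assumes "\<phi> \<in> test_functions \<Omega>"
  shows "(\<phi> has_derivative (\<lambda>h. grad \<phi> x \<bullet> h)) (at x)" and "continuous_on UNIV (grad \<phi>)"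
    and "continuous_on UNIV \<phi>"
    and "x \<notin> \<Omega> \<Longrightarrow> \<phi> x = 0" and "x \<notin> \<Omega> \<Longrightarrow> grad \<phi> x = 0"
proof -
  have sm: "smooth \<phi>" and sub: "closure {x. \<phi> x \<noteq> 0} \<subseteq> \<Omega>"
    using assms by (auto simp: test_functions_def)
  have lin: "linear (frechet_derivative \<phi> (at x))" for x
    using smooth_derivative(1)[OF sm, of x] by (rule has_derivative_linear)
  have "grad \<phi> x \<bullet> h = frechet_derivative \<phi> (at x) h" for x h
  proof -
    have "frechet_derivative \<phi> (at x) h = frechet_derivative \<phi> (at x) (\<Sum>b\<in>Basis. (h \<bullet> b) *\<^sub>R b)"
      by (simp add: euclidean_representation)
    also have "\<dots> = (\<Sum>b\<in>Basis. (h \<bullet> b) * frechet_derivative \<phi> (at x) b)"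
      by (simp add: linear_sum[OF lin] linear_cmul[OF lin])
    also have "\<dots> = grad \<phi> x \<bullet> h"
      by (simp add: grad_def inner_sum_left inner_commute[of h] mult.commute)
    finally show ?thesis ..
  qed
  then have "(\<lambda>h. grad \<phi> x \<bullet> h) = frechet_derivative \<phi> (at x)" for x by auto
  then show d: "(\<phi> has_derivative (\<lambda>h. grad \<phi> x \<bullet> h)) (at x)" for x
    using smooth_derivative(1)[OF sm, of x] by simp
  show "continuous_on UNIV (grad \<phi>)"
    unfolding grad_def[abs_def]
    by (intro continuous_on_sum continuous_on_scaleR continuous_on_const smooth_derivative(3)[OF smooth_derivative(2)[OF sm]])
  show "continuous_on UNIV \<phi>" by (rule smooth_derivative(3)[OF sm])
  assume x: "x \<notin> \<Omega>"
  then show "\<phi> x = 0" using sub closure_subset[of "{x. \<phi> x \<noteq> 0}"] by auto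
  have "(\<lambda>h. grad \<phi> x \<bullet> h) = (\<lambda>_. 0)"
  proof (rule zero_derivative_off_support[OF d])
    show "closed (closure {x. \<phi> x \<noteq> 0})" by simp
    show "x \<notin> closure {x. \<phi> x \<noteq> 0}" using x sub by blast
    show "\<phi> y = 0" if "y \<notin> closure {x. \<phi> x \<noteq> 0}" for y
      using that closure_subset[of "{x. \<phi> x \<noteq> 0}"] by blast
  qed
  from fun_cong[OF this, of "grad \<phi> x"] show "grad \<phi> x = 0" by simp
qed

lemma set_integral_lebesgue_eq_lborel:
  fixes f :: "'a::euclidean_space \<Rightarrow> real"
  assumes "continuous_on UNIV f" and "\<And>x. x \<notin> \<Omega> \<Longrightarrow> f x = 0"
  shows "(LINT x:\<Omega>|lebesgue. f x) = (LINT x|lborel. f x)"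
proof -
  have "(LINT x:\<Omega>|lebesgue. f x) = (LINT x|lebesgue. f x)"
    unfolding set_lebesgue_integral_def
    by (intro Bochner_Integration.integral_cong) (use assms(2) in \<open>auto simp: indicator_def\<close>)
  also have "\<dots> = (LINT x|lborel. f x)"
    by (rule integral_completion) (use borel_measurable_continuous_onI[OF assms(1)] in simp)
  finally show ?thesis .
qed

lemma rayleigh_quotient_lborel:
  fixes \<phi> :: "'a::euclidean_space \<Rightarrow> real"
  assumes \<phi>: "\<phi> \<in> test_functions \<Omega>" and q: "q > 0"
  shows "(LINT x:\<Omega>|lebesgue. (norm (grad \<phi> x))\<^sup>2) / (LINT x:\<Omega>|lebesgue. \<bar>\<phi> x\<bar> powr q) powr (2 / q)
    = (LINT x|lborel. (norm (grad \<phi> x))\<^sup>2) / (LINT x|lborel. \<bar>\<phi> x\<bar> powr q) powr (2 / q)"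
proof -
  note t = test_function_gradient[OF \<phi>]
  have "(LINT x:\<Omega>|lebesgue. (norm (grad \<phi> x))\<^sup>2) = (LINT x|lborel. (norm (grad \<phi> x))\<^sup>2)"
    by (rule set_integral_lebesgue_eq_lborel) (auto simp: t(5) intro!: continuous_intros t(2))
  moreover have "(LINT x:\<Omega>|lebesgue. \<bar>\<phi> x\<bar> powr q) = (LINT x|lborel. \<bar>\<phi> x\<bar> powr q)"
    by (rule set_integral_lebesgue_eq_lborel)
       (use q in \<open>auto simp: t(4) intro!: continuous_intros continuous_on_powr' t(3)\<close>)
  ultimately show ?thesis by simp
qed

lemma lambda2_le:
  assumes \<phi>: "\<phi> \<in> test_functions \<Omega>" "\<phi> \<noteq> (\<lambda>_. 0)" and q: "q > 0"
  shows "lambda2 q \<Omega> \<le> (LINT x|lborel. (norm (grad \<phi> x))\<^sup>2) / (LINT x|lborel. \<bar>\<phi> x\<bar> powr q) powr (2 / q)"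
  unfolding lambda2_def rayleigh_quotient_lborel[OF \<phi>(1) q, symmetric]
proof (rule cINF_lower)
  show "bdd_below ((\<lambda>\<phi>. (LINT x:\<Omega>|lebesgue. (norm (grad \<phi> x))\<^sup>2) / (LINT x:\<Omega>|lebesgue. \<bar>\<phi> x\<bar> powr q) powr (2 / q))
      ` (test_functions \<Omega> - {\<lambda>_. 0}))"
  proof (rule bdd_belowI2[of _ 0])
    fix \<phi> :: "'a \<Rightarrow> real"
    have "0 \<le> (LINT x:\<Omega>|lebesgue. (norm (grad \<phi> x))\<^sup>2)"
      unfolding set_lebesgue_integral_def by (intro integral_nonneg_AE) simp
    then show "0 \<le> (LINT x:\<Omega>|lebesgue. (norm (grad \<phi> x))\<^sup>2) / (LINT x:\<Omega>|lebesgue. \<bar>\<phi> x\<bar> powr q) powr (2 / q)"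
      by simp
  qed
qed (use \<phi> in simp)

lemma lambda2_ge:
  assumes ne: "test_functions \<Omega> - {\<lambda>_. 0} \<noteq> {}" and q: "q > 0"
    and "\<And>\<phi>. \<phi> \<in> test_functions \<Omega> \<Longrightarrow> \<phi> \<noteq> (\<lambda>_. 0) \<Longrightarrow>
      C \<le> (LINT x|lborel. (norm (grad \<phi> x))\<^sup>2) / (LINT x|lborel. \<bar>\<phi> x\<bar> powr q) powr (2 / q)"
  shows "C \<le> lambda2 q \<Omega>"
  unfolding lambda2_def
proof (rule cINF_greatest[OF ne])
  fix \<phi> assume "\<phi> \<in> test_functions \<Omega> - {\<lambda>_. 0}"
  then have "\<phi> \<in> test_functions \<Omega>" "\<phi> \<noteq> (\<lambda>_. 0)" by auto
  from assms(3)[OF this] rayleigh_quotient_lborel[OF this(1) q]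
  show "C \<le> (LINT x:\<Omega>|lebesgue. (norm (grad \<phi> x))\<^sup>2) / (LINT x:\<Omega>|lebesgue. \<bar>\<phi> x\<bar> powr q) powr (2 / q)"
    by (simp only:)
qed

lemma coordinate_product_test_function:
  fixes g :: "'a::euclidean_space \<Rightarrow> real \<Rightarrow> real"
  assumes g: "\<And>b. b \<in> Basis \<Longrightarrow> smooth (g b)" and K: "\<And>b t. b \<in> Basis \<Longrightarrow> t \<notin> {lo \<bullet> b..hi \<bullet> b} \<Longrightarrow> g b t = 0"
    and sub: "cbox lo hi \<subseteq> \<Omega>"
  shows "(\<lambda>x. \<Prod>b\<in>Basis. g b (x \<bullet> b)) \<in> test_functions \<Omega>"
proof -
  let ?f = "\<lambda>x. \<Prod>b\<in>Basis. g b (x \<bullet> b)"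
  have z: "?f x = 0" if "x \<notin> cbox lo hi" for x
  proof -
    have "\<exists>b\<in>Basis. x \<bullet> b \<notin> {lo \<bullet> b..hi \<bullet> b}" using that by (auto simp: mem_box)
    then obtain b where b: "b \<in> Basis" "x \<bullet> b \<notin> {lo \<bullet> b..hi \<bullet> b}" by blast
    from K[OF this] show ?thesis using b(1) by (auto intro!: prod_zero)
  qed
  show ?thesis
    by (rule test_functionsI[OF _ compact_cbox sub]) (rule smooth_coordinate_product(1), rule g, assumption, rule z)
qed

lemma test_functions_nonempty:
  fixes \<Omega> :: "'a::euclidean_space set"
  assumes "\<Omega> \<noteq> {}" and "open \<Omega>"
  obtains \<phi> where "\<phi> \<in> test_functions \<Omega>" "\<phi> \<noteq> (\<lambda>_. 0)"
proof -
  obtain z where z: "z \<in> \<Omega>" using assms by blast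
  obtain lo hi where c: "z \<in> box lo hi" "cbox lo hi \<subseteq> \<Omega>" by (rule open_contains_cbox[OF assms(2) z]) blast
  define g where "g = (\<lambda>b::'a. \<lambda>t. 1 * bump (1 / (hi \<bullet> b - lo \<bullet> b) * t + - (lo \<bullet> b / (hi \<bullet> b - lo \<bullet> b))))"
  have pos: "hi \<bullet> b - lo \<bullet> b > 0" if "b \<in> Basis" for b using c(1) that by (auto simp: mem_box)
  have g: "g b t = bump ((t - lo \<bullet> b) / (hi \<bullet> b - lo \<bullet> b))" for b t by (simp add: g_def diff_divide_distrib)
  have sm: "smooth (g b)" for b unfolding g_def by (rule smooth_affine[OF smooth_bump])
  have zero: "g b t = 0" if "b \<in> Basis" "t \<notin> {lo \<bullet> b..hi \<bullet> b}" for b t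
    unfolding g using that pos[OF that(1)] by (intro bump_zero) (auto simp: divide_simps)
  have test: "(\<lambda>x. \<Prod>b\<in>Basis. g b (x \<bullet> b)) \<in> test_functions \<Omega>"
    by (rule coordinate_product_test_function[of g lo hi \<Omega>]) (simp_all add: sm zero c(2))
  have pos_z: "(\<Prod>b\<in>Basis. g b (z \<bullet> b)) > 0"
  proof (rule prod_pos)
    fix b :: 'a assume b: "b \<in> Basis"
    have "lo \<bullet> b < z \<bullet> b" "z \<bullet> b < hi \<bullet> b" using c(1) b by (auto simp: mem_box)
    then show "0 < g b (z \<bullet> b)" unfolding g using pos[OF b] by (intro bump_pos) (auto simp: divide_simps)
  qed
  show ?thesis
  proof (rule that[OF test])
    show "(\<lambda>x. \<Prod>b\<in>Basis. g b (x \<bullet> b)) \<noteq> (\<lambda>_. 0)" using pos_z by (auto dest: fun_cong[of _ _ z])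
  qed
qed

lemma integral_coordinate_product:
  fixes f :: "'a::euclidean_space \<Rightarrow> real \<Rightarrow> real"
  assumes "\<And>b. b \<in> Basis \<Longrightarrow> integrable lborel (f b)" and "\<And>b t. b \<in> Basis \<Longrightarrow> 0 \<le> f b t"
  shows "integrable lborel (\<lambda>x. \<Prod>b\<in>Basis. f b (x \<bullet> b))"
    and "(LINT x|lborel. (\<Prod>b\<in>Basis. f b (x \<bullet> b))) = (\<Prod>b\<in>Basis. LINT t|lborel. f b t)"
proof -
  have meas [measurable]: "f b \<in> borel_measurable borel" if "b \<in> Basis" for b
    using borel_measurable_integrable[OF assms(1)[OF that]] by simp
  have nn: "(\<Prod>b\<in>Basis. f b (x \<bullet> b)) \<ge> 0" for x by (intro prod_nonneg assms(2))
  have m: "(\<lambda>x. \<Prod>b\<in>Basis. f b (x \<bullet> b)) \<in> borel_measurable lborel"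
  proof (rule borel_measurable_prod)
    fix b :: 'a assume b: "b \<in> Basis"
    have "(\<lambda>x. f b (x \<bullet> b)) = f b \<circ> (\<lambda>x. x \<bullet> b)" by auto
    then show "(\<lambda>x. f b (x \<bullet> b)) \<in> borel_measurable lborel"
      using meas[OF b] by (simp only:) (rule measurable_comp[of _ _ borel], auto)
  qed
  have "(\<integral>\<^sup>+x. ennreal (\<Prod>b\<in>Basis. f b (x \<bullet> b)) \<partial>lborel) = (\<integral>\<^sup>+x. (\<Prod>b\<in>Basis. ennreal (f b (x \<bullet> b))) \<partial>lborel)"
    using assms(2) by (simp add: prod_ennreal)
  also have "\<dots> = (\<Prod>b\<in>Basis. (\<integral>\<^sup>+t. ennreal (f b t) \<partial>lborel))"
    by (rule nn_integral_lborel_prod) (use assms(2) in auto)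
  also have "\<dots> = (\<Prod>b\<in>Basis. ennreal (LINT t|lborel. f b t))"
    by (intro prod.cong refl nn_integral_eq_integral assms(1)) (use assms(2) in auto)
  also have "\<dots> = ennreal (\<Prod>b\<in>Basis. LINT t|lborel. f b t)"
    using assms(2) by (intro prod_ennreal integral_nonneg_AE) auto
  finally have I: "(\<integral>\<^sup>+x. ennreal (\<Prod>b\<in>Basis. f b (x \<bullet> b)) \<partial>lborel) = ennreal (\<Prod>b\<in>Basis. LINT t|lborel. f b t)" .
  show int: "integrable lborel (\<lambda>x. \<Prod>b\<in>Basis. f b (x \<bullet> b))"
    by (rule integrableI_nonneg[OF m]) (use nn I in auto)
  have "0 \<le> (\<Prod>b\<in>Basis. LINT t|lborel. f b t)" using assms(2) by (intro prod_nonneg integral_nonneg_AE) auto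
  then show "(LINT x|lborel. (\<Prod>b\<in>Basis. f b (x \<bullet> b))) = (\<Prod>b\<in>Basis. LINT t|lborel. f b t)"
    using I nn m by (subst integral_eq_nn_integral) auto
qed

text \<open>Each partial derivative of the product is again a product, so its square integrates
  factor by factor.\<close>

lemma integral_grad_coordinate_product:
  fixes g :: "'a::euclidean_space \<Rightarrow> real \<Rightarrow> real"
  assumes g: "\<And>b. b \<in> Basis \<Longrightarrow> smooth (g b)" and K: "\<And>b t. b \<in> Basis \<Longrightarrow> t \<notin> {lo \<bullet> b..hi \<bullet> b} \<Longrightarrow> g b t = 0"
  shows "(LINT x|lborel. (norm (grad (\<lambda>x. \<Prod>b\<in>Basis. g b (x \<bullet> b)) x))\<^sup>2)
    = (\<Sum>c\<in>Basis. \<Prod>b\<in>Basis. LINT t|lborel. ((if b = c then deriv (g b) else g b) t)\<^sup>2)"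
proof -
  have grad: "(norm (grad (\<lambda>x. \<Prod>b\<in>Basis. g b (x \<bullet> b)) x))\<^sup>2
      = (\<Sum>c\<in>Basis. \<Prod>b\<in>Basis. ((if b = c then deriv (g b) else g b) (x \<bullet> b))\<^sup>2)" for x
  proof -
    let ?v = "grad (\<lambda>x. \<Prod>b\<in>Basis. g b (x \<bullet> b)) x"
    have "?v \<bullet> c = (\<Prod>b\<in>Basis. (if b = c then deriv (g b) else g b) (x \<bullet> b))" if c: "c \<in> Basis" for c
      unfolding grad_def using c smooth_coordinate_product(2)[where g = g and x = x, OF g c] by (simp add: inner_sum_left_Basis)
    then have "(\<Sum>c\<in>Basis. (?v \<bullet> c)\<^sup>2) = (\<Sum>c\<in>Basis. \<Prod>b\<in>Basis. ((if b = c then deriv (g b) else g b) (x \<bullet> b))\<^sup>2)"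
      by (intro sum.cong) (auto simp: prod_power_distrib)
    moreover have "(norm ?v)\<^sup>2 = (\<Sum>c\<in>Basis. (?v \<bullet> c)\<^sup>2)"
      unfolding power2_norm_eq_inner by (subst euclidean_inner) (simp add: power2_eq_square)
    ultimately show ?thesis by simp
  qed
  have int: "integrable lborel (\<lambda>t. ((if b = c then deriv (g b) else g b) t)\<^sup>2)" if b: "b \<in> Basis" for b c
  proof (rule integrable_continuous_compact_support)
    have "smooth (if b = c then deriv (g b) else g b)" using g[OF b] smooth_real_derivative(2) by auto
    from smooth_derivative(3)[OF this] show "continuous_on UNIV (\<lambda>t. ((if b = c then deriv (g b) else g b) t)\<^sup>2)"
      by (rule continuous_on_power)
    show "((if b = c then deriv (g b) else g b) t)\<^sup>2 = 0" if "t \<notin> {lo \<bullet> b..hi \<bullet> b}" for t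
      using K[OF b that] deriv_zero_off_interval[of "lo \<bullet> b" "hi \<bullet> b" "g b" t] K[OF b] that by auto
  qed simp
  have "(LINT x|lborel. (norm (grad (\<lambda>x. \<Prod>b\<in>Basis. g b (x \<bullet> b)) x))\<^sup>2)
      = (\<Sum>c\<in>Basis. LINT x|lborel. (\<Prod>b\<in>Basis. ((if b = c then deriv (g b) else g b) (x \<bullet> b))\<^sup>2))"
    unfolding grad
    by (intro Bochner_Integration.integral_sum integral_coordinate_product(1)[where f = "\<lambda>b t. ((if b = _ then deriv (g b) else g b) t)\<^sup>2"] int) auto
  also have "\<dots> = (\<Sum>c\<in>Basis. \<Prod>b\<in>Basis. LINT t|lborel. ((if b = c then deriv (g b) else g b) t)\<^sup>2)"
    by (intro sum.cong refl integral_coordinate_product(2)[where f = "\<lambda>b t. ((if b = _ then deriv (g b) else g b) t)\<^sup>2"] int) auto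
  finally show ?thesis .
qed

section \<open>Product competitors on long slabs\<close>

lemma test_function_unit_support:
  assumes "\<psi> \<in> test_functions {0<..<1::real}"
  obtains a b where "0 < a" "a \<le> b" "b < 1" "\<And>t. t \<notin> {a..b} \<Longrightarrow> \<psi> t = 0"
proof (cases "closure {t. \<psi> t \<noteq> 0} = {}")
  case True
  then have "\<psi> t = 0" for t by auto
  then show ?thesis using that[of "1/2" "1/2"] by simp
next
  case False
  have c: "compact (closure {t. \<psi> t \<noteq> 0})" and sub: "closure {t. \<psi> t \<noteq> 0} \<subseteq> {0<..<1}"
    using assms unfolding test_functions_def by auto
  obtain a where a: "a \<in> closure {t. \<psi> t \<noteq> 0}" "\<And>t. t \<in> closure {t. \<psi> t \<noteq> 0} \<Longrightarrow> a \<le> t"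
    using compact_attains_inf[OF c False] by blast
  obtain b where b: "b \<in> closure {t. \<psi> t \<noteq> 0}" "\<And>t. t \<in> closure {t. \<psi> t \<noteq> 0} \<Longrightarrow> t \<le> b"
    using compact_attains_sup[OF c False] by blast
  have "\<psi> t = 0" if t: "t \<notin> {a..b}" for t
  proof (rule ccontr)
    assume "\<psi> t \<noteq> 0"
    then have "t \<in> closure {t. \<psi> t \<noteq> 0}" using closure_subset[of "{t. \<psi> t \<noteq> 0}"] by blast
    then show False using a(2)[of t] b(2)[of t] t by auto
  qed
  moreover have "0 < a" "b < 1" using a(1) b(1) sub by auto
  ultimately show ?thesis using that[of a b] a(2)[OF b(1)] by blast
qed

text \<open>In dimension at least two the volume grows without bound in \<open>L\<close>, while the
  inradius stays at most half of the unit width in direction \<open>e\<close>.\<close>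

definition slab :: "'a \<Rightarrow> real \<Rightarrow> 'a::euclidean_space set" where
  "slab e L = box (\<Sum>b\<in>Basis. (if b = e then 0 else - L) *\<^sub>R b) (\<Sum>b\<in>Basis. (if b = e then 1 else L) *\<^sub>R b)"

lemma mem_slab: "x \<in> slab e L \<longleftrightarrow> (\<forall>b\<in>Basis. if b = e then 0 < x \<bullet> b \<and> x \<bullet> b < 1 else \<bar>x \<bullet> b\<bar> < L)"
  unfolding slab_def mem_box by (intro ball_cong refl) (auto simp: inner_sum_left_Basis)

lemma slab_convex_body:
  fixes e :: "'a::euclidean_space"
  assumes e: "e \<in> Basis" and L: "L \<ge> 1"
  shows "open (slab e L)" and "bounded (slab e L)" and "convex (slab e L)" and "slab e L \<noteq> {}"
    and "measure lebesgue (slab e L) = (2 * L) ^ (DIM('a) - 1)" and "0 < inradius (slab e L)" and "inradius (slab e L) \<le> 1 / 2"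
proof -
  show o: "open (slab e L)" and bd: "bounded (slab e L)" and cv: "convex (slab e L)"
    by (auto simp: slab_def open_box bounded_box convex_box)
  have "(1 / 2) *\<^sub>R e \<in> slab e L" using e L by (auto simp: mem_slab inner_Basis)
  then show ne: "slab e L \<noteq> {}" by blast
  have "measure lebesgue (slab e L) = (\<Prod>b\<in>Basis. ((\<Sum>b\<in>Basis. (if b = e then 1 else L) *\<^sub>R b) - (\<Sum>b\<in>Basis. (if b = e then 0 else - L) *\<^sub>R b)) \<bullet> b)"
    unfolding slab_def using L by (subst measure_completion) (auto simp: measure_lborel_box_eq inner_sum_left_Basis)
  also have "\<dots> = (\<Prod>b\<in>Basis. if b = e then 1 else 2 * L)"
    by (intro prod.cong) (auto simp: inner_diff_left inner_sum_left_Basis)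
  also have "\<dots> = (\<Prod>b\<in>Basis - {e}. 2 * L)"
    using e by (subst prod.remove[of _ e]) (auto intro!: prod.cong)
  also have "\<dots> = (2 * L) ^ (DIM('a) - 1)" using e by (simp add: card_Diff_singleton)
  finally show "measure lebesgue (slab e L) = (2 * L) ^ (DIM('a) - 1)" .
  obtain x where x: "inradius (slab e L) > 0" "ball x (inradius (slab e L)) \<subseteq> slab e L"
    by (rule inradius_attained[OF ne o bd]) blast
  show "0 < inradius (slab e L)" by (rule x(1))
  show "inradius (slab e L) \<le> 1 / 2"
  proof (rule dense_ge)
    fix s :: real assume "1 / 2 < s"
    show "inradius (slab e L) \<le> s"
    proof (rule ccontr)
      assume "\<not> ?thesis"
      then have s: "s < inradius (slab e L)" by simp
      then have "x + s *\<^sub>R e \<in> slab e L" "x - s *\<^sub>R e \<in> slab e L"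
        using x(2) e \<open>1 / 2 < s\<close> by (auto simp: subset_iff dist_norm)
      then have "(x + s *\<^sub>R e) \<bullet> e < 1" "0 < (x - s *\<^sub>R e) \<bullet> e" using e by (auto simp: mem_slab)
      then show False using e \<open>1 / 2 < s\<close> by (simp add: inner_add_left inner_diff_left)
    qed
  qed
qed

lemma plateau_exists:
  assumes \<tau>: "0 < \<tau>" "\<tau> < 1"
  obtains \<eta> :: "real \<Rightarrow> real" and D where "smooth \<eta>" "\<And>t. 0 \<le> \<eta> t" "\<And>t. \<eta> t \<le> 1"
    "\<And>t. \<bar>t\<bar> \<le> 1 - \<tau> \<Longrightarrow> \<eta> t = 1" "\<And>t. t \<notin> {- (1 - \<tau> / 2)..1 - \<tau> / 2} \<Longrightarrow> \<eta> t = 0" "\<And>t. \<bar>deriv \<eta> t\<bar> \<le> D" "D \<ge> 0"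
proof -
  obtain H :: "real \<Rightarrow> real" where H: "smooth H" "\<And>x. x \<le> \<tau> / 2 \<Longrightarrow> H x = 0" "\<And>x. x \<ge> \<tau> \<Longrightarrow> H x = 1"
    "\<And>x. 0 \<le> H x" "\<And>x. H x \<le> 1"
  proof (rule smooth_ramp_exists)
    show "\<tau> / 2 < \<tau>" using \<tau> by simp
  qed blast
  define \<eta> where "\<eta> = (\<lambda>t. (1 * H (1 * t + 1)) * (1 * H ((- 1) * t + 1)))"
  have \<eta>: "\<eta> t = H (1 + t) * H (1 - t)" for t by (simp add: \<eta>_def add.commute)
  have sm: "smooth \<eta>" unfolding \<eta>_def by (rule smooth_mult[OF smooth_affine[OF H(1)] smooth_affine[OF H(1)]])
  have z: "\<eta> t = 0" if "t \<notin> {- (1 - \<tau> / 2)..1 - \<tau> / 2}" for t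
  proof (cases "t < - (1 - \<tau> / 2)")
    case True
    then show ?thesis unfolding \<eta> using H(2)[of "1 + t"] by simp
  next
    case False
    then show ?thesis unfolding \<eta> using H(2)[of "1 - t"] that by simp
  qed
  have "bounded (deriv \<eta> ` {- (1 - \<tau> / 2)..1 - \<tau> / 2})"
    by (intro compact_imp_bounded compact_continuous_image smooth_derivative(3)[OF smooth_real_derivative(2)[OF sm]]) simp
  then have "\<exists>D. \<forall>t\<in>{- (1 - \<tau> / 2)..1 - \<tau> / 2}. \<bar>deriv \<eta> t\<bar> \<le> D" by (auto simp: bounded_real)
  then obtain D where D: "\<And>t. t \<in> {- (1 - \<tau> / 2)..1 - \<tau> / 2} \<Longrightarrow> \<bar>deriv \<eta> t\<bar> \<le> D" by blast
  have D0: "D \<ge> 0" using D[of 0] \<tau> by auto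
  have "\<bar>deriv \<eta> t\<bar> \<le> D" for t
  proof (cases "t \<in> {- (1 - \<tau> / 2)..1 - \<tau> / 2}")
    case False
    have "deriv \<eta> t = 0"
      by (rule deriv_zero_off_interval[of "- (1 - \<tau> / 2)" "1 - \<tau> / 2"]) (rule z, assumption, rule False)
    then show ?thesis using D0 by simp
  qed (rule D)
  moreover have "\<eta> t = 1" if "\<bar>t\<bar> \<le> 1 - \<tau>" for t
    unfolding \<eta> using H(3)[of "1 + t"] H(3)[of "1 - t"] that by auto
  moreover have "0 \<le> \<eta> t" for t unfolding \<eta> by (rule mult_nonneg_nonneg[OF H(4) H(4)])
  moreover have "\<eta> t \<le> 1" for t unfolding \<eta> by (rule mult_le_one[OF H(5) H(4) H(5)])
  ultimately show ?thesis by (intro that[of \<eta> D] sm D0 z)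
qed

text \<open>The competitor is \<open>\<psi>\<close> across the slab, times a plateau of length scale
  \<open>L\<close> in each of the other directions. The energy in those directions carries the
  factor \<open>1 / L\<^sup>2\<close>, the plateaus retain at least the fraction
  \<open>(1 - \<tau>) ^ (DIM('a) - 1)\<close> of the volume in the norm, and the powers of the
  volume cancel because \<open>1 - 2 / q + (2 - q) / q = 0\<close>. It is essential that
  \<open>D\<close> does not depend on \<open>L\<close>.\<close>

lemma slab_lambda2_le:
  fixes e :: "'a::euclidean_space"
  assumes e: "e \<in> Basis" and \<psi>: "\<psi> \<in> test_functions {0<..<1}" and F: "(LINT t|lborel. \<bar>\<psi> t\<bar> powr q) > 0"
    and q: "q > 0" and \<tau>: "0 < \<tau>" "\<tau> < 1"
  obtains D where "\<And>L. L \<ge> 1 \<Longrightarrow> lambda2 q (slab e L) * measure lebesgue (slab e L) powr ((2 - q) / q)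
    \<le> ((LINT t|lborel. (deriv \<psi> t)\<^sup>2) + D / L\<^sup>2) / ((LINT t|lborel. \<bar>\<psi> t\<bar> powr q) * (1 - \<tau>) ^ (DIM('a) - 1)) powr (2 / q)"
proof -
  obtain \<eta> :: "real \<Rightarrow> real" and D\<^sub>0 where \<eta>: "smooth \<eta>" "\<And>t. 0 \<le> \<eta> t" "\<And>t. \<eta> t \<le> 1"
    "\<And>t. \<bar>t\<bar> \<le> 1 - \<tau> \<Longrightarrow> \<eta> t = 1" "\<And>t. t \<notin> {- (1 - \<tau> / 2)..1 - \<tau> / 2} \<Longrightarrow> \<eta> t = 0" "\<And>t. \<bar>deriv \<eta> t\<bar> \<le> D\<^sub>0" "D\<^sub>0 \<ge> 0"
    by (rule plateau_exists[OF \<tau>]) blast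
  obtain a\<^sub>0 b\<^sub>0 where ab: "0 < a\<^sub>0" "a\<^sub>0 \<le> b\<^sub>0" "b\<^sub>0 < 1" "\<And>t. t \<notin> {a\<^sub>0..b\<^sub>0} \<Longrightarrow> \<psi> t = 0"
    by (rule test_function_unit_support[OF \<psi>]) blast
  have s\<psi>: "smooth \<psi>" using \<psi> by (simp add: test_functions_def)
  define A where "A = (LINT t|lborel. (deriv \<psi> t)\<^sup>2)"
  define B where "B = (LINT t|lborel. (\<psi> t)\<^sup>2)"
  define F where "F = (LINT t|lborel. \<bar>\<psi> t\<bar> powr q)"
  define m where "m = DIM('a) - 1"
  have nn: "A \<ge> 0" "B \<ge> 0" "F > 0" unfolding A_def B_def F_def using F by (auto intro!: integral_nonneg_AE)
  have "lambda2 q (slab e L) * measure lebesgue (slab e L) powr ((2 - q) / q)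
    \<le> (A + (real m * B * D\<^sub>0\<^sup>2) / L\<^sup>2) / (F * (1 - \<tau>) ^ m) powr (2 / q)" if L: "L \<ge> 1" for L
  proof -
    define l where "l = L * (1 - \<tau> / 2)"
    have l: "0 < l" "l < L" using L \<tau> by (auto simp: l_def)
    define \<eta>\<^sub>L where "\<eta>\<^sub>L = (\<lambda>t. 1 * \<eta> ((1 / L) * t + 0))"
    have \<eta>L: "\<eta>\<^sub>L t = \<eta> (t / L)" for t by (simp add: \<eta>\<^sub>L_def)
    have sm: "smooth \<eta>\<^sub>L" unfolding \<eta>\<^sub>L_def by (rule smooth_affine[OF \<eta>(1)])
    have z: "\<eta>\<^sub>L t = 0" if "t \<notin> {- l..l}" for t
      unfolding \<eta>L by (rule \<eta>(5)) (use that L in \<open>auto simp: l_def divide_simps algebra_simps\<close>)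
    have dL: "deriv \<eta>\<^sub>L t = deriv \<eta> (t / L) / L" for t
    proof (rule DERIV_imp_deriv)
      have "((\<lambda>t. \<eta> (t / L)) has_real_derivative deriv \<eta> (t / L) * (1 / L)) (at t)"
        by (rule DERIV_chain2[OF smooth_real_derivative(1)[OF \<eta>(1)]]) (use L in \<open>auto intro!: derivative_eq_intros\<close>)
      then show "(\<eta>\<^sub>L has_real_derivative deriv \<eta> (t / L) / L) (at t)" by (simp add: \<eta>\<^sub>L_def)
    qed
    have z': "deriv \<eta>\<^sub>L t = 0" if "t \<notin> {- l..l}" for t
      by (rule deriv_zero_off_interval[of "- l" l]) (rule z, assumption, rule that)
    have ind_int: "integrable lborel (\<lambda>t. indicat_real {- L..L} t * c)" "(LINT t|lborel. indicat_real {- L..L} t * c) = 2 * L * c" for c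
      using L by auto
    have le_ind: "(LINT t|lborel. h t) \<le> 2 * L * c"
      if "continuous_on UNIV h" "\<And>t. t \<notin> {- l..l} \<Longrightarrow> h t = 0" "\<And>t. h t \<le> c" "c \<ge> 0" for h c
    proof -
      have "(LINT t|lborel. h t) \<le> (LINT t|lborel. indicat_real {- L..L} t * c)"
      proof (rule integral_mono[OF integrable_continuous_compact_support[OF that(1) compact_Icc that(2)] ind_int(1)])
        show "h t \<le> indicat_real {- L..L} t * c" for t
          using that(2)[of t] that(3)[of t] l by (cases "t \<in> {- L..L}") auto
      qed auto
      then show ?thesis by (simp only: ind_int)
    qed
    define g where "g = (\<lambda>b. if b = e then \<psi> else \<eta>\<^sub>L)"
    define lo where "lo = (\<Sum>b\<in>Basis. (if b = e then a\<^sub>0 else - l) *\<^sub>R b)"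
    define hi where "hi = (\<Sum>b\<in>Basis. (if b = e then b\<^sub>0 else l) *\<^sub>R b)"
    have lohi: "lo \<bullet> b = (if b = e then a\<^sub>0 else - l)" "hi \<bullet> b = (if b = e then b\<^sub>0 else l)" if "b \<in> Basis" for b
      using that by (auto simp: lo_def hi_def inner_sum_left_Basis)
    have gs: "smooth (g b)" for b using s\<psi> sm by (simp add: g_def)
    have gz: "g b t = 0" if "b \<in> Basis" "t \<notin> {lo \<bullet> b..hi \<bullet> b}" for b t
      using that(2) ab(4)[of t] z[of t] unfolding g_def lohi[OF that(1)] by (cases "b = e") auto
    have sub: "cbox lo hi \<subseteq> slab e L"
    proof
      fix x assume "x \<in> cbox lo hi"
      then have x: "lo \<bullet> b \<le> x \<bullet> b" "x \<bullet> b \<le> hi \<bullet> b" if "b \<in> Basis" for b using that by (auto simp: mem_box)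
      show "x \<in> slab e L"
        unfolding mem_slab
      proof
        fix b :: 'a assume b: "b \<in> Basis"
        show "if b = e then 0 < x \<bullet> b \<and> x \<bullet> b < 1 else \<bar>x \<bullet> b\<bar> < L"
          using x[OF b] lohi[OF b] ab l by (auto simp: abs_less_iff)
      qed
    qed
    let ?\<Phi> = "\<lambda>x. \<Prod>b\<in>Basis. g b (x \<bullet> b)"
    have test: "?\<Phi> \<in> test_functions (slab e L)"
      by (rule coordinate_product_test_function[of g lo hi]) (simp_all add: gs gz sub)
    have split: "(\<Prod>b\<in>Basis. h b) = h e * (\<Prod>b\<in>Basis - {e}. h b)" for h :: "'a \<Rightarrow> real"
      using e by (intro prod.remove) auto
    have card: "card (Basis - {e}) = m" using e by (simp add: m_def card_Diff_singleton)
    have Lq: "F * (2 * L * (1 - \<tau>)) ^ m \<le> (LINT x|lborel. \<bar>?\<Phi> x\<bar> powr q)"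
    proof -
      have cont: "continuous_on UNIV (\<lambda>t. \<bar>g b t\<bar> powr q)" for b
        using q smooth_derivative(3)[OF gs] by (auto intro!: continuous_intros continuous_on_powr')
      have int: "integrable lborel (\<lambda>t. \<bar>g b t\<bar> powr q)" if b: "b \<in> Basis" for b
        by (rule integrable_continuous_compact_support[OF cont compact_Icc[of "lo \<bullet> b" "hi \<bullet> b"]]) (use gz[OF b] in simp)
      have one: "2 * L * (1 - \<tau>) \<le> (LINT t|lborel. \<bar>g b t\<bar> powr q)" if b: "b \<in> Basis - {e}" for b
      proof -
        have "(LINT t|lborel. indicat_real {- (L * (1 - \<tau>))..L * (1 - \<tau>)} t) \<le> (LINT t|lborel. \<bar>g b t\<bar> powr q)"
        proof (rule integral_mono)
          show "integrable lborel (indicat_real {- (L * (1 - \<tau>))..L * (1 - \<tau>)})"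
            by (rule integrable_real_indicator) (auto simp: emeasure_lborel_Icc_eq)
          show "integrable lborel (\<lambda>t. \<bar>g b t\<bar> powr q)" using b by (intro int) auto
          fix t :: real
          show "indicat_real {- (L * (1 - \<tau>))..L * (1 - \<tau>)} t \<le> \<bar>g b t\<bar> powr q"
          proof (cases "t \<in> {- (L * (1 - \<tau>))..L * (1 - \<tau>)}")
            case True
            then have "\<bar>t / L\<bar> \<le> 1 - \<tau>" using L by (auto simp: abs_le_iff divide_simps algebra_simps)
            then show ?thesis using b \<eta>(4)[of "t / L"] by (auto simp: g_def \<eta>L)
          qed auto
        qed
        then show ?thesis using L \<tau> by (simp add: mult.assoc)
      qed
      have "\<bar>?\<Phi> x\<bar> powr q = (\<Prod>b\<in>Basis. \<bar>g b (x \<bullet> b)\<bar> powr q)" for x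
        by (simp add: abs_prod prod_powr_distrib)
      then have "(LINT x|lborel. \<bar>?\<Phi> x\<bar> powr q) = (\<Prod>b\<in>Basis. LINT t|lborel. \<bar>g b t\<bar> powr q)"
        using integral_coordinate_product(2)[where f = "\<lambda>b t. \<bar>g b t\<bar> powr q", OF int] by simp
      also have "\<dots> = F * (\<Prod>b\<in>Basis - {e}. LINT t|lborel. \<bar>g b t\<bar> powr q)"
        unfolding split by (simp add: g_def F_def)
      also have "\<dots> \<ge> F * (\<Prod>b\<in>Basis - {e}. 2 * L * (1 - \<tau>))"
        using nn L \<tau> one by (intro mult_left_mono prod_mono) auto
      finally show ?thesis using card by simp
    qed
    have energy: "(LINT x|lborel. (norm (grad ?\<Phi> x))\<^sup>2) \<le> (2 * L) ^ m * (A + (real m * B * D\<^sub>0\<^sup>2) / L\<^sup>2)"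
    proof -
      \<comment> \<open>\<open>\<kappa>\<close> bounds the square of the slope of the stretched
        plateau.\<close>
      define \<kappa> where "\<kappa> = D\<^sub>0\<^sup>2 / L\<^sup>2"
      have \<kappa>: "\<kappa> \<ge> 0" by (simp add: \<kappa>_def)
      have c: "continuous_on UNIV (\<lambda>t. (\<eta>\<^sub>L t)\<^sup>2)" "continuous_on UNIV (\<lambda>t. (deriv \<eta>\<^sub>L t)\<^sup>2)"
        by (rule continuous_on_power[OF smooth_derivative(3)[OF sm]],
            rule continuous_on_power[OF smooth_derivative(3)[OF smooth_real_derivative(2)[OF sm]]])
      have i1: "(LINT t|lborel. (\<eta>\<^sub>L t)\<^sup>2) \<le> 2 * L * 1"
        by (rule le_ind[OF c(1)]) (use z \<eta>(2,3) in \<open>auto simp: \<eta>L intro: power_le_one\<close>)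
      have i2: "(LINT t|lborel. (deriv \<eta>\<^sub>L t)\<^sup>2) \<le> 2 * L * \<kappa>"
      proof (rule le_ind[OF c(2)])
        show "(deriv \<eta>\<^sub>L t)\<^sup>2 = 0" if "t \<notin> {- l..l}" for t using z'[OF that] by simp
        show "(deriv \<eta>\<^sub>L t)\<^sup>2 \<le> \<kappa>" for t
        proof -
          have "(deriv \<eta> (t / L))\<^sup>2 \<le> D\<^sub>0\<^sup>2" using \<eta>(6)[of "t / L"] \<eta>(7) by (simp add: abs_le_square_iff[symmetric])
          then show ?thesis using L by (simp add: dL \<kappa>_def power_divide divide_right_mono)
        qed
      qed (rule \<kappa>)
      have "(LINT x|lborel. (norm (grad ?\<Phi> x))\<^sup>2)
          = (\<Sum>c\<in>Basis. \<Prod>b\<in>Basis. LINT t|lborel. ((if b = c then deriv (g b) else g b) t)\<^sup>2)"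
        by (rule integral_grad_coordinate_product[of g lo hi]) (simp_all add: gs gz)
      also have "\<dots> \<le> (\<Sum>c\<in>Basis. (if c = e then A else B * \<kappa>) * (2 * L) ^ m)"
      proof (rule sum_mono)
        fix c :: 'a assume cB: "c \<in> Basis"
        have "(\<Prod>b\<in>Basis. LINT t|lborel. ((if b = c then deriv (g b) else g b) t)\<^sup>2)
            = (if c = e then A else B) * (\<Prod>b\<in>Basis - {e}. LINT t|lborel. ((if b = c then deriv (g b) else g b) t)\<^sup>2)"
          unfolding split by (auto simp: g_def A_def B_def)
        \<comment> \<open>For \<open>c = e\<close> all plateaus enter undifferentiated; otherwise
          exactly one of them enters through its slope.\<close>
        also have "\<dots> \<le> (if c = e then A else B) * (\<Prod>b\<in>Basis - {e}. 2 * L * (if b = c then \<kappa> else 1))"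
        proof (intro mult_left_mono prod_mono conjI)
          fix b assume "b \<in> Basis - {e}"
          then show "(LINT t|lborel. ((if b = c then deriv (g b) else g b) t)\<^sup>2) \<le> 2 * L * (if b = c then \<kappa> else 1)"
            using i1 i2 by (auto simp: g_def)
        qed (use nn in \<open>auto intro!: integral_nonneg_AE\<close>)
        also have "(\<Prod>b\<in>Basis - {e}. 2 * L * (if b = c then \<kappa> else 1)) = (2 * L) ^ m * (if c = e then 1 else \<kappa>)"
          unfolding prod.distrib using cB by (simp add: card prod.delta)
        finally show "(\<Prod>b\<in>Basis. LINT t|lborel. ((if b = c then deriv (g b) else g b) t)\<^sup>2) \<le> (if c = e then A else B * \<kappa>) * (2 * L) ^ m"
          by (simp add: algebra_simps split: if_splits)
      qed
      also have "\<dots> = (2 * L) ^ m * (\<Sum>c\<in>Basis. (if c = e then A else B * \<kappa>))"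
        by (simp add: sum_distrib_right[symmetric] mult.commute)
      also have "(\<Sum>c\<in>Basis. (if c = e then A else B * \<kappa>)) = A + (\<Sum>c\<in>Basis - {e}. B * \<kappa>)"
        using e by (subst sum.remove[of _ e]) (auto intro!: sum.cong)
      also have "(\<Sum>c\<in>Basis - {e}. B * \<kappa>) = real m * B * D\<^sub>0\<^sup>2 / L\<^sup>2" by (simp add: card \<kappa>_def)
      finally show ?thesis .
    qed
    define V where "V = (2 * L) ^ m"
    have V: "V > 0" using L by (simp add: V_def)
    have F\<tau>: "F * (1 - \<tau>) ^ m > 0" using nn \<tau> by simp
    have Lq': "V * (F * (1 - \<tau>) ^ m) \<le> (LINT x|lborel. \<bar>?\<Phi> x\<bar> powr q)"
    proof -
      have "V * (F * (1 - \<tau>) ^ m) = F * (2 * L * (1 - \<tau>)) ^ m" unfolding V_def power_mult_distrib by simp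
      then show ?thesis using Lq by (simp only:)
    qed
    have "?\<Phi> \<noteq> (\<lambda>_. 0)"
    proof
      assume "?\<Phi> = (\<lambda>_. 0)"
      then have "?\<Phi> x = 0" for x by (rule fun_cong)
      then have "(LINT x|lborel. \<bar>?\<Phi> x\<bar> powr q) = 0" by (simp only:) simp
      then show False using Lq' mult_pos_pos[OF V F\<tau>] by linarith
    qed
    then have "lambda2 q (slab e L) \<le> (LINT x|lborel. (norm (grad ?\<Phi> x))\<^sup>2) / (LINT x|lborel. \<bar>?\<Phi> x\<bar> powr q) powr (2 / q)"
      by (rule lambda2_le[OF test _ q])
    also have "\<dots> \<le> (V * (A + (real m * B * D\<^sub>0\<^sup>2) / L\<^sup>2)) / (V * (F * (1 - \<tau>) ^ m)) powr (2 / q)"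
    proof (rule frac_le)
      show "(LINT x|lborel. (norm (grad ?\<Phi> x))\<^sup>2) \<le> V * (A + (real m * B * D\<^sub>0\<^sup>2) / L\<^sup>2)"
        using energy by (simp only: V_def)
      show "0 \<le> V * (A + (real m * B * D\<^sub>0\<^sup>2) / L\<^sup>2)" using V nn by simp
      show "0 < (V * (F * (1 - \<tau>) ^ m)) powr (2 / q)" using V nn \<tau> by simp
      show "(V * (F * (1 - \<tau>) ^ m)) powr (2 / q) \<le> (LINT x|lborel. \<bar>?\<Phi> x\<bar> powr q) powr (2 / q)"
        using Lq' q mult_pos_pos[OF V F\<tau>] by (intro powr_mono2) auto
    qed
    also have "\<dots> = (A + (real m * B * D\<^sub>0\<^sup>2) / L\<^sup>2) / (F * (1 - \<tau>) ^ m) powr (2 / q) * (V / V powr (2 / q))"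
      unfolding powr_mult[of V] by (simp only: times_divide_times_eq mult.commute)
    finally have "lambda2 q (slab e L) * V powr ((2 - q) / q)
        \<le> (A + (real m * B * D\<^sub>0\<^sup>2) / L\<^sup>2) / (F * (1 - \<tau>) ^ m) powr (2 / q) * (V / V powr (2 / q)) * V powr ((2 - q) / q)"
      by (intro mult_right_mono) auto
    also have "\<dots> = (A + (real m * B * D\<^sub>0\<^sup>2) / L\<^sup>2) / (F * (1 - \<tau>) ^ m) powr (2 / q) * (V powr 1 / V powr (2 / q) * V powr ((2 - q) / q))"
      using V by simp
    also have "V powr 1 / V powr (2 / q) * V powr ((2 - q) / q) = V powr (1 - 2 / q + (2 - q) / q)"
      by (simp only: powr_diff powr_add)
    also have "1 - 2 / q + (2 - q) / q = 0" using q by (simp add: field_simps)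
    finally show ?thesis
      unfolding slab_convex_body(5)[OF e L] m_def[symmetric] V_def[symmetric] using V by simp
  qed
  then show ?thesis using that[of "real m * B * D\<^sub>0\<^sup>2"] unfolding A_def F_def m_def by blast
qed

section \<open>Optimality of the constant\<close>

lemma test_function_c1_compact:
  fixes \<phi> :: "'a::euclidean_space \<Rightarrow> real"
  assumes "open \<Omega>" "bounded \<Omega>" "convex \<Omega>" and \<phi>: "\<phi> \<in> test_functions \<Omega>" "\<phi> \<noteq> (\<lambda>_. 0)"
  shows "c1_compact \<Omega> \<phi> (grad \<phi>) (closure {x. \<phi> x \<noteq> 0})"
proof
  show "compact (closure {x. \<phi> x \<noteq> 0})" "closure {x. \<phi> x \<noteq> 0} \<subseteq> \<Omega>" using \<phi>(1) by (auto simp: test_functions_def)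
  show "\<phi> x = 0" if "x \<notin> closure {x. \<phi> x \<noteq> 0}" for x
    using that closure_subset[of "{x. \<phi> x \<noteq> 0}"] by blast
  show "\<exists>x. \<phi> x \<noteq> 0" using \<phi>(2) by auto
qed (use assms test_function_gradient[OF \<phi>(1)] in auto)

text \<open>An infimum of quantities above a bound need not lie above it. Strictness requires a
  constant \<open>C\<close> beyond the bound that serves all test functions at once, and this is
  what the two gap theorems supply.\<close>

theorem lambda2_strict_lower_bound:
  fixes \<Omega> :: "'a::euclidean_space set"
  assumes q: "1 \<le> q" "q \<le> 2" and dim: "DIM('a) \<ge> 2" and \<Omega>: "\<Omega> \<noteq> {}" "open \<Omega>" "bounded \<Omega>" "convex \<Omega>"
  shows "lambda2 q \<Omega> * measure lebesgue \<Omega> powr ((2 - q) / q) > (pi2 q / (2 * inradius \<Omega>))\<^sup>2"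
proof -
  define V where "V = measure lborel \<Omega>"
  have mV: "measure lebesgue \<Omega> = V" unfolding V_def using \<Omega>(2) by (intro measure_completion) simp
  have V: "V > 0" unfolding V_def by (rule measure_pos_open[OF \<Omega>(2,3,1)])
  have ne: "test_functions \<Omega> - {\<lambda>_. 0} \<noteq> {}" using test_functions_nonempty[OF \<Omega>(1,2)] by blast
  note c1 = test_function_c1_compact[OF \<Omega>(2-4)]
  show ?thesis
  proof (cases "q = 2")
    case True
    obtain C where C: "C > (pi2 2 / (2 * inradius \<Omega>))\<^sup>2"
      "\<And>\<phi> G K. c1_compact \<Omega> \<phi> G K \<Longrightarrow> (LINT x|lborel. (norm (G x))\<^sup>2) \<ge> C * (LINT x|lborel. (\<phi> x)\<^sup>2)"
      by (rule quadratic_gap[OF dim \<Omega>]) blast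
    have "C \<le> lambda2 2 \<Omega>"
    proof (rule lambda2_ge[OF ne])
      fix \<phi> :: "'a \<Rightarrow> real" assume \<phi>: "\<phi> \<in> test_functions \<Omega>" "\<phi> \<noteq> (\<lambda>_. 0)"
      have pos: "(LINT x|lborel. (\<phi> x)\<^sup>2) > 0"
        using c1_compact.integral_phi_powr_pos[OF c1[OF \<phi>], of 2] by simp
      have "C \<le> (LINT x|lborel. (norm (grad \<phi> x))\<^sup>2) / (LINT x|lborel. (\<phi> x)\<^sup>2)"
        using C(2)[OF c1[OF \<phi>]] pos by (simp add: pos_le_divide_eq)
      then show "C \<le> (LINT x|lborel. (norm (grad \<phi> x))\<^sup>2) / (LINT x|lborel. \<bar>\<phi> x\<bar> powr 2) powr (2 / 2)"
        using pos by simp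
    qed simp
    then show ?thesis using True V C(1) by (simp add: mV)
  next
    case False
    then have q2: "q < 2" using q by simp
    obtain C where C: "C > (pi2 q / (2 * inradius \<Omega>))\<^sup>2 * V powr (1 - 2 / q)"
      "\<And>\<phi> G K. c1_compact \<Omega> \<phi> G K \<Longrightarrow> (LINT x|lborel. (norm (G x))\<^sup>2) \<ge> C * (LINT x|lborel. \<bar>\<phi> x\<bar> powr q) powr (2 / q)"
      unfolding V_def by (rule subquadratic_gap[OF q(1) q2 dim \<Omega>]) blast
    have "C \<le> lambda2 q \<Omega>"
    proof (rule lambda2_ge[OF ne])
      show "q > 0" using q by simp
      fix \<phi> :: "'a \<Rightarrow> real" assume \<phi>: "\<phi> \<in> test_functions \<Omega>" "\<phi> \<noteq> (\<lambda>_. 0)"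
      have "(LINT x|lborel. \<bar>\<phi> x\<bar> powr q) powr (2 / q) > 0"
        using c1_compact.integral_phi_powr_pos[OF c1[OF \<phi>], of q] q by simp
      then show "C \<le> (LINT x|lborel. (norm (grad \<phi> x))\<^sup>2) / (LINT x|lborel. \<bar>\<phi> x\<bar> powr q) powr (2 / q)"
        using C(2)[OF c1[OF \<phi>]] by (simp add: pos_le_divide_eq)
    qed
    then have "(pi2 q / (2 * inradius \<Omega>))\<^sup>2 * V powr (1 - 2 / q) * V powr ((2 - q) / q) < lambda2 q \<Omega> * V powr ((2 - q) / q)"
      using C(1) V by (intro mult_strict_right_mono) auto
    moreover have "V powr (1 - 2 / q) * V powr ((2 - q) / q) = 1"
    proof -
      have "1 - 2 / q + (2 - q) / q = 0" using q by (simp add: field_simps)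
      then show ?thesis unfolding powr_add[symmetric] using V by simp
    qed
    ultimately show ?thesis by (simp add: mV mult.assoc)
  qed
qed

lemma lambda2_nonneg:
  assumes "\<Omega> \<noteq> {}" and "open \<Omega>" and "q > 0"
  shows "lambda2 q \<Omega> \<ge> 0"
  by (rule lambda2_ge) (use assms test_functions_nonempty[OF assms(1,2)] in \<open>auto intro!: integral_nonneg_AE divide_nonneg_nonneg\<close>)

definition convex_bodies :: "'a::euclidean_space set set" where
  "convex_bodies = {\<Omega>. \<Omega> \<noteq> {} \<and> open \<Omega> \<and> bounded \<Omega> \<and> convex \<Omega>}"

definition scaled_lambda2 :: "real \<Rightarrow> 'a::euclidean_space set \<Rightarrow> real" where
  "scaled_lambda2 q \<Omega> = (inradius \<Omega>)\<^sup>2 * lambda2 q \<Omega> * measure lebesgue \<Omega> powr ((2 - q) / q)"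

lemma scaled_lambda2_nonneg: "q > 0 \<Longrightarrow> \<Omega> \<in> convex_bodies \<Longrightarrow> scaled_lambda2 q \<Omega> \<ge> 0"
  by (simp add: scaled_lambda2_def convex_bodies_def lambda2_nonneg)

lemma slab_in_convex_bodies: "e \<in> Basis \<Longrightarrow> L \<ge> 1 \<Longrightarrow> slab e L \<in> convex_bodies"
  by (simp add: convex_bodies_def slab_convex_body)

text \<open>The factor \<open>1 / 4\<close> is the square of the bound \<open>1 / 2\<close> for the
  inradius of the slab; it becomes the 2 in \<open>pi2 q / 2\<close>.\<close>

lemma INF_scaled_lambda2_le_slab:
  fixes e :: "'a::euclidean_space"
  assumes e: "e \<in> Basis" and L: "L \<ge> 1" and q: "q > 0"
  shows "(INF \<Omega>\<in>(convex_bodies :: 'a set set). scaled_lambda2 q \<Omega>)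
    \<le> (1 / 4) * (lambda2 q (slab e L) * measure lebesgue (slab e L) powr ((2 - q) / q))"
proof -
  note s = slab_convex_body[OF e L]
  have "(INF \<Omega>\<in>(convex_bodies :: 'a set set). scaled_lambda2 q \<Omega>) \<le> scaled_lambda2 q (slab e L)"
    by (intro cINF_lower slab_in_convex_bodies e L bdd_belowI2[of _ 0]) (simp add: scaled_lambda2_nonneg q)
  also have "\<dots> \<le> (1 / 2)\<^sup>2 * (lambda2 q (slab e L) * measure lebesgue (slab e L) powr ((2 - q) / q))"
    unfolding scaled_lambda2_def mult.assoc
    using s lambda2_nonneg[OF s(4,1) q] by (intro mult_right_mono power_mono) auto
  finally show ?thesis by (simp add: power2_eq_square)
qed

lemma INF_scaled_lambda2_nonneg:
  assumes "q > 0"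
  shows "0 \<le> (INF \<Omega>\<in>(convex_bodies :: 'a::euclidean_space set set). scaled_lambda2 q \<Omega>)"
proof (rule cINF_greatest)
  obtain e :: 'a where "e \<in> Basis" using nonempty_Basis by blast
  then show "convex_bodies \<noteq> ({} :: 'a set set)" using slab_in_convex_bodies[of e 1] by auto
qed (rule scaled_lambda2_nonneg[OF assms])

lemma INF_scaled_lambda2_ge:
  assumes q: "1 \<le> q" "q \<le> 2" and dim: "DIM('a::euclidean_space) \<ge> 2"
  shows "(pi2 q / 2)\<^sup>2 \<le> (INF \<Omega>\<in>(convex_bodies :: 'a set set). scaled_lambda2 q \<Omega>)"
proof (rule cINF_greatest)
  obtain e :: 'a where "e \<in> Basis" using nonempty_Basis by blast
  then show "convex_bodies \<noteq> ({} :: 'a set set)" using slab_in_convex_bodies[of e 1] by auto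
  fix \<Omega> :: "'a set" assume "\<Omega> \<in> convex_bodies"
  then have \<Omega>: "\<Omega> \<noteq> {}" "open \<Omega>" "bounded \<Omega>" "convex \<Omega>" by (auto simp: convex_bodies_def)
  have R: "inradius \<Omega> > 0" by (rule inradius_attained[OF \<Omega>(1-3)])
  have "(pi2 q / 2)\<^sup>2 = (inradius \<Omega>)\<^sup>2 * (pi2 q / (2 * inradius \<Omega>))\<^sup>2"
    using R by (simp add: power_divide power_mult_distrib)
  also have "\<dots> \<le> (inradius \<Omega>)\<^sup>2 * (lambda2 q \<Omega> * measure lebesgue \<Omega> powr ((2 - q) / q))"
    using lambda2_strict_lower_bound[OF q dim \<Omega>] by (intro mult_left_mono) auto
  finally show "(pi2 q / 2)\<^sup>2 \<le> scaled_lambda2 q \<Omega>" by (simp add: scaled_lambda2_def mult.assoc)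
qed

text \<open>Two successive limits, since the error constant \<open>D\<close> depends on the plateau:
  the length of the slab tends to infinity for fixed \<open>\<tau>\<close>, and only then
  \<open>\<tau>\<close> tends to 0.\<close>

lemma INF_scaled_lambda2_le_test_function:
  assumes \<psi>: "\<psi> \<in> test_functions {0<..<1}" and F: "(LINT t|lborel. \<bar>\<psi> t\<bar> powr q) > 0" and q: "q > 0"
  shows "(INF \<Omega>\<in>(convex_bodies :: 'a::euclidean_space set set). scaled_lambda2 q \<Omega>)
    \<le> (1 / 4) * ((LINT t|lborel. (deriv \<psi> t)\<^sup>2) / (LINT t|lborel. \<bar>\<psi> t\<bar> powr q) powr (2 / q))" (is "?I \<le> _")
proof -
  define A where "A = (LINT t|lborel. (deriv \<psi> t)\<^sup>2)"
  define F where "F = (LINT t|lborel. \<bar>\<psi> t\<bar> powr q)"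
  have F0: "F > 0" using F by (simp add: F_def)
  define m where "m = DIM('a) - 1"
  obtain e :: 'a where e: "e \<in> Basis" using nonempty_Basis by blast
  have I\<tau>: "?I \<le> (1 / 4) * (A / (F * (1 - \<tau>) ^ m) powr (2 / q))" if \<tau>: "0 < \<tau>" "\<tau> < 1" for \<tau>
  proof -
    obtain D where D: "\<And>L. L \<ge> 1 \<Longrightarrow> lambda2 q (slab e L) * measure lebesgue (slab e L) powr ((2 - q) / q)
        \<le> (A + D / L\<^sup>2) / (F * (1 - \<tau>) ^ m) powr (2 / q)"
      unfolding A_def F_def m_def by (rule slab_lambda2_le[OF e \<psi> F q \<tau>]) blast
    have "(\<lambda>n. (1 / 4) * ((A + D * (inverse (real (Suc n)))\<^sup>2) / (F * (1 - \<tau>) ^ m) powr (2 / q)))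
        \<longlonglongrightarrow> (1 / 4) * ((A + D * 0\<^sup>2) / (F * (1 - \<tau>) ^ m) powr (2 / q))"
      using F0 \<tau> by (intro tendsto_intros LIMSEQ_inverse_real_of_nat) auto
    moreover have "?I \<le> (1 / 4) * ((A + D * (inverse (real (Suc n)))\<^sup>2) / (F * (1 - \<tau>) ^ m) powr (2 / q))" for n
    proof -
      have "?I \<le> (1 / 4) * (lambda2 q (slab e (real (Suc n))) * measure lebesgue (slab e (real (Suc n))) powr ((2 - q) / q))"
        by (rule INF_scaled_lambda2_le_slab[OF e _ q]) simp
      also have "\<dots> \<le> (1 / 4) * ((A + D / (real (Suc n))\<^sup>2) / (F * (1 - \<tau>) ^ m) powr (2 / q))"
        by (intro mult_left_mono D) auto
      finally show ?thesis by (simp only: divide_inverse power_inverse)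
    qed
    ultimately have "?I \<le> (1 / 4) * ((A + D * 0\<^sup>2) / (F * (1 - \<tau>) ^ m) powr (2 / q))"
      by (intro LIMSEQ_le_const) auto
    then show ?thesis by simp
  qed
  \<comment> \<open>Halving keeps \<open>\<tau>\<close> below 1 also for
    \<open>n = 0\<close>.\<close>
  have lim: "(\<lambda>n. (1 / 4) * (A / (F * (1 - inverse (real (Suc n)) / 2) ^ m) powr (2 / q)))
      \<longlonglongrightarrow> (1 / 4) * (A / (F * (1 - 0 / 2) ^ m) powr (2 / q))"
    using F0 by (intro tendsto_intros LIMSEQ_inverse_real_of_nat) auto
  have "?I \<le> (1 / 4) * (A / (F * (1 - inverse (real (Suc n)) / 2) ^ m) powr (2 / q))" for n
    by (rule I\<tau>) (auto simp: divide_simps)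
  then have "?I \<le> (1 / 4) * (A / (F * (1 - 0 / 2) ^ m) powr (2 / q))"
    by (intro LIMSEQ_le_const[OF lim]) auto
  then show ?thesis by (simp add: A_def F_def)
qed

lemma Lp_norm_power2:
  assumes "p > 0"
  shows "(Lp_norm p S f)\<^sup>2 = (LINT x:S|lebesgue. \<bar>f x\<bar> powr p) powr (2 / p)"
  unfolding Lp_norm_def power2_eq_square powr_add[symmetric] by simp

text \<open>The smooth approximations converge uniformly and have energy at most \<open>E\<close>,
  so only the integral of the \<open>q\<close>-th power in the denominator needs a limit.\<close>

lemma INF_scaled_lambda2_le_W12:
  assumes W: "W12 \<phi> g" and cont: "continuous_on {0..1} \<phi>" and bd: "\<phi> 0 = 0" "\<phi> 1 = 0"
    and z: "z \<in> {0<..<1}" "\<phi> z \<noteq> 0" and q: "q \<ge> 1"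
  shows "(INF \<Omega>\<in>(convex_bodies :: 'a::euclidean_space set set). scaled_lambda2 q \<Omega>)
    \<le> (1 / 4) * (Lp_norm 2 {0<..<1} g / Lp_norm q {0<..<1} \<phi>)\<^sup>2" (is "?I \<le> _")
proof -
  define E where "E = (LINT x:{0<..<1}|lebesgue. \<bar>g x\<bar> powr 2)"
  define F where "F = integral {0..1} (\<lambda>x. \<bar>\<phi> x\<bar> powr q)"
  have E0: "E \<ge> 0" unfolding E_def set_lebesgue_integral_def by (intro integral_nonneg_AE) simp
  have cp: "continuous_on A (\<lambda>x. \<bar>f x\<bar> powr q)" if "continuous_on A f" for A and f :: "real \<Rightarrow> real"
    using q that by (auto intro!: continuous_intros continuous_on_powr')
  have F0: "F > 0"
  proof -
    have "F \<ge> 0" unfolding F_def by (intro integral_nonneg integrable_continuous_real cp cont) simp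
    moreover have "F \<noteq> 0"
    proof
      assume "F = 0"
      then have "\<bar>\<phi> z\<bar> powr q = 0"
        using integral_eq_0_iff[of 0 1 "\<lambda>x. \<bar>\<phi> x\<bar> powr q"] cp[OF cont] z(1) unfolding F_def by auto
      then show False using z(2) by simp
    qed
    ultimately show ?thesis by simp
  qed
  have "\<forall>n. \<exists>\<psi>. \<psi> \<in> test_functions {0<..<1} \<and> (\<forall>x\<in>{0<..<1}. \<bar>\<psi> x - \<phi> x\<bar> \<le> inverse (real (Suc n))) \<and> (LINT t|lborel. (deriv \<psi> t)\<^sup>2) \<le> E"
  proof
    fix n
    have "inverse (real (Suc n)) > 0" by simp
    from W12_approx_test_function[OF W cont bd this]
    show "\<exists>\<psi>. \<psi> \<in> test_functions {0<..<1} \<and> (\<forall>x\<in>{0<..<1}. \<bar>\<psi> x - \<phi> x\<bar> \<le> inverse (real (Suc n))) \<and> (LINT t|lborel. (deriv \<psi> t)\<^sup>2) \<le> E"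
      unfolding E_def by metis
  qed
  from choice[OF this] obtain \<psi> where
    \<psi>: "\<And>n. \<psi> n \<in> test_functions {0<..<1}" "\<And>n x. x \<in> {0<..<1} \<Longrightarrow> \<bar>\<psi> n x - \<phi> x\<bar> \<le> inverse (real (Suc n))"
      "\<And>n. (LINT t|lborel. (deriv (\<psi> n) t)\<^sup>2) \<le> E" by blast
  have close: "\<bar>\<psi> n x - \<phi> x\<bar> \<le> inverse (real (Suc n))" if "x \<in> {0..1}" for n x
  proof (cases "x \<in> {0<..<1}")
    case False
    then have "x = 0 \<or> x = 1" using that by auto
    then have "\<psi> n x = 0" "\<phi> x = 0" using test_function_gradient(4)[OF \<psi>(1)[of n], of x] bd by auto
    then show ?thesis by simp
  qed (rule \<psi>(2))
  have c\<psi>: "continuous_on UNIV (\<psi> n)" for n by (rule test_function_gradient(3)[OF \<psi>(1)])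
  have F\<psi>: "(LINT t|lborel. \<bar>\<psi> n t\<bar> powr q) = integral {0..1} (\<lambda>x. \<bar>\<psi> n x\<bar> powr q)" for n
  proof -
    have "(LINT t|lborel. \<bar>\<psi> n t\<bar> powr q) = (LINT t:{0<..<1}|lebesgue. \<bar>\<psi> n t\<bar> powr q)"
      by (rule set_integral_lebesgue_eq_lborel[symmetric]) (use test_function_gradient(4)[OF \<psi>(1)] cp[OF c\<psi>] in auto)
    then show ?thesis using set_integral_unit_continuous(1)[OF cp[OF continuous_on_subset[OF c\<psi>]]] by simp
  qed
  have "bounded (\<phi> ` {0..1})" by (intro compact_imp_bounded compact_continuous_image cont compact_Icc)
  then have "\<exists>M. \<forall>x\<in>{0..1}. \<bar>\<phi> x\<bar> \<le> M" by (auto simp: bounded_real)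
  then obtain M where M: "\<And>x. x \<in> {0..1} \<Longrightarrow> \<bar>\<phi> x\<bar> \<le> M" by blast
  have lim: "(\<lambda>n. integral {0..1} (\<lambda>x. \<bar>\<psi> n x\<bar> powr q)) \<longlonglongrightarrow> F"
    unfolding F_def
  proof (rule dominated_convergence(2))
    show "(\<lambda>x. \<bar>\<psi> n x\<bar> powr q) integrable_on {0..1}" for n
      by (intro integrable_continuous_real cp continuous_on_subset[OF c\<psi>]) simp
    show "(\<lambda>_. (M + 1) powr q) integrable_on {0..1::real}" by (intro integrable_continuous_real continuous_on_const)
    show "norm (\<bar>\<psi> n x\<bar> powr q) \<le> (M + 1) powr q" if "x \<in> {0..1}" for n x
    proof -
      have "inverse (real (Suc n)) \<le> 1" by (simp add: divide_simps)
      then have "\<bar>\<psi> n x\<bar> \<le> M + 1" using close[OF that, of n] M[OF that] by linarith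
      then show ?thesis using q by (simp add: powr_mono2)
    qed
    show "(\<lambda>n. \<bar>\<psi> n x\<bar> powr q) \<longlonglongrightarrow> \<bar>\<phi> x\<bar> powr q" if x: "x \<in> {0..1}" for x
    proof -
      have "(\<lambda>n. \<psi> n x - \<phi> x) \<longlonglongrightarrow> 0"
        by (rule Lim_null_comparison[OF _ LIMSEQ_inverse_real_of_nat]) (use close[OF x] in auto)
      then have "(\<lambda>n. \<psi> n x) \<longlonglongrightarrow> \<phi> x" by (simp add: LIM_zero_iff)
      then show ?thesis using q by (intro tendsto_powr' tendsto_rabs tendsto_const) auto
    qed
  qed
  \<comment> \<open>Multiplied out, the estimate also covers those \<open>n\<close> for which
    \<open>\<psi> n\<close> vanishes.\<close>
  have "?I * (integral {0..1} (\<lambda>x. \<bar>\<psi> n x\<bar> powr q)) powr (2 / q) \<le> (1 / 4) * E" for n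
  proof (cases "(LINT t|lborel. \<bar>\<psi> n t\<bar> powr q) > 0")
    case True
    define P where "P = (LINT t|lborel. \<bar>\<psi> n t\<bar> powr q) powr (2 / q)"
    have P: "P > 0" using True by (simp add: P_def)
    have "?I \<le> (1 / 4) * ((LINT t|lborel. (deriv (\<psi> n) t)\<^sup>2) / P)"
      unfolding P_def by (rule INF_scaled_lambda2_le_test_function[OF \<psi>(1) True]) (use q in simp)
    then have "?I * P \<le> (1 / 4) * (LINT t|lborel. (deriv (\<psi> n) t)\<^sup>2)" using P by (simp add: field_simps)
    also have "\<dots> \<le> (1 / 4) * E" using \<psi>(3)[of n] by simp
    finally show ?thesis by (simp add: P_def F\<psi>)
  next
    case False
    moreover have "(LINT t|lborel. \<bar>\<psi> n t\<bar> powr q) \<ge> 0" by (intro integral_nonneg_AE) simp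
    ultimately show ?thesis using E0 by (simp add: F\<psi>)
  qed
  moreover have "(\<lambda>n. ?I * (integral {0..1} (\<lambda>x. \<bar>\<psi> n x\<bar> powr q)) powr (2 / q)) \<longlonglongrightarrow> ?I * F powr (2 / q)"
    using F0 by (intro tendsto_intros lim) auto
  ultimately have "?I * F powr (2 / q) \<le> (1 / 4) * E" by (intro LIMSEQ_le_const2) auto
  then have "?I \<le> (1 / 4) * (E / F powr (2 / q))" using F0 by (simp add: field_simps)
  also have "E / F powr (2 / q) = (Lp_norm 2 {0<..<1} g / Lp_norm q {0<..<1} \<phi>)\<^sup>2"
  proof -
    have "(Lp_norm 2 {0<..<1} g)\<^sup>2 = E powr (2 / 2)" unfolding E_def by (rule Lp_norm_power2) simp
    moreover have "(Lp_norm q {0<..<1} \<phi>)\<^sup>2 = F powr (2 / q)"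
      unfolding F_def set_integral_unit_continuous(1)[OF cp[OF cont], symmetric] by (rule Lp_norm_power2) (use q in simp)
    ultimately show ?thesis using E0 by (simp add: power_divide)
  qed
  finally show ?thesis .
qed

text \<open>Needed to see that the set whose infimum is \<open>pi2 q\<close> is nonempty.\<close>

lemma W12_test_function:
  assumes \<phi>: "\<phi> \<in> test_functions {0<..<1}"
  shows "W12 \<phi> (deriv \<phi>)"
proof -
  note d\<phi> = test_function_unit_derivative[OF \<phi>]
  have in_Lp: "in_Lp 2 {0<..<1} f" if f: "continuous_on UNIV f" for f :: "real \<Rightarrow> real"
    unfolding in_Lp_def set_borel_measurable_def
  proof
    show "(\<lambda>x. indicat_real {0<..<1} x *\<^sub>R f x) \<in> borel_measurable lebesgue"
      using borel_measurable_integrable[OF set_integral_unit_continuous(2)[OF continuous_on_subset[OF f], unfolded set_integrable_def]]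
      by simp
    have "continuous_on {0..1} (\<lambda>x. \<bar>f x\<bar> powr 2)"
      by (auto intro!: continuous_intros continuous_on_subset[OF f])
    then show "set_integrable lebesgue {0<..<1} (\<lambda>x. \<bar>f x\<bar> powr 2)" by (rule set_integral_unit_continuous(2))
  qed
  have "(LINT x:{0<..<1}|lebesgue. \<phi> x * deriv \<psi> x) = - (LINT x:{0<..<1}|lebesgue. deriv \<phi> x * \<psi> x)"
    if \<psi>: "\<psi> \<in> test_functions {0<..<1}" for \<psi>
  proof -
    note d\<psi> = test_function_unit_derivative[OF \<psi>]
    have c: "continuous_on {0..1} (\<lambda>x. \<phi> x * deriv \<psi> x)" "continuous_on {0..1} (\<lambda>x. deriv \<phi> x * \<psi> x)"
      by (rule continuous_on_mult[OF d\<phi>(2) d\<psi>(3)], rule continuous_on_mult[OF d\<phi>(3) d\<psi>(2)])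
    have "((\<lambda>x. \<phi> x * \<psi> x) has_vector_derivative \<phi> x * deriv \<psi> x + deriv \<phi> x * \<psi> x) (at x within {0..1})" for x
      by (rule has_vector_derivative_at_within)
         (rule DERIV_mult'[OF d\<phi>(1) d\<psi>(1), unfolded has_real_derivative_iff_has_vector_derivative])
    then have "((\<lambda>x. \<phi> x * deriv \<psi> x + deriv \<phi> x * \<psi> x) has_integral (\<phi> 1 * \<psi> 1 - \<phi> 0 * \<psi> 0)) {0..1}"
      by (rule fundamental_theorem_of_calculus[OF zero_le_one])
    then have "integral {0..1} (\<lambda>x. \<phi> x * deriv \<psi> x + deriv \<phi> x * \<psi> x) = 0"
      using test_function_gradient(4)[OF \<psi>, of 0] test_function_gradient(4)[OF \<psi>, of 1] by (simp add: integral_unique)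
    then have "integral {0..1} (\<lambda>x. \<phi> x * deriv \<psi> x) + integral {0..1} (\<lambda>x. deriv \<phi> x * \<psi> x) = 0"
      using Henstock_Kurzweil_Integration.integral_add[OF integrable_continuous_real[OF c(1)] integrable_continuous_real[OF c(2)]] by simp
    then show ?thesis using set_integral_unit_continuous(1)[OF c(1)] set_integral_unit_continuous(1)[OF c(2)] by simp
  qed
  then show ?thesis unfolding W12_def using in_Lp[OF d\<phi>(2)] in_Lp[OF d\<phi>(3)] by blast
qed

text \<open>\<open>pi2 q\<close> is an infimum of quotients of norms, not of their squares; so
  \<open>2 * sqrt\<close> of the infimum over convex bodies is shown to be a lower bound of every
  admissible quotient.\<close>

lemma INF_scaled_lambda2_le_pi2:
  assumes q: "q \<ge> 1"
  shows "(INF \<Omega>\<in>(convex_bodies :: 'a::euclidean_space set set). scaled_lambda2 q \<Omega>) \<le> (pi2 q / 2)\<^sup>2" (is "?I \<le> _")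
proof -
  have I0: "?I \<ge> 0" by (rule INF_scaled_lambda2_nonneg) (use q in simp)
  have "2 * sqrt ?I \<le> pi2 q"
    unfolding pi2_def
  proof (rule cInf_greatest)
    obtain \<phi> where \<phi>: "\<phi> \<in> test_functions {0<..<1::real}" "\<phi> \<noteq> (\<lambda>_. 0)"
      by (rule test_functions_nonempty[of "{0<..<1::real}"]) auto
    then obtain z where z: "\<phi> z \<noteq> 0" by auto
    have z0: "\<phi> x = 0" if "x \<notin> {0<..<1}" for x by (rule test_function_gradient(4)[OF \<phi>(1) that])
    then have "z \<in> {0<..<1}" "\<phi> 0 = 0" "\<phi> 1 = 0" using z by auto
    then have "Lp_norm 2 {0<..<1} (deriv \<phi>) / Lp_norm q {0<..<1} \<phi> \<in> {Lp_norm 2 {0<..<1} \<phi>' / Lp_norm q {0<..<1} \<phi> | \<phi> \<phi>'.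
        W12 \<phi> \<phi>' \<and> continuous_on {0..1} \<phi> \<and> \<phi> 0 = 0 \<and> \<phi> 1 = 0 \<and> (\<exists>x\<in>{0<..<1}. \<phi> x \<noteq> 0)}"
      using z by (intro CollectI exI[of _ \<phi>] exI[of _ "deriv \<phi>"] conjI refl bexI[of _ z] W12_test_function \<phi>
          test_function_unit_derivative(2)[OF \<phi>(1)])
    then show "{Lp_norm 2 {0<..<1} \<phi>' / Lp_norm q {0<..<1} \<phi> | \<phi> \<phi>'.
        W12 \<phi> \<phi>' \<and> continuous_on {0..1} \<phi> \<and> \<phi> 0 = 0 \<and> \<phi> 1 = 0 \<and> (\<exists>x\<in>{0<..<1}. \<phi> x \<noteq> 0)} \<noteq> {}"
      by (rule ex_in_conv[THEN iffD1, OF exI])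
  next
    fix r assume "r \<in> {Lp_norm 2 {0<..<1} \<phi>' / Lp_norm q {0<..<1} \<phi> | \<phi> \<phi>'.
        W12 \<phi> \<phi>' \<and> continuous_on {0..1} \<phi> \<and> \<phi> 0 = 0 \<and> \<phi> 1 = 0 \<and> (\<exists>x\<in>{0<..<1}. \<phi> x \<noteq> 0)}"
    then obtain \<phi> g z where r: "r = Lp_norm 2 {0<..<1} g / Lp_norm q {0<..<1} \<phi>"
      and \<phi>: "W12 \<phi> g" "continuous_on {0..1} \<phi>" "\<phi> 0 = 0" "\<phi> 1 = 0" "z \<in> {0<..<1}" "\<phi> z \<noteq> 0" by blast
    have "?I \<le> (1 / 4) * r\<^sup>2" unfolding r by (rule INF_scaled_lambda2_le_W12[OF \<phi> q])
    then have "?I \<le> (r / 2)\<^sup>2" by (simp add: power_divide)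
    moreover have "r \<ge> 0" unfolding r Lp_norm_def by simp
    ultimately have "sqrt ?I \<le> r / 2" by (intro real_le_lsqrt) auto
    then show "2 * sqrt ?I \<le> r" by simp
  qed
  then have "sqrt ?I \<le> pi2 q / 2" by simp
  then have "(sqrt ?I)\<^sup>2 \<le> (pi2 q / 2)\<^sup>2" using I0 by (intro power_mono) auto
  then show ?thesis using I0 by simp
qed

text \<open>A test function for the slab with \<open>L = 1\<close> is one for all longer slabs, so
  \<open>lambda2\<close> stays bounded while the negative power of the volume tends to 0.\<close>

lemma INF_scaled_lambda2_supercritical:
  assumes q: "q > 2" and dim: "DIM('a::euclidean_space) \<ge> 2"
  shows "(INF \<Omega>\<in>(convex_bodies :: 'a set set). scaled_lambda2 q \<Omega>) = 0" (is "?I = 0")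
proof (rule antisym)
  have q0: "q > 0" using q by simp
  show "?I \<ge> 0" by (rule INF_scaled_lambda2_nonneg[OF q0])
  obtain e :: 'a where e: "e \<in> Basis" using nonempty_Basis by blast
  obtain \<phi> where \<phi>: "\<phi> \<in> test_functions (slab e 1)" "\<phi> \<noteq> (\<lambda>_. 0)"
    by (rule test_functions_nonempty[OF slab_convex_body(4,1)[OF e order_refl]])
  define C where "C = (LINT x|lborel. (norm (grad \<phi> x))\<^sup>2) / (LINT x|lborel. \<bar>\<phi> x\<bar> powr q) powr (2 / q)"
  have C: "C \<ge> 0" unfolding C_def by (intro divide_nonneg_nonneg integral_nonneg_AE) auto
  have neg: "(2 - q) / q < 0" using q by (simp add: divide_neg_pos)
  have "?I \<le> (1 / 4) * (C * (real (Suc n)) powr ((2 - q) / q))" for n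
  proof -
    define L where "L = real (Suc n)"
    have L: "L \<ge> 1" by (simp add: L_def)
    have "slab e 1 \<subseteq> slab e L"
    proof
      fix x assume "x \<in> slab e 1"
      then show "x \<in> slab e L" unfolding mem_slab using L by (auto split: if_splits)
    qed
    then have "\<phi> \<in> test_functions (slab e L)" using \<phi>(1) unfolding test_functions_def by auto
    from lambda2_le[OF this \<phi>(2) q0] have l: "lambda2 q (slab e L) \<le> C" by (simp only: C_def)
    have "L \<le> 2 * L" using L by simp
    \<comment> \<open>In dimension at least two the exponent is positive, so the volume grows at
      least like \<open>L\<close>.\<close>
    also have "\<dots> \<le> (2 * L) ^ (DIM('a) - 1)" using L dim by (intro self_le_power) auto
    finally have "measure lebesgue (slab e L) powr ((2 - q) / q) \<le> L powr ((2 - q) / q)"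
      unfolding slab_convex_body(5)[OF e L] using L neg by (intro powr_mono2') auto
    then have "lambda2 q (slab e L) * measure lebesgue (slab e L) powr ((2 - q) / q) \<le> C * L powr ((2 - q) / q)"
      using l C by (intro mult_mono) auto
    then show ?thesis using INF_scaled_lambda2_le_slab[OF e L q0] unfolding L_def by linarith
  qed
  moreover have "(\<lambda>n. (1 / 4) * (C * (real (Suc n)) powr ((2 - q) / q))) \<longlonglongrightarrow> (1 / 4) * (C * 0)"
    by (intro tendsto_mult tendsto_const tendsto_neg_powr neg filterlim_compose[OF filterlim_real_sequentially filterlim_Suc])
  ultimately show "?I \<le> 0" using LIMSEQ_le_const by fastforce
qed

theorem theorem1p1:
  assumes "CARD('n::finite) \<ge> 2"
  shows
    "(\<forall>q::real. 1 \<le> q \<and> q \<le> 2 \<longrightarrow>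
        (\<forall>\<Omega> :: (real^'n) set. \<Omega> \<noteq> {} \<and> open \<Omega> \<and> bounded \<Omega> \<and> convex \<Omega> \<longrightarrow>
           lambda2 q \<Omega> * measure lebesgue \<Omega> powr ((2 - q) / q) > (pi2 q / (2 * inradius \<Omega>))\<^sup>2) \<and>
        (INF \<Omega> \<in> {\<Omega> :: (real^'n) set. \<Omega> \<noteq> {} \<and> open \<Omega> \<and> bounded \<Omega> \<and> convex \<Omega>}.
           (inradius \<Omega>)\<^sup>2 * lambda2 q \<Omega> * measure lebesgue \<Omega> powr ((2 - q) / q)) = (pi2 q / 2)\<^sup>2) \<and>
     (\<forall>q::real. 2 < q \<and> ereal q < crit_exp CARD('n) \<longrightarrow>
        (INF \<Omega> \<in> {\<Omega> :: (real^'n) set. \<Omega> \<noteq> {} \<and> open \<Omega> \<and> bounded \<Omega> \<and> convex \<Omega>}.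
           (inradius \<Omega>)\<^sup>2 * lambda2 q \<Omega> * measure lebesgue \<Omega> powr ((2 - q) / q)) = 0)"
proof -
  have dim: "DIM(real^'n) \<ge> 2" using assms by simp
  have eq: "(INF \<Omega> \<in> {\<Omega> :: (real^'n) set. \<Omega> \<noteq> {} \<and> open \<Omega> \<and> bounded \<Omega> \<and> convex \<Omega>}.
      (inradius \<Omega>)\<^sup>2 * lambda2 q \<Omega> * measure lebesgue \<Omega> powr ((2 - q) / q))
    = (INF \<Omega>\<in>(convex_bodies :: (real^'n) set set). scaled_lambda2 q \<Omega>)" for q
    by (simp only: convex_bodies_def scaled_lambda2_def)
  show ?thesis
    unfolding eq
  proof (intro conjI allI impI, goal_cases)
    case (1 q \<Omega>)
    then show ?case using dim by (intro lambda2_strict_lower_bound) auto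
  next
    case (2 q)
    then show ?case using dim by (intro antisym INF_scaled_lambda2_le_pi2 INF_scaled_lambda2_ge) auto
  next
    case (3 q)
    then show ?case using dim by (intro INF_scaled_lambda2_supercritical) auto
  qed
qed

end
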